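(* Let $(\alpha,\beta)\in[0,1)\times(0,1)$ and let $f\in\mathcal{A}^{+}_{\alpha,\beta}$ be such that $Z_f=\{(1,1)\}$. Then $I_{\mathcal{A}^{+}_{\alpha,\beta}}(f)=I_{\mathcal{A}^{+}_{\alpha,\beta}}(\{(1,1)\})$ if and only if the functions $f(\cdot,1)$ and $f(1,\cdot)$ are outer.
   Context: $\mathbb{D}$ is the open unit disc of $\mathbb{C}$. $\mathcal{A}(\mathbb{D}^n)$ is the algebra of functions continuous on $\overline{\mathbb{D}}^n$ and holomorphic on $\mathbb{D}^n$, with the sup norm. For $\alpha,\beta\ge 0$, $\mathcal{A}^{+}_{\alpha,\beta}$ is the Banach algebra (pointwise product) of all $f(z,w)=\sum_{n,m\ge 0}a_{n,m}z^nw^m\in\mathcal{A}(\mathbb{D}^2)$ with $\|f\|_{\alpha,\beta}:=\sum_{n,m\ge0}|a_{n,m}|(1+n)^{\alpha}(1+m)^{\beta}<\infty$. For a Banach algebra $B\subset\mathcal{A}(\mathbb{D}^2)$, $f\in B$ and a closed set $E\subset\overline{\mathbb{D}}^2$: $I_B(f)=\overline{fB}$ (closure in the norm of $B$) is the closed ideal generated by $f$; $Z_f=\{z\in\overline{\mathbb{D}}^2: f(z)=0\}$; $I_B(E)=\{g\in B: g|_E=0\}$. A function $h\in\mathcal{A}(\mathbb{D})$, $h\not\equiv0$, is outer if there is $c\in\mathbb{C}$ with $|c|=1$ such that $h(z)=c\exp\int_0^{2\pi}\frac{e^{i\theta}+z}{e^{i\theta}-z}\log|h(e^{i\theta})|\frac{d\theta}{2\pi}$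 for all $z\in\mathbb{D}$. *)

theory Defs
  imports "HOL-Complex_Analysis.Complex_Analysis"
begin

text \<open>
  A function on the closed disc or the closed bidisc is represented by its extension by zero to
  the whole type. The representation is unique, so equality of functions is equality in HOL, and
  it is preserved by the pointwise algebra operations.
\<close>

abbreviation disc :: "complex set"
  where "disc \<equiv> ball 0 1"

abbreviation cdisc :: "complex set"
  where "cdisc \<equiv> cball 0 1"

definition disc_algebra :: "(complex \<Rightarrow> complex) set"
  where "disc_algebra =
    {h. continuous_on cdisc h \<and> h holomorphic_on disc \<and> (\<forall>z. z \<notin> cdisc \<longrightarrow> h z = 0)}"

text \<open>Holomorphy in two variables: the total derivative exists and is complex linear.\<close>

definition holomorphic2_on :: "(complex \<times> complex \<Rightarrow> complex) \<Rightarrow> (complex \<times> complex) set \<Rightarrow> bool"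
  where "holomorphic2_on f S \<longleftrightarrow>
    (\<forall>p\<in>S. \<exists>a b. (f has_derivative (\<lambda>(u, v). a * u + b * v)) (at p within S))"

definition bidisc_algebra :: "(complex \<times> complex \<Rightarrow> complex) set"
  where "bidisc_algebra =
    {f. continuous_on (cdisc \<times> cdisc) f \<and> holomorphic2_on f (disc \<times> disc) \<and>
        (\<forall>p. p \<notin> cdisc \<times> cdisc \<longrightarrow> f p = 0)}"

definition has_power_series2 ::
    "(complex \<times> complex \<Rightarrow> complex) \<Rightarrow> (nat \<times> nat \<Rightarrow> complex) \<Rightarrow> bool"
  where "has_power_series2 f a \<longleftrightarrow>
    (\<forall>z\<in>disc. \<forall>w\<in>disc. ((\<lambda>(n, m). a (n, m) * z ^ n * w ^ m) has_sum f (z, w)) UNIV)"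

definition weighted_coeff :: "real \<Rightarrow> real \<Rightarrow> (nat \<times> nat \<Rightarrow> complex) \<Rightarrow> nat \<times> nat \<Rightarrow> real"
  where "weighted_coeff \<alpha> \<beta> a =
    (\<lambda>(n, m). cmod (a (n, m)) * (1 + real n) powr \<alpha> * (1 + real m) powr \<beta>)"

definition Aplus :: "real \<Rightarrow> real \<Rightarrow> (complex \<times> complex \<Rightarrow> complex) set"
  where "Aplus \<alpha> \<beta> =
    {f \<in> bidisc_algebra. \<exists>a. has_power_series2 f a \<and> weighted_coeff \<alpha> \<beta> a summable_on UNIV}"

text \<open>The description is proper because power series coefficients are unique.\<close>

definition power_series_coeff2 :: "(complex \<times> complex \<Rightarrow> complex) \<Rightarrow> nat \<times> nat \<Rightarrow> complex"
  where "power_series_coeff2 f = (THE a. has_power_series2 f a)"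

definition Aplus_norm :: "real \<Rightarrow> real \<Rightarrow> (complex \<times> complex \<Rightarrow> complex) \<Rightarrow> real"
  where "Aplus_norm \<alpha> \<beta> f = (\<Sum>\<^sub>\<infinity>p. weighted_coeff \<alpha> \<beta> (power_series_coeff2 f) p)"

text \<open>
  A Banach algebra of functions on the closed bidisc is given by its carrier \<open>B\<close> and its
  norm \<open>N\<close>.
\<close>

definition norm_closure ::
    "(complex \<times> complex \<Rightarrow> complex) set \<Rightarrow> ((complex \<times> complex \<Rightarrow> complex) \<Rightarrow> real) \<Rightarrow>
     (complex \<times> complex \<Rightarrow> complex) set \<Rightarrow> (complex \<times> complex \<Rightarrow> complex) set"
  where "norm_closure B N S = {g \<in> B. \<forall>\<epsilon>>0. \<exists>s\<in>S. N (\<lambda>p. g p - s p) < \<epsilon>}"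

definition closed_ideal_gen ::
    "(complex \<times> complex \<Rightarrow> complex) set \<Rightarrow> ((complex \<times> complex \<Rightarrow> complex) \<Rightarrow> real) \<Rightarrow>
     (complex \<times> complex \<Rightarrow> complex) \<Rightarrow> (complex \<times> complex \<Rightarrow> complex) set"
  where "closed_ideal_gen B N f = norm_closure B N ((\<lambda>g p. f p * g p) ` B)"

definition vanishing_ideal ::
    "(complex \<times> complex \<Rightarrow> complex) set \<Rightarrow> (complex \<times> complex) set \<Rightarrow>
     (complex \<times> complex \<Rightarrow> complex) set"
  where "vanishing_ideal B E = {g \<in> B. \<forall>p\<in>E. g p = 0}"

definition zero_set :: "(complex \<times> complex \<Rightarrow> complex) \<Rightarrow> (complex \<times> complex) set"
  where "zero_set f = {p \<in> cdisc \<times> cdisc. f p = 0}"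

text \<open>
  The boundary zeros of a nonzero \<open>h\<close> in the disc algebra form a null set and
  \<open>ln \<bar>h\<bar>\<close> is integrable on the circle, so neither the value of \<open>ln 0\<close> nor the default value of
  the Lebesgue integral plays a role.
\<close>

definition outer_function :: "(complex \<Rightarrow> complex) \<Rightarrow> bool"
  where "outer_function h \<longleftrightarrow>
    h \<in> disc_algebra \<and> (\<exists>z\<in>cdisc. h z \<noteq> 0) \<and>
    (\<exists>c. cmod c = 1 \<and>
      (\<forall>z\<in>disc. h z = c * exp (LINT \<theta>:{0..2 * pi}|lborel.
          (cis \<theta> + z) / (cis \<theta> - z) * complex_of_real (ln (cmod (h (cis \<theta>))) / (2 * pi)))))"

end

(*
  A function in the ideal of the point (1,1) that is not in the closure of f B is separated from it
  by a functional L on B that annihilates f B. The transform of L at the resolvent of the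
  coordinate z modulo f B extends analytically to the complement of the point 1, because f has no
  other zero than (1,1). For |l| < 1 the slice f(l, .) is invertible in the algebra of the second
  variable, and inversion with control of the norm reduces the size of the inverse to a lower
  bound of |f(l, .)|, which Harnack's inequality provides. When f(., 1) is outer, (1 - r) log
  |f(r, w)| tends to 0 for every w, so the singularity at 1 is of minimal exponential type along
  the radius; a Phragmen-Lindelof argument, with the growth (1 + n)^alpha, alpha < 1, outside the
  disc, then leaves only a simple pole, that is, L(z g) = L(g). Hence L factors through the slice
  z = 1, and the same argument in the second variable gives L(w g) = L(g), so L is a multiple of
  the evaluation at (1,1).

  Conversely, f(., 1) vanishes on the closed disc only at 1, so its inner factor can only be an
  atom at 1, that is, a power of exp((z + 1)/(z - 1)). If z - 1 is a uniform limit of multiples of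
  f(., 1), the maximum principle excludes this factor.
*)
theory Submission
  imports Defs "HOL-Real_Asymp.Real_Asymp"
begin

section \<open>Weighted power series with coefficients in a normed algebra\<close>

text \<open>The two variables play different parts. Inversion in the algebra of w must cost only a
  power of 1/\<delta>, \<delta> being the lower bound of the slice: then a bound exp(-\<epsilon>/(1
  - r)) for |f(r, w)| becomes exp(C \<epsilon>/(1 - r)) for the resolvent, and minimal type
  survives. The weight (1 + m)^\<beta> with \<beta> > 0 makes this possible, because F(w) - F(\<eta>
  w), merely bounded in the weighted norm, is small in the unweighted one. In the algebra of z only
  elements near 1 are inverted, so \<alpha> = 0 is allowed. Exponents below 1 exclude a double pole
  at 1; for exponent 1 the derivative at 1 would be a bounded functional. The radial estimate is
  needed for all w at once. Since (1 - r)/(1 + r) (log M - log |f(r, w)|) decreases in r, one radius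
  controls all later ones, and compactness in w applies as in Dini's theorem. Norms may be infinite
  on formal power series, so that a double series is simply a series of series.\<close>

lemma ennreal_suminf_commute:
  fixes f :: "nat \<Rightarrow> nat \<Rightarrow> ennreal"
  shows "(\<Sum>i. \<Sum>j. f i j) = (\<Sum>j. \<Sum>i. f i j)"
proof -
  have "(\<Sum>i. \<Sum>j. f i j) = (\<integral>\<^sup>+i. (\<Sum>j. f i j) \<partial>count_space UNIV)"
    by (simp add: nn_integral_count_space_nat)
  also have "\<dots> = (\<Sum>j. \<integral>\<^sup>+i. f i j \<partial>count_space UNIV)"
    by (rule nn_integral_suminf) simp
  finally show ?thesis by (simp add: nn_integral_count_space_nat)
qed

lemma ennreal_suminf_add:
  fixes f g :: "nat \<Rightarrow> ennreal"
  shows "(\<Sum>i. f i + g i) = (\<Sum>i. f i) + (\<Sum>i. g i)"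
  by (rule suminf_add[symmetric]) auto

lemma ennreal_suminf_shift:
  fixes B :: "nat \<Rightarrow> ennreal"
  shows "(\<Sum>n. if k \<le> n then B (n - k) else 0) = (\<Sum>n. B n)"
proof -
  have "(\<Sum>n. B n) = (\<Sum>n. if k \<le> n + k then B (n + k - k) else 0)" by simp
  also have "\<dots> = (\<Sum>n. if k \<le> n then B (n - k) else 0)"
    using suminf_offset[of "\<lambda>n. if k \<le> n then B (n - k) else 0" k] by simp
  finally show ?thesis by simp
qed

lemma ennreal_suminf_Cauchy_product:
  fixes A B :: "nat \<Rightarrow> ennreal"
  shows "(\<Sum>n. \<Sum>i=0..n. A i * B (n - i)) = (\<Sum>n. A n) * (\<Sum>n. B n)"
proof -
  have "(\<Sum>i=0..n. A i * B (n - i)) = (\<Sum>i. if i \<le> n then A i * B (n - i) else 0)" for n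
    by (subst suminf_finite[of "{0..n}"]) (auto intro!: sum.cong)
  then have "(\<Sum>n. \<Sum>i=0..n. A i * B (n - i)) = (\<Sum>n. \<Sum>i. if i \<le> n then A i * B (n - i) else 0)"
    by simp
  also have "\<dots> = (\<Sum>i. \<Sum>n. if i \<le> n then A i * B (n - i) else 0)"
    by (rule ennreal_suminf_commute)
  also have "\<dots> = (\<Sum>i. A i * (\<Sum>n. B n))"
  proof -
    have "(\<Sum>n. if i \<le> n then A i * B (n - i) else 0) = A i * (\<Sum>n. B n)" for i
      using ennreal_suminf_shift[of i "\<lambda>n. A i * B n"] by simp
    then show ?thesis by simp
  qed
  finally show ?thesis by simp
qed

lemma ennreal_suminf_tail_le:
  fixes B :: "nat \<Rightarrow> ennreal"
  shows "(\<Sum>n. B (n + k)) \<le> (\<Sum>n. B n)"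
  using suminf_offset[of B k] by simp

lemma ennreal_suminf_tail_tendsto_0:
  fixes B :: "nat \<Rightarrow> ennreal"
  assumes "(\<Sum>n. B n) < \<infinity>"
  shows "(\<lambda>k. \<Sum>n. B (n + k)) \<longlonglongrightarrow> 0"
proof -
  have s: "(\<Sum>n. B n) = ennreal (\<Sum>n. enn2real (B n))" and S: "summable (\<lambda>n. enn2real (B n))"
  proof -
    have fin: "B n < \<infinity>" for n
      using ennreal_suminf_lessD[of B \<infinity> n] assms by simp
    then have e: "B n = ennreal (enn2real (B n))" for n by (simp add: less_top)
    show S: "summable (\<lambda>n. enn2real (B n))"
      by (rule summable_suminf_not_top) (use e assms in auto)
    show "(\<Sum>n. B n) = ennreal (\<Sum>n. enn2real (B n))"
      by (subst e, rule suminf_ennreal2) (use S in auto)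
  qed
  have fin: "B n < \<infinity>" for n
    using ennreal_suminf_lessD[of B \<infinity> n] assms by simp
  have e: "(\<Sum>n. B (n + k)) = ennreal (\<Sum>n. enn2real (B (n + k)))" for k
  proof -
    have "(\<Sum>n. B (n + k)) = (\<Sum>n. ennreal (enn2real (B (n + k))))"
      using fin by (simp add: less_top)
    also have "\<dots> = ennreal (\<Sum>n. enn2real (B (n + k)))"
      by (rule suminf_ennreal2) (use S summable_ignore_initial_segment[OF S] in auto)
    finally show ?thesis .
  qed
  have "(\<lambda>k. \<Sum>n. enn2real (B (n + k))) \<longlonglongrightarrow> 0"
    using suminf_exist_split2[OF S] .
  then have "(\<lambda>k. ennreal (\<Sum>n. enn2real (B (n + k)))) \<longlonglongrightarrow> ennreal 0"
    by (rule tendsto_ennrealI)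
  then show ?thesis using e by simp
qed

text \<open>The norm may be infinite; the Banach algebra is the set \<open>carr\<close> of elements
  of finite norm. The ring can then be the type of all formal power series, and the construction can
  be repeated with power series as coefficients. Completeness is stated for absolutely convergent
  series, with the tail of the norms as error: in this form it passes from coefficients to weighted
  sums of coefficients.\<close>

locale complete_algebra_norm =
  fixes \<nu> :: "'a::comm_ring_1 \<Rightarrow> ennreal" and \<kappa> :: "complex \<Rightarrow> 'a"
  assumes nrm_zero: "\<nu> 0 = 0"
    and nrm_one: "\<nu> 1 = 1"
    and nrm_minus: "\<nu> (- a) = \<nu> a"
    and nrm_add: "\<nu> (a + b) \<le> \<nu> a + \<nu> b"
    and nrm_mult: "\<nu> (a * b) \<le> \<nu> a * \<nu> b"
    and nrm_eq_0: "\<nu> a = 0 \<Longrightarrow> a = 0"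
    and complete: "(\<Sum>k. \<nu> (s k)) < \<infinity> \<Longrightarrow>
      \<exists>l. \<forall>K. \<nu> (l - (\<Sum>k<K. s k)) \<le> (\<Sum>k. \<nu> (s (k + K)))"
    and scalar_add: "\<kappa> (c + d) = \<kappa> c + \<kappa> d"
    and scalar_mult: "\<kappa> (c * d) = \<kappa> c * \<kappa> d"
    and scalar_one: "\<kappa> 1 = 1"
    and nrm_scalar: "\<nu> (\<kappa> c) = ennreal (cmod c)"
begin

definition carr :: "'a set" where "carr = {a. \<nu> a < \<infinity>}"

lemma scalar_zero: "\<kappa> 0 = 0"
  using nrm_scalar[of 0] by (simp add: nrm_eq_0)

lemma scalar_minus: "\<kappa> (- c) = - \<kappa> c"
  using scalar_add[of c "- c"] by (simp add: scalar_zero minus_unique)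

lemma scalar_diff: "\<kappa> (c - d) = \<kappa> c - \<kappa> d"
  using scalar_add[of c "- d"] by (simp add: scalar_minus)

lemma scalar_power: "\<kappa> (c ^ n) = \<kappa> c ^ n"
  by (induction n) (simp_all add: scalar_one scalar_mult)

lemma nrm_scale: "\<nu> (\<kappa> c * a) \<le> ennreal (cmod c) * \<nu> a"
  using nrm_mult[of "\<kappa> c" a] by (simp add: nrm_scalar)

lemma nrm_diff: "\<nu> (a - b) \<le> \<nu> a + \<nu> b"
  using nrm_add[of a "- b"] by (simp add: nrm_minus)

lemma nrm_sum: "\<nu> (\<Sum>i\<in>I. s i) \<le> (\<Sum>i\<in>I. \<nu> (s i))"
  by (induction I rule: infinite_finite_induct)
    (auto simp: nrm_zero intro: order_trans[OF nrm_add] add_left_mono)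

lemma nrm_power: "\<nu> (a ^ n) \<le> \<nu> a ^ n"
  by (induction n) (auto simp: nrm_one intro!: order_trans[OF nrm_mult] mult_left_mono)

lemma carr_0 [simp]: "0 \<in> carr" and carr_1 [simp]: "1 \<in> carr" and carr_scalar [simp]: "\<kappa> c \<in> carr"
  by (auto simp: carr_def nrm_zero nrm_one nrm_scalar)

lemma carr_minus [simp]: "- a \<in> carr \<longleftrightarrow> a \<in> carr"
  by (simp add: carr_def nrm_minus)

lemma carr_add [simp]: "a \<in> carr \<Longrightarrow> b \<in> carr \<Longrightarrow> a + b \<in> carr"
  using nrm_add[of a b] by (auto simp: carr_def order.strict_trans1)

lemma carr_diff [simp]: "a \<in> carr \<Longrightarrow> b \<in> carr \<Longrightarrow> a - b \<in> carr"
  using carr_add[of a "- b"] by simp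

lemma carr_mult [simp]: "a \<in> carr \<Longrightarrow> b \<in> carr \<Longrightarrow> a * b \<in> carr"
  using nrm_mult[of a b] by (auto simp: carr_def ennreal_mult_less_top intro: order.strict_trans1)

lemma carr_power [simp]: "a \<in> carr \<Longrightarrow> a ^ n \<in> carr"
  by (induction n) auto

lemma carr_sum [simp]: "(\<And>i. i \<in> I \<Longrightarrow> s i \<in> carr) \<Longrightarrow> (\<Sum>i\<in>I. s i) \<in> carr"
  by (induction I rule: infinite_finite_induct) auto

lemma norm_finite_real: "a \<in> carr \<Longrightarrow> \<nu> a = ennreal (enn2real (\<nu> a))"
  by (simp add: carr_def less_top)

lemma carr_sum_limit:
  assumes "(\<Sum>k. \<nu> (s k)) < \<infinity>"
  obtains l where "l \<in> carr" "\<And>K. \<nu> (l - (\<Sum>k<K. s k)) \<le> (\<Sum>k. \<nu> (s (k + K)))"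
    "\<nu> l \<le> (\<Sum>k. \<nu> (s k))" "(\<lambda>K. \<nu> (l - (\<Sum>k<K. s k))) \<longlonglongrightarrow> 0"
proof -
  obtain l where l: "\<And>K. \<nu> (l - (\<Sum>k<K. s k)) \<le> (\<Sum>k. \<nu> (s (k + K)))"
    using complete[OF assms] by blast
  have "\<nu> l \<le> (\<Sum>k. \<nu> (s k))" using l[of 0] by simp
  moreover have "(\<lambda>K. \<nu> (l - (\<Sum>k<K. s k))) \<longlonglongrightarrow> 0"
    by (rule tendsto_sandwich[OF _ _ tendsto_const ennreal_suminf_tail_tendsto_0[OF assms]])
      (use l in auto)
  ultimately show ?thesis using l assms by (intro that) (auto simp: carr_def)
qed

lemma eq_if_norm_diff_tendsto_0:
  assumes "(\<lambda>K. \<nu> (a - s K)) \<longlonglongrightarrow> 0" "(\<lambda>K. \<nu> (b - s K)) \<longlonglongrightarrow> 0"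
  shows "a = b"
proof -
  have "(\<lambda>K. \<nu> (a - s K) + \<nu> (b - s K)) \<longlonglongrightarrow> 0 + 0"
    by (intro tendsto_intros assms)
  moreover have "\<nu> (a - b) \<le> \<nu> (a - s K) + \<nu> (b - s K)" for K
    using nrm_diff[of "a - s K" "b - s K"] by simp
  ultimately have "\<nu> (a - b) \<le> 0"
    by (intro LIMSEQ_le_const[of _ "0::ennreal"]) auto
  then show ?thesis using nrm_eq_0[of "a - b"] by simp
qed

lemma mult_norm_diff_tendsto_0:
  assumes "(\<lambda>K. \<nu> (a - s K)) \<longlonglongrightarrow> 0" and c: "c \<in> carr"
  shows "(\<lambda>K. \<nu> (c * a - c * s K)) \<longlonglongrightarrow> 0"
proof (rule tendsto_sandwich[OF _ _ tendsto_const])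
  have "(\<lambda>K. \<nu> c * \<nu> (a - s K)) \<longlonglongrightarrow> \<nu> c * 0"
    by (rule ennreal_tendsto_cmult) (use c assms in \<open>auto simp: carr_def\<close>)
  then show "(\<lambda>K. \<nu> c * \<nu> (a - s K)) \<longlonglongrightarrow> 0" by simp
  show "\<forall>\<^sub>F n in sequentially. \<nu> (c * a - c * s n) \<le> \<nu> c * \<nu> (a - s n)"
    using nrm_mult[of c] by (simp add: right_diff_distrib[symmetric])
qed auto

text \<open>The geometric series of \<open>E\<close>; the fixed threshold 1/2 gives an absolute
  bound for the inverse.\<close>

lemma neumann:
  assumes E: "\<nu> E \<le> ennreal (1 / 2)"
  obtains b where "b \<in> carr" "(1 - E) * b = 1" "\<nu> b \<le> 2"
proof -
  have le: "\<nu> (E ^ k) \<le> ennreal ((1/2) ^ k)" for k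
  proof -
    have "\<nu> (E ^ k) \<le> \<nu> E ^ k" by (rule nrm_power)
    also have "\<dots> \<le> ennreal (1 / 2) ^ k" using E by (rule power_mono) simp
    also have "\<dots> = ennreal ((1/2) ^ k)" by (rule ennreal_power) simp
    finally show ?thesis .
  qed
  have s: "(\<Sum>k. \<nu> (E ^ k)) \<le> 2"
  proof -
    have "(\<Sum>k. \<nu> (E ^ k)) \<le> (\<Sum>k. ennreal ((1/2) ^ k))"
      by (intro suminf_le le) auto
    also have "\<dots> = ennreal (\<Sum>k. (1/2) ^ k)"
      by (rule suminf_ennreal2) (auto intro: summable_geometric)
    also have "(\<Sum>k. (1/2::real) ^ k) = 2" by (subst suminf_geometric) auto
    finally show ?thesis by simp
  qed
  then have "(\<Sum>k. \<nu> (E ^ k)) < \<infinity>" by (rule order.strict_trans1) simp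
  then obtain b where b: "b \<in> carr" "\<nu> b \<le> (\<Sum>k. \<nu> (E ^ k))"
    "(\<lambda>K. \<nu> (b - (\<Sum>k<K. E ^ k))) \<longlonglongrightarrow> 0"
    by (rule carr_sum_limit)
  have Ec: "E \<in> carr" using order.strict_trans1[OF E ennreal_less_top] by (simp add: carr_def)
  have "(\<lambda>K. \<nu> ((1 - E) * b - (1 - E) * (\<Sum>k<K. E ^ k))) \<longlonglongrightarrow> 0"
    by (rule mult_norm_diff_tendsto_0) (use b Ec in auto)
  then have 1: "(\<lambda>K. \<nu> ((1 - E) * b - (1 - E ^ K))) \<longlonglongrightarrow> 0"
    by (simp add: one_diff_power_eq)
  have 2: "(\<lambda>K. \<nu> (1 - (1 - E ^ K))) \<longlonglongrightarrow> 0"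
  proof (rule tendsto_sandwich[OF _ _ tendsto_const])
    have "(\<lambda>K. ennreal ((1/2) ^ K)) \<longlonglongrightarrow> ennreal 0"
      by (intro tendsto_ennrealI LIMSEQ_power_zero) simp
    then show "(\<lambda>K. ennreal ((1/2) ^ K)) \<longlonglongrightarrow> 0" by simp
  qed (use le in auto)
  have "(1 - E) * b = 1" by (rule eq_if_norm_diff_tendsto_0[OF 1 2])
  then show ?thesis using b s by (intro that) auto
qed

end

interpretation cmod_norm: complete_algebra_norm "\<lambda>z. ennreal (cmod z)" "\<lambda>z. z"
proof
  fix s :: "nat \<Rightarrow> complex"
  assume a: "(\<Sum>k. ennreal (cmod (s k))) < \<infinity>"
  have S: "summable (\<lambda>n. cmod (s n))"
    by (rule summable_suminf_not_top) (use a in auto)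
  have "ennreal (cmod (suminf s - (\<Sum>k<K. s k))) \<le> (\<Sum>k. ennreal (cmod (s (k + K))))" for K
  proof -
    have "suminf s - (\<Sum>k<K. s k) = (\<Sum>k. s (k + K))"
      using suminf_split_initial_segment[OF summable_norm_cancel[OF S], of K] by simp
    also have "cmod \<dots> \<le> (\<Sum>k. cmod (s (k + K)))"
      by (rule summable_norm) (rule summable_ignore_initial_segment[OF S])
    finally show ?thesis
      by (subst suminf_ennreal2) (auto intro: summable_ignore_initial_segment[OF S] ennreal_leI)
  qed
  then show "\<exists>l. \<forall>K. ennreal (cmod (l - (\<Sum>k<K. s k))) \<le> (\<Sum>k. ennreal (cmod (s (k + K))))"
    by blast
qed (auto simp: norm_mult ennreal_mult simp flip: ennreal_plus intro: ennreal_leI norm_triangle_ineq)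

definition wnorm :: "real \<Rightarrow> ('a \<Rightarrow> ennreal) \<Rightarrow> 'a fps \<Rightarrow> ennreal"
  where "wnorm \<gamma> \<nu> f = (\<Sum>n. ennreal ((1 + real n) powr \<gamma>) * \<nu> (fps_nth f n))"

lemma one_le_weight: "0 \<le> \<gamma> \<Longrightarrow> 1 \<le> (1 + real n) powr \<gamma>"
  by (rule ge_one_powr_ge_zero) auto

text \<open>1 + n is at most (1 + i)(1 + n - i). This makes the weighted norm
  submultiplicative.\<close>

lemma weight_submult:
  assumes "0 \<le> \<gamma>" "i \<le> n"
  shows "(1 + real n) powr \<gamma> \<le> (1 + real i) powr \<gamma> * (1 + real (n - i)) powr \<gamma>"
proof -
  have "1 + real n \<le> (1 + real i) * (1 + real (n - i))"
    using assms by (simp add: of_nat_diff algebra_simps) (simp add: mult_left_mono flip: of_nat_mult of_nat_add)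
  then have "(1 + real n) powr \<gamma> \<le> ((1 + real i) * (1 + real (n - i))) powr \<gamma>"
    using assms by (intro powr_mono2) auto
  then show ?thesis by (simp add: powr_mult)
qed

text \<open>Completeness is inherited coefficientwise: each coefficient has a limit with its own
  tail bound, and Tonelli's theorem exchanges the weighted sum over the coefficients with the sum
  over the tail. The result is an instance of the same locale, so a second application yields the
  norm of double series.\<close>

lemma (in complete_algebra_norm) wnorm_complete_algebra_norm:
  assumes \<gamma>: "0 \<le> \<gamma>"
  shows "complete_algebra_norm (wnorm \<gamma> \<nu>) (\<lambda>c. fps_const (\<kappa> c))"
proof
  let ?\<omega> = "\<lambda>n. ennreal ((1 + real n) powr \<gamma>)"
  have \<omega>1: "1 \<le> ?\<omega> n" for n using one_le_weight[OF \<gamma>, of n] by (metis ennreal_1 ennreal_leI)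
  have conc: "wnorm \<gamma> \<nu> (fps_const a) = \<nu> a" for a
    unfolding wnorm_def by (subst suminf_finite[of "{0}"]) (auto simp: nrm_zero)
  show "wnorm \<gamma> \<nu> 0 = 0" by (simp add: wnorm_def nrm_zero)
  show "wnorm \<gamma> \<nu> 1 = 1" using conc[of 1] by (simp add: nrm_one)
  show "wnorm \<gamma> \<nu> (fps_const (\<kappa> c)) = ennreal (cmod c)" for c by (simp add: conc nrm_scalar)
  show "wnorm \<gamma> \<nu> (- a) = wnorm \<gamma> \<nu> a" for a by (simp add: wnorm_def nrm_minus)
  show "wnorm \<gamma> \<nu> (a + b) \<le> wnorm \<gamma> \<nu> a + wnorm \<gamma> \<nu> b" for a b
    unfolding wnorm_def ennreal_suminf_add[symmetric] distrib_left[symmetric]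
    by (intro suminf_le mult_left_mono) (auto intro: nrm_add)
  show "wnorm \<gamma> \<nu> (a * b) \<le> wnorm \<gamma> \<nu> a * wnorm \<gamma> \<nu> b" for a b
    unfolding wnorm_def ennreal_suminf_Cauchy_product[symmetric]
  proof (intro suminf_le)
    fix n
    have "?\<omega> n * \<nu> ((a * b) $ n) \<le> ?\<omega> n * (\<Sum>i=0..n. \<nu> (a $ i) * \<nu> (b $ (n - i)))"
      unfolding fps_mult_nth
      by (intro mult_left_mono order_trans[OF nrm_sum] sum_mono) (auto intro: nrm_mult)
    also have "\<dots> = (\<Sum>i=0..n. ?\<omega> n * (\<nu> (a $ i) * \<nu> (b $ (n - i))))"
      by (simp add: sum_distrib_left)
    also have "\<dots> \<le> (\<Sum>i=0..n. ?\<omega> i * \<nu> (a $ i) * (?\<omega> (n - i) * \<nu> (b $ (n - i))))"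
    proof (intro sum_mono)
      fix i assume "i \<in> {0..n}"
      then have "?\<omega> n \<le> ?\<omega> i * ?\<omega> (n - i)"
        using weight_submult[OF \<gamma>, of i n] by (simp flip: ennreal_mult add: ennreal_leI)
      then have "?\<omega> n * (\<nu> (a $ i) * \<nu> (b $ (n - i))) \<le>
          ?\<omega> i * ?\<omega> (n - i) * (\<nu> (a $ i) * \<nu> (b $ (n - i)))" by (intro mult_right_mono) auto
      then show "?\<omega> n * (\<nu> (a $ i) * \<nu> (b $ (n - i))) \<le>
          ?\<omega> i * \<nu> (a $ i) * (?\<omega> (n - i) * \<nu> (b $ (n - i)))" by (simp add: mult_ac)
    qed
    finally show "?\<omega> n * \<nu> ((a * b) $ n) \<le>
        (\<Sum>i=0..n. ?\<omega> i * \<nu> (a $ i) * (?\<omega> (n - i) * \<nu> (b $ (n - i))))" .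
  qed auto
  have nth_le: "\<nu> (a $ n) \<le> wnorm \<gamma> \<nu> a" for a n
  proof -
    have "\<nu> (a $ n) \<le> ?\<omega> n * \<nu> (a $ n)" using mult_right_mono[OF \<omega>1[of n], of "\<nu> (a $ n)"] by simp
    also have "\<dots> \<le> wnorm \<gamma> \<nu> a" unfolding wnorm_def
      using sum_le_suminf[of "\<lambda>n. ?\<omega> n * \<nu> (a $ n)" "{n}"] by simp
    finally show ?thesis .
  qed
  show "a = 0" if "wnorm \<gamma> \<nu> a = 0" for a
    using nth_le[of a] that by (intro fps_ext) (auto intro!: nrm_eq_0)
  show "\<exists>l. \<forall>K. wnorm \<gamma> \<nu> (l - (\<Sum>k<K. s k)) \<le> (\<Sum>k. wnorm \<gamma> \<nu> (s (k + K)))"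
    if s: "(\<Sum>k. wnorm \<gamma> \<nu> (s k)) < \<infinity>" for s
  proof -
    have "(\<Sum>k. \<nu> (s k $ n)) < \<infinity>" for n
      by (rule order.strict_trans1[OF _ s]) (intro suminf_le nth_le; auto)
    then have "\<exists>l. \<forall>K. \<nu> (l - (\<Sum>k<K. s k $ n)) \<le> (\<Sum>k. \<nu> (s (k + K) $ n))" for n
      by (rule complete)
    then obtain l where l: "\<And>n K. \<nu> (l n - (\<Sum>k<K. s k $ n)) \<le> (\<Sum>k. \<nu> (s (k + K) $ n))"
      by metis
    have "wnorm \<gamma> \<nu> (Abs_fps l - (\<Sum>k<K. s k)) \<le> (\<Sum>k. wnorm \<gamma> \<nu> (s (k + K)))" for K
    proof -
      have "wnorm \<gamma> \<nu> (Abs_fps l - (\<Sum>k<K. s k)) \<le> (\<Sum>n. ?\<omega> n * (\<Sum>k. \<nu> (s (k + K) $ n)))"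
        unfolding wnorm_def by (intro suminf_le mult_left_mono) (auto simp: fps_sum_nth l)
      also have "\<dots> = (\<Sum>n. \<Sum>k. ?\<omega> n * \<nu> (s (k + K) $ n))" by simp
      also have "\<dots> = (\<Sum>k. \<Sum>n. ?\<omega> n * \<nu> (s (k + K) $ n))" by (rule ennreal_suminf_commute)
      finally show ?thesis by (simp add: wnorm_def)
    qed
    then show ?thesis by blast
  qed
qed (simp_all add: scalar_add scalar_mult scalar_one)

section \<open>Bounded functionals\<close>

context complete_algebra_norm
begin

text \<open>Zorn's lemma is applied to graphs of partial functionals. A graph closed under the
  linear operations and dominated by \<open>p\<close> is single-valued of itself, because two values
  at one point differ by at most \<open>p 0 = 0\<close>.\<close>

lemma hahn_banach_real:
  fixes p :: "'a \<Rightarrow> real"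
  assumes padd: "\<And>a b. a \<in> carr \<Longrightarrow> b \<in> carr \<Longrightarrow> p (a + b) \<le> p a + p b"
    and phom: "\<And>t a. a \<in> carr \<Longrightarrow> p (\<kappa> (of_real t) * a) = \<bar>t\<bar> * p a"
    and e: "e \<in> carr"
  obtains \<phi> :: "'a \<Rightarrow> real" where
    "\<And>a b. a \<in> carr \<Longrightarrow> b \<in> carr \<Longrightarrow> \<phi> (a + b) = \<phi> a + \<phi> b"
    "\<And>t a. a \<in> carr \<Longrightarrow> \<phi> (\<kappa> (of_real t) * a) = t * \<phi> a"
    "\<And>a. a \<in> carr \<Longrightarrow> \<phi> a \<le> p a" "\<phi> e = p e"
proof -
  define sc where "sc t a = \<kappa> (of_real t) * a" for t :: real and a
  have sc_carr: "sc t a \<in> carr" if "a \<in> carr" for t a using that by (simp add: sc_def)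
  have sc_add: "sc t (a + b) = sc t a + sc t b" for t a b by (simp add: sc_def distrib_left)
  have sc_plus: "sc (s + t) a = sc s a + sc t a" for s t a by (simp add: sc_def scalar_add distrib_right)
  have sc_mult: "sc s (sc t a) = sc (s * t) a" for s t a by (simp add: sc_def scalar_mult mult.assoc)
  have sc_1: "sc 1 a = a" and sc_0: "sc 0 a = 0" for a by (simp_all add: sc_def scalar_one scalar_zero)
  have sc_neg: "sc (- 1) a = - a" for a
    using sc_plus[of 1 "-1" a] by (simp add: sc_1 sc_0 minus_unique)
  have phom': "p (sc t a) = \<bar>t\<bar> * p a" if "a \<in> carr" for t a using phom that by (simp add: sc_def)
  have p0: "p 0 = 0" using phom'[of 0 0] by (simp add: sc_0)
  have p_nonneg: "0 \<le> p a" if "a \<in> carr" for a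
    using padd[of a "- a"] phom'[of a "- 1"] that by (simp add: p0 sc_neg)
  define \<G> where "\<G> = {G. G \<subseteq> carr \<times> UNIV \<and> (e, p e) \<in> G \<and>
      (\<forall>a r b s. (a, r) \<in> G \<longrightarrow> (b, s) \<in> G \<longrightarrow> (a + b, r + s) \<in> G) \<and>
      (\<forall>t a r. (a, r) \<in> G \<longrightarrow> (sc t a, t * r) \<in> G) \<and> (\<forall>a r. (a, r) \<in> G \<longrightarrow> r \<le> p a)}"
  have "\<exists>M\<in>\<G>. \<forall>X\<in>\<G>. M \<subseteq> X \<longrightarrow> X = M"
  proof (rule subset_Zorn_nonempty)
    have "range (\<lambda>t. (sc t e, t * p e)) \<in> \<G>"
      unfolding \<G>_def
    proof (intro CollectI conjI allI impI)
      show "range (\<lambda>t. (sc t e, t * p e)) \<subseteq> carr \<times> UNIV" using e by (auto simp: sc_carr)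
      show "(e, p e) \<in> range (\<lambda>t. (sc t e, t * p e))"
        by (intro range_eqI[of _ _ 1]) (simp add: sc_1)
      show "(a + b, r + s) \<in> range (\<lambda>t. (sc t e, t * p e))"
        if ab: "(a, r) \<in> range (\<lambda>t. (sc t e, t * p e))" "(b, s) \<in> range (\<lambda>t. (sc t e, t * p e))" for a r b s
      proof -
        obtain t u where "a = sc t e" "r = t * p e" "b = sc u e" "s = u * p e" using ab by auto
        then show ?thesis by (intro range_eqI[of _ _ "t + u"]) (simp add: sc_plus distrib_right)
      qed
      show "(sc u a, u * r) \<in> range (\<lambda>t. (sc t e, t * p e))"
        if ab: "(a, r) \<in> range (\<lambda>t. (sc t e, t * p e))" for u a r
      proof -
        obtain t where "a = sc t e" "r = t * p e" using ab by auto
        then show ?thesis by (intro range_eqI[of _ _ "u * t"]) (simp add: sc_mult)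
      qed
      show "r \<le> p a" if ab: "(a, r) \<in> range (\<lambda>t. (sc t e, t * p e))" for a r
      proof -
        obtain t where "a = sc t e" "r = t * p e" using ab by auto
        then show ?thesis using phom'[OF e, of t] mult_right_mono[OF abs_ge_self[of t] p_nonneg[OF e]] by simp
      qed
    qed
    then show "\<G> \<noteq> {}" by blast
  next
    fix C assume C: "C \<noteq> {}" "subset.chain \<G> C"
    then have CG: "C \<subseteq> \<G>" and ch: "\<And>X Y. X \<in> C \<Longrightarrow> Y \<in> C \<Longrightarrow> X \<subseteq> Y \<or> Y \<subseteq> X"
      by (auto simp: subset_chain_def)
    show "\<Union>C \<in> \<G>"
      unfolding \<G>_def
    proof (intro CollectI conjI allI impI)
      show "\<Union>C \<subseteq> carr \<times> UNIV" using CG by (auto simp: \<G>_def)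
      show "(e, p e) \<in> \<Union>C" using CG C by (auto simp: \<G>_def)
      show "(sc t a, t * r) \<in> \<Union>C" if "(a, r) \<in> \<Union>C" for t a r
        using that CG by (auto simp: \<G>_def) blast
      show "r \<le> p a" if "(a, r) \<in> \<Union>C" for a r using that CG by (auto simp: \<G>_def)
      show "(a + b, r + s) \<in> \<Union>C" if ab: "(a, r) \<in> \<Union>C" "(b, s) \<in> \<Union>C" for a r b s
      proof -
        obtain X Y where XY: "X \<in> C" "Y \<in> C" "(a, r) \<in> X" "(b, s) \<in> Y" using ab by blast
        then obtain Z where "Z \<in> C" "(a, r) \<in> Z" "(b, s) \<in> Z" using ch[of X Y] by blast
        moreover from this CG have "Z \<in> \<G>" by blast
        then have "(a + b, r + s) \<in> Z" unfolding \<G>_def using \<open>(a, r) \<in> Z\<close> \<open>(b, s) \<in> Z\<close> by blast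
        ultimately show ?thesis by blast
      qed
    qed
  qed
  then obtain M where M: "M \<in> \<G>" and max: "\<And>X. X \<in> \<G> \<Longrightarrow> M \<subseteq> X \<Longrightarrow> X = M" by blast
  have M_carr: "a \<in> carr" if "(a, r) \<in> M" for a r using M that by (auto simp: \<G>_def)
  have M_e: "(e, p e) \<in> M" using M by (auto simp: \<G>_def)
  have M_add: "(a + b, r + s) \<in> M" if "(a, r) \<in> M" "(b, s) \<in> M" for a r b s
    using M that by (auto simp: \<G>_def)
  have M_sc: "(sc t a, t * r) \<in> M" if "(a, r) \<in> M" for t a r using M that by (auto simp: \<G>_def)
  have M_le: "r \<le> p a" if "(a, r) \<in> M" for a r using M that by (auto simp: \<G>_def)
  have M_0: "(0, 0) \<in> M" using M_sc[OF M_e, of 0] by (simp add: sc_0)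
  have M_neg: "(- a, - r) \<in> M" if "(a, r) \<in> M" for a r using M_sc[OF that, of "-1"] by (simp add: sc_neg)
  have ex: "\<exists>r. (a, r) \<in> M" if a: "a \<in> carr" for a
  proof -
    \<comment> \<open>The value at the new point \<open>a\<close> has to lie above every r - p (b -
      a) and below every p (b + a) - r. By \<open>key\<close> the first family stays below the
      second, and the supremum of the first is taken.\<close>
    define A where "A = (\<lambda>(b, r). r - p (b - a)) ` M"
    have key: "r - p (b - a) \<le> p (b' + a) - r'" if "(b, r) \<in> M" "(b', r') \<in> M" for b r b' r'
    proof -
      have "r + r' \<le> p ((b - a) + (b' + a))" using M_le[OF M_add[OF that]] by simp
      also have "\<dots> \<le> p (b - a) + p (b' + a)" using that a M_carr by (intro padd) auto
      finally show ?thesis by simp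
    qed
    have "bdd_above A" unfolding A_def by (rule bdd_aboveI2[of _ _ "p (0 + a) - 0"]) (use key[OF _ M_0] in auto)
    define c where "c = Sup A"
    have c1: "r - p (b - a) \<le> c" if "(b, r) \<in> M" for b r
      unfolding c_def using that by (intro cSup_upper \<open>bdd_above A\<close>) (force simp: A_def)
    have c2: "c \<le> p (b + a) - r" if "(b, r) \<in> M" for b r
      unfolding c_def using that M_0 key by (intro cSup_least) (auto simp: A_def)
    define M' where "M' = {(b + sc t a, r + t * c) | b r t. (b, r) \<in> M}"
    have "M' \<in> \<G>" unfolding \<G>_def
    proof (intro CollectI conjI allI impI)
      show "M' \<subseteq> carr \<times> UNIV" using M_carr a by (auto simp: M'_def sc_carr)
      show "(e, p e) \<in> M'" unfolding M'_def using M_e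
        by (intro CollectI exI[of _ e] exI[of _ "p e"] exI[of _ 0]) (simp add: sc_0)
      show "(u + v, r + s) \<in> M'" if uv: "(u, r) \<in> M'" "(v, s) \<in> M'" for u r v s
      proof -
        obtain b r' t where 1: "u = b + sc t a" "r = r' + t * c" "(b, r') \<in> M" using uv by (auto simp: M'_def)
        obtain d s' t' where 2: "v = d + sc t' a" "s = s' + t' * c" "(d, s') \<in> M" using uv by (auto simp: M'_def)
        show ?thesis unfolding M'_def using M_add[OF 1(3) 2(3)]
          by (intro CollectI exI[of _ "b + d"] exI[of _ "r' + s'"] exI[of _ "t + t'"])
            (simp add: 1 2 sc_plus algebra_simps)
      qed
      show "(sc t' u, t' * r) \<in> M'" if u: "(u, r) \<in> M'" for t' u r
      proof -
        obtain b r' t where 1: "u = b + sc t a" "r = r' + t * c" "(b, r') \<in> M" using u by (auto simp: M'_def)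
        show ?thesis unfolding M'_def using M_sc[OF 1(3), of t']
          by (intro CollectI exI[of _ "sc t' b"] exI[of _ "t' * r'"] exI[of _ "t' * t"])
            (simp add: 1 sc_add sc_mult algebra_simps)
      qed
      show "r \<le> p u" if u: "(u, r) \<in> M'" for u r
      proof -
        obtain b r' t where 1: "u = b + sc t a" "r = r' + t * c" "(b, r') \<in> M" using u by (auto simp: M'_def)
        \<comment> \<open>After division by the modulus of t, its sign decides which of the two
          inequalities for \<open>c\<close> applies.\<close>
        consider "t = 0" | "t > 0" | "t < 0" by linarith
        then show ?thesis
        proof cases
          case 1 then show ?thesis using \<open>(b, r') \<in> M\<close> \<open>u = _\<close> \<open>r = _\<close> M_le by (simp add: sc_0)
        next
          case 2
          have bt: "(sc (1/t) b, (1/t) * r') \<in> M" by (rule M_sc) (rule 1)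
          have "r = t * ((1/t) * r' + c)" using 2 1 by (simp add: field_simps)
          also have "\<dots> \<le> t * p (sc (1/t) b + a)" using c2[OF bt] 2 by (intro mult_left_mono) auto
          also have "\<dots> = p (sc t (sc (1/t) b + a))"
            using 2 a M_carr[OF 1(3)] by (subst phom') (auto simp: sc_carr)
          also have "sc t (sc (1/t) b + a) = u" using 2 1 by (simp add: sc_add sc_mult sc_1)
          finally show ?thesis .
        next
          case 3
          have bt: "(sc (-1/t) b, (-1/t) * r') \<in> M" by (rule M_sc) (rule 1)
          have "r = (- t) * ((-1/t) * r' - c)" using 3 1 by (simp add: field_simps)
          also have "\<dots> \<le> (- t) * p (sc (-1/t) b - a)" using c1[OF bt] 3 by (intro mult_left_mono) auto
          also have "\<dots> = p (sc (- t) (sc (-1/t) b - a))"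
            using 3 a M_carr[OF 1(3)] by (subst phom') (auto simp: sc_carr)
          also have "sc (- t) (sc (-1/t) b - a) = sc (- t) (sc (-1/t) b) + sc (- t) (sc (- 1) a)"
            using sc_add[of "-t" "sc (-1/t) b" "sc (- 1) a"] by (simp add: sc_neg)
          also have "\<dots> = u" using 3 1 by (simp add: sc_mult sc_1)
          finally show ?thesis .
        qed
      qed
    qed
    moreover have "M \<subseteq> M'"
    proof
      fix z assume z: "z \<in> M"
      show "z \<in> M'" unfolding M'_def
        by (intro CollectI exI[of _ "fst z"] exI[of _ "snd z"] exI[of _ "0::real"]) (use z in \<open>simp add: sc_0\<close>)
    qed
    ultimately have "M' = M" by (rule max)
    moreover have "(a, c) \<in> M'" unfolding M'_def
      using M_0 by (intro CollectI exI[of _ 0] exI[of _ "0::real"] exI[of _ 1]) (simp add: sc_1)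
    ultimately show ?thesis by blast
  qed
  have uniq: "r = s" if "(a, r) \<in> M" "(a, s) \<in> M" for a r s
    using M_le[OF M_add[OF that(1) M_neg[OF that(2)]]] M_le[OF M_add[OF that(2) M_neg[OF that(1)]]]
    by (simp add: p0)
  define \<phi> where "\<phi> a = (THE r. (a, r) \<in> M)" for a
  have \<phi>_eq: "\<phi> a = r" if "(a, r) \<in> M" for a r
    unfolding \<phi>_def using that uniq by blast
  have \<phi>: "(a, \<phi> a) \<in> M" if "a \<in> carr" for a using ex[OF that] \<phi>_eq by auto
  show ?thesis
  proof (rule that[of \<phi>])
    show "\<phi> (a + b) = \<phi> a + \<phi> b" if "a \<in> carr" "b \<in> carr" for a b
      by (rule \<phi>_eq) (intro M_add \<phi> that)
    show "\<phi> (\<kappa> (of_real t) * a) = t * \<phi> a" if "a \<in> carr" for t a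
      using \<phi>_eq[OF M_sc[OF \<phi>[OF that], of t]] by (simp add: sc_def)
    show "\<phi> a \<le> p a" if "a \<in> carr" for a using M_le[OF \<phi>[OF that]] .
    show "\<phi> e = p e" by (rule \<phi>_eq[OF M_e])
  qed
qed

definition bdd_functional :: "('a \<Rightarrow> complex) \<Rightarrow> real \<Rightarrow> bool" where
  "bdd_functional L C \<longleftrightarrow> (\<forall>a\<in>carr. \<forall>b\<in>carr. L (a + b) = L a + L b) \<and>
    (\<forall>c. \<forall>a\<in>carr. L (\<kappa> c * a) = c * L a) \<and> (\<forall>a\<in>carr. cmod (L a) \<le> C * enn2real (\<nu> a))"

text \<open>\<open>p\<close> is the distance to the ideal of multiples of \<open>f\<close>, a
  seminorm that vanishes on this ideal. Hahn-Banach gives a real functional dominated by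
  \<open>p\<close> with value \<open>p g\<close> at \<open>g\<close>. Complexification adds the
  bounds of real and imaginary part, whence the constant 2.\<close>

lemma separating_functional:
  assumes f: "f \<in> carr" and g: "g \<in> carr" and d: "0 < d"
    and sep: "\<And>s. s \<in> carr \<Longrightarrow> ennreal d \<le> \<nu> (g - f * s)"
  obtains L where "bdd_functional L 2" "\<And>s. s \<in> carr \<Longrightarrow> L (f * s) = 0" "L g \<noteq> 0"
proof -
  define X where "X a s = enn2real (\<nu> (a - f * s))" for a s
  define p where "p a = Inf (X a ` carr)" for a
  have bdd: "bdd_below (X a ` carr)" for a by (rule bdd_belowI2[of _ 0]) (simp add: X_def)
  have le: "p a \<le> X a s" if "s \<in> carr" for a s
    unfolding p_def using that bdd by (intro cInf_lower) auto
  have ge: "m \<le> p a" if "\<And>s. s \<in> carr \<Longrightarrow> m \<le> X a s" for a m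
    unfolding p_def using that by (intro cInf_greatest) (use carr_0 in blast)+
  have p_nonneg: "0 \<le> p a" for a by (rule ge) (simp add: X_def)
  have real_le: "enn2real (\<nu> a) \<le> enn2real (\<nu> b) + enn2real (\<nu> c)" if "\<nu> a \<le> \<nu> b + \<nu> c" "b \<in> carr" "c \<in> carr" for a b c
  proof -
    have "enn2real (\<nu> a) \<le> enn2real (\<nu> b + \<nu> c)"
      using that by (intro enn2real_mono) (auto simp: carr_def)
    also have "\<dots> = enn2real (\<nu> b) + enn2real (\<nu> c)"
      using that by (intro enn2real_plus) (auto simp: carr_def)
    finally show ?thesis .
  qed
  have padd: "p (a + b) \<le> p a + p b" if ab: "a \<in> carr" "b \<in> carr" for a b
  proof -
    have "p (a + b) \<le> X a s + X b t" if st: "s \<in> carr" "t \<in> carr" for s t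
    proof -
      have "X (a + b) (s + t) \<le> X a s + X b t" unfolding X_def
      proof (rule real_le)
        have "a + b - f * (s + t) = (a - f * s) + (b - f * t)" by (simp add: algebra_simps)
        then show "\<nu> (a + b - f * (s + t)) \<le> \<nu> (a - f * s) + \<nu> (b - f * t)" using nrm_add by metis
      qed (use ab st f in auto)
      then show ?thesis using le[of "s + t" "a + b"] st by simp
    qed
    then have "p (a + b) - X a s \<le> p b" if "s \<in> carr" for s using that by (intro ge) (smt (verit))
    then have "p (a + b) - p b \<le> p a" by (intro ge) (smt (verit))
    then show ?thesis by simp
  qed
  have scale_le: "p (\<kappa> c * a) \<le> cmod c * p a" if a: "a \<in> carr" for c a
  proof (cases "c = 0")
    case True then show ?thesis using le[of 0 0] by (simp add: scalar_zero X_def nrm_zero)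
  next
    case False
    have "p (\<kappa> c * a) / cmod c \<le> X a s" if s: "s \<in> carr" for s
    proof -
      have "X (\<kappa> c * a) (\<kappa> c * s) \<le> enn2real (ennreal (cmod c) * \<nu> (a - f * s))"
        unfolding X_def
      proof (rule enn2real_mono)
        have "\<kappa> c * a - f * (\<kappa> c * s) = \<kappa> c * (a - f * s)" by (simp add: algebra_simps)
        then show "\<nu> (\<kappa> c * a - f * (\<kappa> c * s)) \<le> ennreal (cmod c) * \<nu> (a - f * s)"
          using nrm_scale by metis
        have "a - f * s \<in> carr" using a f s by simp
        then show "ennreal (cmod c) * \<nu> (a - f * s) < top"
          by (auto simp: carr_def ennreal_mult_less_top)
      qed
      also have "\<dots> = cmod c * X a s" by (simp add: enn2real_mult X_def)
      finally show ?thesis using le[of "\<kappa> c * s" "\<kappa> c * a"] s False by (simp add: field_simps)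
    qed
    then have "p (\<kappa> c * a) / cmod c \<le> p a" by (rule ge)
    then show ?thesis using False by (simp add: field_simps)
  qed
  have scale: "p (\<kappa> c * a) = cmod c * p a" if a: "a \<in> carr" for c a
  proof (cases "c = 0")
    case True then show ?thesis using scale_le[OF a, of 0] p_nonneg[of "\<kappa> 0 * a"] by simp
  next
    case False
    have "\<kappa> (1 / c) * (\<kappa> c * a) = a"
      using False scalar_mult[of "1 / c" c] by (simp add: mult.assoc[symmetric] scalar_one)
    then have "p a \<le> cmod (1 / c) * p (\<kappa> c * a)" using scale_le[of "\<kappa> c * a" "1 / c"] a by simp
    then have "cmod c * p a \<le> p (\<kappa> c * a)" using False by (simp add: norm_divide field_simps)
    then show ?thesis using scale_le[OF a, of c] by simp
  qed
  have p_ideal: "p (f * s) = 0" if "s \<in> carr" for s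
    using le[OF that, of "f * s"] p_nonneg[of "f * s"] by (simp add: X_def nrm_zero)
  have p_le: "p a \<le> enn2real (\<nu> a)" for a using le[of 0 a] by (simp add: X_def)
  have pg: "d \<le> p g"
  proof (rule ge)
    fix s assume s: "s \<in> carr"
    have "ennreal d \<le> ennreal (enn2real (\<nu> (g - f * s)))"
      using sep[OF s] norm_finite_real[of "g - f * s"] s f g by simp
    then show "d \<le> X g s" using d by (simp add: X_def ennreal_le_iff2)
  qed
  obtain \<phi> :: "'a \<Rightarrow> real" where
    \<phi>_add: "\<And>a b. a \<in> carr \<Longrightarrow> b \<in> carr \<Longrightarrow> \<phi> (a + b) = \<phi> a + \<phi> b" and
    \<phi>_sc: "\<And>t a. a \<in> carr \<Longrightarrow> \<phi> (\<kappa> (of_real t) * a) = t * \<phi> a" and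
    \<phi>_le: "\<And>a. a \<in> carr \<Longrightarrow> \<phi> a \<le> p a" and \<phi>g: "\<phi> g = p g"
    by (rule hahn_banach_real[of p g]) (use padd scale g in auto)
  have \<phi>_neg: "\<phi> (- a) = - \<phi> a" if "a \<in> carr" for a
    using \<phi>_sc[OF that, of "-1"] by (simp add: scalar_minus scalar_one)
  have p_neg: "p (- a) = p a" if "a \<in> carr" for a
    using scale[OF that, of "-1"] by (simp add: scalar_minus scalar_one)
  have \<phi>_abs: "\<bar>\<phi> a\<bar> \<le> p a" if "a \<in> carr" for a
    using \<phi>_le[of a] \<phi>_le[of "- a"] \<phi>_neg[of a] p_neg[of a] that by auto
  \<comment> \<open>The complex linear functional with real part \<phi>.\<close>
  define L where "L a = Complex (\<phi> a) (- \<phi> (\<kappa> \<i> * a))" for a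
  have bd: "cmod (L a) \<le> 2 * p a" if "a \<in> carr" for a
  proof -
    have "cmod (L a) \<le> \<bar>\<phi> a\<bar> + \<bar>\<phi> (\<kappa> \<i> * a)\<bar>" using cmod_le[of "L a"] by (simp add: L_def)
    then show ?thesis using \<phi>_abs[of a] \<phi>_abs[of "\<kappa> \<i> * a"] scale[of a \<i>] that by auto
  qed
  have L_add: "L (a + b) = L a + L b" if "a \<in> carr" "b \<in> carr" for a b
    using that by (simp add: L_def \<phi>_add distrib_left complex_eq_iff)
  have L_sc: "L (\<kappa> c * a) = c * L a" if a: "a \<in> carr" for c a
  proof -
    have c: "c = of_real (Re c) + \<i> * of_real (Im c)" by (simp add: complex_eq_iff)
    have e1: "\<phi> (\<kappa> c * b) = Re c * \<phi> b + Im c * \<phi> (\<kappa> \<i> * b)" if b: "b \<in> carr" for b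
    proof -
      have "\<kappa> c * b = \<kappa> (of_real (Re c)) * b + \<kappa> (of_real (Im c)) * (\<kappa> \<i> * b)"
        by (subst c) (simp add: scalar_add scalar_mult algebra_simps)
      then show ?thesis using b by (simp add: \<phi>_add \<phi>_sc)
    qed
    have "\<kappa> \<i> * \<kappa> \<i> = - 1" by (simp flip: scalar_mult add: scalar_minus scalar_one)
    then have "\<kappa> \<i> * (\<kappa> \<i> * a) = - a" by (simp add: mult.assoc[symmetric])
    then have e2: "\<phi> (\<kappa> \<i> * (\<kappa> \<i> * a)) = - \<phi> a" using \<phi>_neg[OF a] by simp
    have "\<kappa> \<i> * (\<kappa> c * a) = \<kappa> c * (\<kappa> \<i> * a)" by (simp add: algebra_simps)
    then show ?thesis using e1[OF a] e1[of "\<kappa> \<i> * a"] a e2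
      by (simp add: L_def complex_eq_iff algebra_simps)
  qed
  show ?thesis
  proof (rule that[of L])
    show "bdd_functional L 2" unfolding bdd_functional_def
    proof (intro conjI ballI allI)
      fix a assume "a \<in> carr" then show "cmod (L a) \<le> 2 * enn2real (\<nu> a)"
        using bd[of a] p_le[of a] by auto
    qed (auto simp: L_add L_sc)
    show "L (f * s) = 0" if "s \<in> carr" for s using bd[of "f * s"] p_ideal[OF that] f that by simp
    show "L g \<noteq> 0" using \<phi>g pg d by (auto simp: L_def complex_eq_iff)
  qed
qed

end

section \<open>Resolvents modulo the kernel of a functional\<close>

context complete_algebra_norm
begin

lemma bdd_functional_add: "bdd_functional L C \<Longrightarrow> a \<in> carr \<Longrightarrow> b \<in> carr \<Longrightarrow> L (a + b) = L a + L b"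
  and bdd_functional_scale: "bdd_functional L C \<Longrightarrow> a \<in> carr \<Longrightarrow> L (\<kappa> c * a) = c * L a"
  and bdd_functional_bound: "bdd_functional L C \<Longrightarrow> a \<in> carr \<Longrightarrow> cmod (L a) \<le> C * enn2real (\<nu> a)"
  by (auto simp: bdd_functional_def)

lemma bdd_functional_0: "bdd_functional L C \<Longrightarrow> L 0 = 0"
  using bdd_functional_add[of L C 0 0] by simp

lemma bdd_functional_minus: "bdd_functional L C \<Longrightarrow> a \<in> carr \<Longrightarrow> L (- a) = - L a"
  using bdd_functional_scale[of L C a "-1"] by (simp add: scalar_minus scalar_one)

lemma bdd_functional_diff:
  "bdd_functional L C \<Longrightarrow> a \<in> carr \<Longrightarrow> b \<in> carr \<Longrightarrow> L (a - b) = L a - L b"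
  using bdd_functional_add[of L C a "- b"] bdd_functional_minus[of L C b] by simp

lemma bdd_functional_sum:
  assumes L: "bdd_functional L C"
  shows "(\<And>i. i \<in> I \<Longrightarrow> s i \<in> carr) \<Longrightarrow> L (\<Sum>i\<in>I. s i) = (\<Sum>i\<in>I. L (s i))"
  by (induction I rule: infinite_finite_induct)
    (auto simp: bdd_functional_0[OF L] bdd_functional_add[OF L])

lemma enn2real_norm_mult: "a \<in> carr \<Longrightarrow> b \<in> carr \<Longrightarrow> enn2real (\<nu> (a * b)) \<le> enn2real (\<nu> a) * enn2real (\<nu> b)"
  unfolding enn2real_mult[symmetric]
  by (rule enn2real_mono[OF nrm_mult]) (auto simp: carr_def ennreal_mult_less_top)

lemma enn2real_norm_power: "a \<in> carr \<Longrightarrow> enn2real (\<nu> (a ^ n)) \<le> enn2real (\<nu> a) ^ n"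
  by (induction n) (auto simp: nrm_one intro!: order_trans[OF enn2real_norm_mult] mult_left_mono)

text \<open>The largest ideal inside the kernel of \<open>L\<close>. It contains f as soon as
  \<open>L\<close> annihilates all multiples of f, and \<open>L\<close> is well defined on the
  quotient.\<close>

definition null_ideal :: "('a \<Rightarrow> complex) \<Rightarrow> 'a set"
  where "null_ideal L = {a \<in> carr. \<forall>b\<in>carr. L (a * b) = 0}"

text \<open>\<open>a\<close> represents the inverse of l - x in the quotient by
  \<open>null_ideal L\<close>.\<close>

definition resolvent_mod :: "('a \<Rightarrow> complex) \<Rightarrow> 'a \<Rightarrow> complex \<Rightarrow> 'a \<Rightarrow> bool"
  where "resolvent_mod L x l a \<longleftrightarrow> a \<in> carr \<and> (\<kappa> l - x) * a - 1 \<in> null_ideal L"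

lemma null_ideal_mult: "a \<in> null_ideal L \<Longrightarrow> b \<in> carr \<Longrightarrow> L (a * b) = 0"
  by (simp add: null_ideal_def)

text \<open>In the quotient a - b = a (1 - (l - x) b): the error of an approximate resolvent is its
  residual times the exact resolvent.\<close>

lemma resolvent_mod_approx:
  assumes L: "bdd_functional L C" and x: "x \<in> carr"
    and a: "resolvent_mod L x l a" and b: "b \<in> carr"
  shows "L a - L b = L (a * (1 - (\<kappa> l - x) * b))"
proof -
  have ac: "a \<in> carr" and an: "(\<kappa> l - x) * a - 1 \<in> null_ideal L"
    using a by (auto simp: resolvent_mod_def)
  have "a - b = a * (1 - (\<kappa> l - x) * b) + ((\<kappa> l - x) * a - 1) * b" by (simp add: algebra_simps)
  moreover have "L (((\<kappa> l - x) * a - 1) * b) = 0" by (rule null_ideal_mult[OF an b])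
  ultimately show ?thesis
    using bdd_functional_add[OF L, of "a * (1 - (\<kappa> l - x) * b)" "((\<kappa> l - x) * a - 1) * b"]
      bdd_functional_diff[OF L ac b] ac b x by simp
qed

lemma resolvent_mod_unique:
  assumes L: "bdd_functional L C" and x: "x \<in> carr"
    and a: "resolvent_mod L x l a" and b: "resolvent_mod L x l b"
  shows "L a = L b"
proof -
  have ac: "a \<in> carr" and bc: "b \<in> carr" and bn: "(\<kappa> l - x) * b - 1 \<in> null_ideal L"
    using a b by (auto simp: resolvent_mod_def)
  have "a * (1 - (\<kappa> l - x) * b) = - (((\<kappa> l - x) * b - 1) * a)" by (simp add: algebra_simps)
  then have "L (a * (1 - (\<kappa> l - x) * b)) = 0"
    using bdd_functional_minus[OF L, of "((\<kappa> l - x) * b - 1) * a"] null_ideal_mult[OF bn ac] ac bc x by simp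
  then show ?thesis using resolvent_mod_approx[OF L x a bc] by simp
qed

text \<open>The Neumann series of l - x = (l0 - x) + (l - l0). Modulo the ideal, l - x times the
  partial sum \<open>b K\<close> is 1 - m^K, so the error under \<open>L\<close> is L (a m^K), which
  tends to 0 geometrically.\<close>

lemma resolvent_mod_power_series:
  assumes L: "bdd_functional L C" and x: "x \<in> carr"
    and a0: "resolvent_mod L x l0 a0" and a: "resolvent_mod L x l a"
    and small: "cmod (l - l0) * enn2real (\<nu> a0) < 1"
  shows "(\<lambda>k. (- 1) ^ k * L (a0 ^ (k + 1)) * (l - l0) ^ k) sums L a"
proof -
  have ac: "a \<in> carr" and a0c: "a0 \<in> carr" and a0n: "(\<kappa> l0 - x) * a0 - 1 \<in> null_ideal L"
    using a a0 by (auto simp: resolvent_mod_def)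
  define m where "m = \<kappa> (- (l - l0)) * a0"
  have mc: "m \<in> carr" using a0c by (simp add: m_def)
  define b where "b K = a0 * (\<Sum>k<K. m ^ k)" for K
  have bc: "b K \<in> carr" for K using a0c mc by (simp add: b_def)
  have mk: "m ^ k = \<kappa> ((- (l - l0)) ^ k) * a0 ^ k" for k
    by (simp add: m_def power_mult_distrib scalar_power)
  have Lb: "L (b K) = (\<Sum>k<K. (- 1) ^ k * L (a0 ^ (k + 1)) * (l - l0) ^ k)" for K
  proof -
    have "b K = (\<Sum>k<K. \<kappa> ((- (l - l0)) ^ k) * a0 ^ (k + 1))"
      unfolding b_def sum_distrib_left by (intro sum.cong) (auto simp: mk algebra_simps)
    then have "L (b K) = (\<Sum>k<K. (- (l - l0)) ^ k * L (a0 ^ (k + 1)))"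
      using a0c by (simp add: bdd_functional_sum[OF L] bdd_functional_scale[OF L])
    also have "\<dots> = (\<Sum>k<K. (- 1) ^ k * L (a0 ^ (k + 1)) * (l - l0) ^ k)"
      by (intro sum.cong refl) (simp only: power_minus[of "l - l0"] mult_ac)
    finally show ?thesis .
  qed
  have diff: "L a - L (b K) = L (a * m ^ K)" for K
  proof -
    have "(1 - m) * (\<Sum>k<K. m ^ k) = 1 - m ^ K" by (simp add: one_diff_power_eq)
    moreover have "(\<kappa> l - x) * a0 = ((\<kappa> l0 - x) * a0 - 1) + (1 - m)"
      by (simp add: m_def scalar_minus scalar_diff algebra_simps)
    then have "(\<kappa> l - x) * b K = (((\<kappa> l0 - x) * a0 - 1) + (1 - m)) * (\<Sum>k<K. m ^ k)"
      unfolding b_def mult.assoc[symmetric] by (rule arg_cong)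
    then have "(\<kappa> l - x) * b K = ((\<kappa> l0 - x) * a0 - 1) * (\<Sum>k<K. m ^ k) + (1 - m) * (\<Sum>k<K. m ^ k)"
      by (simp only: distrib_right)
    ultimately have "1 - (\<kappa> l - x) * b K = m ^ K - ((\<kappa> l0 - x) * a0 - 1) * (\<Sum>k<K. m ^ k)" by simp
    then have "a * (1 - (\<kappa> l - x) * b K) = a * (m ^ K - ((\<kappa> l0 - x) * a0 - 1) * (\<Sum>k<K. m ^ k))"
      by (rule arg_cong)
    also have "\<dots> = a * m ^ K - ((\<kappa> l0 - x) * a0 - 1) * ((\<Sum>k<K. m ^ k) * a)"
      by (simp only: right_diff_distrib mult_ac)
    finally have e: "a * (1 - (\<kappa> l - x) * b K) = a * m ^ K - ((\<kappa> l0 - x) * a0 - 1) * ((\<Sum>k<K. m ^ k) * a)" .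
    have "L (((\<kappa> l0 - x) * a0 - 1) * ((\<Sum>k<K. m ^ k) * a)) = 0"
      by (rule null_ideal_mult[OF a0n]) (use mc ac in simp)
    then show ?thesis
      using resolvent_mod_approx[OF L x a bc[of K]] e ac mc a0c x
      by (simp add: bdd_functional_diff[OF L])
  qed
  have "(\<lambda>K. L a - L (b K)) \<longlonglongrightarrow> 0"
  proof (rule Lim_null_comparison[OF always_eventually])
    define q where "q = cmod (l - l0) * enn2real (\<nu> a0)"
    have mq: "enn2real (\<nu> m) \<le> q"
    proof -
      have "enn2real (\<nu> m) \<le> enn2real (ennreal (cmod (- (l - l0))) * \<nu> a0)"
        unfolding m_def by (rule enn2real_mono[OF nrm_scale])
          (use a0c in \<open>auto simp: carr_def ennreal_mult_less_top\<close>)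
      then show ?thesis by (simp add: q_def enn2real_mult norm_minus_commute)
    qed
    show "\<forall>K. cmod (L a - L (b K)) \<le> \<bar>C\<bar> * enn2real (\<nu> a) * q ^ K"
    proof
      fix K
      have "cmod (L (a * m ^ K)) \<le> C * enn2real (\<nu> (a * m ^ K))"
        by (rule bdd_functional_bound[OF L]) (use ac mc in simp)
      also have "\<dots> \<le> \<bar>C\<bar> * enn2real (\<nu> (a * m ^ K))" by (intro mult_right_mono) auto
      also have "\<dots> \<le> \<bar>C\<bar> * (enn2real (\<nu> a) * q ^ K)"
      proof (intro mult_left_mono)
        have "enn2real (\<nu> (a * m ^ K)) \<le> enn2real (\<nu> a) * enn2real (\<nu> (m ^ K))"
          by (rule enn2real_norm_mult) (use ac mc in auto)
        also have "enn2real (\<nu> (m ^ K)) \<le> enn2real (\<nu> m) ^ K" by (rule enn2real_norm_power[OF mc])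
        also have "\<dots> \<le> q ^ K" by (rule power_mono[OF mq]) simp
        finally show "enn2real (\<nu> (a * m ^ K)) \<le> enn2real (\<nu> a) * q ^ K" by (simp add: mult_left_mono)
      qed auto
      finally show "cmod (L a - L (b K)) \<le> \<bar>C\<bar> * enn2real (\<nu> a) * q ^ K" by (simp add: diff mult.assoc)
    qed
    show "(\<lambda>K. \<bar>C\<bar> * enn2real (\<nu> a) * q ^ K) \<longlonglongrightarrow> 0"
      by (intro tendsto_mult_right_zero LIMSEQ_power_zero) (use small in \<open>auto simp: q_def\<close>)
  qed
  then have "(\<lambda>K. L (b K)) \<longlonglongrightarrow> L a" using tendsto_diff[OF tendsto_const[of "L a"]] by fastforce
  then show ?thesis by (simp add: sums_def Lb)
qed

text \<open>The choice is harmless: by \<open>resolvent_mod_unique\<close> a bounded functional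
  \<open>L\<close> takes the same value on all resolvents.\<close>

definition resolvent_value :: "('a \<Rightarrow> complex) \<Rightarrow> 'a \<Rightarrow> complex \<Rightarrow> complex"
  where "resolvent_value L x l = L (SOME a. resolvent_mod L x l a)"

lemma resolvent_value_eq:
  assumes "bdd_functional L C" "x \<in> carr" "resolvent_mod L x l a"
  shows "resolvent_value L x l = L a"
  unfolding resolvent_value_def
  by (rule resolvent_mod_unique[OF assms(1,2) someI[of "resolvent_mod L x l"] assms(3)]) (rule assms)

lemma resolvent_value_holomorphic:
  assumes L: "bdd_functional L C" and x: "x \<in> carr" and S: "open S"
    and ex: "\<And>l. l \<in> S \<Longrightarrow> \<exists>a. resolvent_mod L x l a"
  shows "resolvent_value L x holomorphic_on S"
proof -
  have "\<exists>e>0. resolvent_value L x holomorphic_on ball l0 e" if l0: "l0 \<in> S" for l0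
  proof -
    obtain a0 where a0: "resolvent_mod L x l0 a0" using ex[OF l0] by blast
    obtain e1 where e1: "e1 > 0" "ball l0 e1 \<subseteq> S" using S l0 by (meson openE)
    define N where "N = enn2real (\<nu> a0)"
    define e where "e = min e1 (1 / (N + 1))"
    have N: "N \<ge> 0" by (simp add: N_def)
    have e: "e > 0" using e1 N by (simp add: e_def)
    have "resolvent_value L x holomorphic_on ball l0 e"
    proof (rule power_series_holomorphic[where a = "\<lambda>k. (- 1) ^ k * L (a0 ^ (k + 1))"])
      fix l assume l: "l \<in> ball l0 e"
      then have "l \<in> S" using e1 by (auto simp: e_def)
      then obtain a where a: "resolvent_mod L x l a" using ex by blast
      have "cmod (l - l0) < 1 / (N + 1)" using l by (simp add: e_def dist_norm norm_minus_commute)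
      then have "cmod (l - l0) * (N + 1) < 1" using N by (simp add: field_simps)
      moreover have "cmod (l - l0) * N \<le> cmod (l - l0) * (N + 1)" by (intro mult_left_mono) auto
      ultimately have "cmod (l - l0) * enn2real (\<nu> a0) < 1" unfolding N_def by linarith
      from resolvent_mod_power_series[OF L x a0 a this]
      show "(\<lambda>k. (- 1) ^ k * L (a0 ^ (k + 1)) * (l - l0) ^ k) sums resolvent_value L x l"
        by (simp add: resolvent_value_eq[OF L x a])
    qed
    then show ?thesis using e by blast
  qed
  then have "resolvent_value L x analytic_on S" by (auto simp: analytic_on_def)
  then show ?thesis by (rule analytic_imp_holomorphic)
qed

text \<open>Outside the unit disc the Neumann series in 1/l converges in the algebra itself, since
  the powers of x grow at most linearly. Under \<open>L\<close> it becomes the expansion at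
  infinity, whose coefficients are the moments L (x^k).\<close>

lemma resolvent_exterior:
  assumes L: "bdd_functional L C" and x: "x \<in> carr" and l: "1 < cmod l"
    and xk: "\<And>k. \<nu> (x ^ k) \<le> ennreal (1 + real k)"
  shows "\<exists>a. resolvent_mod L x l a"
    and "(\<lambda>k. L (x ^ k) * inverse l ^ (k + 1)) sums resolvent_value L x l"
proof -
  define s where "s k = \<kappa> (inverse l ^ (k + 1)) * x ^ k" for k
  define r where "r = cmod (inverse l)"
  have "r = 1 / cmod l" by (simp add: r_def norm_inverse divide_inverse)
  then have r: "0 \<le> r" "r < 1" using l by (auto simp: divide_less_eq)
  have l0: "l \<noteq> 0" using l by auto
  have S: "summable (\<lambda>k. (1 + real k) * r ^ k)"
  proof -
    have "(\<lambda>k. of_nat (Suc k) * r ^ k) sums (1 / (1 - r)\<^sup>2)"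
      by (rule geometric_deriv_sums) (use r in simp)
    then show ?thesis by (simp add: sums_iff add.commute)
  qed
  have sk: "\<nu> (s k) \<le> ennreal (r * ((1 + real k) * r ^ k))" for k
  proof -
    have "\<nu> (s k) \<le> ennreal (cmod (inverse l ^ (k + 1))) * \<nu> (x ^ k)" unfolding s_def by (rule nrm_scale)
    also have "\<dots> \<le> ennreal (cmod (inverse l ^ (k + 1))) * ennreal (1 + real k)" by (intro mult_left_mono xk) auto
    also have "\<dots> = ennreal (r * ((1 + real k) * r ^ k))"
      by (subst ennreal_mult[symmetric]) (auto simp: norm_mult norm_power r_def algebra_simps)
    finally show ?thesis .
  qed
  have "(\<Sum>k. \<nu> (s k)) \<le> (\<Sum>k. ennreal (r * ((1 + real k) * r ^ k)))" by (intro suminf_le sk) auto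
  also have "\<dots> < \<infinity>"
    by (subst suminf_ennreal2) (use r S in \<open>auto intro: summable_mult\<close>)
  finally obtain a where a: "a \<in> carr" "(\<lambda>K. \<nu> (a - (\<Sum>k<K. s k))) \<longlonglongrightarrow> 0"
    by (rule carr_sum_limit)
  have tel: "(\<kappa> l - x) * (\<Sum>k<K. s k) = 1 - \<kappa> (inverse l ^ K) * x ^ K" for K
  proof (induction K)
    case 0 then show ?case by (simp add: scalar_one)
  next
    case (Suc K)
    have "l * inverse l ^ (K + 1) = inverse l ^ K" using l0 by simp
    then have "\<kappa> l * \<kappa> (inverse l ^ (K + 1)) = \<kappa> (inverse l ^ K)"
      by (simp only: scalar_mult[symmetric])
    then have "(\<kappa> l - x) * s K = \<kappa> (inverse l ^ K) * x ^ K - \<kappa> (inverse l ^ Suc K) * x ^ Suc K"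
      by (simp add: s_def algebra_simps)
    then show ?case using Suc by (simp add: distrib_left del: power_Suc)
  qed
  have rest: "(\<lambda>K. \<nu> (1 - (1 - \<kappa> (inverse l ^ K) * x ^ K))) \<longlonglongrightarrow> 0"
  proof (rule tendsto_sandwich[OF _ _ tendsto_const])
    have "(\<lambda>K. ennreal ((1 + real K) * r ^ K)) \<longlonglongrightarrow> ennreal 0"
      by (intro tendsto_ennrealI summable_LIMSEQ_zero[OF S])
    then show "(\<lambda>K. ennreal ((1 + real K) * r ^ K)) \<longlonglongrightarrow> 0" by simp
    show "\<forall>\<^sub>F K in sequentially. \<nu> (1 - (1 - \<kappa> (inverse l ^ K) * x ^ K)) \<le> ennreal ((1 + real K) * r ^ K)"
    proof (rule always_eventually, rule allI)
      fix K
      have "\<nu> (\<kappa> (inverse l ^ K) * x ^ K) \<le> ennreal (cmod (inverse l ^ K)) * \<nu> (x ^ K)" by (rule nrm_scale)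
      also have "\<dots> \<le> ennreal (cmod (inverse l ^ K)) * ennreal (1 + real K)" by (intro mult_left_mono xk) auto
      finally show "\<nu> (1 - (1 - \<kappa> (inverse l ^ K) * x ^ K)) \<le> ennreal ((1 + real K) * r ^ K)"
        by (subst (asm) ennreal_mult[symmetric]) (auto simp: norm_power r_def mult.commute)
    qed
  qed auto
  have "(\<lambda>K. \<nu> ((\<kappa> l - x) * a - (\<kappa> l - x) * (\<Sum>k<K. s k))) \<longlonglongrightarrow> 0"
    by (rule mult_norm_diff_tendsto_0[OF a(2)]) (use x in simp)
  then have "(\<kappa> l - x) * a = 1" unfolding tel by (rule eq_if_norm_diff_tendsto_0[OF _ rest])
  then have res: "resolvent_mod L x l a"
    using a by (auto simp: resolvent_mod_def null_ideal_def bdd_functional_0[OF L])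
  then show "\<exists>a. resolvent_mod L x l a" by blast
  have sc: "s k \<in> carr" for k using x by (simp add: s_def)
  have Ls: "L (s k) = L (x ^ k) * inverse l ^ (k + 1)" for k
    unfolding s_def using x by (subst bdd_functional_scale[OF L]) auto
  have "(\<lambda>K. L a - L (\<Sum>k<K. s k)) \<longlonglongrightarrow> 0"
  proof (rule Lim_null_comparison[OF always_eventually])
    show "\<forall>K. cmod (L a - L (\<Sum>k<K. s k)) \<le> C * enn2real (\<nu> (a - (\<Sum>k<K. s k)))"
      using bdd_functional_bound[OF L] bdd_functional_diff[OF L] a sc by (metis carr_diff carr_sum)
    show "(\<lambda>K. C * enn2real (\<nu> (a - (\<Sum>k<K. s k)))) \<longlonglongrightarrow> 0"
      using tendsto_enn2real[of _ 0, simplified, OF a(2)] by (rule tendsto_mult_right_zero)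
  qed
  then have "(\<lambda>K. L (\<Sum>k<K. s k)) \<longlonglongrightarrow> L a" using tendsto_diff[OF tendsto_const[of "L a"]] by fastforce
  then show "(\<lambda>k. L (x ^ k) * inverse l ^ (k + 1)) sums resolvent_value L x l"
    using sc by (simp add: sums_def resolvent_value_eq[OF L x res] bdd_functional_sum[OF L] Ls)
qed

end

section \<open>Growth of entire functions\<close>

text \<open>Taking n-th roots removes the constants \<open>p\<close> and \<open>q\<close>. This is
  how auxiliary factors are discarded in the maximum principles below.\<close>

lemma le_if_power_le:
  fixes a b p q :: real
  assumes "\<And>n. n \<ge> 1 \<Longrightarrow> a ^ n * p \<le> b ^ n * q" "0 < p" "0 \<le> b" "0 \<le> a"
  shows "a \<le> b"
proof (rule ccontr)
  assume "\<not> a \<le> b"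
  then have ab: "b < a" by simp
  show False
  proof (cases "b = 0")
    case True
    then show False using assms(1)[of 1] ab assms(2) by (simp add: mult_le_0_iff)
  next
    case False
    then have b: "b > 0" using assms by simp
    obtain n where n: "q / p < (a / b) ^ n" using real_arch_pow[of "a / b" "q / p"] ab b by auto
    also have "\<dots> \<le> (a / b) ^ Suc n" using ab b by (intro power_increasing) auto
    also have "\<dots> = a ^ Suc n / b ^ Suc n" by (rule power_divide)
    finally have "q * b ^ Suc n < a ^ Suc n * p"
      using b assms(2) by (simp add: divide_less_eq less_divide_eq field_simps del: power_Suc)
    then show False using assms(1)[of "Suc n"] by (simp add: mult.commute del: power_Suc)
  qed
qed

text \<open>
  A high power of the function is multiplied by a fixed polynomial that vanishes at the exceptional
  points; the factor disappears when the root is taken.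
\<close>

lemma maximum_modulus_exceptional:
  fixes f :: "complex \<Rightarrow> complex"
  assumes hol: "f holomorphic_on interior S" and cont: "continuous_on (S - K) f"
    and S: "compact S" and K: "finite K"
    and bdd: "\<And>z. z \<in> S - K \<Longrightarrow> cmod (f z) \<le> B0"
    and fr: "\<And>z. z \<in> frontier S - K \<Longrightarrow> cmod (f z) \<le> B" and B: "0 \<le> B"
    and \<xi>: "\<xi> \<in> S - K"
  shows "cmod (f \<xi>) \<le> B"
proof -
  define P where "P z = (\<Prod>c\<in>K. z - c)" for z :: complex
  have Pcont: "continuous_on A P" for A unfolding P_def by (intro continuous_intros)
  have P0: "P z = 0 \<longleftrightarrow> z \<in> K" for z using K by (auto simp: P_def)
  obtain Q where Q: "\<And>z. z \<in> S \<Longrightarrow> cmod (P z) \<le> Q"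
    using compact_imp_bounded[OF compact_continuous_image[OF Pcont S]] by (auto simp: bounded_iff)
  have "cmod (f \<xi>) ^ n * cmod (P \<xi>) \<le> B ^ n * Q" if n: "n \<ge> 1" for n
  proof -
    have "cmod (f \<xi> ^ n * P \<xi>) \<le> B ^ n * Q"
    proof (rule maximum_modulus_frontier[where S = S and f = "\<lambda>z. f z ^ n * P z" and \<xi> = \<xi>])
      show "(\<lambda>z. f z ^ n * P z) holomorphic_on interior S"
        unfolding P_def by (intro holomorphic_intros hol)
      show "bounded S" using S by (rule compact_imp_bounded)
      show "\<xi> \<in> S" using \<xi> by simp
      show "continuous_on (closure S) (\<lambda>z. f z ^ n * P z)"
        unfolding closure_closed[OF compact_imp_closed[OF S]] continuous_on_def
      proof
        fix z assume z: "z \<in> S"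
        show "((\<lambda>z. f z ^ n * P z) \<longlongrightarrow> f z ^ n * P z) (at z within S)"
        proof (cases "z \<in> K")
          case False
          have "at z within S = at z within (S - K)"
            by (rule at_within_nhd[of _ "- K"]) (use False K in \<open>auto intro: finite_imp_closed\<close>)
          moreover have "continuous_on (S - K) (\<lambda>z. f z ^ n * P z)" by (intro continuous_intros cont Pcont)
          ultimately show ?thesis using z False by (auto simp: continuous_on_def)
        next
          case True
          have Pz: "(P \<longlongrightarrow> 0) (at z within S)"
            using Pcont[of S] z True P0[of z] by (auto simp: continuous_on_def)
          \<comment> \<open>At an exceptional point f^n stays bounded while \<open>P\<close>
            vanishes, so the product is continuous with value 0 whatever f is there.\<close>
          have lim: "((\<lambda>z. f z ^ n * P z) \<longlongrightarrow> 0) (at z within S)"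
          proof (rule Lim_null_comparison)
            show "\<forall>\<^sub>F w in at z within S. cmod (f w ^ n * P w) \<le> \<bar>B0\<bar> ^ n * cmod (P w)"
              unfolding eventually_at_filter
            proof (intro always_eventually allI impI)
              fix w assume "w \<noteq> z" "w \<in> S"
              show "cmod (f w ^ n * P w) \<le> \<bar>B0\<bar> ^ n * cmod (P w)"
              proof (cases "w \<in> K")
                case True then show ?thesis using P0[of w] by simp
              next
                case False
                then have "cmod (f w) \<le> \<bar>B0\<bar>" using bdd[of w] \<open>w \<in> S\<close> by auto
                then show ?thesis by (auto simp: norm_mult norm_power intro!: mult_right_mono power_mono)
              qed
            qed
            show "((\<lambda>w. \<bar>B0\<bar> ^ n * cmod (P w)) \<longlongrightarrow> 0) (at z within S)"
              using tendsto_mult_right_zero[OF tendsto_norm_zero[OF Pz]] .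
          qed
          have e0: "f z ^ n * P z = 0" using True P0[of z] by simp
          show ?thesis by (subst e0) (rule lim)
        qed
      qed
      show "cmod (f z ^ n * P z) \<le> B ^ n * Q" if z: "z \<in> frontier S" for z
      proof (cases "z \<in> K")
        case True
        have "0 \<le> Q" using Q[of \<xi>] \<xi> norm_ge_zero order_trans by blast
        then show ?thesis using True P0[of z] B by simp
      next
        case False
        have "z \<in> S" using z compact_imp_closed[OF S] frontier_subset_closed by blast
        then show ?thesis
          using fr[of z] z False Q[of z] B
          by (auto simp: norm_mult norm_power intro!: mult_mono power_mono)
      qed
    qed
    then show ?thesis by (simp add: norm_mult norm_power)
  qed
  moreover have "0 < cmod (P \<xi>)" using P0 \<xi> by auto
  ultimately show ?thesis using B by (rule le_if_power_le) auto
qed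

text \<open>Moving an interior point to the left turns a weak inequality such as |Im z| \<le> Re z
  into a strict one; this locates the interiors of the truncated sectors and half-planes
  below.\<close>

lemma left_translate_in_interior:
  fixes z :: complex
  assumes "z \<in> interior S"
  obtains e where "e > 0" "z - of_real e \<in> S"
proof -
  obtain e where e: "e > 0" "ball z e \<subseteq> S" using assms by (auto simp: mem_interior)
  have "z - of_real (e / 2) \<in> ball z e" using e by (simp add: dist_norm)
  then show ?thesis using e by (intro that[of "e / 2"]) auto
qed

text \<open>In the sector |arg s| \<le> pi/4 the argument of s^(3/2) is at most 3 pi/8 in modulus,
  and cos (3 pi/8) > 3/10. The proof replaces trigonometry by the real and imaginary part of the
  square root.\<close>

lemma Re_mult_csqrt_ge:
  assumes "\<bar>Im s\<bar> \<le> Re s"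
  shows "Re (s * csqrt s) \<ge> 3 / 10 * cmod s * sqrt (cmod s)"
proof -
  define t where "t = csqrt s"
  define a where "a = Re t"
  define b where "b = \<bar>Im t\<bar>"
  have st: "s = t\<^sup>2" by (simp add: t_def)
  have a: "a \<ge> 0" using csqrt_principal[of s] by (auto simp: a_def t_def)
  have b: "b \<ge> 0" by (simp add: b_def)
  have bs: "b\<^sup>2 = (Im t)\<^sup>2" by (simp add: b_def)
  have "Re s = a\<^sup>2 - b\<^sup>2" "\<bar>Im s\<bar> = 2 * a * b"
    using a by (auto simp: st a_def b_def power2_eq_square abs_mult)
  then have h: "2 * a * b \<le> a\<^sup>2 - b\<^sup>2" using assms by simp
  \<comment> \<open>The root has argument at most pi/8 in modulus, and tan (pi/8)^2 is about 0.172;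
    1/5 is a convenient rational bound.\<close>
  have b5: "5 * b\<^sup>2 \<le> a\<^sup>2"
  proof (rule ccontr)
    assume n: "\<not> 5 * b\<^sup>2 \<le> a\<^sup>2"
    have "\<not> 9 / 4 * b \<ge> a"
    proof
      assume le: "a \<le> 9 / 4 * b"
      have "a * a \<le> (9 / 4 * b) * a" by (rule mult_right_mono[OF le a])
      then have "b * (4 * b) \<le> b * a" using h by (simp add: power2_eq_square algebra_simps)
      then have "b = 0 \<or> 4 * b \<le> a" using b by (auto simp: mult_le_cancel_left)
      then have "b = 0" using le b by auto
      then show False using n a le by simp
    qed
    then have "9 / 4 * b < a" by simp
    then have "(9 / 4 * b) * (9 / 4 * b) \<le> a * a" using a b by (intro mult_mono) auto
    moreover have "0 \<le> b * b" by simp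
    ultimately show False using n unfolding power2_eq_square by linarith
  qed
  have "s * csqrt s = t\<^sup>2 * t" using st t_def by metis
  then have "Re (s * csqrt s) = a * (a\<^sup>2 - 3 * b\<^sup>2)"
    by (simp add: bs) (simp add: a_def power2_eq_square algebra_simps)
  moreover have "a * (a\<^sup>2 - 3 * b\<^sup>2) \<ge> a * (2 / 5 * a\<^sup>2)" using b5 a by (intro mult_left_mono) auto
  moreover have "3 / 10 * cmod s * sqrt (cmod s) \<le> a * (2 / 5 * a\<^sup>2)"
  proof -
    have n: "cmod s = (cmod t)\<^sup>2" by (simp add: st norm_power)
    have "(cmod t)\<^sup>2 = a\<^sup>2 + b\<^sup>2" by (simp add: cmod_power2 a_def bs)
    also have "\<dots> \<le> 121 / 100 * a\<^sup>2" using b5 zero_le_power2[of a] by linarith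
    also have "\<dots> = (11 / 10 * a)\<^sup>2" by (simp add: power2_eq_square)
    finally have le: "cmod t \<le> 11 / 10 * a" using a by (simp add: power2_le_iff_abs_le)
    have "cmod s * sqrt (cmod s) = cmod t ^ 3" by (simp add: n power3_eq_cube power2_eq_square)
    also have "\<dots> \<le> (11 / 10 * a) ^ 3" by (rule power_mono[OF le]) simp
    also have "3 / 10 * (11 / 10 * a) ^ 3 \<le> a * (2 / 5 * a\<^sup>2)"
    proof -
      have "0 \<le> a ^ 3" using a by simp
      then show ?thesis by (simp add: power3_eq_cube power2_eq_square field_simps)
    qed
    finally show ?thesis by simp
  qed
  ultimately show ?thesis by linarith
qed

text \<open>This sector meets the branch cut only in 0, where |csqrt w| = sqrt |w| gives
  continuity.\<close>

lemma continuous_on_csqrt_right: "continuous_on {s. \<bar>Im s\<bar> \<le> Re s} csqrt"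
  unfolding continuous_on_def
proof
  fix z assume z: "z \<in> {s. \<bar>Im s\<bar> \<le> Re s}"
  show "(csqrt \<longlongrightarrow> csqrt z) (at z within {s. \<bar>Im s\<bar> \<le> Re s})"
  proof (cases "z = 0")
    case True
    have "((\<lambda>w. sqrt (cmod w)) \<longlongrightarrow> sqrt (cmod 0)) (at 0 within {s. \<bar>Im s\<bar> \<le> Re s})"
      by (intro tendsto_intros)
    then have "((\<lambda>w. sqrt (cmod w)) \<longlongrightarrow> 0) (at 0 within {s. \<bar>Im s\<bar> \<le> Re s})" by simp
    then have "(csqrt \<longlongrightarrow> 0) (at 0 within {s. \<bar>Im s\<bar> \<le> Re s})"
      by (rule Lim_null_comparison[rotated]) (simp add: always_eventually)
    then show ?thesis using True by simp
  next
    case False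
    then have "z \<notin> \<real>\<^sub>\<le>\<^sub>0" using z by (auto simp: complex_nonpos_Reals_iff complex_eq_iff)
    then have "isCont csqrt z" by (rule continuous_at_csqrt)
    then show ?thesis by (auto simp: isCont_def intro: tendsto_within_subset)
  qed
qed

text \<open>The multiplier exp (- \<eta> s^(3/2)) has order 3/2, strictly between the order 1 of the
  growth and the critical order 2 of a sector of opening pi/2. It makes the arc of radius R
  negligible as R tends to infinity; then \<eta> tends to 0.\<close>

lemma Phragmen_Lindelof_quarter_plane:
  fixes f :: "complex \<Rightarrow> complex"
  assumes cont: "continuous_on {s. \<bar>Im s\<bar> \<le> Re s} f" and hol: "f holomorphic_on {s. \<bar>Im s\<bar> < Re s}"
    and growth: "\<And>s. \<bar>Im s\<bar> \<le> Re s \<Longrightarrow> cmod (f s) \<le> exp (C * (1 + cmod s))"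
    and bd: "\<And>s. \<bar>Im s\<bar> = Re s \<Longrightarrow> cmod (f s) \<le> M"
    and s0: "\<bar>Im s0\<bar> \<le> Re s0"
  shows "cmod (f s0) \<le> M"
proof -
  have M: "0 \<le> M" using bd[of 0] norm_ge_zero order_trans by (metis abs_0 zero_complex.simps)
  have step: "cmod (f s0) * exp (- \<eta> * Re (s0 * csqrt s0)) \<le> M" if \<eta>: "\<eta> > 0" for \<eta> :: real
  proof -
    define g where "g s = f s * exp (- of_real \<eta> * (s * csqrt s))" for s
    have ng: "cmod (g s) = cmod (f s) * exp (- \<eta> * Re (s * csqrt s))" for s
      by (simp add: g_def norm_mult)
    define E where "E R = exp (C * (1 + R) - 3 / 10 * \<eta> * R * sqrt R)" for R
    have "cmod (g s0) \<le> M + E R" if R: "R > cmod s0" for R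
    proof (rule maximum_modulus_frontier[where S = "{s. \<bar>Im s\<bar> \<le> Re s} \<inter> cball 0 R" and f = g])
      let ?T = "{s. \<bar>Im s\<bar> \<le> Re s} \<inter> cball 0 R"
      have cl: "closed {s. \<bar>Im s\<bar> \<le> Re s}" by (intro closed_Collect_le continuous_intros)
      then have clT: "closed ?T" by auto
      have int: "interior ?T \<subseteq> {s. \<bar>Im s\<bar> < Re s}"
      proof
        fix z assume "z \<in> interior ?T"
        then obtain e where "e > 0" "z - of_real e \<in> ?T" by (rule left_translate_in_interior)
        then show "z \<in> {s. \<bar>Im s\<bar> < Re s}" by auto
      qed
      show "g holomorphic_on interior ?T"
        unfolding g_def
      proof (intro holomorphic_intros)
        show "f holomorphic_on interior ?T" using hol int holomorphic_on_subset by blast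
        show "z \<notin> \<real>\<^sub>\<le>\<^sub>0" if "z \<in> interior ?T" for z
          using that int by (auto simp: complex_nonpos_Reals_iff)
      qed
      show "continuous_on (closure ?T) g"
        unfolding closure_closed[OF clT] g_def
        by (intro continuous_intros continuous_on_subset[OF cont] continuous_on_subset[OF continuous_on_csqrt_right]) auto
      show "bounded ?T" by (auto intro: bounded_subset[OF bounded_cball])
      show "s0 \<in> ?T" using s0 R by auto
      show "cmod (g z) \<le> M + E R" if z: "z \<in> frontier ?T" for z
      proof -
        have zT: "z \<in> ?T" using z frontier_subset_closed[OF clT] by blast
        have "open ({s. \<bar>Im s\<bar> < Re s} \<inter> ball 0 R)"
          by (intro open_Int open_ball open_Collect_less continuous_intros)
        then have "{s. \<bar>Im s\<bar> < Re s} \<inter> ball 0 R \<subseteq> interior ?T" by (intro interior_maximal) auto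
        then have "z \<notin> {s. \<bar>Im s\<bar> < Re s} \<inter> ball 0 R" using z by (auto simp only: frontier_def)
        then have cases: "\<bar>Im z\<bar> = Re z \<or> cmod z = R" using zT by auto
        have ReP: "Re (z * csqrt z) \<ge> 3 / 10 * cmod z * sqrt (cmod z)"
          by (rule Re_mult_csqrt_ge) (use zT in auto)
        from cases show ?thesis
        proof
          assume "\<bar>Im z\<bar> = Re z"
          then have "cmod (f z) \<le> M" by (rule bd)
          moreover have "0 \<le> Re (z * csqrt z)" by (rule order_trans[OF _ ReP]) simp
          then have "exp (- \<eta> * Re (z * csqrt z)) \<le> 1" using \<eta> by simp
          ultimately have "cmod (g z) \<le> M * 1" unfolding ng using M by (intro mult_mono) auto
          then show ?thesis by (simp add: E_def add_increasing2)
        next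
          assume zR: "cmod z = R"
          have "cmod (g z) \<le> exp (C * (1 + R)) * exp (- (3 / 10 * \<eta> * R * sqrt R))"
            unfolding ng
          proof (rule mult_mono)
            show "cmod (f z) \<le> exp (C * (1 + R))" using growth[of z] zT zR by auto
            have "\<eta> * (3 / 10 * R * sqrt R) \<le> \<eta> * Re (z * csqrt z)"
              using ReP zR \<eta> by (intro mult_left_mono) auto
            then show "exp (- \<eta> * Re (z * csqrt z)) \<le> exp (- (3 / 10 * \<eta> * R * sqrt R))"
              by (simp add: algebra_simps)
          qed auto
          also have "\<dots> = E R" unfolding E_def exp_add[symmetric] by simp
          finally show ?thesis using M by simp
        qed
      qed
    qed
    then have "\<forall>\<^sub>F R in at_top. cmod (g s0) \<le> M + E R"
      by (rule eventually_mono[OF eventually_gt_at_top])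
    moreover have "((\<lambda>R. M + E R) \<longlongrightarrow> M + 0) at_top"
      unfolding E_def using \<eta> by (intro tendsto_add tendsto_const) real_asymp
    ultimately have "cmod (g s0) \<le> M + 0" by (intro tendsto_lowerbound) auto
    then show ?thesis by (simp add: ng)
  qed
  have "((\<lambda>\<eta>. cmod (f s0) * exp (- \<eta> * Re (s0 * csqrt s0))) \<longlongrightarrow> cmod (f s0) * exp (- 0 * Re (s0 * csqrt s0))) (at_right 0)"
    by (intro tendsto_intros)
  moreover have "\<forall>\<^sub>F \<eta> in at_right 0. cmod (f s0) * exp (- \<eta> * Re (s0 * csqrt s0)) \<le> M"
    using step by (auto simp: eventually_at_right_field intro!: exI[of _ 1])
  ultimately have "cmod (f s0) * exp (- 0 * Re (s0 * csqrt s0)) \<le> M"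
    by (intro tendsto_upperbound) auto
  then show ?thesis by simp
qed

text \<open>For bounded f the quotient f^n / (1 + s) tends to 0 at infinity, so the maximum
  principle on large half-discs applies. The factor 1 + s disappears with the n-th root.\<close>

lemma bounded_half_plane_maximum:
  fixes f :: "complex \<Rightarrow> complex"
  assumes cont: "continuous_on {s. 0 \<le> Re s} f" and hol: "f holomorphic_on {s. 0 < Re s}"
    and bdd: "\<And>s. 0 \<le> Re s \<Longrightarrow> cmod (f s) \<le> B"
    and bd: "\<And>s. Re s = 0 \<Longrightarrow> cmod (f s) \<le> M"
    and s0: "0 \<le> Re s0"
  shows "cmod (f s0) \<le> M"
proof -
  have M: "0 \<le> M" using bd[of 0] norm_ge_zero order_trans by (metis zero_complex.simps(1))
  have ge1: "1 \<le> cmod (1 + s)" if "0 \<le> Re s" for s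
    using that complex_Re_le_cmod[of "1 + s"] by simp
  have gen: "cmod s \<le> cmod (1 + s)" if "0 \<le> Re s" for s
    unfolding cmod_def using that by (intro real_sqrt_le_mono) (simp add: power2_eq_square algebra_simps)
  have ne: "1 + s \<noteq> 0" if "0 \<le> Re s" for s using ge1[OF that] by auto
  have "cmod (f s0) ^ n * (1 / cmod (1 + s0)) \<le> M ^ n * 1" for n
  proof -
    define g where "g s = f s ^ n / (1 + s)" for s
    have "cmod (g s0) \<le> M ^ n + \<bar>B\<bar> ^ n / R" if R: "R > cmod s0" for R
    proof (rule maximum_modulus_frontier[where S = "{s. 0 \<le> Re s} \<inter> cball 0 R" and f = g])
      let ?T = "{s. 0 \<le> Re s} \<inter> cball 0 R"
      have Rp: "R > 0" using R norm_ge_zero[of s0] by linarith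
      have cl: "closed {s. 0 \<le> Re s}" by (intro closed_Collect_le continuous_intros)
      then have clT: "closed ?T" by auto
      have int: "interior ?T \<subseteq> {s. 0 < Re s}"
      proof
        fix z assume "z \<in> interior ?T"
        then obtain e where "e > 0" "z - of_real e \<in> ?T" by (rule left_translate_in_interior)
        then show "z \<in> {s. 0 < Re s}" by auto
      qed
      show "g holomorphic_on interior ?T" unfolding g_def
        by (intro holomorphic_intros holomorphic_on_subset[OF hol int]) (use int ne in force)
      show "continuous_on (closure ?T) g"
        unfolding closure_closed[OF clT] g_def
        by (intro continuous_intros continuous_on_subset[OF cont]) (use ne in auto)
      show "bounded ?T" by (auto intro: bounded_subset[OF bounded_cball])
      show "s0 \<in> ?T" using s0 R by auto
      show "cmod (g z) \<le> M ^ n + \<bar>B\<bar> ^ n / R" if z: "z \<in> frontier ?T" for z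
      proof -
        have zT: "z \<in> ?T" using z frontier_subset_closed[OF clT] by blast
        have "open ({s. 0 < Re s} \<inter> ball 0 R)"
          by (intro open_Int open_ball open_Collect_less continuous_intros)
        then have "{s. 0 < Re s} \<inter> ball 0 R \<subseteq> interior ?T" by (intro interior_maximal) auto
        then have "z \<notin> {s. 0 < Re s} \<inter> ball 0 R" using z by (auto simp only: frontier_def)
        then have cases: "Re z = 0 \<or> cmod z = R" using zT by auto
        have gz: "cmod (g z) = cmod (f z) ^ n / cmod (1 + z)" by (simp add: g_def norm_divide norm_power)
        from cases show ?thesis
        proof
          assume "Re z = 0"
          then have "cmod (f z) ^ n / cmod (1 + z) \<le> M ^ n / 1"
            using bd[of z] ge1[of z] M by (intro frac_le power_mono) auto
          then show ?thesis unfolding gz using Rp by (simp add: add_increasing2)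
        next
          assume "cmod z = R"
          moreover have "cmod (f z) \<le> \<bar>B\<bar>" using bdd[of z] zT by auto
          ultimately have "cmod (f z) ^ n / cmod (1 + z) \<le> \<bar>B\<bar> ^ n / R"
            using gen[of z] zT Rp by (intro frac_le power_mono) auto
          then show ?thesis unfolding gz using M by (simp add: add_increasing)
        qed
      qed
    qed
    then have "\<forall>\<^sub>F R in at_top. cmod (g s0) \<le> M ^ n + \<bar>B\<bar> ^ n / R"
      by (rule eventually_mono[OF eventually_gt_at_top])
    moreover have "((\<lambda>R. M ^ n + \<bar>B\<bar> ^ n / R) \<longlongrightarrow> M ^ n + 0) at_top"
      by (intro tendsto_add tendsto_const real_tendsto_divide_at_top[OF tendsto_const] filterlim_ident)
    ultimately have "cmod (g s0) \<le> M ^ n + 0" by (intro tendsto_lowerbound) auto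
    then show ?thesis by (simp add: g_def norm_divide norm_power)
  qed
  moreover have "0 < 1 / cmod (1 + s0)" using ne[OF s0] by simp
  ultimately show ?thesis using M by (intro le_if_power_le[of "cmod (f s0)" "1 / cmod (1 + s0)" M 1]) auto
qed

text \<open>
  The maximum principle on a square with corners \<open>\<plusminus>R\<close>, \<open>\<plusminus>\<i>R\<close>: at the two corners on the imaginary axis
  the interior angle is less than \<open>\<pi>\<close>, so the multiplier absorbs the singular bound.
\<close>

lemma exponential_type_if_singular_bound:
  fixes H :: "complex \<Rightarrow> complex"
  assumes hol: "H holomorphic_on UNIV" and A: "0 \<le> A"
    and bd: "\<And>R s. 1 \<le> R \<Longrightarrow> cmod s \<le> R \<Longrightarrow> Re s \<noteq> 0 \<Longrightarrow> cmod (H s) \<le> exp (A * R\<^sup>2 / \<bar>Re s\<bar>)"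
  shows "cmod (H s0) \<le> exp (16 * A * (1 + cmod s0))"
proof -
  \<comment> \<open>The factor 2 gives |s0| \<le> R/2, so \<open>s0\<close> stays away from the
    singularities of \<open>p\<close> and Re (p s0) is of order A R only.\<close>
  define R where "R = 2 * (1 + cmod s0)"
  have R1: "R \<ge> 1" by (simp add: R_def)
  define S where "S = {s. \<bar>Re s\<bar> + \<bar>Im s\<bar> \<le> R}"
  define c1 where "c1 = \<i> * of_real R"
  define K where "K = {c1, - c1}"
  \<comment> \<open>The poles are the corners i R and - i R. The weight 2 A R^2 makes Re p at least
    A R^2 / |Re s| on the sides of the square.\<close>
  define p where "p s = of_real (2 * A * R\<^sup>2) * (1 / (of_real R + \<i> * s) + 1 / (of_real R - \<i> * s))" for s
  define q where "q s = exp (- p s) * H s" for s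
  have clS: "closed S" unfolding S_def by (intro closed_Collect_le continuous_intros)
  have SR: "cmod s \<le> R" if "s \<in> S" for s using that cmod_le[of s] by (auto simp: S_def)
  then have "bounded S" by (auto simp: bounded_iff)
  then have cS: "compact S" using clS by (simp add: compact_eq_bounded_closed)
  have nz: "of_real R + \<i> * s \<noteq> 0 \<and> of_real R - \<i> * s \<noteq> 0" if "s \<notin> K" for s
    using that by (auto simp: K_def c1_def complex_eq_iff)
  have inv: "Re (1 / (of_real R + \<i> * s)) = (R - Im s) / ((R - Im s)\<^sup>2 + (Re s)\<^sup>2)"
    "Re (1 / (of_real R - \<i> * s)) = (R + Im s) / ((R + Im s)\<^sup>2 + (Re s)\<^sup>2)" for s
    by (simp_all add: Re_divide)
  have Rep: "Re (p s) = 2 * A * R\<^sup>2 * (Re (1 / (of_real R + \<i> * s)) + Re (1 / (of_real R - \<i> * s)))" for s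
    unfolding p_def
    by (simp only: Re_complex_of_real Im_complex_of_real times_complex.simps plus_complex.simps mult_zero_left diff_zero)
  have pS: "0 \<le> Re (p s)" if "s \<in> S" for s
  proof -
    have "0 \<le> R - Im s" "0 \<le> R + Im s" using that by (auto simp: S_def)
    then show ?thesis using A unfolding Rep inv by (intro mult_nonneg_nonneg add_nonneg_nonneg) auto
  qed
  obtain B0 where B0: "\<And>s. s \<in> S \<Longrightarrow> cmod (H s) \<le> B0"
    using compact_imp_bounded[OF compact_continuous_image[OF _ cS, of H]] holomorphic_on_imp_continuous_on[OF hol]
    by (auto simp: bounded_iff intro: continuous_on_subset)
  have qle: "cmod (q s) = exp (- Re (p s)) * cmod (H s)" for s by (simp add: q_def norm_mult)
  have s0S: "s0 \<in> S"
    using abs_Re_le_cmod[of s0] abs_Im_le_cmod[of s0] by (auto simp: S_def R_def)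
  have s0K: "s0 \<notin> K"
  proof -
    have "cmod c1 = R" using R1 by (simp add: c1_def norm_mult)
    then have "cmod s0 = R" if "s0 \<in> K" using that by (auto simp: K_def)
    moreover have "cmod s0 < R" unfolding R_def by (rule order.strict_trans1[of _ "1 * cmod s0"]) (auto intro!: mult_strict_mono' simp: add_nonneg_pos)
    ultimately show ?thesis by auto
  qed
  have "cmod (q s0) \<le> 1"
  proof (rule maximum_modulus_exceptional[OF _ _ cS, of q K B0 1])
    show "q holomorphic_on interior S"
    proof -
      have "s \<notin> K" if s: "s \<in> interior S" for s
      proof
        assume "s \<in> K"
        obtain e where "e > 0" "s - of_real e \<in> S" using s by (rule left_translate_in_interior)
        then show False using \<open>s \<in> K\<close> R1 by (auto simp: K_def c1_def S_def)
      qed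
      then show ?thesis unfolding q_def p_def
        by (intro holomorphic_intros holomorphic_on_subset[OF hol]) (use nz in auto)
    qed
    show "continuous_on (S - K) q" unfolding q_def p_def
      by (intro continuous_intros continuous_on_subset[OF holomorphic_on_imp_continuous_on[OF hol]]) (use nz in auto)
    show "finite K" by (simp add: K_def)
    show "cmod (q z) \<le> B0" if z: "z \<in> S - K" for z
    proof -
      have "exp (- Re (p z)) * cmod (H z) \<le> 1 * B0" using pS[of z] B0[of z] z by (intro mult_mono) auto
      then show ?thesis by (simp add: qle)
    qed
    show "cmod (q z) \<le> 1" if z: "z \<in> frontier S - K" for z
    proof -
      have zS: "z \<in> S" using z frontier_subset_closed[OF clS] by blast
      have "open {s. \<bar>Re s\<bar> + \<bar>Im s\<bar> < R}" by (intro open_Collect_less continuous_intros)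
      then have "{s. \<bar>Re s\<bar> + \<bar>Im s\<bar> < R} \<subseteq> interior S" by (intro interior_maximal) (auto simp: S_def)
      then have "z \<notin> {s. \<bar>Re s\<bar> + \<bar>Im s\<bar> < R}" using z by (auto simp only: frontier_def)
      then have zb: "\<bar>Re z\<bar> + \<bar>Im z\<bar> = R" using zS by (auto simp: S_def)
      have Re0: "Re z \<noteq> 0"
      proof
        assume "Re z = 0"
        then have "z \<in> K" using zb by (auto simp: K_def c1_def complex_eq_iff abs_if split: if_splits)
        then show False using z by simp
      qed
      \<comment> \<open>On a side one of R - Im z and R + Im z equals |Re z|, and the corresponding
        fraction in \<open>inv\<close> is then exactly 1 / (2 |Re z|).\<close>
      have half: "x / (x\<^sup>2 + (Re z)\<^sup>2) = 1 / (2 * \<bar>Re z\<bar>)" if "x = \<bar>Re z\<bar>" for x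
        using Re0 by (simp add: that power2_eq_square field_simps)
      have nn: "0 \<le> (R - Im z) / ((R - Im z)\<^sup>2 + (Re z)\<^sup>2)" "0 \<le> (R + Im z) / ((R + Im z)\<^sup>2 + (Re z)\<^sup>2)"
        using zS by (auto simp: S_def)
      have "1 / (2 * \<bar>Re z\<bar>) \<le> Re (1 / (of_real R + \<i> * z) + 1 / (of_real R - \<i> * z))"
      proof (cases "Im z \<ge> 0")
        case True
        have "(R - Im z) / ((R - Im z)\<^sup>2 + (Re z)\<^sup>2) = 1 / (2 * \<bar>Re z\<bar>)"
          by (rule half) (use True zb in simp)
        then show ?thesis using nn unfolding plus_complex.simps inv by linarith
      next
        case False
        have "(R + Im z) / ((R + Im z)\<^sup>2 + (Re z)\<^sup>2) = 1 / (2 * \<bar>Re z\<bar>)"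
          by (rule half) (use False zb in simp)
        then show ?thesis using nn unfolding plus_complex.simps inv by linarith
      qed
      then have "2 * A * R\<^sup>2 * (1 / (2 * \<bar>Re z\<bar>)) \<le> 2 * A * R\<^sup>2 * Re (1 / (of_real R + \<i> * z) + 1 / (of_real R - \<i> * z))"
        using A by (intro mult_left_mono) auto
      also have "\<dots> = Re (p z)" unfolding Rep by simp
      finally have "A * R\<^sup>2 / \<bar>Re z\<bar> \<le> Re (p z)" by simp
      then have "cmod (q z) \<le> exp (- (A * R\<^sup>2 / \<bar>Re z\<bar>)) * exp (A * R\<^sup>2 / \<bar>Re z\<bar>)"
        unfolding qle using bd[OF R1 SR[OF zS] Re0] by (intro mult_mono) auto
      then show ?thesis by (simp add: exp_minus)
    qed
    show "s0 \<in> S - K" using s0S s0K by simp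
  qed auto
  then have "exp (- Re (p s0)) * cmod (H s0) \<le> 1" by (simp add: qle)
  then have "cmod (H s0) \<le> exp (Re (p s0))" by (simp add: exp_minus field_simps)
  also have "Re (p s0) \<le> 16 * A * (1 + cmod s0)"
  proof -
    have h: "cmod (1 / (of_real R + \<i> * s)) \<le> 2 / R" if "cmod s \<le> R / 2" for s
    proof -
      have "R - cmod s \<le> cmod (of_real R + \<i> * s)"
        using norm_diff_ineq[of "of_real R" "\<i> * s"] R1 by (simp add: norm_mult)
      then have "R / 2 \<le> cmod (of_real R + \<i> * s)" using that by linarith
      then have "1 / cmod (of_real R + \<i> * s) \<le> 1 / (R / 2)" using R1 by (intro frac_le) auto
      then show ?thesis by (simp add: norm_divide)
    qed
    have "cmod s0 \<le> R / 2" by (simp add: R_def)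
    then have "cmod (1 / (of_real R + \<i> * s0)) \<le> 2 / R" "cmod (1 / (of_real R - \<i> * s0)) \<le> 2 / R"
      using h[of s0] h[of "- s0"] by auto
    then have tri: "cmod (1 / (of_real R + \<i> * s0) + 1 / (of_real R - \<i> * s0)) \<le> 2 / R + 2 / R"
      by (meson norm_triangle_mono)
    have "Re (p s0) \<le> cmod (p s0)" by (rule complex_Re_le_cmod)
    moreover have "cmod (p s0) = 2 * A * R\<^sup>2 * cmod (1 / (of_real R + \<i> * s0) + 1 / (of_real R - \<i> * s0))"
      unfolding p_def norm_mult norm_of_real by (subst abs_of_nonneg) (use A in auto)
    moreover have "2 * A * R\<^sup>2 * cmod (1 / (of_real R + \<i> * s0) + 1 / (of_real R - \<i> * s0)) \<le>
        2 * A * R\<^sup>2 * (2 / R + 2 / R)"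
      by (rule mult_left_mono[OF tri]) (use A in simp)
    ultimately have "Re (p s0) \<le> 2 * A * R\<^sup>2 * (2 / R + 2 / R)" by linarith
    also have "\<dots> = 8 * A * R" using R1 by (simp add: power2_eq_square)
    finally show ?thesis by (simp add: R_def algebra_simps)
  qed
  finally show ?thesis by simp
qed

text \<open>With u = 1 - r and y = (1 + k) u, the inequality y^\<gamma> \<le> 1 + y bounds the
  weight by u^(-\<gamma>) (1 + (1 + k) u). Only the sums of r^k and of (1 + k) r^k remain, and each
  contributes C u^(-1-\<gamma>).\<close>

lemma weighted_geometric_bound:
  fixes a :: "nat \<Rightarrow> complex"
  assumes a: "\<And>k. cmod (a k) \<le> C * (1 + real k) powr \<gamma>" and \<gamma>: "0 \<le> \<gamma>" "\<gamma> \<le> 1"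
    and r: "0 \<le> r" "r < 1" and C: "0 \<le> C"
  shows "summable (\<lambda>k. cmod (a k) * r ^ k)"
    "(\<Sum>k. cmod (a k) * r ^ k) \<le> 2 * C * (1 - r) powr (- 1 - \<gamma>)"
proof -
  define u where "u = 1 - r"
  have u: "0 < u" using r by (simp add: u_def)
  have g1: "(\<lambda>k. r ^ k) sums (1 / u)" unfolding u_def using geometric_sums[of r] r by simp
  have g2: "(\<lambda>k. (1 + real k) * r ^ k) sums (1 / u\<^sup>2)"
    using geometric_deriv_sums[of r] r by (simp add: u_def add.commute)
  have S: "(\<lambda>k. C * u powr (- \<gamma>) * (r ^ k + u * ((1 + real k) * r ^ k))) sums
      (C * u powr (- \<gamma>) * (1 / u + u * (1 / u\<^sup>2)))"
    by (intro sums_mult sums_add g1 g2)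
  have le: "cmod (a k) * r ^ k \<le> C * u powr (- \<gamma>) * (r ^ k + u * ((1 + real k) * r ^ k))" for k
  proof -
    define y where "y = (1 + real k) * u"
    have y: "y > 0" using u by (simp add: y_def)
    have "y powr \<gamma> \<le> 1 + y"
    proof (cases "y \<le> 1")
      case True
      then have "y powr \<gamma> \<le> 1" using y \<gamma> by (simp add: powr_le1)
      then show ?thesis using y by simp
    next
      case False
      then have "y powr \<gamma> \<le> y powr 1" using \<gamma> by (intro powr_mono) auto
      then show ?thesis using y by simp
    qed
    moreover have "y powr \<gamma> = (1 + real k) powr \<gamma> * u powr \<gamma>"
      unfolding y_def using u by (intro powr_mult)
    then have "(1 + real k) powr \<gamma> = y powr \<gamma> * u powr (- \<gamma>)"
      using u by (simp add: powr_minus)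
    ultimately have "(1 + real k) powr \<gamma> \<le> (1 + y) * u powr (- \<gamma>)"
      by (simp add: mult_right_mono)
    then have "cmod (a k) \<le> C * ((1 + y) * u powr (- \<gamma>))"
      using a[of k] C by (meson mult_left_mono order_trans)
    then have "cmod (a k) * r ^ k \<le> C * ((1 + y) * u powr (- \<gamma>)) * r ^ k"
      using r by (intro mult_right_mono) auto
    then show ?thesis by (simp add: y_def algebra_simps)
  qed
  show sm: "summable (\<lambda>k. cmod (a k) * r ^ k)"
    by (rule summable_comparison_test[OF _ sums_summable[OF S]]) (use le r in \<open>auto intro!: exI[of _ 0]\<close>)
  have "(\<Sum>k. cmod (a k) * r ^ k) \<le> C * u powr (- \<gamma>) * (1 / u + u * (1 / u\<^sup>2))"
    using suminf_le[OF le sm sums_summable[OF S]] sums_unique[OF S] by simp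
  also have "\<dots> = 2 * C * (u powr (- 1) * u powr (- \<gamma>))"
    using u by (simp add: power2_eq_square powr_minus_divide mult.commute)
  also have "u powr (- 1) * u powr (- \<gamma>) = u powr (- 1 - \<gamma>)"
    using powr_add[of u "- 1" "- \<gamma>"] by simp
  finally show "(\<Sum>k. cmod (a k) * r ^ k) \<le> 2 * C * (1 - r) powr (- 1 - \<gamma>)" by (simp add: u_def)
qed

text \<open>For \<epsilon> > 0 the function H e^(\<epsilon> z) / (z - 1)^4 is bounded on the
  negative axis and on the imaginary axis, hence by Phragmen-Lindelof on both quadrants between
  them, with a bound that depends on \<epsilon>. Once it is bounded, the half-plane principle
  replaces that bound by M, which comes from the imaginary axis and does not depend on \<epsilon>.
  Then \<epsilon> tends to 0.\<close>

lemma subexponential_polynomial_bound: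
  fixes H :: "complex \<Rightarrow> complex"
  assumes hol: "H holomorphic_on UNIV" and M: "0 \<le> M" and C: "0 \<le> C"
    and right: "\<And>z. 0 \<le> Re z \<Longrightarrow> cmod (H z) \<le> M * cmod (z + 1) ^ 4"
    and expo: "\<And>z. cmod (H z) \<le> exp (K * (1 + cmod z))" and K: "0 \<le> K"
    and left: "\<And>\<epsilon>. \<epsilon> > 0 \<Longrightarrow> \<exists>t0\<ge>0. \<forall>t\<ge>t0. cmod (H (- of_real t)) \<le> C * exp (\<epsilon> * t)"
    and z0: "Re z0 \<le> 0"
  shows "cmod (H z0) \<le> M * cmod (z0 - 1) ^ 4"
proof -
  have step: "cmod (H z0) * exp (\<epsilon> * Re z0) \<le> M * cmod (z0 - 1) ^ 4" if \<epsilon>: "\<epsilon> > 0" for \<epsilon>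
  proof -
    define k where "k z = H z * exp (of_real \<epsilon> * z) / (z - 1) ^ 4" for z
    have ne: "z - 1 \<noteq> 0" if "Re z \<le> 0" for z using that by auto
    have ge1: "1 \<le> cmod (z - 1)" if "Re z \<le> 0" for z
      using that abs_Re_le_cmod[of "z - 1"] by simp
    have nk: "cmod (k z) = cmod (H z) * exp (\<epsilon> * Re z) / cmod (z - 1) ^ 4" for z
      by (simp add: k_def norm_mult norm_divide norm_power)
    have kH: "cmod (k z) \<le> cmod (H z) * exp (\<epsilon> * Re z)" if "Re z \<le> 0" for z
    proof -
      have "1 \<le> cmod (z - 1) ^ 4" using ge1[OF that] by simp
      then have "cmod (H z) * exp (\<epsilon> * Re z) / cmod (z - 1) ^ 4 \<le> cmod (H z) * exp (\<epsilon> * Re z) / 1"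
        by (intro divide_left_mono) auto
      then show ?thesis by (simp add: nk)
    qed
    have kH': "cmod (k z) \<le> cmod (H z)" if "Re z \<le> 0" for z
    proof -
      have "cmod (H z) * exp (\<epsilon> * Re z) \<le> cmod (H z) * 1"
        using that \<epsilon> by (intro mult_left_mono) (auto simp: mult_nonneg_nonpos)
      then show ?thesis using kH[OF that] by simp
    qed
    have khol: "k holomorphic_on {z. Re z \<le> 0}" unfolding k_def
      by (intro holomorphic_intros holomorphic_on_subset[OF hol]) (use ne in auto)
    obtain t0 where t0: "t0 \<ge> 0" "\<And>t. t \<ge> t0 \<Longrightarrow> cmod (H (- of_real t)) \<le> C * exp (\<epsilon> * t)"
      using left[OF \<epsilon>] by blast
    define B where "B = max C (max (exp (K * (1 + t0))) M)"
    have Bneg: "cmod (k (- of_real t)) \<le> B" if t: "t \<ge> 0" for t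
    proof (cases "t \<ge> t0")
      case True
      have "cmod (k (- of_real t)) \<le> cmod (H (- of_real t)) * exp (\<epsilon> * (- t))"
        using kH[of "- of_real t"] t by simp
      also have "\<dots> \<le> C * exp (\<epsilon> * t) * exp (\<epsilon> * (- t))" using t0 True by (intro mult_right_mono) auto
      also have "\<dots> = C" by (simp add: exp_minus)
      finally show ?thesis by (simp add: B_def)
    next
      case False
      have "cmod (k (- of_real t)) \<le> exp (K * (1 + t))"
        using kH'[of "- of_real t"] expo[of "- of_real t"] t by simp
      also have "\<dots> \<le> exp (K * (1 + t0))" using False K by (simp add: mult_left_mono)
      finally show ?thesis by (simp add: B_def)
    qed
    have Bim: "cmod (k z) \<le> M" if z: "Re z = 0" for z
    proof -
      have "cmod (z + 1) = cmod (z - 1)" using z by (simp add: cmod_def)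
      then have "cmod (H z) \<le> M * cmod (z - 1) ^ 4" using right[of z] z by simp
      then show ?thesis using ge1[of z] z unfolding nk by (simp add: divide_le_eq M)
    qed
    have kB: "cmod (k z) \<le> B" if z: "Re z \<le> 0" for z
    proof -
      \<comment> \<open>Multiplication by - 1 + i or - 1 - i carries the sector |Im s| \<le> Re s
        onto the second or third quadrant. The modulus of \<open>c\<close> only changes the
        exponential type.\<close>
      have main: "cmod (k (c * s)) \<le> B"
        if c: "c = - 1 + \<i> \<or> c = - 1 - \<i>" and s: "\<bar>Im s\<bar> \<le> Re s" for c s
      proof (rule Phragmen_Lindelof_quarter_plane[of "\<lambda>s. k (c * s)" "2 * K"])
        have Re_le: "Re (c * s) \<le> 0" if "\<bar>Im s\<bar> \<le> Re s" for s using c that by auto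
        show "continuous_on {s. \<bar>Im s\<bar> \<le> Re s} (\<lambda>s. k (c * s))"
          by (rule continuous_on_compose2[OF holomorphic_on_imp_continuous_on[OF khol]])
            (use Re_le in \<open>auto intro!: continuous_intros\<close>)
        show "(\<lambda>s. k (c * s)) holomorphic_on {s. \<bar>Im s\<bar> < Re s}"
          by (rule holomorphic_on_compose_gen[OF _ khol, unfolded o_def])
            (use Re_le in \<open>auto intro!: holomorphic_intros\<close>)
        show "cmod (k (c * s)) \<le> exp (2 * K * (1 + cmod s))" if s: "\<bar>Im s\<bar> \<le> Re s" for s
        proof -
          have "cmod c \<le> 2" using c norm_triangle_ineq[of "- 1" \<i>] norm_triangle_ineq4[of "- 1" \<i>] by auto
          then have "cmod (c * s) \<le> 2 * cmod s" by (simp add: norm_mult mult_right_mono)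
          then have "1 + cmod (c * s) \<le> 2 * (1 + cmod s)" by simp
          then have "K * (1 + cmod (c * s)) \<le> K * (2 * (1 + cmod s))" by (rule mult_left_mono[OF _ K])
          then have "exp (K * (1 + cmod (c * s))) \<le> exp (2 * K * (1 + cmod s))" by (simp add: algebra_simps)
          then show ?thesis using kH'[OF Re_le[OF s]] expo[of "c * s"] by linarith
        qed
        show "cmod (k (c * s)) \<le> B" if s: "\<bar>Im s\<bar> = Re s" for s
        proof (cases "Re (c * s) = 0")
          case True then show ?thesis using Bim[of "c * s"] by (simp add: B_def)
        next
          case False
          have "c * s = - of_real (2 * Re s)"
            using c s False by (auto simp: complex_eq_iff abs_if split: if_splits)
          moreover have "0 \<le> Re s" using s abs_ge_zero[of "Im s"] by linarith
          ultimately show ?thesis using Bneg[of "2 * Re s"] by simp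
        qed
        show "\<bar>Im s\<bar> \<le> Re s" by (rule s)
      qed
      show ?thesis
      proof (cases "Im z \<ge> 0")
        case True
        define s where "s = Complex ((Im z - Re z) / 2) (- (Re z + Im z) / 2)"
        have "(- 1 + \<i>) * s = z" by (simp add: s_def complex_eq_iff field_simps)
        moreover have "\<bar>Im s\<bar> \<le> Re s" using True z by (auto simp: s_def)
        ultimately show ?thesis using main[of "- 1 + \<i>" s] by simp
      next
        case False
        define s where "s = Complex (- (Re z + Im z) / 2) ((Re z - Im z) / 2)"
        have "(- 1 - \<i>) * s = z" by (simp add: s_def complex_eq_iff field_simps)
        moreover have "\<bar>Im s\<bar> \<le> Re s" using False z by (auto simp: s_def)
        ultimately show ?thesis using main[of "- 1 - \<i>" s] by simp
      qed
    qed
    have "cmod (k (- (- z0))) \<le> M"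
    proof (rule bounded_half_plane_maximum[of "\<lambda>s. k (- s)" B])
      show "continuous_on {s. 0 \<le> Re s} (\<lambda>s. k (- s))"
        by (rule continuous_on_compose2[OF holomorphic_on_imp_continuous_on[OF khol]])
          (auto intro!: continuous_intros)
      show "(\<lambda>s. k (- s)) holomorphic_on {s. 0 < Re s}"
        by (rule holomorphic_on_compose_gen[OF _ khol, unfolded o_def]) (auto intro!: holomorphic_intros)
    qed (use kB Bim z0 in auto)
    then have "cmod (H z0) * exp (\<epsilon> * Re z0) / cmod (z0 - 1) ^ 4 \<le> M" by (simp add: nk)
    moreover have "0 < cmod (z0 - 1) ^ 4" using ge1[OF z0] by (intro zero_less_power) linarith
    ultimately show ?thesis by (simp add: divide_le_eq)
  qed
  have "((\<lambda>\<epsilon>. cmod (H z0) * exp (\<epsilon> * Re z0)) \<longlongrightarrow> cmod (H z0) * exp (0 * Re z0)) (at_right 0)"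
    by (intro tendsto_intros)
  moreover have "\<forall>\<^sub>F \<epsilon> in at_right 0. cmod (H z0) * exp (\<epsilon> * Re z0) \<le> M * cmod (z0 - 1) ^ 4"
    using step by (auto simp: eventually_at_right_field intro!: exI[of _ 1])
  ultimately have "cmod (H z0) * exp (0 * Re z0) \<le> M * cmod (z0 - 1) ^ 4"
    by (intro tendsto_upperbound) auto
  then show ?thesis by simp
qed

text \<open>Growth of order 1 + \<gamma> < 2 on the positive axis removes the coefficients of degree
  4, 3 and 2 in turn, each as the limit of H (t) / t^m.\<close>

lemma linear_if_degree_4_and_growth:
  fixes H :: "complex \<Rightarrow> complex"
  assumes H: "\<And>z. H z = (\<Sum>k\<le>4. c k * z ^ k)" and H0: "H 0 = 0" and \<gamma>: "\<gamma> < 1"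
    and gr: "\<And>t. t > 0 \<Longrightarrow> cmod (H (of_real t)) \<le> C * (t + 1) powr (1 + \<gamma>)"
  shows "H z = c 1 * z"
proof -
  have c0: "c 0 = 0" using H[of 0] H0 by (simp add: numeral_eq_Suc)
  have He: "H z = c 1 * z + c 2 * z ^ 2 + c 3 * z ^ 3 + c 4 * z ^ 4" for z
    unfolding H using c0 by (simp add: numeral_eq_Suc)
  have inv: "((\<lambda>t::real. inverse (of_real t) :: complex) \<longlongrightarrow> 0) at_top"
  proof -
    have "((\<lambda>t::real. of_real (inverse t) :: complex) \<longlongrightarrow> of_real 0) at_top"
      by (intro tendsto_of_real tendsto_inverse_0_at_top filterlim_ident)
    then show ?thesis by simp
  qed
  have lim0: "((\<lambda>t. H (of_real t) / of_real t ^ m) \<longlongrightarrow> 0) at_top" if m: "m \<ge> 2" for m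
  proof (rule Lim_null_comparison)
    show "\<forall>\<^sub>F t in at_top. cmod (H (of_real t) / of_real t ^ m) \<le> \<bar>C\<bar> * ((t + 1) powr (1 + \<gamma>) / t ^ 2)"
      using eventually_gt_at_top[of 1]
    proof eventually_elim
      case (elim t)
      have "cmod (H (of_real t)) \<le> \<bar>C\<bar> * (t + 1) powr (1 + \<gamma>)"
        by (rule order_trans[OF gr]) (use elim in \<open>auto intro!: mult_right_mono\<close>)
      then have "cmod (H (of_real t)) / t ^ m \<le> \<bar>C\<bar> * (t + 1) powr (1 + \<gamma>) / t ^ 2"
        using elim m by (intro frac_le power_increasing) auto
      then show ?case using elim by (simp add: norm_divide norm_power)
    qed
    have "((\<lambda>t. (t + 1) powr (1 + \<gamma>) / t ^ 2) \<longlongrightarrow> 0) at_top" using \<gamma> by real_asymp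
    then show "((\<lambda>t. \<bar>C\<bar> * ((t + 1) powr (1 + \<gamma>) / t ^ 2)) \<longlongrightarrow> 0) at_top"
      by (rule tendsto_mult_right_zero)
  qed
  define v where "v t = inverse (of_real t :: complex)" for t :: real
  have v0: "(v \<longlongrightarrow> 0) at_top" unfolding v_def by (rule inv)
  have pos: "\<forall>\<^sub>F t in at_top. (of_real t :: complex) \<noteq> 0"
    by (rule eventually_mono[OF eventually_gt_at_top[of 0]]) auto
  have "((\<lambda>t. c 1 * v t ^ 3 + c 2 * v t ^ 2 + c 3 * v t + c 4) \<longlongrightarrow> c 1 * 0 ^ 3 + c 2 * 0 ^ 2 + c 3 * 0 + c 4) at_top"
    by (intro tendsto_intros v0)
  moreover have "\<forall>\<^sub>F t in at_top. c 1 * v t ^ 3 + c 2 * v t ^ 2 + c 3 * v t + c 4 = H (of_real t) / of_real t ^ 4"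
    using pos by eventually_elim (simp add: He v_def field_simps power2_eq_square power3_eq_cube power4_eq_xxxx)
  ultimately have "((\<lambda>t. H (of_real t) / of_real t ^ 4) \<longlongrightarrow> c 1 * 0 ^ 3 + c 2 * 0 ^ 2 + c 3 * 0 + c 4) at_top"
    by (rule Lim_transform_eventually)
  then have "((\<lambda>t. H (of_real t) / of_real t ^ 4) \<longlongrightarrow> c 4) at_top" by simp
  with lim0[of 4] have c4: "c 4 = 0" using tendsto_unique trivial_limit_at_top_linorder by fastforce
  have "((\<lambda>t. c 1 * v t ^ 2 + c 2 * v t + c 3) \<longlongrightarrow> c 1 * 0 ^ 2 + c 2 * 0 + c 3) at_top"
    by (intro tendsto_intros v0)
  moreover have "\<forall>\<^sub>F t in at_top. c 1 * v t ^ 2 + c 2 * v t + c 3 = H (of_real t) / of_real t ^ 3"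
    using pos by eventually_elim (simp add: He v_def field_simps power2_eq_square power3_eq_cube power4_eq_xxxx c4)
  ultimately have "((\<lambda>t. H (of_real t) / of_real t ^ 3) \<longlongrightarrow> c 1 * 0 ^ 2 + c 2 * 0 + c 3) at_top"
    by (rule Lim_transform_eventually)
  then have "((\<lambda>t. H (of_real t) / of_real t ^ 3) \<longlongrightarrow> c 3) at_top" by simp
  with lim0[of 3] have c3: "c 3 = 0" using tendsto_unique trivial_limit_at_top_linorder by fastforce
  have "((\<lambda>t. c 1 * v t + c 2) \<longlongrightarrow> c 1 * 0 + c 2) at_top"
    by (intro tendsto_intros v0)
  moreover have "\<forall>\<^sub>F t in at_top. c 1 * v t + c 2 = H (of_real t) / of_real t ^ 2"
    using pos by eventually_elim (simp add: He v_def field_simps power2_eq_square power3_eq_cube power4_eq_xxxx c4 c3)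
  ultimately have "((\<lambda>t. H (of_real t) / of_real t ^ 2) \<longlongrightarrow> c 1 * 0 + c 2) at_top"
    by (rule Lim_transform_eventually)
  then have "((\<lambda>t. H (of_real t) / of_real t ^ 2) \<longlongrightarrow> c 2) at_top" by simp
  with lim0[of 2] have c2: "c 2 = 0" using tendsto_unique trivial_limit_at_top_linorder by fastforce
  show ?thesis by (simp add: He c2 c3 c4)
qed

text \<open>
  The substitution \<open>\<lambda> = 1 + 1/\<zeta>\<close> maps the exterior of the unit disc to the half-plane \<open>Re \<zeta> > -1/2\<close>, and
  \<open>\<psi>\<close> becomes an entire function.
\<close>

lemma coefficients_constant_if_resolvent_growth:
  fixes \<psi> :: "complex \<Rightarrow> complex" and a :: "nat \<Rightarrow> complex"
  assumes hol: "\<psi> holomorphic_on - {1}"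
    and ext: "\<And>l. 1 < cmod l \<Longrightarrow> (\<lambda>k. a k * inverse l ^ (k + 1)) sums \<psi> l"
    and a: "\<And>k. cmod (a k) \<le> C * (1 + real k) powr \<gamma>" and \<gamma>: "0 \<le> \<gamma>" "\<gamma> < 1" and C: "1 \<le> C"
    and int: "\<And>l. cmod l < 1 \<Longrightarrow> cmod (\<psi> l) \<le> C * exp (A / (1 - cmod l))" and A: "0 \<le> A"
    and rad: "\<And>\<epsilon>. \<epsilon> > 0 \<Longrightarrow> \<exists>r0<1. \<forall>r. r0 < r \<longrightarrow> r < 1 \<longrightarrow> cmod (\<psi> (of_real r)) \<le> C * exp (\<epsilon> / (1 - r))"
  shows "a 1 = a 0"
proof -
  \<comment> \<open>The value at 0 corresponds to the zero of \<psi> at infinity.\<close>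
  define H where "H z = (if z = 0 then 0 else \<psi> (1 + 1 / z))" for z
  have ext_bd: "cmod (\<psi> l) \<le> 2 * C * inverse (cmod l) * (1 - inverse (cmod l)) powr (- 1 - \<gamma>)" if l: "1 < cmod l" for l
  proof -
    define r where "r = inverse (cmod l)"
    have r: "0 \<le> r" "r < 1" using l by (auto simp: r_def inverse_less_1_iff)
    note w = weighted_geometric_bound[OF a \<gamma>(1) _ r]
    have S: "summable (\<lambda>k. cmod (a k) * r ^ k)" by (rule w(1)) (use \<gamma> C in auto)
    have e: "cmod (a k * inverse l ^ (k + 1)) = r * (cmod (a k) * r ^ k)" for k
      by (simp add: norm_mult norm_power norm_inverse r_def)
    have "cmod (\<psi> l) = cmod (\<Sum>k. a k * inverse l ^ (k + 1))" using ext[OF l] by (simp add: sums_iff)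
    also have "\<dots> \<le> (\<Sum>k. cmod (a k * inverse l ^ (k + 1)))"
      by (rule summable_norm) (unfold e, intro summable_mult S)
    also have "\<dots> = r * (\<Sum>k. cmod (a k) * r ^ k)" unfolding e by (rule suminf_mult[OF S])
    also have "\<dots> \<le> r * (2 * C * (1 - r) powr (- 1 - \<gamma>))" using w(2) \<gamma> C r by (intro mult_left_mono) auto
    finally show ?thesis by (simp add: r_def algebra_simps)
  qed
  have Hl: "1 + 1 / z \<noteq> 1" if "z \<noteq> 0" for z :: complex using that by simp
  have lz: "cmod (1 + 1 / z) = cmod (z + 1) / cmod z" if "z \<noteq> 0" for z
  proof -
    have "1 + 1 / z = (z + 1) / z" using that by (simp add: field_simps)
    then show ?thesis by (simp add: norm_divide)
  qed
  have D: "cmod (z + 1) ^ 2 - cmod z ^ 2 = 2 * Re z + 1" for z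
    unfolding cmod_power2 by (simp add: power2_eq_square algebra_simps)
  have sq: "x < y \<longleftrightarrow> x\<^sup>2 < y\<^sup>2" if "0 \<le> x" "0 \<le> y" for x y :: real
    using that by (metis abs_of_nonneg abs_le_square_iff not_le)
  have gtD: "cmod z < cmod (z + 1) \<longleftrightarrow> 0 < 2 * Re z + 1" for z
    unfolding D[of z, symmetric] by (subst sq) auto
  have ltD: "cmod (z + 1) < cmod z \<longleftrightarrow> 2 * Re z + 1 < 0" for z
    unfolding D[of z, symmetric] by (subst sq) auto
  \<comment> \<open>1 - q/p = (p^2 - q^2) / (p (p + q)) is at least (2 Re z + 1) / (2 p^2). The
    exponent -1-\<gamma> is weakened to -2: polynomial growth is enough here, and \<gamma> returns
    on the positive axis.\<close>
  have right: "cmod (H z) \<le> 2 * C * (2 * cmod (z + 1) ^ 2 / (2 * Re z + 1)) ^ 2" if z: "0 < 2 * Re z + 1" for z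
  proof (cases "z = 0")
    case True then show ?thesis using C by (simp add: H_def)
  next
    case False
    define p q where "p = cmod (z + 1)" and "q = cmod z"
    have pq: "q < p" "0 < q" using gtD[of z] z False by (auto simp: p_def q_def)
    have l: "1 < cmod (1 + 1 / z)" using lz[OF False] pq by (simp add: p_def q_def)
    have inv: "inverse (cmod (1 + 1 / z)) = q / p" using lz[OF False] by (simp add: p_def q_def)
    have "cmod (H z) \<le> 2 * C * (q / p) * (1 - q / p) powr (- 1 - \<gamma>)"
      using ext_bd[OF l] False unfolding inv by (simp add: H_def)
    also have "\<dots> \<le> 2 * C * 1 * (1 - q / p) powr (- 2)"
    proof (rule mult_mono)
      show "(1 - q / p) powr (- 1 - \<gamma>) \<le> (1 - q / p) powr (- 2)"
        using pq \<gamma> by (intro powr_mono') (auto simp: field_simps)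
    qed (use pq C in \<open>auto simp: divide_le_eq\<close>)
    also have "(1 - q / p) powr (- 2) = (1 / (1 - q / p)) ^ 2"
    proof -
      have "0 < 1 - q / p" using pq by (simp add: divide_less_eq)
      then show ?thesis by (simp add: powr_minus powr_numeral power_divide inverse_eq_divide)
    qed
    also have "2 * C * 1 * (1 / (1 - q / p)) ^ 2 \<le> 2 * C * (2 * p ^ 2 / (2 * Re z + 1)) ^ 2"
    proof -
      have "2 * Re z + 1 = (p - q) * (p + q)" using D[of z] by (simp add: p_def q_def power2_eq_square algebra_simps)
      also have "\<dots> \<le> (p - q) * (2 * p)" using pq by (intro mult_left_mono) auto
      finally have "(2 * Re z + 1) / (2 * p ^ 2) \<le> (p - q) * (2 * p) / (2 * p ^ 2)"
        by (rule divide_right_mono) simp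
      also have "\<dots> = 1 - q / p" using pq by (simp add: power2_eq_square field_simps)
      finally have le: "(2 * Re z + 1) / (2 * p ^ 2) \<le> 1 - q / p" .
      have "1 / (1 - q / p) \<le> 1 / ((2 * Re z + 1) / (2 * p ^ 2))"
        by (rule divide_left_mono[OF le]) (use pq z in \<open>auto intro!: mult_pos_pos\<close>)
      then have "(1 / (1 - q / p)) ^ 2 \<le> (2 * p ^ 2 / (2 * Re z + 1)) ^ 2"
        using pq by (intro power_mono) auto
      then show ?thesis using C by simp
    qed
    finally show ?thesis by (simp add: p_def)
  qed
  have left: "cmod (H z) \<le> C * exp (A * (2 * cmod z ^ 2 / \<bar>2 * Re z + 1\<bar>))" if z: "2 * Re z + 1 < 0" for z
  proof -
    define p q where "p = cmod (z + 1)" and "q = cmod z"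
    have z0: "z \<noteq> 0" using z by auto
    have pq: "p < q" "0 < q" "0 \<le> p" using ltD[of z] z z0 by (auto simp: p_def q_def)
    have l: "cmod (1 + 1 / z) = p / q" using lz[OF z0] by (simp add: p_def q_def)
    have "\<bar>2 * Re z + 1\<bar> = (q - p) * (q + p)" using D[of z] z by (simp add: p_def q_def power2_eq_square algebra_simps)
    also have "\<dots> \<le> (q - p) * (2 * q)" using pq by (intro mult_left_mono) auto
    finally have "\<bar>2 * Re z + 1\<bar> / (2 * q ^ 2) \<le> (q - p) * (2 * q) / (2 * q ^ 2)"
      by (rule divide_right_mono) simp
    also have "\<dots> = 1 - p / q" using pq by (simp add: power2_eq_square field_simps)
    finally have le: "\<bar>2 * Re z + 1\<bar> / (2 * q ^ 2) \<le> 1 - p / q" .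
    have "1 / (1 - p / q) \<le> 1 / (\<bar>2 * Re z + 1\<bar> / (2 * q ^ 2))"
      by (rule divide_left_mono[OF le]) (use pq z in \<open>auto intro!: mult_pos_pos divide_pos_pos\<close>)
    then have "A * (1 / (1 - p / q)) \<le> A * (2 * q ^ 2 / \<bar>2 * Re z + 1\<bar>)" using A by (intro mult_left_mono) auto
    then have "C * exp (A / (1 - p / q)) \<le> C * exp (A * (2 * q ^ 2 / \<bar>2 * Re z + 1\<bar>))" using C by simp
    moreover have "cmod (H z) \<le> C * exp (A / (1 - p / q))"
      using int[of "1 + 1 / z"] l pq z0 by (simp add: H_def)
    ultimately show ?thesis by (simp add: q_def)
  qed
  \<comment> \<open>The singularity at 0 is removable because 1 + 1/z tends to infinity there, where
    \<psi> tends to 0.\<close>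
  have Hhol: "H holomorphic_on UNIV"
  proof (rule no_isolated_singularity'[where K = "{0}"])
    have "(\<lambda>z. \<psi> (1 + 1 / z)) holomorphic_on UNIV - {0}"
      by (rule holomorphic_on_compose_gen[OF _ hol, unfolded o_def]) (use Hl in \<open>auto intro!: holomorphic_intros\<close>)
    then show "H holomorphic_on UNIV - {0}"
      by (rule holomorphic_transform) (auto simp: H_def)
    have "(H \<longlongrightarrow> 0) (at 0)"
    proof (rule Lim_null_comparison)
      define g where "g z = 2 * C * (cmod z / cmod (z + 1)) * (1 - cmod z / cmod (z + 1)) powr (- 1 - \<gamma>)" for z
      show "\<forall>\<^sub>F z in at 0. cmod (H z) \<le> g z"
        unfolding eventually_at
      proof (intro exI[of _ "1/4"] conjI ballI impI)
        fix z :: complex assume z: "z \<noteq> 0 \<and> dist z 0 < 1 / 4"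
        have "- Re z \<le> cmod z" using abs_Re_le_cmod[of z] by linarith
        then have "cmod z < cmod (z + 1)" using z gtD[of z] by auto
        then have "1 < cmod (1 + 1 / z)" using lz[of z] z by simp
        from ext_bd[OF this] show "cmod (H z) \<le> g z" using z lz[of z] by (simp add: H_def g_def)
      qed auto
      have "(g \<longlongrightarrow> 2 * C * (cmod 0 / cmod (0 + 1)) * (1 - cmod 0 / cmod (0 + 1)) powr (- 1 - \<gamma>)) (at 0)"
        unfolding g_def by (intro tendsto_intros) auto
      then show "(g \<longlongrightarrow> 0) (at 0)" by simp
    qed
    then show "(H \<longlongrightarrow> H z) (at z within UNIV)" if "z \<in> {0}" for z using that by (simp add: H_def)
  qed auto
  \<comment> \<open>In terms of y = R^2 / |Re s| the right half-plane gives 2 C (9 y/4)^2 \<le> 22 C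
    y^2 / 2, bounded by exp (22 C) exp y; the left one gives an exponent of at most 9 A y and a
    factor C. As y is at least 1, exp (A' y) dominates both.\<close>
  define A' where "A' = 22 * C + 1 + 9 * A"
  have A': "0 \<le> A'" using A C by (simp add: A'_def)
  have expo: "cmod (H z) \<le> exp (32 * A' * (1 + cmod z))" for z
  proof -
    \<comment> \<open>The shift by 1/2 moves the image of the unit circle to the imaginary
      axis.\<close>
    have "cmod (H ((z + 1 / 2) - 1 / 2)) \<le> exp (16 * A' * (1 + cmod (z + 1 / 2)))"
    proof (rule exponential_type_if_singular_bound[of "\<lambda>s. H (s - 1 / 2)", OF _ A'])
      show "(\<lambda>s. H (s - 1 / 2)) holomorphic_on UNIV"
        by (rule holomorphic_on_compose_gen[OF _ Hhol, unfolded o_def]) (auto intro!: holomorphic_intros)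
      fix R s assume R: "1 \<le> R" and sR: "cmod s \<le> R" and s0: "Re s \<noteq> 0"
      define y where "y = R\<^sup>2 / \<bar>Re s\<bar>"
      have "\<bar>Re s\<bar> \<le> R" using sR abs_Re_le_cmod[of s] by simp
      then have "\<bar>Re s\<bar> * 1 \<le> R * R" using R by (intro mult_mono) auto
      then have y1: "1 \<le> y" using s0 by (simp add: y_def power2_eq_square le_divide_eq)
      have h: "cmod (s + 1 / 2) ^ 2 \<le> 9 / 4 * R\<^sup>2" "cmod (s - 1 / 2) ^ 2 \<le> 9 / 4 * R\<^sup>2"
      proof -
        have "cmod (s + 1 / 2) \<le> 3 / 2 * R" "cmod (s - 1 / 2) \<le> 3 / 2 * R"
          using norm_triangle_ineq[of s "1/2"] norm_triangle_ineq4[of s "1/2"] sR R by auto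
        then have "cmod (s + 1 / 2) ^ 2 \<le> (3 / 2 * R) ^ 2" "cmod (s - 1 / 2) ^ 2 \<le> (3 / 2 * R) ^ 2"
          by (auto intro!: power_mono)
        then show "cmod (s + 1 / 2) ^ 2 \<le> 9 / 4 * R\<^sup>2" "cmod (s - 1 / 2) ^ 2 \<le> 9 / 4 * R\<^sup>2"
          by (auto simp: power2_eq_square)
      qed
      have "cmod (H (s - 1 / 2)) \<le> exp (A' * y)"
      proof (cases "Re s > 0")
        case True
        have "cmod (H (s - 1 / 2)) \<le> 2 * C * (2 * cmod (s + 1 / 2) ^ 2 / (2 * Re s)) ^ 2"
          using right[of "s - 1 / 2"] True by (simp add: add.commute)
        also have "\<dots> \<le> 2 * C * (9 / 4 * y) ^ 2"
        proof -
          have "2 * cmod (s + 1 / 2) ^ 2 / (2 * Re s) \<le> 9 / 4 * R\<^sup>2 / Re s"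
            using divide_right_mono[OF h(1), of "Re s"] True by simp
          also have "\<dots> = 9 / 4 * y" using True by (simp add: y_def)
          finally show ?thesis using C True by (intro mult_left_mono power_mono) auto
        qed
        also have "\<dots> \<le> 22 * C * (y\<^sup>2 / 2)" using C by (simp add: power2_eq_square)
        also have "\<dots> \<le> exp (22 * C) * exp y"
        proof (rule mult_mono)
          show "22 * C \<le> exp (22 * C)" using exp_ge_add_one_self[of "22 * C"] by linarith
          have "y\<^sup>2 / 2 \<le> 1 + y + y\<^sup>2 / 2" using y1 by simp
          also have "\<dots> \<le> exp y" using exp_lower_Taylor_quadratic[of y] y1 by simp
          finally show "y\<^sup>2 / 2 \<le> exp y" .
        qed (use C in auto)
        also have "\<dots> \<le> exp (A' * y)"
        proof -
          have "22 * C * 1 \<le> 22 * C * y" using y1 C by (intro mult_left_mono) auto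
          moreover have "0 \<le> 9 * A * y" using y1 A by simp
          ultimately have "22 * C * 1 + y \<le> 22 * C * y + y + 9 * A * y" by linarith
          then show ?thesis by (simp add: exp_add[symmetric] A'_def algebra_simps)
        qed
        finally show ?thesis .
      next
        case False
        then have neg: "Re s < 0" using s0 by simp
        have "cmod (H (s - 1 / 2)) \<le> C * exp (A * (2 * cmod (s - 1 / 2) ^ 2 / \<bar>2 * Re s\<bar>))"
          using left[of "s - 1 / 2"] neg by simp
        also have "\<dots> \<le> exp C * exp (A * (9 * y))"
        proof (rule mult_mono)
          show "C \<le> exp C" using exp_ge_add_one_self[of C] by linarith
          have "2 * cmod (s - 1 / 2) ^ 2 / \<bar>2 * Re s\<bar> = cmod (s - 1 / 2) ^ 2 / \<bar>Re s\<bar>" by simp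
          also have "\<dots> \<le> (9 * R\<^sup>2) / \<bar>Re s\<bar>" using h(2) zero_le_power2[of R] by (intro divide_right_mono) linarith+
          finally have "2 * cmod (s - 1 / 2) ^ 2 / \<bar>2 * Re s\<bar> \<le> 9 * y" by (simp add: y_def)
          then show "exp (A * (2 * cmod (s - 1 / 2) ^ 2 / \<bar>2 * Re s\<bar>)) \<le> exp (A * (9 * y))"
            by (simp only: exp_le_cancel_iff) (rule mult_left_mono[OF _ A])
        qed auto
        also have "\<dots> \<le> exp (A' * y)"
        proof -
          have "C * 1 \<le> C * y" using y1 C by (intro mult_left_mono) auto
          moreover have "0 \<le> C * y" using y1 C by simp
          ultimately have "C + A * (9 * y) \<le> A' * y" using y1 by (simp add: A'_def algebra_simps)
          then show ?thesis by (simp add: exp_add[symmetric])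
        qed
        finally show ?thesis .
      qed
      then show "cmod (H (s - 1 / 2)) \<le> exp (A' * R\<^sup>2 / \<bar>Re s\<bar>)" by (simp add: y_def)
    qed
    also have "\<dots> \<le> exp (32 * A' * (1 + cmod z))"
    proof -
      have "cmod (z + 1 / 2) \<le> cmod z + 1 / 2" using norm_triangle_ineq[of z "1/2"] by (simp add: norm_divide)
      then have "1 + cmod (z + 1 / 2) \<le> 2 * (1 + cmod z)" using norm_ge_zero[of z]
        unfolding distrib_left mult_1_right by linarith
      then have "16 * A' * (1 + cmod (z + 1 / 2)) \<le> 16 * A' * (2 * (1 + cmod z))" using A' by (intro mult_left_mono) auto
      then show ?thesis by (simp add: algebra_simps)
    qed
    finally show ?thesis by simp
  qed
  have right4: "cmod (H z) \<le> 8 * C * cmod (z + 1) ^ 4" if z: "0 \<le> Re z" for z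
  proof -
    have "cmod (H z) \<le> 2 * C * (2 * cmod (z + 1) ^ 2 / (2 * Re z + 1)) ^ 2" using right[of z] z by simp
    also have "\<dots> \<le> 2 * C * (2 * cmod (z + 1) ^ 2 / 1) ^ 2"
      using z C by (intro mult_left_mono power_mono divide_left_mono) auto
    also have "\<dots> = 8 * C * cmod (z + 1) ^ 4" by (simp add: power_mult_distrib flip: power_mult)
    finally show ?thesis .
  qed
  \<comment> \<open>z = - t corresponds to \<lambda> = 1 - 1/t, so that \<epsilon> / (1 - r) becomes
    \<epsilon> t.\<close>
  have neg: "\<exists>t0\<ge>0. \<forall>t\<ge>t0. cmod (H (- of_real t)) \<le> C * exp (\<epsilon> * t)" if \<epsilon>: "\<epsilon> > 0" for \<epsilon>
  proof -
    obtain r0 where r0: "r0 < 1" "\<And>r. r0 < r \<Longrightarrow> r < 1 \<Longrightarrow> cmod (\<psi> (of_real r)) \<le> C * exp (\<epsilon> / (1 - r))"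
      using rad[OF \<epsilon>] by blast
    define t0 where "t0 = 2 + 1 / (1 - r0)"
    have t0: "t0 \<ge> 2" using r0 by (simp add: t0_def)
    have "cmod (H (- of_real t)) \<le> C * exp (\<epsilon> * t)" if t: "t \<ge> t0" for t
    proof -
      have tp: "t > 0" using t t0 by simp
      have "1 / (1 - r0) < t" using t by (simp add: t0_def)
      then have "1 / t < 1 - r0" using r0 tp by (simp add: field_simps)
      then have "cmod (\<psi> (of_real (1 - 1 / t))) \<le> C * exp (\<epsilon> / (1 - (1 - 1 / t)))"
        using tp by (intro r0(2)) auto
      then show ?thesis using tp by (simp add: H_def)
    qed
    then show ?thesis using t0 by (intro exI[of _ t0]) auto
  qed
  have left4: "cmod (H z) \<le> 8 * C * cmod (z - 1) ^ 4" if z: "Re z \<le> 0" for z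
    by (rule subexponential_polynomial_bound[OF Hhol _ _ right4 expo _ neg z]) (use C A' in auto)
  have poly4: "cmod (H z) \<le> 128 * C * cmod z ^ 4" if z: "1 \<le> cmod z" for z
  proof -
    have "cmod (z + 1) \<le> 2 * cmod z" "cmod (z - 1) \<le> 2 * cmod z"
      using norm_triangle_ineq[of z 1] norm_triangle_ineq4[of z 1] z by auto
    then have "cmod (z + 1) ^ 4 \<le> (2 * cmod z) ^ 4" "cmod (z - 1) ^ 4 \<le> (2 * cmod z) ^ 4"
      by (intro power_mono; simp)+
    then have "cmod (H z) \<le> 8 * C * (2 * cmod z) ^ 4"
      using right4[of z] left4[of z] C by (cases "0 \<le> Re z") (auto intro: order_trans mult_left_mono)
    then show ?thesis by (simp add: power_mult_distrib)
  qed
  define c where "c k = (deriv ^^ k) H 0 / fact k" for k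
  have Hc: "H z = (\<Sum>k\<le>4. c k * z ^ k)" for z
    unfolding c_def by (rule Liouville_polynomial[OF Hhol poly4])
  \<comment> \<open>The positive axis is the image of the ray \<lambda> > 1, where the growth of the
    coefficients gives the exact exponent 1 + \<gamma> < 2.\<close>
  have lin: "H z = c 1 * z" for z
  proof (rule linear_if_degree_4_and_growth[OF Hc _ \<gamma>(2)])
    show "H 0 = 0" by (simp add: H_def)
    fix t :: real assume t: "t > 0"
    have nt: "cmod (of_real t + 1) = t + 1"
      using t norm_of_real[of "t + 1", where 'a = complex] by simp
    have lt: "cmod (1 + 1 / of_real t) = (t + 1) / t" using lz[of "of_real t"] t nt by simp
    then have "1 < cmod (1 + 1 / of_real t)" using t by simp
    from ext_bd[OF this] have "cmod (H (of_real t)) \<le> 2 * C * (t / (t + 1)) * (1 - t / (t + 1)) powr (- 1 - \<gamma>)"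
      using t by (simp add: H_def lt)
    also have "1 - t / (t + 1) = 1 / (t + 1)" using t by (simp add: field_simps)
    also have "(1 / (t + 1)) powr (- 1 - \<gamma>) = (t + 1) powr (1 + \<gamma>)"
      using t by (simp add: powr_divide powr_minus powr_diff powr_add field_simps)
    also have "2 * C * (t / (t + 1)) * (t + 1) powr (1 + \<gamma>) \<le> 2 * C * 1 * (t + 1) powr (1 + \<gamma>)"
      using t C by (intro mult_right_mono mult_left_mono) auto
    finally show "cmod (H (of_real t)) \<le> 2 * C * (t + 1) powr (1 + \<gamma>)" by simp
  qed
  \<comment> \<open>Linearity of \<open>H\<close> means \<psi> (\<lambda>) = c 1 / (\<lambda> - 1).
    In powers of v = 1/\<lambda> all coefficients of this simple pole are equal.\<close>
  have sums0: "(\<lambda>k. (a k - c 1) * v ^ k) sums 0" if v: "v \<noteq> 0" "cmod v < 1" for v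
  proof -
    define l where "l = inverse v"
    have l: "1 < cmod l" "inverse l = v" "l \<noteq> 1" using v by (auto simp: l_def norm_inverse one_less_inverse_iff)
    have "\<psi> l = H (1 / (l - 1))" using l by (simp add: H_def)
    also have "\<dots> = c 1 * (1 / (l - 1))" by (rule lin)
    finally have "(\<lambda>k. a k * v ^ (k + 1)) sums (c 1 * (1 / (l - 1)))" using ext[OF l(1)] l by simp
    then have s: "(\<lambda>k. l * (a k * v ^ (k + 1))) sums (l * (c 1 * (1 / (l - 1))))" by (rule sums_mult)
    have e1: "l * (a k * v ^ (k + 1)) = a k * v ^ k" for k using v by (simp add: l_def)
    have e2: "l * (c 1 * (1 / (l - 1))) = c 1 * (1 / (1 - v))" using v l by (simp add: l_def field_simps)
    have "(\<lambda>k. a k * v ^ k) sums (c 1 * (1 / (1 - v)))" using s unfolding e1 e2 .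
    moreover have "(\<lambda>k. c 1 * v ^ k) sums (c 1 * (1 / (1 - v)))" by (intro sums_mult geometric_sums v)
    ultimately have "(\<lambda>k. a k * v ^ k - c 1 * v ^ k) sums (c 1 * (1 / (1 - v)) - c 1 * (1 / (1 - v)))" by (rule sums_diff)
    then show ?thesis by (simp add: left_diff_distrib)
  qed
  have coeff0: "b 0 = 0" if b: "\<And>v. v \<noteq> 0 \<Longrightarrow> cmod v < 1 \<Longrightarrow> (\<lambda>k. b k * v ^ k) sums 0" for b :: "nat \<Rightarrow> complex"
  proof -
    have "((\<lambda>v. 0) \<longlongrightarrow> b 0) (at (0::complex))"
      by (rule powser_limit_0_strong[of 1]) (use b in auto)
    then show ?thesis using LIM_unique[of "\<lambda>v. 0" "b 0" "0::complex" 0] by auto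
  qed
  have a0: "a 0 = c 1" using coeff0[of "\<lambda>k. a k - c 1"] sums0 by simp
  have "(\<lambda>k. (a (Suc k) - c 1) * v ^ k) sums 0" if v: "v \<noteq> 0" "cmod v < 1" for v
  proof -
    have "(\<lambda>k. (a (Suc k) - c 1) * v ^ Suc k) sums 0"
      using sums0[OF v] by (subst sums_Suc_iff) (simp add: a0)
    then have s: "(\<lambda>k. inverse v * ((a (Suc k) - c 1) * v ^ Suc k)) sums (inverse v * 0)" by (rule sums_mult)
    have e: "inverse v * ((a (Suc k) - c 1) * v ^ Suc k) = (a (Suc k) - c 1) * v ^ k" for k
      using v by simp
    show ?thesis using s unfolding e mult_zero_right .
  qed
  then have "a 1 = c 1" using coeff0[of "\<lambda>k. a (Suc k) - c 1"] by simp
  then show ?thesis using a0 by simp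
qed

section \<open>The variable of a power series algebra modulo an ideal\<close>

context complete_algebra_norm
begin

text \<open>The numbers a k of the preceding result are the moments L (x^k). Existence of resolvents
  gives the continuation to the complement of 1, and their norms give the growth.\<close>

lemma functional_fixed_if_resolvent_growth:
  assumes L: "bdd_functional L C" and x: "x \<in> carr"
    and xk: "\<And>k. \<nu> (x ^ k) \<le> ennreal ((1 + real k) powr \<gamma>)" and \<gamma>: "0 \<le> \<gamma>" "\<gamma> < 1" and A: "0 \<le> A"
    and res: "\<And>l. cmod l \<le> 1 \<Longrightarrow> l \<noteq> 1 \<Longrightarrow> \<exists>a. resolvent_mod L x l a"
    and bd: "\<And>l. cmod l < 1 \<Longrightarrow> \<exists>a. resolvent_mod L x l a \<and> \<nu> a \<le> ennreal (exp (A / (1 - cmod l)))"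
    and rad: "\<And>\<epsilon>. \<epsilon> > 0 \<Longrightarrow> \<exists>r0<1. \<forall>r. r0 < r \<longrightarrow> r < 1 \<longrightarrow>
      (\<exists>a. resolvent_mod L x (of_real r) a \<and> \<nu> a \<le> ennreal (exp (\<epsilon> / (1 - r))))"
  shows "L x = L 1"
proof -
  define C' where "C' = max 1 C"
  have C': "1 \<le> C'" "C \<le> C'" by (auto simp: C'_def)
  have Lle: "cmod (L a) \<le> C' * t" if "a \<in> carr" "\<nu> a \<le> ennreal t" "0 \<le> t" for a t
  proof -
    have "enn2real (\<nu> a) \<le> t" using that enn2real_mono[of "\<nu> a" "ennreal t"] by simp
    then have "C * enn2real (\<nu> a) \<le> C' * t" using C' by (intro mult_mono) auto
    then show ?thesis using bdd_functional_bound[OF L that(1)] by linarith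
  qed
  have xk': "\<nu> (x ^ k) \<le> ennreal (1 + real k)" for k
  proof -
    have "(1 + real k) powr \<gamma> \<le> (1 + real k) powr 1" using \<gamma> by (intro powr_mono) auto
    then show ?thesis by (intro order_trans[OF xk ennreal_leI]) simp
  qed
  have ex: "\<exists>a. resolvent_mod L x l a" if "l \<noteq> 1" for l
    using res[of l] resolvent_exterior(1)[OF L x _ xk', of l] that by (meson linorder_not_le)
  have "L (x ^ 1) = L (x ^ 0)"
  proof (rule coefficients_constant_if_resolvent_growth[of "resolvent_value L x" "\<lambda>k. L (x ^ k)" C' \<gamma> A])
    show "resolvent_value L x holomorphic_on - {1}"
      by (rule resolvent_value_holomorphic[OF L x]) (use ex in auto)
    show "(\<lambda>k. L (x ^ k) * inverse l ^ (k + 1)) sums resolvent_value L x l" if "1 < cmod l" for l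
      by (rule resolvent_exterior(2)[OF L x that xk'])
    show "cmod (L (x ^ k)) \<le> C' * (1 + real k) powr \<gamma>" for k
      by (rule Lle) (use x xk in auto)
    show "cmod (resolvent_value L x l) \<le> C' * exp (A / (1 - cmod l))" if "cmod l < 1" for l
    proof -
      obtain a where a: "resolvent_mod L x l a" "\<nu> a \<le> ennreal (exp (A / (1 - cmod l)))" using bd[OF \<open>cmod l < 1\<close>] by blast
      have "a \<in> carr" using a(1) by (simp add: resolvent_mod_def)
      then show ?thesis unfolding resolvent_value_eq[OF L x a(1)] using a(2) by (rule Lle) simp
    qed
    show "\<exists>r0<1. \<forall>r. r0 < r \<longrightarrow> r < 1 \<longrightarrow> cmod (resolvent_value L x (of_real r)) \<le> C' * exp (\<epsilon> / (1 - r))"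
      if \<epsilon>: "\<epsilon> > 0" for \<epsilon>
    proof -
      obtain r0 where r0: "r0 < 1" and R: "\<And>r. r0 < r \<Longrightarrow> r < 1 \<Longrightarrow>
        \<exists>a. resolvent_mod L x (of_real r) a \<and> \<nu> a \<le> ennreal (exp (\<epsilon> / (1 - r)))" using rad[OF \<epsilon>] by blast
      have "cmod (resolvent_value L x (of_real r)) \<le> C' * exp (\<epsilon> / (1 - r))" if r: "r0 < r" "r < 1" for r
      proof -
        obtain a where a: "resolvent_mod L x (of_real r) a" "\<nu> a \<le> ennreal (exp (\<epsilon> / (1 - r)))" using R[OF r] by blast
        have "a \<in> carr" using a(1) by (simp add: resolvent_mod_def)
        then show ?thesis unfolding resolvent_value_eq[OF L x a(1)] using a(2) by (rule Lle) simp
      qed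
      then show ?thesis using r0 by blast
    qed
  qed (use \<gamma> C' A in auto)
  then show ?thesis by simp
qed

text \<open>Synthetic division: the sum truncates (f - f(c)) / (X - c). The truncation matters for
  scalars of modulus 1, where the full series of shifts need not converge in norm.\<close>

lemma fps_resolvent_identity:
  fixes f :: "'a fps"
  shows "(fps_X - fps_const c) * (\<Sum>k<K. fps_const (c ^ k) * fps_shift (Suc k) f) =
    f - fps_const (c ^ K) * fps_shift K f - fps_const (\<Sum>k<K. c ^ k * f $ k)"
proof (induction K)
  case 0 then show ?case by simp
next
  case (Suc K)
  have X: "fps_X * fps_shift (Suc K) f = fps_shift K f - fps_const (f $ K)"
    by (rule fps_ext) (auto simp: fps_X_mult_nth)
  have "(fps_X - fps_const c) * (fps_const (c ^ K) * fps_shift (Suc K) f) =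
      fps_const (c ^ K) * (fps_X * fps_shift (Suc K) f) - fps_const (c ^ Suc K) * fps_shift (Suc K) f"
    by (simp add: algebra_simps flip: fps_const_mult)
  also have "\<dots> = fps_const (c ^ K) * fps_shift K f - fps_const (c ^ K * f $ K) - fps_const (c ^ Suc K) * fps_shift (Suc K) f"
    unfolding X by (simp add: algebra_simps)
  finally have "(fps_X - fps_const c) * (fps_const (c ^ K) * fps_shift (Suc K) f) = \<dots>" .
  then show ?case
    using Suc by (simp add: distrib_left flip: fps_const_add)
qed

lemma wnorm_const: "wnorm \<gamma> \<nu> (fps_const a) = \<nu> a"
  unfolding wnorm_def by (subst suminf_finite[of "{0}"]) (auto simp: nrm_zero)

lemma wnorm_X_power: "wnorm \<gamma> \<nu> (fps_X ^ k) = ennreal ((1 + real k) powr \<gamma>)"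
  unfolding wnorm_def by (subst suminf_finite[of "{k}"]) (auto simp: nrm_zero nrm_one)

lemma wnorm_shift_le:
  assumes "0 \<le> \<gamma>"
  shows "wnorm \<gamma> \<nu> (fps_shift K f) \<le> (\<Sum>n. ennreal ((1 + real (n + K)) powr \<gamma>) * \<nu> (f $ (n + K)))"
  unfolding wnorm_def fps_shift_nth
  by (intro suminf_le mult_right_mono ennreal_leI powr_mono2) (use assms in auto)

text \<open>Let \<open>h\<close> invert the slice \<open>F\<close> of f at l. By synthetic division
  \<open>u K\<close> times h inverts l - X modulo f, up to the truncation error \<open>E K\<close>.
  This error tends to 0 in norm, also for |l| = 1, and a Neumann series corrects it at the cost of a
  factor 2. For |l| < 1 the norm of \<open>u K\<close> is bounded by a geometric series.\<close>

lemma fps_resolvent_mod: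
  fixes f :: "'a fps" and F h :: 'a
  assumes \<gamma>: "0 \<le> \<gamma>" and f: "wnorm \<gamma> \<nu> f < \<infinity>" and l: "cmod l \<le> 1"
    and F: "(\<lambda>K. \<nu> (F - (\<Sum>k<K. \<kappa> l ^ k * f $ k))) \<longlonglongrightarrow> 0"
    and h: "\<nu> h < \<infinity>" "F * h = 1"
    and L: "\<And>s. wnorm \<gamma> \<nu> s < \<infinity> \<Longrightarrow> L (f * s) = 0"
    and Lb: "complete_algebra_norm.bdd_functional (wnorm \<gamma> \<nu>) (\<lambda>c. fps_const (\<kappa> c)) L C"
  shows "\<exists>a. complete_algebra_norm.resolvent_mod (wnorm \<gamma> \<nu>) (\<lambda>c. fps_const (\<kappa> c)) L fps_X l a \<and>
    (cmod l < 1 \<longrightarrow> wnorm \<gamma> \<nu> a \<le> ennreal (2 / (1 - cmod l)) * wnorm \<gamma> \<nu> f * \<nu> h)"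
proof -
  interpret w: complete_algebra_norm "wnorm \<gamma> \<nu>" "\<lambda>c. fps_const (\<kappa> c)"
    by (rule wnorm_complete_algebra_norm[OF \<gamma>])
  define c where "c = \<kappa> l"
  have ck: "\<nu> (c ^ k) \<le> 1" for k
  proof -
    have "\<nu> (c ^ k) = ennreal (cmod l ^ k)" by (simp add: c_def nrm_scalar norm_power flip: scalar_power)
    also have "\<dots> \<le> ennreal 1" using l by (intro ennreal_leI power_le_one) auto
    finally show ?thesis by simp
  qed
  define u where "u K = (\<Sum>k<K. fps_const (c ^ k) * fps_shift (Suc k) f)" for K
  define E where "E K = fps_const (F - (\<Sum>k<K. c ^ k * f $ k)) * fps_const h - fps_const (c ^ K) * fps_shift K f * fps_const h" for K
  have shift_le: "wnorm \<gamma> \<nu> (fps_shift K f) \<le> wnorm \<gamma> \<nu> f" for K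
    using order_trans[OF wnorm_shift_le[OF \<gamma>]
        ennreal_suminf_tail_le[of "\<lambda>n. ennreal ((1 + real n) powr \<gamma>) * \<nu> (f $ n)" K]]
    by (simp add: wnorm_def)
  have fc: "f \<in> w.carr" and hc: "fps_const h \<in> w.carr" and Xc: "fps_X \<in> w.carr"
    using f h wnorm_X_power[of \<gamma> 1] by (simp_all add: w.carr_def wnorm_const)
  have shc: "fps_shift K f \<in> w.carr" for K
    using shift_le[of K] fc by (auto simp: w.carr_def intro: order.strict_trans1)
  have cc: "fps_const (c ^ k) \<in> w.carr" for k
    using ck[of k] by (auto simp: w.carr_def wnorm_const intro: order.strict_trans1)
  have uc: "u K \<in> w.carr" for K unfolding u_def by (intro w.carr_sum w.carr_mult cc shc)
  have id: "(fps_const c - fps_X) * (u K * fps_const h) = 1 - E K - f * fps_const h" for K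
  proof -
    have "(fps_X - fps_const c) * (u K * fps_const h) =
        (f - fps_const (c ^ K) * fps_shift K f - fps_const (\<Sum>k<K. c ^ k * f $ k)) * fps_const h"
      unfolding u_def fps_resolvent_identity[symmetric] by (simp only: mult.assoc)
    moreover have "fps_const F * fps_const h = 1" using h by simp
    ultimately show ?thesis
      by (simp add: E_def algebra_simps flip: fps_const_sub fps_const_mult)
  qed
  have E0: "(\<lambda>K. wnorm \<gamma> \<nu> (E K)) \<longlonglongrightarrow> 0"
  proof (rule tendsto_sandwich[OF _ _ tendsto_const])
    define T where "T K = (\<Sum>n. ennreal ((1 + real (n + K)) powr \<gamma>) * \<nu> (f $ (n + K)))" for K
    have "T \<longlonglongrightarrow> 0" unfolding T_def
      using ennreal_suminf_tail_tendsto_0[of "\<lambda>n. ennreal ((1 + real n) powr \<gamma>) * \<nu> (f $ n)"] f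
      by (simp add: wnorm_def)
    then have "(\<lambda>K. \<nu> h * (\<nu> (F - (\<Sum>k<K. c ^ k * f $ k)) + T K)) \<longlonglongrightarrow> \<nu> h * (0 + 0)"
      by (intro ennreal_tendsto_cmult tendsto_add) (use h F in \<open>auto simp: c_def\<close>)
    then show "(\<lambda>K. \<nu> h * (\<nu> (F - (\<Sum>k<K. c ^ k * f $ k)) + T K)) \<longlonglongrightarrow> 0" by simp
    show "\<forall>\<^sub>F K in sequentially. wnorm \<gamma> \<nu> (E K) \<le> \<nu> h * (\<nu> (F - (\<Sum>k<K. c ^ k * f $ k)) + T K)"
    proof (rule always_eventually, rule allI)
      fix K
      have "wnorm \<gamma> \<nu> (E K) \<le> wnorm \<gamma> \<nu> (fps_const (F - (\<Sum>k<K. c ^ k * f $ k)) * fps_const h) +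
          wnorm \<gamma> \<nu> (fps_const (c ^ K) * fps_shift K f * fps_const h)"
        unfolding E_def by (rule w.nrm_diff)
      also have "\<dots> \<le> \<nu> (F - (\<Sum>k<K. c ^ k * f $ k)) * \<nu> h + T K * \<nu> h"
      proof (rule add_mono)
        show "wnorm \<gamma> \<nu> (fps_const (F - (\<Sum>k<K. c ^ k * f $ k)) * fps_const h) \<le> \<nu> (F - (\<Sum>k<K. c ^ k * f $ k)) * \<nu> h"
          using w.nrm_mult[of "fps_const (F - (\<Sum>k<K. c ^ k * f $ k))" "fps_const h"] unfolding wnorm_const .
        have "wnorm \<gamma> \<nu> (fps_const (c ^ K) * fps_shift K f * fps_const h) \<le>
            wnorm \<gamma> \<nu> (fps_const (c ^ K)) * wnorm \<gamma> \<nu> (fps_shift K f) * wnorm \<gamma> \<nu> (fps_const h)"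
          by (meson w.nrm_mult mult_right_mono order_trans zero_le)
        also have "\<dots> \<le> 1 * T K * \<nu> h"
          unfolding wnorm_const T_def by (intro mult_mono ck wnorm_shift_le \<gamma>) auto
        finally show "wnorm \<gamma> \<nu> (fps_const (c ^ K) * fps_shift K f * fps_const h) \<le> T K * \<nu> h" by simp
      qed
      finally show "wnorm \<gamma> \<nu> (E K) \<le> \<nu> h * (\<nu> (F - (\<Sum>k<K. c ^ k * f $ k)) + T K)"
        by (simp add: distrib_left mult.commute)
    qed
  qed auto
  have "\<forall>\<^sub>F K in sequentially. wnorm \<gamma> \<nu> (E K) < ennreal (1 / 2)"
    by (rule order_tendstoD(2)[OF E0]) (subst ennreal_less_zero_iff, simp)
  then obtain K where K: "wnorm \<gamma> \<nu> (E K) \<le> ennreal (1 / 2)"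
    unfolding eventually_sequentially by (auto intro: less_imp_le)
  obtain b where b: "b \<in> w.carr" "(1 - E K) * b = 1" "wnorm \<gamma> \<nu> b \<le> 2" using w.neumann[OF K] by blast
  define a where "a = u K * fps_const h * b"
  have ac: "a \<in> w.carr" unfolding a_def by (intro w.carr_mult uc hc b)
  have "(fps_const c - fps_X) * a = (1 - E K - f * fps_const h) * b"
    unfolding a_def id[symmetric] by (simp only: mult.assoc)
  also have "\<dots> = 1 - f * (fps_const h * b)" using b(2) by (simp add: algebra_simps)
  finally have "(fps_const c - fps_X) * a - 1 = - (f * (fps_const h * b))" by simp
  moreover have "- (f * (fps_const h * b)) \<in> w.null_ideal L"
  proof -
    have "L (- (f * (fps_const h * b)) * s) = 0" if s: "s \<in> w.carr" for s
    proof -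
      have "- (f * (fps_const h * b)) * s = f * (- (fps_const h * b * s))" by (simp add: mult.assoc)
      moreover have "L (f * (- (fps_const h * b * s))) = 0"
      proof (rule L)
        have "- (fps_const h * b * s) \<in> w.carr" using hc b s by simp
        then show "wnorm \<gamma> \<nu> (- (fps_const h * b * s)) < \<infinity>" by (simp only: w.carr_def mem_Collect_eq)
      qed
      ultimately show ?thesis by (simp only:)
    qed
    then show ?thesis using fc hc b by (simp add: w.null_ideal_def)
  qed
  ultimately have "w.resolvent_mod L fps_X l a" using ac by (simp add: w.resolvent_mod_def c_def)
  moreover have "wnorm \<gamma> \<nu> a \<le> ennreal (2 / (1 - cmod l)) * wnorm \<gamma> \<nu> f * \<nu> h" if l1: "cmod l < 1"
  proof -
    have "wnorm \<gamma> \<nu> (u K) \<le> (\<Sum>k<K. wnorm \<gamma> \<nu> (fps_const (c ^ k) * fps_shift (Suc k) f))"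
      unfolding u_def by (rule w.nrm_sum)
    also have "\<dots> \<le> (\<Sum>k<K. ennreal (cmod l ^ k) * wnorm \<gamma> \<nu> f)"
    proof (rule sum_mono)
      fix k
      have "wnorm \<gamma> \<nu> (fps_const (c ^ k) * fps_shift (Suc k) f) \<le> wnorm \<gamma> \<nu> (fps_const (c ^ k)) * wnorm \<gamma> \<nu> (fps_shift (Suc k) f)"
        by (rule w.nrm_mult)
      also have "wnorm \<gamma> \<nu> (fps_const (c ^ k)) = ennreal (cmod l ^ k)"
        by (simp add: wnorm_const c_def nrm_scalar norm_power flip: scalar_power)
      finally show "wnorm \<gamma> \<nu> (fps_const (c ^ k) * fps_shift (Suc k) f) \<le> ennreal (cmod l ^ k) * wnorm \<gamma> \<nu> f"
        using shift_le[of "Suc k"] by (meson mult_left_mono order_trans zero_le)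
    qed
    also have "\<dots> = ennreal (\<Sum>k<K. cmod l ^ k) * wnorm \<gamma> \<nu> f"
      by (simp add: sum_distrib_right[symmetric])
    also have "\<dots> \<le> ennreal (1 / (1 - cmod l)) * wnorm \<gamma> \<nu> f"
    proof (intro mult_right_mono ennreal_leI)
      have "(\<Sum>k<K. cmod l ^ k) \<le> (\<Sum>k. cmod l ^ k)"
        by (rule sum_le_suminf) (use l1 in \<open>auto intro: summable_geometric\<close>)
      also have "\<dots> = 1 / (1 - cmod l)" by (rule suminf_geometric) (use l1 in simp)
      finally show "(\<Sum>k<K. cmod l ^ k) \<le> 1 / (1 - cmod l)" .
    qed auto
    finally have ub: "wnorm \<gamma> \<nu> (u K) \<le> ennreal (1 / (1 - cmod l)) * wnorm \<gamma> \<nu> f" .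
    have "wnorm \<gamma> \<nu> a \<le> wnorm \<gamma> \<nu> (u K) * wnorm \<gamma> \<nu> (fps_const h) * wnorm \<gamma> \<nu> b"
      unfolding a_def by (meson w.nrm_mult mult_right_mono order_trans zero_le)
    also have "\<dots> \<le> (ennreal (1 / (1 - cmod l)) * wnorm \<gamma> \<nu> f) * \<nu> h * 2"
      unfolding wnorm_const by (intro mult_mono ub b(3)) auto
    also have "\<dots> = ennreal 2 * ennreal (1 / (1 - cmod l)) * wnorm \<gamma> \<nu> f * \<nu> h" by (simp add: mult_ac)
    also have "ennreal 2 * ennreal (1 / (1 - cmod l)) = ennreal (2 / (1 - cmod l))"
      using l1 by (subst ennreal_mult[symmetric]) auto
    finally show ?thesis .
  qed
  ultimately show ?thesis by blast
qed

end

section \<open>Norm-controlled inversion\<close>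

abbreviation pnorm :: "real \<Rightarrow> complex fps \<Rightarrow> ennreal"
  where "pnorm \<beta> \<equiv> wnorm \<beta> (\<lambda>z. ennreal (cmod z))"

lemma pnorm_complete_algebra_norm: "0 \<le> \<beta> \<Longrightarrow> complete_algebra_norm (pnorm \<beta>) fps_const"
  by (rule cmod_norm.wnorm_complete_algebra_norm)

lemma pnorm_mono:
  assumes "\<And>n. cmod (fps_nth F n) \<le> cmod (fps_nth G n)"
  shows "pnorm \<beta> F \<le> pnorm \<beta> G"
  unfolding wnorm_def by (intro suminf_le mult_left_mono ennreal_leI assms) auto

lemma powr_subadditive:
  fixes x y \<beta> :: real
  assumes "0 < x" "0 < y" "0 \<le> \<beta>" "\<beta> \<le> 1"
  shows "(x + y) powr \<beta> \<le> x powr \<beta> + y powr \<beta>"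
proof -
  have h: "x * (x + y) powr (\<beta> - 1) \<le> x powr \<beta>" if "0 < x" "0 < y" for x y :: real
  proof -
    have "(x + y) powr (\<beta> - 1) \<le> x powr (\<beta> - 1)" using that assms by (intro powr_mono2') auto
    then have "x * (x + y) powr (\<beta> - 1) \<le> x * x powr (\<beta> - 1)" using that by (simp add: mult_left_mono)
    then show ?thesis using powr_add[of x 1 "\<beta> - 1"] that by simp
  qed
  have "(x + y) powr \<beta> = (x + y) * (x + y) powr (\<beta> - 1)"
    using powr_add[of "x + y" 1 "\<beta> - 1"] assms by simp
  also have "\<dots> = x * (x + y) powr (\<beta> - 1) + y * (y + x) powr (\<beta> - 1)"
    using assms by (simp add: distrib_right add.commute)
  also have "\<dots> \<le> x powr \<beta> + y powr \<beta>" using h[of x y] h[of y x] assms by (intro add_mono) auto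
  finally show ?thesis .
qed

text \<open>For \<beta> \<le> 1 the weight of n is at most the sum of the weights of i and n - i, so
  a Leibniz rule holds: in a product only one factor at a time carries the weighted norm. The
  weighted norm of r^k thus grows like k times a power of the unweighted norm.\<close>

lemma pnorm_product_rule:
  assumes \<beta>: "0 \<le> \<beta>" "\<beta> \<le> 1"
  shows "pnorm \<beta> (F * G) \<le> pnorm \<beta> F * pnorm 0 G + pnorm 0 F * pnorm \<beta> G"
proof -
  let ?w = "\<lambda>n. ennreal ((1 + real n) powr \<beta>)"
  let ?F = "\<lambda>n. ennreal (cmod (fps_nth F n))" and ?G = "\<lambda>n. ennreal (cmod (fps_nth G n))"
  have p0: "pnorm 0 H = (\<Sum>n. ennreal (cmod (fps_nth H n)))" for H by (simp add: wnorm_def)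
  have w: "?w n \<le> ?w i + ?w (n - i)" if "i \<le> n" for i n
  proof -
    have "(1 + real n) powr \<beta> \<le> ((1 + real i) + (1 + real (n - i))) powr \<beta>"
      using that \<beta> by (intro powr_mono2) auto
    also have "\<dots> \<le> (1 + real i) powr \<beta> + (1 + real (n - i)) powr \<beta>" using \<beta> by (intro powr_subadditive) auto
    finally show ?thesis by (simp flip: ennreal_plus add: ennreal_leI)
  qed
  have "pnorm \<beta> (F * G) \<le> (\<Sum>n. (\<Sum>i=0..n. (?w i * ?F i) * ?G (n - i)) + (\<Sum>i=0..n. ?F i * (?w (n - i) * ?G (n - i))))"
    unfolding wnorm_def
  proof (rule suminf_le)
    fix n
    have "ennreal (cmod (fps_nth (F * G) n)) \<le> (\<Sum>i=0..n. ?F i * ?G (n - i))"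
    proof -
      have "cmod (fps_nth (F * G) n) \<le> (\<Sum>i=0..n. cmod (fps_nth F i) * cmod (fps_nth G (n - i)))"
        unfolding fps_mult_nth norm_mult[symmetric] by (rule norm_sum)
      then have "ennreal (cmod (fps_nth (F * G) n)) \<le> ennreal (\<Sum>i=0..n. cmod (fps_nth F i) * cmod (fps_nth G (n - i)))"
        by (rule ennreal_leI)
      also have "\<dots> = (\<Sum>i=0..n. ?F i * ?G (n - i))" by (simp add: ennreal_mult flip: sum_ennreal)
      finally show ?thesis .
    qed
    then have "?w n * ennreal (cmod (fps_nth (F * G) n)) \<le> ?w n * (\<Sum>i=0..n. ?F i * ?G (n - i))"
      by (rule mult_left_mono) simp
    also have "\<dots> = (\<Sum>i=0..n. ?w n * (?F i * ?G (n - i)))" by (rule sum_distrib_left)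
    also have "\<dots> \<le> (\<Sum>i=0..n. (?w i + ?w (n - i)) * (?F i * ?G (n - i)))"
      by (intro sum_mono mult_right_mono w) auto
    also have "\<dots> = (\<Sum>i=0..n. (?w i * ?F i) * ?G (n - i)) + (\<Sum>i=0..n. ?F i * (?w (n - i) * ?G (n - i)))"
      unfolding sum.distrib[symmetric] by (intro sum.cong refl) (simp only: distrib_right, simp only: mult_ac)
    finally show "?w n * ennreal (cmod (fps_nth (F * G) n)) \<le> \<dots>" .
  qed auto
  also have "\<dots> = (\<Sum>n. \<Sum>i=0..n. (?w i * ?F i) * ?G (n - i)) + (\<Sum>n. \<Sum>i=0..n. ?F i * (?w (n - i) * ?G (n - i)))"
    by (rule ennreal_suminf_add)
  also have "\<dots> = pnorm \<beta> F * pnorm 0 G + pnorm 0 F * pnorm \<beta> G"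
    unfolding p0 unfolding wnorm_def
    by (simp only: ennreal_suminf_Cauchy_product[of "\<lambda>i. ?w i * ?F i" ?G] ennreal_suminf_Cauchy_product[of ?F "\<lambda>i. ?w i * ?G i"])
  finally show ?thesis .
qed

definition fps_dilate :: "complex \<Rightarrow> complex fps \<Rightarrow> complex fps"
  where "fps_dilate c F = Abs_fps (\<lambda>n. c ^ n * fps_nth F n)"

lemma fps_dilate_nth [simp]: "fps_nth (fps_dilate c F) n = c ^ n * fps_nth F n"
  by (simp add: fps_dilate_def)

lemma fps_dilate_mult: "fps_dilate c (F * G) = fps_dilate c F * fps_dilate c G"
proof (rule fps_ext)
  fix n
  have "fps_nth (fps_dilate c (F * G)) n = (\<Sum>i=0..n. c ^ n * (fps_nth F i * fps_nth G (n - i)))"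
    by (simp add: fps_mult_nth sum_distrib_left)
  also have "\<dots> = (\<Sum>i=0..n. (c ^ i * fps_nth F i) * (c ^ (n - i) * fps_nth G (n - i)))"
  proof (rule sum.cong[OF refl])
    fix i assume "i \<in> {0..n}"
    then have "c ^ n = c ^ i * c ^ (n - i)" by (simp flip: power_add)
    then show "c ^ n * (fps_nth F i * fps_nth G (n - i)) = (c ^ i * fps_nth F i) * (c ^ (n - i) * fps_nth G (n - i))"
      by simp
  qed
  finally show "fps_nth (fps_dilate c (F * G)) n = fps_nth (fps_dilate c F * fps_dilate c G) n"
    by (simp add: fps_mult_nth)
qed

lemma fps_dilate_1: "fps_dilate c 1 = 1"
  by (rule fps_ext) simp

lemma fps_dilate_power: "fps_dilate c (F ^ k) = fps_dilate c F ^ k"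
  by (induction k) (simp_all add: fps_dilate_1 fps_dilate_mult)

lemma pnorm_finite_summable:
  assumes "pnorm \<beta> F < \<infinity>" "0 \<le> \<beta>"
  shows "summable (\<lambda>n. cmod (fps_nth F n))"
proof (rule summable_suminf_not_top)
  have "(\<Sum>n. ennreal (cmod (fps_nth F n))) = pnorm 0 F" by (simp add: wnorm_def)
  also have "\<dots> \<le> pnorm \<beta> F" unfolding wnorm_def
    using one_le_weight[OF assms(2)] by (intro suminf_le mult_right_mono ennreal_leI) auto
  finally show "(\<Sum>n. ennreal (cmod (fps_nth F n))) \<noteq> top" using assms by (auto simp: top_unique)
qed simp

lemma fps_conv_radius_ge_1:
  assumes "summable (\<lambda>n. cmod (fps_nth F n))"
  shows "fps_conv_radius F \<ge> 1"
proof -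
  have "conv_radius (fps_nth F) \<ge> ereal (norm (1::complex))"
    by (rule conv_radius_geI) (use summable_norm_cancel[OF assms] in simp)
  then show ?thesis by (simp add: fps_conv_radius_def one_ereal_def)
qed

text \<open>The modulus of 1/F^k is at most \<delta>^(-k) in the disc, and Cauchy's inequality on
  circles of radius \<rho> gives the same bound for the coefficients as \<rho> tends to 1. No
  constant depends on k or on the norm of F.\<close>

lemma inverse_power_coefficient_bound:
  fixes F :: "complex fps"
  assumes F: "summable (\<lambda>n. cmod (fps_nth F n))" and \<delta>: "0 < \<delta>"
    and lower: "\<And>w. cmod w < 1 \<Longrightarrow> \<delta> \<le> cmod (eval_fps F w)"
  shows "cmod (fps_nth (inverse F ^ k) n) \<le> (1 / \<delta>) ^ k"
proof -
  have cr: "fps_conv_radius F \<ge> 1" by (rule fps_conv_radius_ge_1[OF F])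
  define h where "h w = inverse (eval_fps F w) ^ k" for w
  have nz: "eval_fps F w \<noteq> 0" if "cmod w < 1" for w using lower[OF that] \<delta> by auto
  have F0: "fps_nth F 0 \<noteq> 0" using nz[of 0] by (simp add: eval_fps_at_0)
  have "eval_fps F has_fps_expansion F"
    by (rule eval_fps_has_fps_expansion) (use cr in \<open>auto intro: less_le_trans[of _ 1]\<close>)
  then have "h has_fps_expansion inverse F ^ k"
    unfolding h_def by (intro has_fps_expansion_power has_fps_expansion_inverse F0)
  then have nth: "fps_nth (inverse F ^ k) n = (deriv ^^ n) h 0 / fact n" by (rule fps_nth_fps_expansion)
  have hol: "h holomorphic_on ball 0 1"
  proof -
    have rad: "ereal (cmod x) < fps_conv_radius F" if "cmod x < 1" for x
      by (rule less_le_trans[OF _ cr]) (use that in simp)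
    then have "eval_fps F holomorphic_on ball 0 1"
      by (intro holomorphic_on_eval_fps) (auto simp: eball_def)
    then show ?thesis unfolding h_def by (intro holomorphic_intros) (use nz rad in auto)
  qed
  have hb: "cmod (h w) \<le> (1 / \<delta>) ^ k" if "cmod w < 1" for w
    unfolding h_def norm_power norm_inverse
    by (intro power_mono) (use lower[OF that] \<delta> in \<open>auto simp: inverse_eq_divide intro!: divide_left_mono mult_pos_pos\<close>)
  have le: "cmod (fps_nth (inverse F ^ k) n) \<le> (1 / \<delta>) ^ k / \<rho> ^ n" if \<rho>: "0 < \<rho>" "\<rho> < 1" for \<rho> :: real
  proof -
    have "cmod ((deriv ^^ n) h 0) \<le> fact n * (1 / \<delta>) ^ k / \<rho> ^ n"
    proof (rule Cauchy_inequality)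
      show "h holomorphic_on ball 0 \<rho>" by (rule holomorphic_on_subset[OF hol]) (use \<rho> in auto)
      show "continuous_on (cball 0 \<rho>) h"
        by (rule continuous_on_subset[OF holomorphic_on_imp_continuous_on[OF hol]]) (use \<rho> in auto)
      show "cmod (h x) \<le> (1 / \<delta>) ^ k" if "cmod (0 - x) = \<rho>" for x using hb[of x] that \<rho> by simp
    qed (use \<rho> in auto)
    then show ?thesis unfolding nth by (simp add: norm_divide divide_le_eq mult.commute)
  qed
  have "((\<lambda>\<rho>. (1 / \<delta>) ^ k / \<rho> ^ n) \<longlongrightarrow> (1 / \<delta>) ^ k / 1 ^ n) (at_left (1::real))"
    by (intro tendsto_intros) auto
  moreover have "\<forall>\<^sub>F \<rho> in at_left (1::real). cmod (fps_nth (inverse F ^ k) n) \<le> (1 / \<delta>) ^ k / \<rho> ^ n"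
    unfolding eventually_at_left_field by (intro exI[of _ 0]) (use le in auto)
  ultimately have "cmod (fps_nth (inverse F ^ k) n) \<le> (1 / \<delta>) ^ k / 1 ^ n"
    by (intro tendsto_lowerbound) auto
  then show ?thesis by simp
qed

text \<open>
  Splitting \<open>F = p + r\<close> with \<open>p(w) = F(\<eta>w)\<close> and expanding \<open>1/F\<close> in powers of \<open>r/p\<close>: all powers of \<open>1/p\<close> are
  controlled by Cauchy's inequality alone, so the bound is polynomial in \<open>1/\<delta>\<close>.
\<close>

lemma norm_controlled_inversion:
  fixes F :: "complex fps"
  assumes \<beta>: "0 < \<beta>" "\<beta> \<le> 1" and FM: "pnorm \<beta> F \<le> ennreal M" and M: "1 \<le> M"
    and \<delta>: "0 < \<delta>" "\<delta> \<le> 1" and lower: "\<And>w. cmod w < 1 \<Longrightarrow> \<delta> \<le> cmod (eval_fps F w)"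
  shows "F * inverse F = 1 \<and>
    pnorm \<beta> (inverse F) \<le> ennreal (8 * M / (\<delta>\<^sup>2 * ((\<delta> / (2 * M)) powr (1 / \<beta>))\<^sup>2))"
proof -
  interpret w: complete_algebra_norm "pnorm \<beta>" fps_const by (rule pnorm_complete_algebra_norm) (use \<beta> in simp)
  interpret w0: complete_algebra_norm "pnorm 0" fps_const by (rule pnorm_complete_algebra_norm) simp
  \<comment> \<open>Chosen such that s^\<beta> M = \<delta>/2, which makes the unweighted norm of
    \<open>r\<close> at most \<delta>/2.\<close>
  define s where "s = (\<delta> / (2 * M)) powr (1 / \<beta>)"
  have dM: "0 < \<delta> / (2 * M)" "\<delta> / (2 * M) < 1" using \<delta> M by (auto simp: divide_less_eq)
  have s: "0 < s" "s < 1" using dM \<beta> powr_less_mono2[of "1 / \<beta>" "\<delta> / (2 * M)" 1] by (auto simp: s_def)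
  have sM: "s powr \<beta> * M = \<delta> / 2" using dM \<beta> M \<delta> by (simp add: s_def powr_powr)
  define \<eta> where "\<eta> = 1 - s"
  have \<eta>: "0 < \<eta>" "\<eta> < 1" using s by (auto simp: \<eta>_def)
  have Ffin: "pnorm \<beta> F < \<infinity>" using FM by (auto intro: order.strict_trans1)
  then have Fsum: "summable (\<lambda>n. cmod (fps_nth F n))" using \<beta> by (intro pnorm_finite_summable[of \<beta>]) auto
  have F0: "fps_nth F 0 \<noteq> 0" using lower[of 0] \<delta> by (auto simp: eval_fps_at_0)
  define G where "G = inverse F"
  have FG: "F * G = 1" unfolding G_def using inverse_mult_eq_1[OF F0] by (simp add: mult.commute)
  define p where "p = fps_dilate (of_real \<eta>) F"
  define P where "P = fps_dilate (of_real \<eta>) G"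
  define r where "r = F - p"
  have pP: "p * P = 1" unfolding p_def P_def by (simp add: FG fps_dilate_1 flip: fps_dilate_mult)
  have rn: "cmod (fps_nth r n) = cmod (fps_nth F n) * (1 - \<eta> ^ n)" for n
  proof -
    have "fps_nth r n = fps_nth F n * of_real (1 - \<eta> ^ n)" by (simp add: r_def p_def algebra_simps)
    moreover have "0 \<le> 1 - \<eta> ^ n" using \<eta> by (simp add: power_le_one)
    ultimately show ?thesis by (simp only: norm_mult norm_of_real abs_of_nonneg)
  qed
  have r\<beta>: "pnorm \<beta> r \<le> ennreal M"
  proof (rule order_trans[OF pnorm_mono FM])
    fix n
    have "cmod (fps_nth F n) * (1 - \<eta> ^ n) \<le> cmod (fps_nth F n) * 1" using \<eta> by (intro mult_left_mono) auto
    then show "cmod (fps_nth r n) \<le> cmod (fps_nth F n)" by (simp add: rn)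
  qed
  have r0: "pnorm 0 r \<le> ennreal (\<delta> / 2)"
  proof -
    have "pnorm 0 r \<le> (\<Sum>n. ennreal (s powr \<beta>) * (ennreal ((1 + real n) powr \<beta>) * ennreal (cmod (fps_nth F n))))"
      unfolding wnorm_def
    proof (rule suminf_le)
      fix n
      define y where "y = (1 + real n) * s"
      have y: "0 < y" using s by (simp add: y_def)
      \<comment> \<open>By Bernoulli the left side is at most n s, hence at most y; it is also at
        most 1. For 0 < \<beta> \<le> 1 the smaller of y and 1 is bounded by y^\<beta>.\<close>
      have "1 - \<eta> ^ n \<le> y powr \<beta>"
      proof (cases "y \<le> 1")
        case True
        have "1 - real n * s \<le> \<eta> ^ n" using Bernoulli_inequality[of "- s" n] s by (simp add: \<eta>_def)
        then have "1 - \<eta> ^ n \<le> y" using s by (simp add: y_def algebra_simps)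
        also have "y = y powr 1" using y by simp
        also have "\<dots> \<le> y powr \<beta>" using True y \<beta> by (intro powr_mono') auto
        finally show ?thesis .
      next
        case False
        have "1 - \<eta> ^ n \<le> 1" using \<eta> by simp
        also have "1 \<le> y powr \<beta>" using False \<beta> by (intro ge_one_powr_ge_zero) auto
        finally show ?thesis .
      qed
      also have "y powr \<beta> = (1 + real n) powr \<beta> * s powr \<beta>" unfolding y_def using s by (intro powr_mult)
      finally have "cmod (fps_nth r n) \<le> s powr \<beta> * ((1 + real n) powr \<beta> * cmod (fps_nth F n))"
        unfolding rn using mult_left_mono[of "1 - \<eta> ^ n" "(1 + real n) powr \<beta> * s powr \<beta>" "cmod (fps_nth F n)"]
        by (simp add: mult_ac)
      then show "ennreal ((1 + real n) powr 0) * ennreal (cmod (fps_nth r n)) \<le>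
          ennreal (s powr \<beta>) * (ennreal ((1 + real n) powr \<beta>) * ennreal (cmod (fps_nth F n)))"
        by (simp add: ennreal_leI flip: ennreal_mult)
    qed auto
    also have "\<dots> = ennreal (s powr \<beta>) * pnorm \<beta> F" by (simp add: wnorm_def)
    also have "\<dots> \<le> ennreal (s powr \<beta>) * ennreal M" by (intro mult_left_mono FM) auto
    also have "\<dots> = ennreal (\<delta> / 2)" using sM M by (subst ennreal_mult[symmetric]) auto
    finally show ?thesis .
  qed
  have rk0: "pnorm 0 (r ^ k) \<le> ennreal ((\<delta> / 2) ^ k)" for k
  proof -
    have "pnorm 0 (r ^ k) \<le> pnorm 0 r ^ k" by (rule w0.nrm_power)
    also have "\<dots> \<le> ennreal (\<delta> / 2) ^ k" by (rule power_mono[OF r0]) simp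
    also have "\<dots> = ennreal ((\<delta> / 2) ^ k)" using \<delta> by (intro ennreal_power) simp
    finally show ?thesis .
  qed
  \<comment> \<open>Induction by the Leibniz rule: one factor carries the weighted norm M, the
    others the small norm \<delta>/2.\<close>
  have rk: "pnorm \<beta> (r ^ k) \<le> ennreal (real (Suc k) * (\<delta> / 2) ^ k * (2 * M / \<delta>))" for k
  proof (induction k)
    case 0
    have "1 \<le> 2 * M / \<delta>" using \<delta> M by (simp add: le_divide_eq)
    then have "ennreal 1 \<le> ennreal (2 * M / \<delta>)" by (rule ennreal_leI)
    then show ?case by (simp add: w.nrm_one)
  next
    case (Suc k)
    have "pnorm \<beta> (r * r ^ k) \<le> pnorm \<beta> r * pnorm 0 (r ^ k) + pnorm 0 r * pnorm \<beta> (r ^ k)"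
      using \<beta> by (intro pnorm_product_rule) auto
    also have "\<dots> \<le> ennreal M * ennreal ((\<delta> / 2) ^ k) +
        ennreal (\<delta> / 2) * ennreal (real (Suc k) * (\<delta> / 2) ^ k * (2 * M / \<delta>))"
      by (intro add_mono mult_mono r\<beta> r0 rk0 Suc) auto
    also have "\<dots> = ennreal (M * (\<delta> / 2) ^ k + (\<delta> / 2) * (real (Suc k) * (\<delta> / 2) ^ k * (2 * M / \<delta>)))"
    proof -
      have "ennreal M * ennreal ((\<delta> / 2) ^ k) = ennreal (M * (\<delta> / 2) ^ k)"
        using M \<delta> by (intro ennreal_mult[symmetric]) auto
      moreover have "ennreal (\<delta> / 2) * ennreal (real (Suc k) * (\<delta> / 2) ^ k * (2 * M / \<delta>)) =
          ennreal ((\<delta> / 2) * (real (Suc k) * (\<delta> / 2) ^ k * (2 * M / \<delta>)))"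
        using M \<delta> by (intro ennreal_mult[symmetric]) auto
      ultimately show ?thesis using M \<delta> by (simp only:) (rule ennreal_plus[symmetric]; simp)
    qed
    also have "M * (\<delta> / 2) ^ k + (\<delta> / 2) * (real (Suc k) * (\<delta> / 2) ^ k * (2 * M / \<delta>)) =
        real (Suc (Suc k)) * (\<delta> / 2) ^ Suc k * (2 * M / \<delta>)"
      using \<delta> by (simp add: field_simps)
    finally show ?case by simp
  qed
  \<comment> \<open>The coefficients of P^k are \<eta>^n times those of F^(-k), and the sum of (1 +
    n) \<eta>^n is 1/s^2.\<close>
  have Pk: "pnorm \<beta> (P ^ k) \<le> ennreal ((1 / \<delta>) ^ k * (1 / s\<^sup>2))" for k
  proof -
    have sm: "(\<lambda>n. (1 / \<delta>) ^ k * ((1 + real n) * \<eta> ^ n)) sums ((1 / \<delta>) ^ k * (1 / s\<^sup>2))"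
      using geometric_deriv_sums[of \<eta>] \<eta> by (intro sums_mult) (simp add: add.commute \<eta>_def)
    have "pnorm \<beta> (P ^ k) \<le> (\<Sum>n. ennreal ((1 / \<delta>) ^ k * ((1 + real n) * \<eta> ^ n)))"
      unfolding wnorm_def
    proof (rule suminf_le)
      fix n
      have "cmod (fps_nth (P ^ k) n) = \<eta> ^ n * cmod (fps_nth (G ^ k) n)"
        unfolding P_def fps_dilate_power[symmetric] using \<eta> by (simp add: norm_mult norm_power)
      also have "\<dots> \<le> \<eta> ^ n * (1 / \<delta>) ^ k"
        unfolding G_def by (intro mult_left_mono inverse_power_coefficient_bound[OF Fsum \<delta>(1) lower]) (use \<eta> in auto)
      finally have "cmod (fps_nth (P ^ k) n) \<le> \<eta> ^ n * (1 / \<delta>) ^ k" .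
      moreover have "(1 + real n) powr \<beta> \<le> (1 + real n) powr 1" using \<beta> by (intro powr_mono) auto
      ultimately have "(1 + real n) powr \<beta> * cmod (fps_nth (P ^ k) n) \<le> (1 + real n) * (\<eta> ^ n * (1 / \<delta>) ^ k)"
        by (intro mult_mono) auto
      then show "ennreal ((1 + real n) powr \<beta>) * ennreal (cmod (fps_nth (P ^ k) n)) \<le>
          ennreal ((1 / \<delta>) ^ k * ((1 + real n) * \<eta> ^ n))"
        by (subst ennreal_mult[symmetric]) (auto intro!: ennreal_leI simp: mult_ac)
    qed auto
    also have "\<dots> = ennreal ((1 / \<delta>) ^ k * (1 / s\<^sup>2))"
      using sm \<eta> \<delta> by (subst suminf_ennreal2) (auto simp: sums_iff)
    finally show ?thesis .
  qed
  \<comment> \<open>The terms of 1/(p + r) expanded in r/p. The factor (\<delta>/2)^k from r^k meets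
    \<delta>^(-k) from the powers of \<open>P\<close>, so the series is dominated by (k + 1)/2^k;
    its sum 4 turns the constant 2 M into 8 M.\<close>
  define S where "S k = (- r) ^ k * P ^ Suc k" for k
  have Sk: "pnorm \<beta> (S k) \<le> ennreal (2 * M / (\<delta>\<^sup>2 * s\<^sup>2) * (real (Suc k) * (1 / 2) ^ k))" for k
  proof -
    have "(- r) ^ k = (- 1) ^ k * r ^ k" by (rule power_minus)
    moreover have "(- 1) ^ k * r ^ k = r ^ k \<or> (- 1) ^ k * r ^ k = - (r ^ k)" by (cases "even k") auto
    ultimately have "pnorm \<beta> ((- r) ^ k) = pnorm \<beta> (r ^ k)" using w.nrm_minus by metis
    then have "pnorm \<beta> (S k) \<le> pnorm \<beta> (r ^ k) * pnorm \<beta> (P ^ Suc k)"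
      unfolding S_def using w.nrm_mult[of "(- r) ^ k" "P ^ Suc k"] by simp
    also have "\<dots> \<le> ennreal (real (Suc k) * (\<delta> / 2) ^ k * (2 * M / \<delta>)) * ennreal ((1 / \<delta>) ^ Suc k * (1 / s\<^sup>2))"
      by (intro mult_mono rk Pk) auto
    also have "\<dots> = ennreal (real (Suc k) * (\<delta> / 2) ^ k * (2 * M / \<delta>) * ((1 / \<delta>) ^ Suc k * (1 / s\<^sup>2)))"
      using \<delta> M by (intro ennreal_mult[symmetric]) auto
    also have "real (Suc k) * (\<delta> / 2) ^ k * (2 * M / \<delta>) * ((1 / \<delta>) ^ Suc k * (1 / s\<^sup>2)) =
        2 * M / (\<delta>\<^sup>2 * s\<^sup>2) * (real (Suc k) * (1 / 2) ^ k)"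
      using \<delta> s by (simp add: power_divide power2_eq_square field_simps)
    finally show ?thesis .
  qed
  have Ssum: "(\<Sum>k. pnorm \<beta> (S k)) \<le> ennreal (8 * M / (\<delta>\<^sup>2 * s\<^sup>2))"
  proof -
    have g: "(\<lambda>k. 2 * M / (\<delta>\<^sup>2 * s\<^sup>2) * (real (Suc k) * (1 / 2) ^ k)) sums (2 * M / (\<delta>\<^sup>2 * s\<^sup>2) * (1 / (1 - 1 / 2)\<^sup>2))"
      using geometric_deriv_sums[of "1 / 2 :: real"] by (intro sums_mult) simp
    have "(\<Sum>k. pnorm \<beta> (S k)) \<le> (\<Sum>k. ennreal (2 * M / (\<delta>\<^sup>2 * s\<^sup>2) * (real (Suc k) * (1 / 2) ^ k)))"
      by (intro suminf_le Sk) auto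
    also have "\<dots> = ennreal (2 * M / (\<delta>\<^sup>2 * s\<^sup>2) * (1 / (1 - 1 / 2)\<^sup>2))"
      using sums_unique[OF g] sums_summable[OF g] M \<delta> by (subst suminf_ennreal2) auto
    also have "2 * M / (\<delta>\<^sup>2 * s\<^sup>2) * (1 / (1 - 1 / 2)\<^sup>2) = 8 * M / (\<delta>\<^sup>2 * s\<^sup>2)" by (simp add: power2_eq_square)
    finally show ?thesis .
  qed
  then have Sfin: "(\<Sum>k. pnorm \<beta> (S k)) < \<infinity>" by (rule order.strict_trans1) simp
  then obtain l where l: "l \<in> w.carr" "pnorm \<beta> l \<le> (\<Sum>k. pnorm \<beta> (S k))"
    "(\<lambda>K. pnorm \<beta> (l - (\<Sum>k<K. S k))) \<longlonglongrightarrow> 0" using w.carr_sum_limit by blast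
  have tel: "F * (\<Sum>k<K. S k) = 1 - (- r) ^ K * P ^ K" for K
  proof (induction K)
    case 0 then show ?case by simp
  next
    case (Suc K)
    have "F * S K = (p + r) * ((- r) ^ K * P ^ Suc K)" by (simp add: S_def r_def)
    also have "\<dots> = (- r) ^ K * P ^ K * (p * P) - (- r) ^ Suc K * P ^ Suc K" by (simp add: algebra_simps)
    finally have "F * S K = (- r) ^ K * P ^ K - (- r) ^ Suc K * P ^ Suc K" by (simp only: pP mult_1_right)
    then show ?case using Suc by (simp add: distrib_left del: power_Suc)
  qed
  have pc: "p \<in> w.carr"
  proof -
    have "pnorm \<beta> p \<le> pnorm \<beta> F" unfolding p_def
      by (rule pnorm_mono) (use \<eta> in \<open>auto simp: norm_mult norm_power power_le_one intro: mult_left_le_one_le\<close>)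
    then show ?thesis using Ffin by (auto simp: w.carr_def)
  qed
  have "(\<lambda>K. pnorm \<beta> (1 - (1 - (- r) ^ K * P ^ K))) \<longlonglongrightarrow> 0"
  proof (rule tendsto_sandwich[OF _ _ tendsto_const])
    have e: "(- r) ^ K * P ^ K = p * S K" for K
    proof -
      have "p * S K = (- r) ^ K * P ^ K * (p * P)" by (simp add: S_def algebra_simps)
      then show ?thesis by (simp only: pP mult_1_right)
    qed
    have "S' \<longlonglongrightarrow> 0" if "(\<Sum>k. S' k) < \<infinity>" for S' :: "nat \<Rightarrow> ennreal"
    proof (rule tendsto_sandwich[OF _ _ tendsto_const ennreal_suminf_tail_tendsto_0[OF that]])
      show "\<forall>\<^sub>F n in sequentially. S' n \<le> (\<Sum>m. S' (m + n))"
        using sum_le_suminf[of "\<lambda>m. S' (m + _)" "{0}"] by (intro always_eventually) auto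
    qed auto
    from this[OF Sfin] have "(\<lambda>K. pnorm \<beta> p * pnorm \<beta> (S K)) \<longlonglongrightarrow> pnorm \<beta> p * 0"
      by (intro ennreal_tendsto_cmult) (use pc in \<open>auto simp: w.carr_def\<close>)
    then show "(\<lambda>K. pnorm \<beta> p * pnorm \<beta> (S K)) \<longlonglongrightarrow> 0" by simp
    show "\<forall>\<^sub>F K in sequentially. pnorm \<beta> (1 - (1 - (- r) ^ K * P ^ K)) \<le> pnorm \<beta> p * pnorm \<beta> (S K)"
      unfolding e using w.nrm_mult[of p] by (intro always_eventually) simp
  qed auto
  moreover have "(\<lambda>K. pnorm \<beta> (F * l - F * (\<Sum>k<K. S k))) \<longlonglongrightarrow> 0"
    by (rule w.mult_norm_diff_tendsto_0[OF l(3)]) (use Ffin in \<open>simp add: w.carr_def\<close>)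
  ultimately have Fl: "F * l = 1" unfolding tel by (intro w.eq_if_norm_diff_tendsto_0[of "F * l"])
  have "l = G * (F * l)" using FG by (simp add: mult.assoc[symmetric] mult.commute[of G])
  then have "l = G" using Fl by simp
  then show ?thesis using l(2) Ssum FG unfolding s_def G_def by (auto intro: order_trans)
qed

section \<open>Lower bounds from the Harnack inequality\<close>

lemma Harnack_upper_bound:
  assumes hol: "k holomorphic_on ball 0 1" and pos: "\<And>z. cmod z < 1 \<Longrightarrow> 0 < Re (k z)" and z: "cmod z < 1"
  shows "Re (k z) \<le> Re (k 0) * ((1 + cmod z) / (1 - cmod z))"
proof -
  define c where "c = k 0"
  define \<phi> where "\<phi> z = (k z - c) / (k z + cnj c)" for z
  have c: "0 < Re c" using pos[of 0] by (simp add: c_def)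
  have ne: "k z + cnj c \<noteq> 0" if "cmod z < 1" for z
    using pos[OF that] c by (auto simp: complex_eq_iff)
  have id: "cmod (w + cnj c) ^ 2 - cmod (w - c) ^ 2 = 4 * Re w * Re c" for w
    unfolding cmod_power2 by (simp add: power2_eq_square algebra_simps)
  have lt: "cmod (\<phi> z) < 1" if "cmod z < 1" for z
  proof -
    have "0 < 4 * Re (k z) * Re c" using pos[OF that] c by simp
    then have "cmod (k z - c) ^ 2 < cmod (k z + cnj c) ^ 2" using id[of "k z"] by linarith
    then have "cmod (k z - c) < cmod (k z + cnj c)" by (rule power2_less_imp_less) simp
    then show ?thesis using ne[OF that] by (simp add: \<phi>_def norm_divide divide_less_eq)
  qed
  have "cmod (\<phi> z) \<le> cmod z"
  proof (rule Schwarz_Lemma(1))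
    show "\<phi> holomorphic_on ball 0 1" unfolding \<phi>_def by (intro holomorphic_intros hol) (use ne in auto)
    show "\<phi> 0 = 0" by (simp add: \<phi>_def c_def)
  qed (use lt z in auto)
  then have le: "cmod (k z - c) \<le> cmod z * cmod (k z + cnj c)"
    using ne[OF z] by (simp add: \<phi>_def norm_divide divide_le_eq)
  define X where "X = Re (k z)"
  define r where "r = cmod z"
  have r: "0 \<le> r" "r < 1" using z by (auto simp: r_def)
  have "cmod (k z - c) ^ 2 \<le> (r * cmod (k z + cnj c)) ^ 2" using le by (intro power_mono) (auto simp: r_def)
  then have "(X - Re c) ^ 2 + (Im (k z) - Im c) ^ 2 \<le> r ^ 2 * ((X + Re c) ^ 2 + (Im (k z) - Im c) ^ 2)"
    unfolding power_mult_distrib cmod_power2 by (simp add: X_def)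
  moreover have "r ^ 2 * (Im (k z) - Im c) ^ 2 \<le> 1 * (Im (k z) - Im c) ^ 2"
    using r by (intro mult_right_mono power_le_one) auto
  ultimately have "(X - Re c) ^ 2 \<le> r ^ 2 * (X + Re c) ^ 2" by (simp add: distrib_left)
  then have "(X - Re c) ^ 2 \<le> (r * (X + Re c)) ^ 2" by (simp add: power_mult_distrib)
  moreover have "0 \<le> r * (X + Re c)" using r c pos[OF z] by (simp add: X_def)
  ultimately have "\<bar>X - Re c\<bar> \<le> r * (X + Re c)" by (metis abs_le_square_iff abs_of_nonneg)
  then have "X * (1 - r) \<le> Re c * (1 + r)" by (simp add: algebra_simps)
  then show ?thesis using r by (simp add: X_def r_def c_def field_simps)
qed

text \<open>ln M - ln |f| is the positive real part of the holomorphic function ln M - log f, so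
  Harnack's inequality applies.\<close>

lemma log_norm_lower_bound:
  assumes hol: "f holomorphic_on ball 0 1" and nz: "\<And>z. cmod z < 1 \<Longrightarrow> f z \<noteq> 0"
    and M: "\<And>z. cmod z < 1 \<Longrightarrow> cmod (f z) < M" and z: "cmod z < 1"
  shows "ln M - ln (cmod (f z)) \<le> (ln M - ln (cmod (f 0))) * ((1 + cmod z) / (1 - cmod z))"
proof -
  obtain g where g: "g holomorphic_on ball 0 1" "\<And>z. z \<in> ball 0 1 \<Longrightarrow> exp (g z) = f z"
    by (rule holomorphic_logarithm_exists[OF convex_ball open_ball hol, of 0]) (use nz in auto)
  have ln: "ln (cmod (f z)) = Re (g z)" if "cmod z < 1" for z using g(2)[of z] that by (auto simp flip: g(2))
  have "Re (of_real (ln M) - g z) \<le> Re (of_real (ln M) - g 0) * ((1 + cmod z) / (1 - cmod z))"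
  proof (rule Harnack_upper_bound[OF _ _ z])
    show "(\<lambda>z. of_real (ln M) - g z) holomorphic_on ball 0 1" by (intro holomorphic_intros g)
    show "0 < Re (of_real (ln M) - g z)" if "cmod z < 1" for z
    proof -
      have "ln (cmod (f z)) < ln M" using M[OF that] nz[OF that] by (subst ln_less_cancel_iff) (auto intro: less_trans[rotated])
      then show ?thesis using ln[OF that] by simp
    qed
  qed
  then show ?thesis using ln[OF z] ln[of 0] by simp
qed

text \<open>Harnack's inequality transported by the automorphism of the disc that moves \<open>0\<close> to \<open>r\<close>.\<close>

lemma log_norm_radial_monotone:
  assumes hol: "f holomorphic_on ball 0 1" and nz: "\<And>z. cmod z < 1 \<Longrightarrow> f z \<noteq> 0"
    and M: "\<And>z. cmod z < 1 \<Longrightarrow> cmod (f z) < M" and r: "0 \<le> r" "r \<le> t" "t < 1"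
  shows "(1 - t) / (1 + t) * (ln M - ln (cmod (f (of_real t)))) \<le>
    (1 - r) / (1 + r) * (ln M - ln (cmod (f (of_real r))))"
proof -
  define \<phi> where "\<phi> = Moebius_function 0 (- of_real r)"
  \<comment> \<open>The preimage of t under the automorphism: the solution of (s + r)/(1 + r s) =
    t.\<close>
  define s where "s = (t - r) / (1 - r * t)"
  have rt: "r * t < 1" using r by (smt (verit) mult_less_cancel_left2 mult_left_le)
  have s: "0 \<le> s" "s < 1" using r rt by (auto simp: s_def divide_less_eq) (smt (verit) mult_less_cancel_right2 distrib_left mult.commute right_diff_distrib mult_pos_pos)
  have \<phi>0: "\<phi> 0 = of_real r" by (simp add: \<phi>_def Moebius_function_def)
  have nw: "cmod (- of_real r) < 1" using r by simp
  have \<phi>s: "\<phi> (of_real s) = of_real t"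
  proof -
    have "1 + r * s \<noteq> 0" using r s by (smt (verit) mult_nonneg_nonneg)
    moreover have "(s + r) = t * (1 + r * s)" using rt by (simp add: s_def field_simps)
    ultimately have "(s + r) / (1 + r * s) = t" by (simp add: divide_eq_eq)
    moreover have "\<phi> (of_real s) = of_real ((s + r) / (1 + r * s))" by (simp add: \<phi>_def Moebius_function_def)
    ultimately show ?thesis by simp
  qed
  have \<phi>1: "cmod (\<phi> z) < 1" if "cmod z < 1" for z
    unfolding \<phi>_def by (rule Moebius_function_norm_lt_1[OF nw that])
  have h: "ln M - ln (cmod (f (\<phi> (of_real s)))) \<le>
      (ln M - ln (cmod (f (\<phi> 0)))) * ((1 + cmod (of_real s)) / (1 - cmod (of_real s)))"
  proof (rule log_norm_lower_bound)
    show "(\<lambda>z. f (\<phi> z)) holomorphic_on ball 0 1"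
    proof (rule holomorphic_on_compose_gen[OF _ hol, unfolded o_def])
      show "\<phi> holomorphic_on ball 0 1" unfolding \<phi>_def by (rule Moebius_function_holomorphic[OF nw])
    qed (use \<phi>1 in auto)
  qed (use nz M \<phi>1 s in auto)
  have e: "(1 - t) / (1 + t) * ((1 + s) / (1 - s)) = (1 - r) / (1 + r)"
  proof -
    have 1: "1 + s = (1 - r) * (1 + t) / (1 - r * t)" and 2: "1 - s = (1 + r) * (1 - t) / (1 - r * t)"
      using rt by (simp_all add: s_def field_simps)
    have "1 - r * t \<noteq> 0" "1 - t \<noteq> 0" "1 + t \<noteq> 0" "1 + r \<noteq> 0" using rt r by auto
    then show ?thesis unfolding 1 2 by simp
  qed
  have "(1 - t) / (1 + t) * (ln M - ln (cmod (f (of_real t)))) \<le>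
      (1 - t) / (1 + t) * ((ln M - ln (cmod (f (of_real r)))) * ((1 + s) / (1 - s)))"
    using h r s unfolding \<phi>0 \<phi>s by (intro mult_left_mono) auto
  also have "\<dots> = (ln M - ln (cmod (f (of_real r)))) * ((1 - t) / (1 + t) * ((1 + s) / (1 - s)))" by simp
  finally show ?thesis unfolding e by (simp add: mult.commute)
qed

text \<open>Uniformity in w is the point. The first bound is Harnack's inequality from z = 0, where
  ln |f| is bounded over w by compactness. For the second, a radius that is good for w is good near
  w by continuity, and larger radii stay good by \<open>log_norm_radial_monotone\<close>; finitely
  many neighbourhoods cover the disc.\<close>

lemma lower_bounds_if_radial_limits:
  fixes f :: "complex \<times> complex \<Rightarrow> complex"
  assumes cont: "continuous_on (cdisc \<times> cdisc) f"
    and hol: "\<And>w. w \<in> cdisc \<Longrightarrow> (\<lambda>z. f (z, w)) holomorphic_on ball 0 1"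
    and nz: "\<And>z w. z \<in> cdisc \<Longrightarrow> w \<in> cdisc \<Longrightarrow> z \<noteq> 1 \<Longrightarrow> f (z, w) \<noteq> 0"
    and rad: "\<And>w. w \<in> cdisc \<Longrightarrow> ((\<lambda>r. (1 - r) * ln (cmod (f (of_real r, w)))) \<longlongrightarrow> 0) (at_left (1::real))"
  shows "\<exists>A\<ge>0. \<forall>z w. cmod z < 1 \<longrightarrow> w \<in> cdisc \<longrightarrow> exp (- (A / (1 - cmod z))) \<le> cmod (f (z, w))"
    and "\<And>\<epsilon>. \<epsilon> > 0 \<Longrightarrow> \<exists>r0<1. \<forall>r w. r0 < r \<longrightarrow> r < 1 \<longrightarrow> w \<in> cdisc \<longrightarrow>
      exp (- (\<epsilon> / (1 - r))) \<le> cmod (f (of_real r, w))"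
proof -
  have "compact (f ` (cdisc \<times> cdisc))" by (intro compact_continuous_image cont compact_Times compact_cball)
  then obtain B where B: "\<And>z w. z \<in> cdisc \<Longrightarrow> w \<in> cdisc \<Longrightarrow> cmod (f (z, w)) \<le> B"
    using compact_imp_bounded by (force simp: bounded_iff)
  define M where "M = \<bar>B\<bar> + 1"
  have M1: "1 \<le> M" by (simp add: M_def)
  have M: "cmod (f (z, w)) < M" if "z \<in> cdisc" "w \<in> cdisc" for z w using B[OF that] by (simp add: M_def)
  have nz': "f (z, w) \<noteq> 0" if "cmod z < 1" "w \<in> cdisc" for z w using nz[of z w] that by force
  define u where "u z w = ln M - ln (cmod (f (z, w)))" for z w
  have exp_u: "cmod (f (z, w)) = M * exp (- u z w)" if "z \<in> cdisc" "w \<in> cdisc" "z \<noteq> 1" for z w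
    using nz[OF that] M1 by (simp add: u_def exp_diff)
  have contw: "continuous_on cdisc (\<lambda>w. u z w)" if "z \<in> cdisc" "z \<noteq> 1" for z
    unfolding u_def
    by (intro continuous_intros continuous_on_compose2[OF cont]) (use nz that in auto)
  have from_u: "exp (- v) \<le> cmod (f (z, w))" if "u z w \<le> v" "z \<in> cdisc" "w \<in> cdisc" "z \<noteq> 1" for z w v
  proof -
    have "exp (- v) \<le> 1 * exp (- u z w)" using that by simp
    also have "\<dots> \<le> M * exp (- u z w)" using M1 by (intro mult_right_mono) auto
    finally show ?thesis using exp_u that by simp
  qed
  show "\<exists>A\<ge>0. \<forall>z w. cmod z < 1 \<longrightarrow> w \<in> cdisc \<longrightarrow> exp (- (A / (1 - cmod z))) \<le> cmod (f (z, w))"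
  proof -
    have "compact ((\<lambda>w. u 0 w) ` cdisc)" by (intro compact_continuous_image contw compact_cball) auto
    then obtain A0 where A0: "\<And>w. w \<in> cdisc \<Longrightarrow> \<bar>u 0 w\<bar> \<le> A0"
      using compact_imp_bounded by (force simp: bounded_iff)
    have A0p: "0 \<le> A0" using A0[of 0] by simp
    have "exp (- (2 * A0 / (1 - cmod z))) \<le> cmod (f (z, w))" if z: "cmod z < 1" and w: "w \<in> cdisc" for z w
    proof (rule from_u)
      have "u z w \<le> u 0 w * ((1 + cmod z) / (1 - cmod z))"
        unfolding u_def by (rule log_norm_lower_bound[OF hol[OF w]]) (use nz' M w z in auto)
      also have "\<dots> \<le> A0 * (2 / (1 - cmod z))"
        using A0[OF w] z A0p by (intro mult_mono divide_right_mono) auto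
      finally show "u z w \<le> 2 * A0 / (1 - cmod z)" by (simp add: mult.commute)
    qed (use z w in auto)
    then show ?thesis using A0p by (intro exI[of _ "2 * A0"]) auto
  qed
  show "\<exists>r0<1. \<forall>r w. r0 < r \<longrightarrow> r < 1 \<longrightarrow> w \<in> cdisc \<longrightarrow> exp (- (\<epsilon> / (1 - r))) \<le> cmod (f (of_real r, w))"
    if \<epsilon>: "\<epsilon> > 0" for \<epsilon>
  proof -
    \<comment> \<open>This quantity decreases in r. Because 1 + r \<le> 2, the bound \<epsilon>/2
      for it yields \<epsilon>/(1 - r) for \<open>u\<close>.\<close>
    define v where "v r w = (1 - r) / (1 + r) * u (of_real r) w" for r :: real and w
    have local_bd: "\<exists>r. 0 \<le> r \<and> r < 1 \<and> v r w < \<epsilon> / 2" if w: "w \<in> cdisc" for w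
    proof -
      have "((\<lambda>r. 1 / (1 + r) * ((1 - r) * ln M - (1 - r) * ln (cmod (f (of_real r, w))))) \<longlongrightarrow>
          1 / (1 + 1) * ((1 - 1) * ln M - 0)) (at_left (1::real))"
        by (intro tendsto_intros rad w) auto
      then have "\<forall>\<^sub>F r in at_left (1::real). 1 / (1 + r) * ((1 - r) * ln M - (1 - r) * ln (cmod (f (of_real r, w)))) < \<epsilon> / 2"
        by (rule order_tendstoD) (use \<epsilon> in simp)
      then have "\<forall>\<^sub>F r in at_left (1::real). v r w < \<epsilon> / 2"
      proof eventually_elim
        case (elim r)
        have "v r w = 1 / (1 + r) * ((1 - r) * ln M - (1 - r) * ln (cmod (f (of_real r, w))))"
          by (simp add: v_def u_def right_diff_distrib)
        then show ?case using elim by simp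
      qed
      moreover have "\<forall>\<^sub>F r in at_left (1::real). 0 \<le> r \<and> r < 1"
        unfolding eventually_at_left_field by (intro exI[of _ 0]) auto
      ultimately have "\<forall>\<^sub>F r in at_left (1::real). 0 \<le> r \<and> r < 1 \<and> v r w < \<epsilon> / 2" by eventually_elim auto
      then show ?thesis using eventually_happens'[OF trivial_limit_at_left_real] by blast
    qed
    then obtain \<rho> where \<rho>: "\<And>w. w \<in> cdisc \<Longrightarrow> 0 \<le> \<rho> w \<and> \<rho> w < 1 \<and> v (\<rho> w) w < \<epsilon> / 2" by metis
    have contv: "continuous_on cdisc (\<lambda>w. v r w)" if "0 \<le> r" "r < 1" for r :: real
      unfolding v_def by (intro continuous_intros contw) (use that in auto)
    have "\<exists>T. open T \<and> w \<in> T \<and> (\<forall>w'\<in>T \<inter> cdisc. v (\<rho> w) w' < \<epsilon> / 2)" if w: "w \<in> cdisc" for w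
    proof -
      have "openin (top_of_set cdisc) (cdisc \<inter> (\<lambda>w'. v (\<rho> w) w') -` {..< \<epsilon> / 2})"
        by (rule continuous_openin_preimage_gen[OF contv]) (use \<rho>[OF w] in auto)
      then obtain T where T: "open T" "cdisc \<inter> (\<lambda>w'. v (\<rho> w) w') -` {..< \<epsilon> / 2} = cdisc \<inter> T"
        by (auto simp: openin_open)
      then show ?thesis using \<rho>[OF w] w by (intro exI[of _ T]) blast
    qed
    then obtain T where T: "\<And>w. w \<in> cdisc \<Longrightarrow> open (T w)" "\<And>w. w \<in> cdisc \<Longrightarrow> w \<in> T w"
      "\<And>w w'. w \<in> cdisc \<Longrightarrow> w' \<in> T w \<Longrightarrow> w' \<in> cdisc \<Longrightarrow> v (\<rho> w) w' < \<epsilon> / 2" by (metis IntI)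
    obtain W where W: "W \<subseteq> cdisc" "finite W" "cdisc \<subseteq> (\<Union>w\<in>W. T w)"
      using compactE_image[OF compact_cball[of 0 1], of cdisc T] T by (metis UN_I subsetI)
    define r0 where "r0 = Max (insert 0 (\<rho> ` W))"
    have r0: "r0 < 1" "0 \<le> r0" "\<And>w. w \<in> W \<Longrightarrow> \<rho> w \<le> r0"
      unfolding r0_def using W \<rho> by (auto simp: subset_iff)
    have "exp (- (\<epsilon> / (1 - r))) \<le> cmod (f (of_real r, w))" if r: "r0 < r" "r < 1" and w: "w \<in> cdisc" for r w
    proof (rule from_u)
      obtain w0 where w0: "w0 \<in> W" "w \<in> T w0" using W w by blast
      then have w0c: "w0 \<in> cdisc" using W by blast
      have "v r w \<le> v (\<rho> w0) w"
        unfolding v_def u_def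
        by (rule log_norm_radial_monotone[OF hol[OF w]]) (use nz' M w \<rho>[OF w0c] r0(3)[OF w0(1)] r in auto)
      also have "\<dots> < \<epsilon> / 2" by (rule T(3)[OF w0c w0(2) w])
      finally have "v r w \<le> \<epsilon> / 2" by simp
      then have "(1 + r) / (1 - r) * v r w \<le> (1 + r) / (1 - r) * (\<epsilon> / 2)" using r r0 by (intro mult_left_mono) auto
      also have "\<dots> \<le> 2 / (1 - r) * (\<epsilon> / 2)" using r \<epsilon> by (intro mult_right_mono divide_right_mono) auto
      also have "\<dots> = \<epsilon> / (1 - r)" using r by (simp add: divide_simps)
      finally have "(1 + r) / (1 - r) * v r w \<le> \<epsilon> / (1 - r)" .
      moreover have "(1 + r) / (1 - r) * v r w = u (of_real r) w" using r r0 by (simp add: v_def)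
      ultimately show "u (of_real r) w \<le> \<epsilon> / (1 - r)" by simp
    qed (use r w r0 in auto)
    then show ?thesis using r0 by blast
  qed
qed

section \<open>Multiplication by the variable modulo the ideal\<close>

lemma eval_fps_norm_le_pnorm:
  assumes "0 \<le> \<beta>" "cmod w \<le> 1"
  shows "ennreal (cmod (eval_fps F w)) \<le> pnorm \<beta> F"
proof (cases "pnorm \<beta> F < \<infinity>")
  case True
  have S: "summable (\<lambda>n. cmod (fps_nth F n))" by (rule pnorm_finite_summable[OF True assms(1)])
  have le: "cmod (fps_nth F n * w ^ n) \<le> cmod (fps_nth F n)" for n
    using assms(2) by (simp add: norm_mult norm_power power_le_one mult_left_le)
  have S': "summable (\<lambda>n. cmod (fps_nth F n * w ^ n))"
    by (rule summable_comparison_test'[OF S]) (use le in simp)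
  have "cmod (eval_fps F w) \<le> (\<Sum>n. cmod (fps_nth F n * w ^ n))" unfolding eval_fps_def by (rule summable_norm[OF S'])
  also have "\<dots> \<le> (\<Sum>n. cmod (fps_nth F n))" by (rule suminf_le[OF le S' S])
  finally have "ennreal (cmod (eval_fps F w)) \<le> ennreal (\<Sum>n. cmod (fps_nth F n))" by (rule ennreal_leI)
  also have "\<dots> = (\<Sum>n. ennreal (cmod (fps_nth F n)))" using S by (subst suminf_ennreal2) auto
  also have "\<dots> \<le> pnorm \<beta> F" unfolding wnorm_def
  proof (rule suminf_le)
    fix n
    have "1 * ennreal (cmod (fps_nth F n)) \<le> ennreal ((1 + real n) powr \<beta>) * ennreal (cmod (fps_nth F n))"
      using one_le_weight[OF assms(1), of n] by (intro mult_right_mono) (auto simp flip: ennreal_1 intro: ennreal_leI)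
    then show "ennreal (cmod (fps_nth F n)) \<le> ennreal ((1 + real n) powr \<beta>) * ennreal (cmod (fps_nth F n))" by simp
  qed auto
  finally show ?thesis .
next
  case False then show ?thesis by (simp add: not_less top_unique)
qed

lemma eval_fps_summable:
  assumes "pnorm \<beta> F < \<infinity>" "0 \<le> \<beta>" "cmod w \<le> 1"
  shows "summable (\<lambda>n. fps_nth F n * w ^ n)"
proof (rule summable_norm_cancel, rule summable_comparison_test'[OF pnorm_finite_summable[OF assms(1,2)]])
  show "norm (cmod (fps_nth F n * w ^ n)) \<le> cmod (fps_nth F n)" for n
    using assms(3) by (simp add: norm_mult norm_power power_le_one mult_left_le)
qed

lemma eval_fps_diff_pnorm:
  assumes "pnorm \<beta> F < \<infinity>" "pnorm \<beta> G < \<infinity>" "0 \<le> \<beta>" "cmod w \<le> 1"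
  shows "eval_fps (F - G) w = eval_fps F w - eval_fps G w"
  unfolding eval_fps_def using suminf_diff[OF eval_fps_summable[OF assms(1,3,4)] eval_fps_summable[OF assms(2,3,4)]]
  by (simp add: left_diff_distrib)

lemma eval_fps_sum_pnorm:
  assumes "\<And>i. i \<in> I \<Longrightarrow> pnorm \<beta> (F i) < \<infinity>" "0 \<le> \<beta>" "cmod w \<le> 1"
  shows "eval_fps (\<Sum>i\<in>I. F i) w = (\<Sum>i\<in>I. eval_fps (F i) w)"
proof -
  have "(\<Sum>i\<in>I. eval_fps (F i) w) = (\<Sum>n. \<Sum>i\<in>I. fps_nth (F i) n * w ^ n)"
    unfolding eval_fps_def by (rule suminf_sum[symmetric]) (use eval_fps_summable assms in auto)
  then show ?thesis unfolding eval_fps_def by (simp add: fps_sum_nth sum_distrib_right)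
qed

lemma eval_fps_const_mult_pnorm:
  assumes "pnorm \<beta> F < \<infinity>" "0 \<le> \<beta>" "cmod w \<le> 1"
  shows "eval_fps (fps_const c * F) w = c * eval_fps F w"
  unfolding eval_fps_def using suminf_mult[OF eval_fps_summable[OF assms], of c] by (simp add: mult.assoc)

text \<open>A double power series is a power series in \<open>z\<close> with coefficients power series in \<open>w\<close>.\<close>

abbreviation bnorm :: "real \<Rightarrow> real \<Rightarrow> complex fps fps \<Rightarrow> ennreal"
  where "bnorm \<alpha> \<beta> \<equiv> wnorm \<alpha> (pnorm \<beta>)"

lemma bnorm_complete_algebra_norm:
  assumes "0 \<le> \<alpha>" "0 \<le> \<beta>"
  shows "complete_algebra_norm (bnorm \<alpha> \<beta>) (\<lambda>c. fps_const (fps_const c))"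
proof -
  interpret w: complete_algebra_norm "pnorm \<beta>" fps_const by (rule pnorm_complete_algebra_norm[OF assms(2)])
  show ?thesis by (rule w.wnorm_complete_algebra_norm[OF assms(1)])
qed

text \<open>The terms l^k \<phi>_k are absolutely summable in the norm of the second variable, also
  for |l| = 1, since the weights in the first variable are at least 1. Norm convergence implies
  convergence of the values.\<close>

lemma slice_exists:
  assumes \<alpha>: "0 \<le> \<alpha>" and \<beta>: "0 \<le> \<beta>" and \<phi>: "bnorm \<alpha> \<beta> \<phi> < \<infinity>" and l: "cmod l \<le> 1"
  obtains F where "pnorm \<beta> F \<le> bnorm \<alpha> \<beta> \<phi>"
    "(\<lambda>K. pnorm \<beta> (F - (\<Sum>k<K. fps_const l ^ k * fps_nth \<phi> k))) \<longlonglongrightarrow> 0"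
    "\<And>w. cmod w \<le> 1 \<Longrightarrow> (\<lambda>k. eval_fps (fps_nth \<phi> k) w * l ^ k) sums eval_fps F w"
proof -
  interpret w: complete_algebra_norm "pnorm \<beta>" fps_const by (rule pnorm_complete_algebra_norm[OF \<beta>])
  define s where "s k = fps_const l ^ k * fps_nth \<phi> k" for k
  have s_eq: "s k = fps_const (l ^ k) * fps_nth \<phi> k" for k by (simp add: s_def fps_const_power)
  have nth_le: "pnorm \<beta> (fps_nth \<phi> k) \<le> ennreal ((1 + real k) powr \<alpha>) * pnorm \<beta> (fps_nth \<phi> k)" for k
  proof -
    have "1 * pnorm \<beta> (fps_nth \<phi> k) \<le> ennreal ((1 + real k) powr \<alpha>) * pnorm \<beta> (fps_nth \<phi> k)"
      using one_le_weight[OF \<alpha>, of k] by (intro mult_right_mono) (auto simp flip: ennreal_1 intro: ennreal_leI)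
    then show ?thesis by simp
  qed
  have s_le: "pnorm \<beta> (s k) \<le> pnorm \<beta> (fps_nth \<phi> k)" for k
    unfolding s_eq
    by (rule pnorm_mono) (use l in \<open>simp add: norm_mult norm_power power_le_one mult_left_le_one_le\<close>)
  have tot: "(\<Sum>k. pnorm \<beta> (s k)) \<le> bnorm \<alpha> \<beta> \<phi>"
    unfolding wnorm_def[of \<alpha>] by (intro suminf_le order_trans[OF s_le nth_le]) auto
  then have "(\<Sum>k. pnorm \<beta> (s k)) < \<infinity>" using \<phi> by (rule order.strict_trans1)
  then obtain F where F: "F \<in> w.carr" "pnorm \<beta> F \<le> (\<Sum>k. pnorm \<beta> (s k))"
    "(\<lambda>K. pnorm \<beta> (F - (\<Sum>k<K. s k))) \<longlonglongrightarrow> 0" using w.carr_sum_limit by blast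
  have nth_fin: "pnorm \<beta> (fps_nth \<phi> k) < \<infinity>" for k
  proof -
    have "ennreal ((1 + real k) powr \<alpha>) * pnorm \<beta> (fps_nth \<phi> k) \<le> bnorm \<alpha> \<beta> \<phi>"
      unfolding wnorm_def[of \<alpha>] using sum_le_suminf[of "\<lambda>n. ennreal ((1 + real n) powr \<alpha>) * pnorm \<beta> (fps_nth \<phi> n)" "{k}"] by simp
    then show ?thesis using nth_le[of k] \<phi> by (meson order.strict_trans1 order_trans)
  qed
  have s_fin: "pnorm \<beta> (s k) < \<infinity>" for k using s_le nth_fin by (rule order.strict_trans1)
  have "(\<lambda>k. eval_fps (fps_nth \<phi> k) w * l ^ k) sums eval_fps F w" if w: "cmod w \<le> 1" for w
  proof -
    have ev: "eval_fps (F - (\<Sum>k<K. s k)) w = eval_fps F w - (\<Sum>k<K. eval_fps (fps_nth \<phi> k) w * l ^ k)" for K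
    proof -
      have "(\<Sum>k<K. s k) \<in> w.carr" using s_fin by (auto simp: w.carr_def intro!: w.carr_sum[unfolded w.carr_def, simplified])
      then have "eval_fps (F - (\<Sum>k<K. s k)) w = eval_fps F w - eval_fps (\<Sum>k<K. s k) w"
        using F(1) \<beta> w by (intro eval_fps_diff_pnorm[of \<beta>]) (auto simp: w.carr_def)
      also have "eval_fps (\<Sum>k<K. s k) w = (\<Sum>k<K. eval_fps (s k) w)"
        by (rule eval_fps_sum_pnorm) (use s_fin \<beta> w in auto)
      also have "\<dots> = (\<Sum>k<K. eval_fps (fps_nth \<phi> k) w * l ^ k)"
        unfolding s_eq by (intro sum.cong refl) (subst eval_fps_const_mult_pnorm[OF nth_fin \<beta> w], rule mult.commute)
      finally show ?thesis .
    qed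
    have "(\<lambda>K. ennreal (cmod (eval_fps (F - (\<Sum>k<K. s k)) w))) \<longlonglongrightarrow> 0"
      by (rule tendsto_sandwich[OF _ _ tendsto_const F(3)]) (use eval_fps_norm_le_pnorm[OF \<beta> w] in auto)
    then have "(\<lambda>K. cmod (eval_fps (F - (\<Sum>k<K. s k)) w)) \<longlonglongrightarrow> 0"
      using tendsto_enn2real[of "\<lambda>K. ennreal (cmod (eval_fps (F - (\<Sum>k<K. s k)) w))" 0 sequentially] by simp
    then have "(\<lambda>K. eval_fps F w - (\<Sum>k<K. eval_fps (fps_nth \<phi> k) w * l ^ k)) \<longlonglongrightarrow> 0"
      unfolding ev by (rule tendsto_norm_zero_cancel)
    from tendsto_diff[OF tendsto_const[of "eval_fps F w"] this] show ?thesis by (simp add: sums_def)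
  qed
  then show ?thesis using F tot by (intro that[of F]) (auto simp: s_def intro: order_trans)
qed

text \<open>A lower bound e^(-y) of the slice f(l, .) yields a resolvent of norm at most K0 e^(q y)
  / (1 - |l|). As y enters the exponent linearly, y = A/(1 - |l|) gives the singular bound inside
  the disc, and y = e/(1 - r) with arbitrarily small e gives minimal type along the radius.\<close>

lemma functional_fixed_by_X:
  fixes \<phi> :: "complex fps fps" and f :: "complex \<times> complex \<Rightarrow> complex"
  assumes \<alpha>: "0 \<le> \<alpha>" "\<alpha> < 1" and \<beta>: "0 < \<beta>" "\<beta> \<le> 1" and \<phi>: "bnorm \<alpha> \<beta> \<phi> < \<infinity>"
    and cont: "continuous_on (cdisc \<times> cdisc) f"
    and ev: "\<And>z w. z \<in> cdisc \<Longrightarrow> w \<in> cdisc \<Longrightarrow> (\<lambda>k. eval_fps (fps_nth \<phi> k) w * z ^ k) sums f (z, w)"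
    and nz: "\<And>z w. z \<in> cdisc \<Longrightarrow> w \<in> cdisc \<Longrightarrow> z \<noteq> 1 \<Longrightarrow> f (z, w) \<noteq> 0"
    and rad: "\<And>w. w \<in> cdisc \<Longrightarrow> ((\<lambda>r. (1 - r) * ln (cmod (f (of_real r, w)))) \<longlongrightarrow> 0) (at_left (1::real))"
    and Lb: "complete_algebra_norm.bdd_functional (bnorm \<alpha> \<beta>) (\<lambda>c. fps_const (fps_const c)) L C"
    and L: "\<And>s. bnorm \<alpha> \<beta> s < \<infinity> \<Longrightarrow> L (\<phi> * s) = 0"
  shows "L fps_X = L 1"
proof -
  have \<beta>0: "0 \<le> \<beta>" using \<beta> by simp
  interpret w: complete_algebra_norm "pnorm \<beta>" fps_const by (rule pnorm_complete_algebra_norm[OF \<beta>0])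
  interpret B: complete_algebra_norm "bnorm \<alpha> \<beta>" "\<lambda>c. fps_const (fps_const c)"
    by (rule bnorm_complete_algebra_norm[OF \<alpha>(1) \<beta>0])
  define M where "M = max 1 (enn2real (bnorm \<alpha> \<beta> \<phi>))"
  have M: "1 \<le> M" by (simp add: M_def)
  have \<phi>M: "bnorm \<alpha> \<beta> \<phi> \<le> ennreal M"
  proof -
    have "bnorm \<alpha> \<beta> \<phi> = ennreal (enn2real (bnorm \<alpha> \<beta> \<phi>))" using \<phi> by simp
    also have "\<dots> \<le> ennreal M" by (rule ennreal_leI) (simp add: M_def)
    finally show ?thesis .
  qed
  \<comment> \<open>With \<delta> = e^(-y) the inversion bound is 8 M \<delta>^(-2) (2
    M/\<delta>)^(2/\<beta>) = 8 M (2 M)^(2/\<beta>) e^(q y). The additional factor 2 M in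
    \<open>K0\<close> comes from \<open>fps_resolvent_mod\<close>.\<close>
  define q where "q = 2 + 2 / \<beta>"
  define K0 where "K0 = 16 * M\<^sup>2 * exp (2 * ln (2 * M) / \<beta>)"
  have q: "0 \<le> q" using \<beta> by (simp add: q_def)
  have K0: "0 \<le> K0" by (simp add: K0_def)
  have res: "\<exists>a. B.resolvent_mod L fps_X l a \<and>
      (cmod l < 1 \<longrightarrow> bnorm \<alpha> \<beta> a \<le> ennreal (K0 * (1 / (1 - cmod l)) * exp (q * y)))"
    if l: "cmod l \<le> 1" and y: "0 \<le> y" and low: "\<And>w. w \<in> cdisc \<Longrightarrow> exp (- y) \<le> cmod (f (l, w))" for l y
  proof -
    obtain F where F: "pnorm \<beta> F \<le> bnorm \<alpha> \<beta> \<phi>"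
      "(\<lambda>K. pnorm \<beta> (F - (\<Sum>k<K. fps_const l ^ k * fps_nth \<phi> k))) \<longlonglongrightarrow> 0"
      "\<And>w. cmod w \<le> 1 \<Longrightarrow> (\<lambda>k. eval_fps (fps_nth \<phi> k) w * l ^ k) sums eval_fps F w"
      using slice_exists[OF \<alpha>(1) \<beta>0 \<phi> l] by blast
    have Fev: "eval_fps F w = f (l, w)" if "cmod w \<le> 1" for w
      using F(3)[OF that] ev[of l w] l that by (auto intro: sums_unique2)
    have FM: "pnorm \<beta> F \<le> ennreal M" using F(1) \<phi>M by (rule order_trans)
    define D where "D = 8 * M / ((exp (- y))\<^sup>2 * ((exp (- y) / (2 * M)) powr (1 / \<beta>))\<^sup>2)"
    have "F * inverse F = 1 \<and> pnorm \<beta> (inverse F) \<le> ennreal D"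
      unfolding D_def by (rule norm_controlled_inversion[OF \<beta> FM M]) (use y low Fev in auto)
    then have h: "F * inverse F = 1" "pnorm \<beta> (inverse F) \<le> ennreal D" by auto
    have hfin: "pnorm \<beta> (inverse F) < \<infinity>" using h(2) by (rule order.strict_trans1) simp
    have D: "D = 8 * M * exp (2 * ln (2 * M) / \<beta>) * exp (q * y)"
    proof -
      have "exp (- (y + ln (2 * M))) = exp (- y) * exp (- ln (2 * M))" by (simp only: minus_add_distrib exp_add)
      moreover have "exp (- ln (2 * M)) = 1 / (2 * M)" using M by (simp add: exp_minus inverse_eq_divide)
      ultimately have "exp (- y) / (2 * M) = exp (- (y + ln (2 * M)))" by simp
      then have "(exp (- y) / (2 * M)) powr (1 / \<beta>) = exp (- (y + ln (2 * M)) / \<beta>)"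
        by (simp add: powr_def)
      then have "(exp (- y))\<^sup>2 * ((exp (- y) / (2 * M)) powr (1 / \<beta>))\<^sup>2 =
          exp (- y + - y + (- (y + ln (2 * M)) / \<beta> + - (y + ln (2 * M)) / \<beta>))"
        by (simp only: power2_eq_square exp_add)
      also have "- y + - y + (- (y + ln (2 * M)) / \<beta> + - (y + ln (2 * M)) / \<beta>) = - (2 * ln (2 * M) / \<beta> + q * y)"
        using \<beta> by (simp add: q_def field_simps)
      finally have "(exp (- y))\<^sup>2 * ((exp (- y) / (2 * M)) powr (1 / \<beta>))\<^sup>2 = exp (- (2 * ln (2 * M) / \<beta> + q * y))" .
      moreover have "8 * M / exp (- t) = 8 * M * exp t" for t by (simp add: exp_minus divide_inverse)
      ultimately show ?thesis unfolding D_def by (simp only: exp_add mult.assoc)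
    qed
    obtain a where a: "B.resolvent_mod L fps_X l a"
      "cmod l < 1 \<longrightarrow> bnorm \<alpha> \<beta> a \<le> ennreal (2 / (1 - cmod l)) * bnorm \<alpha> \<beta> \<phi> * pnorm \<beta> (inverse F)"
      using w.fps_resolvent_mod[OF \<alpha>(1) \<phi> l F(2) hfin h(1) L Lb] by blast
    have "bnorm \<alpha> \<beta> a \<le> ennreal (K0 * (1 / (1 - cmod l)) * exp (q * y))" if l1: "cmod l < 1"
    proof -
      have "bnorm \<alpha> \<beta> a \<le> ennreal (2 / (1 - cmod l)) * bnorm \<alpha> \<beta> \<phi> * pnorm \<beta> (inverse F)" using a(2) l1 by simp
      also have "\<dots> \<le> ennreal (2 / (1 - cmod l)) * ennreal M * ennreal D"
        by (intro mult_mono order_refl \<phi>M h(2)) auto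
      also have "\<dots> = ennreal (2 / (1 - cmod l) * M * D)"
      proof -
        have "0 \<le> D" using M by (simp add: D)
        then show ?thesis using l1 M
          by (subst ennreal_mult[of "2 / (1 - cmod l) * M" D]; (subst ennreal_mult)?; simp)
      qed
      also have "2 / (1 - cmod l) * M * D = K0 * (1 / (1 - cmod l)) * exp (q * y)"
        by (simp add: D K0_def power2_eq_square)
      finally show ?thesis .
    qed
    then show ?thesis using a(1) by blast
  qed
  have hol: "(\<lambda>z. f (z, w)) holomorphic_on ball 0 1" if "w \<in> cdisc" for w
    by (rule power_series_holomorphic[where a = "\<lambda>k. eval_fps (fps_nth \<phi> k) w"]) (use ev[OF _ that] in auto)
  have low1: "\<exists>A\<ge>0. \<forall>z w. cmod z < 1 \<longrightarrow> w \<in> cdisc \<longrightarrow> exp (- (A / (1 - cmod z))) \<le> cmod (f (z, w))"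
    by (rule lower_bounds_if_radial_limits(1)[OF cont]) (use hol nz rad in auto)
  have low2: "\<exists>r0<1. \<forall>r w. r0 < r \<longrightarrow> r < 1 \<longrightarrow> w \<in> cdisc \<longrightarrow> exp (- (\<epsilon> / (1 - r))) \<le> cmod (f (of_real r, w))"
    if "\<epsilon> > 0" for \<epsilon>
    by (rule lower_bounds_if_radial_limits(2)[OF cont _ _ _ that]) (use hol nz rad in auto)
  obtain A where A: "0 \<le> A" "\<And>z w. cmod z < 1 \<Longrightarrow> w \<in> cdisc \<Longrightarrow> exp (- (A / (1 - cmod z))) \<le> cmod (f (z, w))"
    using low1 by blast
  show ?thesis
  proof (rule B.functional_fixed_if_resolvent_growth[OF Lb _ _ \<alpha>, where A = "K0 + q * A"])
    have "bnorm \<alpha> \<beta> (fps_X ^ 1) < \<infinity>" unfolding w.wnorm_X_power by simp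
    then show "fps_X \<in> B.carr" by (simp add: B.carr_def)
    show "bnorm \<alpha> \<beta> (fps_X ^ k) \<le> ennreal ((1 + real k) powr \<alpha>)" for k by (simp only: w.wnorm_X_power order_refl)
    show "0 \<le> K0 + q * A" using K0 q A by simp
    \<comment> \<open>Here existence is enough, also on the circle: the slice has a positive minimum
      by compactness, and its size is irrelevant.\<close>
    show "\<exists>a. B.resolvent_mod L fps_X l a" if l: "cmod l \<le> 1" "l \<noteq> 1" for l
    proof -
      have "continuous_on cdisc (\<lambda>w. cmod (f (l, w)))"
        by (intro continuous_intros continuous_on_compose2[OF cont]) (use l in auto)
      then obtain w0 where w0: "w0 \<in> cdisc" "\<And>w. w \<in> cdisc \<Longrightarrow> cmod (f (l, w0)) \<le> cmod (f (l, w))"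
        using continuous_attains_inf[of cdisc "\<lambda>w. cmod (f (l, w))"] by (metis compact_cball cball_eq_empty less_numeral_extra(1) not_one_less_zero)
      define d where "d = min 1 (cmod (f (l, w0)))"
      have d: "0 < d" "d \<le> 1" using nz[of l w0] w0(1) l by (auto simp: d_def)
      have "exp (- (- ln d)) \<le> cmod (f (l, w))" if "w \<in> cdisc" for w
        using d w0(2)[OF that] by (simp add: d_def)
      then show ?thesis using res[OF l(1), of "- ln d"] d by auto
    qed
    show "\<exists>a. B.resolvent_mod L fps_X l a \<and> bnorm \<alpha> \<beta> a \<le> ennreal (exp ((K0 + q * A) / (1 - cmod l)))"
      if l: "cmod l < 1" for l
    proof -
      obtain a where a: "B.resolvent_mod L fps_X l a"
        "bnorm \<alpha> \<beta> a \<le> ennreal (K0 * (1 / (1 - cmod l)) * exp (q * (A / (1 - cmod l))))"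
        using res[of l "A / (1 - cmod l)"] A l by auto
      have "K0 * (1 / (1 - cmod l)) \<le> exp (K0 * (1 / (1 - cmod l)))"
        using exp_ge_add_one_self[of "K0 * (1 / (1 - cmod l))"] by linarith
      then have "K0 * (1 / (1 - cmod l)) * exp (q * (A / (1 - cmod l))) \<le>
          exp (K0 * (1 / (1 - cmod l))) * exp (q * (A / (1 - cmod l)))" by (intro mult_right_mono) auto
      also have "\<dots> = exp ((K0 + q * A) / (1 - cmod l))" by (simp add: add_divide_distrib flip: exp_add)
      finally show ?thesis using a by (meson ennreal_leI order_trans)
    qed
    show "\<exists>r0<1. \<forall>r. r0 < r \<longrightarrow> r < 1 \<longrightarrow>
        (\<exists>a. B.resolvent_mod L fps_X (of_real r) a \<and> bnorm \<alpha> \<beta> a \<le> ennreal (exp (\<epsilon> / (1 - r))))"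
      if \<epsilon>: "\<epsilon> > 0" for \<epsilon>
    proof -
      \<comment> \<open>One half of \<epsilon> covers q e, the other half absorbs the factor K0/(1 -
        r).\<close>
      define e where "e = \<epsilon> / (2 * (q + 1))"
      have e: "e > 0" using \<epsilon> q by (simp add: e_def)
      obtain r1 where r1: "r1 < 1" "\<And>r w. r1 < r \<Longrightarrow> r < 1 \<Longrightarrow> w \<in> cdisc \<Longrightarrow>
          exp (- (e / (1 - r))) \<le> cmod (f (of_real r, w))" using low2[OF e] by metis
      \<comment> \<open>For x at least 8 K0/\<epsilon>^2 one has K0 x \<le> (\<epsilon> x/2)^2 / 2,
        the quadratic term of the series of exp (\<epsilon> x/2).\<close>
      define x0 where "x0 = 8 * K0 / \<epsilon>\<^sup>2 + 1"
      have x0: "1 \<le> x0" using K0 by (simp add: x0_def)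
      define r0 where "r0 = max (max 0 r1) (1 - 1 / x0)"
      have r0: "r0 < 1" "0 \<le> r0" using r1 x0 by (auto simp: r0_def)
      have "\<exists>a. B.resolvent_mod L fps_X (of_real r) a \<and> bnorm \<alpha> \<beta> a \<le> ennreal (exp (\<epsilon> / (1 - r)))"
        if r: "r0 < r" "r < 1" for r
      proof -
        define x where "x = 1 / (1 - r)"
        have nr: "cmod (of_real r) = r" using r r0 by simp
        have xx: "x0 \<le> x"
        proof -
          have "1 - r \<le> 1 / x0" using r by (simp add: r0_def)
          then have "1 / (1 / x0) \<le> 1 / (1 - r)" using r x0 by (intro divide_left_mono) auto
          then show ?thesis by (simp add: x_def)
        qed
        obtain a where a: "B.resolvent_mod L fps_X (of_real r) a"
          "bnorm \<alpha> \<beta> a \<le> ennreal (K0 * x * exp (q * (e * x)))"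
          using res[of "of_real r" "e / (1 - r)"] r1(2)[of r] r r0 nr e by (auto simp: x_def r0_def)
        have "K0 * x \<le> exp (\<epsilon> * x / 2)"
        proof -
          have "8 * K0 / \<epsilon>\<^sup>2 \<le> x" using xx by (simp add: x0_def)
          then have "8 * K0 \<le> \<epsilon>\<^sup>2 * x" using \<epsilon> by (simp add: divide_le_eq mult.commute)
          then have "8 * K0 * x \<le> \<epsilon>\<^sup>2 * x * x" using xx x0 by (intro mult_right_mono) auto
          then have "K0 * x \<le> (\<epsilon> * x / 2)\<^sup>2 / 2" by (simp add: power2_eq_square algebra_simps)
          also have "\<dots> \<le> 1 + \<epsilon> * x / 2 + (\<epsilon> * x / 2)\<^sup>2 / 2" using \<epsilon> xx x0 by simp
          also have "\<dots> \<le> exp (\<epsilon> * x / 2)" by (rule exp_lower_Taylor_quadratic) (use \<epsilon> xx x0 in simp)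
          finally show ?thesis .
        qed
        moreover have "q * (e * x) \<le> \<epsilon> * x / 2"
        proof -
          have "q / (q + 1) \<le> 1" using q by simp
          then have "q / (q + 1) * (\<epsilon> * x / 2) \<le> 1 * (\<epsilon> * x / 2)" using \<epsilon> xx x0 by (intro mult_right_mono) auto
          then show ?thesis by (simp add: e_def algebra_simps)
        qed
        ultimately have "K0 * x * exp (q * (e * x)) \<le> exp (\<epsilon> * x / 2) * exp (\<epsilon> * x / 2)"
          by (intro mult_mono) auto
        also have "\<dots> = exp (\<epsilon> * x)" by (simp flip: exp_add)
        also have "\<epsilon> * x = \<epsilon> / (1 - r)" by (simp add: x_def)
        finally show ?thesis using a by (meson ennreal_leI order_trans)
      qed
      then show ?thesis using r0 by blast
    qed
  qed
qed

section \<open>Outer functions with one boundary zero\<close>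

definition herglotz_kernel :: "complex \<Rightarrow> real \<Rightarrow> complex"
  where "herglotz_kernel z t = (cis t + z) / (cis t - z)"

lemma cis_ne: "cmod z < 1 \<Longrightarrow> cis t \<noteq> z"
  using norm_cis[of t] by (metis less_irrefl)

lemma cis_minus_nz: "cmod z < 1 \<Longrightarrow> cis t - z \<noteq> 0"
  using cis_ne by auto

lemma continuous_on_herglotz_kernel: "cmod z < 1 \<Longrightarrow> continuous_on A (herglotz_kernel z)"
  unfolding herglotz_kernel_def by (intro continuous_intros) (auto simp: cis_ne)

lemma herglotz_kernel_bound:
  assumes "cmod z < 1"
  shows "cmod (herglotz_kernel z t) \<le> 2 / (1 - cmod z)"
proof -
  have "1 - cmod z \<le> cmod (cis t - z)" using norm_triangle_ineq2[of "cis t" z] by simp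
  moreover have "cmod (cis t + z) \<le> 2" using norm_triangle_ineq[of "cis t" z] assms by simp
  ultimately show ?thesis unfolding herglotz_kernel_def norm_divide using assms by (intro frac_le) auto
qed

lemma Re_herglotz_kernel_nonneg:
  assumes "cmod z < 1"
  shows "0 \<le> Re (herglotz_kernel z t)"
proof -
  have "Re (herglotz_kernel z t) = (1 - cmod z ^ 2) / cmod (cis t - z) ^ 2"
  proof -
    have "Re ((cis t + z) * cnj (cis t - z)) = cmod (cis t) ^ 2 - cmod z ^ 2"
      unfolding cmod_power2 by (simp add: power2_eq_square algebra_simps)
    moreover have "herglotz_kernel z t = ((cis t + z) * cnj (cis t - z)) / of_real (cmod (cis t - z) ^ 2)"
      unfolding herglotz_kernel_def by (subst complex_div_cnj) simp
    ultimately show ?thesis by (simp only: Re_divide_of_real norm_cis power_one)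
  qed
  moreover have "cmod z ^ 2 \<le> 1" using assms by (simp add: power_le_one)
  ultimately show ?thesis by simp
qed

lemma Cauchy_formula_cis:
  assumes cont: "continuous_on cdisc F" and hol: "F holomorphic_on disc" and w: "cmod w < 1"
  shows "((\<lambda>t. F (cis t) * cis t / (cis t - w)) has_integral (2 * of_real pi * F w)) {0..2 * pi}"
proof -
  have "((\<lambda>u. F u / (u - w)) has_contour_integral 2 * of_real pi * \<i> * F w) (circlepath 0 1)"
    by (rule Cauchy_integral_circlepath[OF cont hol]) (use w in simp)
  then have "((\<lambda>t. F (cis t) / (cis t - w) * \<i> * cis t) has_integral 2 * of_real pi * \<i> * F w) {0..2 * pi}"
    unfolding circlepath_def by (subst (asm) has_contour_integral_part_circlepath_iff) auto
  then have s: "((\<lambda>t. - \<i> * (F (cis t) / (cis t - w) * \<i> * cis t)) has_integral - \<i> * (2 * of_real pi * \<i> * F w)) {0..2 * pi}"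
    by (rule has_integral_mult_right)
  have e1: "- \<i> * (F (cis t) / (cis t - w) * \<i> * cis t) = F (cis t) * cis t / (cis t - w)" for t
    by (simp add: algebra_simps)
  have e2: "- \<i> * (2 * of_real pi * \<i> * F w) = 2 * of_real pi * F w" by (simp add: algebra_simps)
  show ?thesis using s unfolding e1 e2 .
qed

lemma mean_value_cis:
  assumes "continuous_on cdisc F" "F holomorphic_on disc"
  shows "((\<lambda>t. F (cis t)) has_integral (2 * of_real pi * F 0)) {0..2 * pi}"
  using Cauchy_formula_cis[OF assms, of 0] by simp

text \<open>The kernel is 2 e^(it)/(e^(it) - w) - 1, so Cauchy's formula integrates it against F. It
  is also the conjugate of (1 + cnj w e^(it))/(1 - cnj w e^(it)), which extends holomorphically to
  the disc with value 1 at 0; so against the conjugate of F the mean value property gives the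
  conjugate of 2 pi F 0. Half the sum is the claim.\<close>

lemma Schwarz_integral_formula:
  assumes cont: "continuous_on cdisc F" and hol: "F holomorphic_on disc" and w: "cmod w < 1"
  shows "((\<lambda>t. herglotz_kernel w t * of_real (Re (F (cis t)))) has_integral
    (2 * of_real pi * (F w - \<i> * of_real (Im (F 0))))) {0..2 * pi}"
proof -
  have 1: "((\<lambda>t. 2 * (F (cis t) * cis t / (cis t - w)) - F (cis t)) has_integral
      2 * (2 * of_real pi * F w) - 2 * of_real pi * F 0) {0..2 * pi}"
    by (intro has_integral_diff has_integral_mult_right Cauchy_formula_cis mean_value_cis cont hol w)
  have e1: "2 * (F (cis t) * cis t / (cis t - w)) - F (cis t) = herglotz_kernel w t * F (cis t)" for t
    using cis_minus_nz[OF w, of t] by (simp add: herglotz_kernel_def field_simps)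
  have nz: "1 - cnj w * z \<noteq> 0" if "z \<in> cdisc" for z
  proof
    assume "1 - cnj w * z = 0"
    then have "cmod (cnj w * z) = 1" by (metis eq_iff_diff_eq_0 norm_one)
    then have "cmod w * cmod z = 1" by (simp add: norm_mult)
    moreover have "cmod w * cmod z \<le> cmod w * 1" using that by (intro mult_left_mono) auto
    ultimately show False using w by simp
  qed
  have "((\<lambda>t. F (cis t) * ((1 + cnj w * cis t) / (1 - cnj w * cis t))) has_integral
      (2 * of_real pi * (F 0 * ((1 + cnj w * 0) / (1 - cnj w * 0))))) {0..2 * pi}"
    by (rule mean_value_cis) (use nz in \<open>auto intro!: continuous_intros cont holomorphic_intros hol\<close>)
  then have "(cnj \<circ> (\<lambda>t. F (cis t) * ((1 + cnj w * cis t) / (1 - cnj w * cis t))) has_integral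
      cnj (2 * of_real pi * F 0)) {0..2 * pi}" by (subst has_integral_cnj) simp
  moreover have "(cnj \<circ> (\<lambda>t. F (cis t) * ((1 + cnj w * cis t) / (1 - cnj w * cis t)))) t =
      herglotz_kernel w t * cnj (F (cis t))" for t
  proof -
    have "cis (- t) * cis t = 1" by (simp add: cis_mult)
    then have "herglotz_kernel w t = (cis (- t) * (cis t + w)) / (cis (- t) * (cis t - w))"
      unfolding herglotz_kernel_def by (subst mult_divide_mult_cancel_left) auto
    also have "\<dots> = (1 + w * cis (- t)) / (1 - w * cis (- t))"
      using \<open>cis (- t) * cis t = 1\<close> by (simp add: distrib_left right_diff_distrib mult.commute)
    finally show ?thesis by (simp add: cis_cnj)
  qed
  ultimately have 2: "((\<lambda>t. herglotz_kernel w t * cnj (F (cis t))) has_integral cnj (2 * of_real pi * F 0)) {0..2 * pi}"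
    by (simp add: fun_eq_iff[symmetric] o_def)
  have s: "((\<lambda>t. (1 / 2) * (herglotz_kernel w t * F (cis t) + herglotz_kernel w t * cnj (F (cis t)))) has_integral
      (1 / 2) * ((2 * (2 * of_real pi * F w) - 2 * of_real pi * F 0) + cnj (2 * of_real pi * F 0))) {0..2 * pi}"
    by (intro has_integral_mult_right has_integral_add 2) (use 1 in \<open>simp only: e1\<close>)
  have e2: "(1 / 2) * (herglotz_kernel w t * F (cis t) + herglotz_kernel w t * cnj (F (cis t))) =
      herglotz_kernel w t * of_real (Re (F (cis t)))" for t
    by (simp add: distrib_left[symmetric] complex_add_cnj)
  have e3: "(1 / 2) * ((2 * (2 * of_real pi * F w) - 2 * of_real pi * F 0) + cnj (2 * of_real pi * F 0)) =
      2 * of_real pi * (F w - \<i> * of_real (Im (F 0)))"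
    by (simp add: complex_eq_iff algebra_simps)
  show ?thesis using s unfolding e2 e3 .
qed

text \<open>The circle without the point \<open>1\<close>.\<close>

abbreviation arc_measure :: "real measure"
  where "arc_measure \<equiv> restrict_space lborel {0<..<2 * pi}"

lemma arc_integral_eq:
  fixes F :: "real \<Rightarrow> 'a::euclidean_space"
  assumes c: "continuous_on {0..2 * pi} F" and I: "(F has_integral I) {0..2 * pi}"
  shows "integrable arc_measure F" "integral\<^sup>L arc_measure F = I"
proof -
  have s: "set_integrable lborel {0<..<2 * pi} F"
    by (rule set_integrable_subset[OF borel_integrable_atLeastAtMost'[OF c]]) auto
  then show "integrable arc_measure F" by (simp add: integrable_restrict_space set_integrable_def)
  have "integral\<^sup>L arc_measure F = set_lebesgue_integral lborel {0<..<2 * pi} F"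
    by (simp add: integral_restrict_space set_lebesgue_integral_def)
  also have "\<dots> = integral {0<..<2 * pi} F" by (rule set_borel_integral_eq_integral(2)[OF s])
  also have "\<dots> = integral {0..2 * pi} F" by (rule integral_open_interval_real[symmetric])
  also have "\<dots> = I" using I by (rule integral_unique)
  finally show "integral\<^sup>L arc_measure F = I" .
qed

lemma set_integral_eq_arc_integral:
  fixes F :: "real \<Rightarrow> complex"
  assumes "F \<in> borel_measurable borel"
  shows "(LINT t:{0..2 * pi}|lborel. F t) = integral\<^sup>L arc_measure F"
proof -
  have "integral\<^sup>L arc_measure F = (LINT t:{0<..<2 * pi}|lborel. F t)"
    by (simp add: integral_restrict_space set_lebesgue_integral_def)
  also have "\<dots> = (LINT t:{0..2 * pi}|lborel. F t)"
    unfolding set_lebesgue_integral_def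
  proof (rule integral_cong_AE)
    have "AE t in lborel. t \<noteq> 0 \<and> t \<noteq> 2 * pi" by (intro AE_conjI AE_lborel_singleton)
    then show "AE t in lborel. indicat_real {0<..<2 * pi} t *\<^sub>R F t = indicat_real {0..2 * pi} t *\<^sub>R F t"
      by eventually_elim (auto simp: indicator_def)
  qed (use assms in measurable)
  finally show ?thesis by simp
qed

lemma space_arc: "space arc_measure = {0<..<2 * pi}"
  by (simp add: space_restrict_space)

lemma cis_ne_1_arc: "t \<in> {0<..<2 * pi} \<Longrightarrow> cis t \<noteq> 1"
proof
  assume t: "t \<in> {0<..<2 * pi}" and "cis t = 1"
  then have "cos t = 1" by (simp add: complex_eq_iff)
  then show False using t cos_one_2pi_int[of t] by (auto simp: mult_less_cancel_right) (smt (verit) of_int_less_1_iff of_int_0_less_iff pi_gt_zero mult_less_cancel_right_pos zero_less_mult_iff mult_le_0_iff)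
qed

lemma finite_measure_arc: "finite_measure arc_measure"
  by (rule finite_measureI) (simp add: space_restrict_space emeasure_restrict_space emeasure_lborel_Ioo)

lemma herglotz_integrable:
  assumes w: "cmod w < 1" and v: "integrable arc_measure v"
  shows "integrable arc_measure (\<lambda>t. herglotz_kernel w t * of_real (v t))"
proof (rule Bochner_Integration.integrable_bound)
  show "integrable arc_measure (\<lambda>t. 2 / (1 - cmod w) * v t)" using v by simp
  have "herglotz_kernel w \<in> borel_measurable (restrict_space borel {0<..<2 * pi})"
    by (rule borel_measurable_continuous_on_restrict[OF continuous_on_herglotz_kernel[OF w]])
  then have "herglotz_kernel w \<in> borel_measurable arc_measure"
    by (simp add: measurable_def space_restrict_space sets_restrict_space)
  then show "(\<lambda>t. herglotz_kernel w t * of_real (v t)) \<in> borel_measurable arc_measure"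
    using borel_measurable_integrable[OF v] by measurable
  show "AE t in arc_measure. norm (herglotz_kernel w t * of_real (v t)) \<le> norm (2 / (1 - cmod w) * v t)"
  proof (rule AE_I2)
    fix t
    have "cmod (herglotz_kernel w t) * \<bar>v t\<bar> \<le> 2 / (1 - cmod w) * \<bar>v t\<bar>"
      by (intro mult_right_mono herglotz_kernel_bound w) auto
    then show "norm (herglotz_kernel w t * of_real (v t)) \<le> norm (2 / (1 - cmod w) * v t)"
      using w by (simp add: norm_mult abs_mult)
  qed
qed

text \<open>The bound \<open>M\<close> is strict so that ln M - ln |h| is the positive real part of
  a holomorphic function. Its boundary values off the point 1 are called \<open>U\<close>.\<close>

locale one_boundary_zero =
  fixes h :: "complex \<Rightarrow> complex" and M :: real
  assumes cont: "continuous_on cdisc h" and hol: "h holomorphic_on disc"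
    and nz: "\<And>z. z \<in> cdisc \<Longrightarrow> z \<noteq> 1 \<Longrightarrow> h z \<noteq> 0"
    and bd: "\<And>z. z \<in> cdisc \<Longrightarrow> cmod (h z) < M" and M: "0 < M"
begin

definition U :: "real \<Rightarrow> real" where "U t = ln M - ln (cmod (h (cis t)))"

lemma measurable_ln_h: "(\<lambda>t. ln (cmod (h (cis t)))) \<in> borel_measurable borel"
proof -
  have "continuous_on UNIV (\<lambda>t. h (cis t))"
    by (intro continuous_on_compose2[OF cont]) (auto intro!: continuous_intros)
  then have "(\<lambda>t. h (cis t)) \<in> borel_measurable borel" by (rule borel_measurable_continuous_onI)
  then show ?thesis by measurable
qed

lemma U_nonneg: "t \<in> {0<..<2 * pi} \<Longrightarrow> 0 \<le> U t"
proof -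
  assume t: "t \<in> {0<..<2 * pi}"
  have "0 < cmod (h (cis t))" using nz[of "cis t"] cis_ne_1_arc[OF t] by simp
  then have "ln (cmod (h (cis t))) < ln M" using bd[of "cis t"] M by (subst ln_less_cancel_iff) auto
  then show "0 \<le> U t" by (simp add: U_def)
qed

lemma measurable_U: "U \<in> borel_measurable arc_measure"
proof -
  have "U \<in> borel_measurable borel"
    unfolding U_def[abs_def] by (intro borel_measurable_diff measurable_ln_h) simp
  then show ?thesis by (intro measurable_restrict_space1) simp
qed

lemma log_exists:
  obtains K where "K holomorphic_on disc" "\<And>z. z \<in> disc \<Longrightarrow> h z = of_real M * exp (- K z)"
    "\<And>z. z \<in> disc \<Longrightarrow> Re (K z) = ln M - ln (cmod (h z))" "\<And>z. z \<in> disc \<Longrightarrow> 0 < Re (K z)"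
proof -
  have nz': "h z \<noteq> 0" if "z \<in> disc" for z using nz[of z] that by (cases "z = 1") auto
  obtain g where g: "g holomorphic_on disc" "\<And>z. z \<in> disc \<Longrightarrow> exp (g z) = h z"
    by (rule holomorphic_logarithm_exists[OF convex_ball open_ball hol, of 0]) (use nz' in auto)
  have Reg: "Re (g z) = ln (cmod (h z))" if "z \<in> disc" for z using g(2)[OF that] by (auto simp flip: g(2)[OF that])
  show ?thesis
  proof (rule that[of "\<lambda>z. of_real (ln M) - g z"])
    show "(\<lambda>z. of_real (ln M) - g z) holomorphic_on disc" by (intro holomorphic_intros g)
    show "h z = of_real M * exp (- (of_real (ln M) - g z))" if "z \<in> disc" for z
      using g(2)[OF that] M by (simp add: exp_diff exp_of_real)
    show "Re (of_real (ln M) - g z) = ln M - ln (cmod (h z))" if "z \<in> disc" for z using Reg[OF that] by simp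
    show "0 < Re (of_real (ln M) - g z)" if z: "z \<in> disc" for z
    proof -
      have "ln (cmod (h z)) < ln M" using bd[of z] nz'[OF z] z by (subst ln_less_cancel_iff) (auto intro: less_trans M)
      then show ?thesis using Reg[OF z] by simp
    qed
  qed
qed

definition \<rho> :: "nat \<Rightarrow> real" where "\<rho> n = 1 - 1 / (real n + 2)"

lemma \<rho>: "1 / 2 \<le> \<rho> n" "\<rho> n < 1"
  by (auto simp: \<rho>_def field_simps)

lemma \<rho>_lim: "\<rho> \<longlonglongrightarrow> 1"
proof -
  have "(\<lambda>n. 1 - 1 / (real n + 2)) \<longlonglongrightarrow> 1" by real_asymp
  then show ?thesis by (simp add: \<rho>_def[abs_def])
qed

section \<open>Herglotz representation of ln M - log h by dilation\<close>

context
  fixes K :: "complex \<Rightarrow> complex"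
  assumes K: "K holomorphic_on disc" and hK: "\<And>z. z \<in> disc \<Longrightarrow> h z = of_real M * exp (- K z)"
    and ReK: "\<And>z. z \<in> disc \<Longrightarrow> Re (K z) = ln M - ln (cmod (h z))" and posK: "\<And>z. z \<in> disc \<Longrightarrow> 0 < Re (K z)"
begin

definition u :: "nat \<Rightarrow> real \<Rightarrow> real" where "u n t = Re (K (of_real (\<rho> n) * cis t))"

lemma \<rho>_disc: "z \<in> cdisc \<Longrightarrow> of_real (\<rho> n) * z \<in> disc"
proof -
  assume "z \<in> cdisc"
  then have "\<rho> n * cmod z \<le> \<rho> n * 1" using \<rho>(1)[of n] by (intro mult_left_mono) auto
  then have "\<rho> n * cmod z < 1" using \<rho>(2)[of n] by linarith
  then show ?thesis using \<rho>(1)[of n] by (simp add: norm_mult)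
qed

lemma dilated:
  "continuous_on cdisc (\<lambda>z. K (of_real (\<rho> n) * z))" "(\<lambda>z. K (of_real (\<rho> n) * z)) holomorphic_on disc"
  by (rule continuous_on_compose2[OF holomorphic_on_imp_continuous_on[OF K]], intro continuous_intros,
      use \<rho>_disc in blast)
    (rule holomorphic_on_compose_gen[OF _ K, unfolded o_def], intro holomorphic_intros, use \<rho>_disc in auto)

lemma continuous_on_u: "continuous_on A (u n)"
  unfolding u_def by (intro continuous_intros continuous_on_compose2[OF dilated(1)]) auto

lemma u_pos: "0 < u n t"
  unfolding u_def by (rule posK, rule \<rho>_disc) simp

lemma u_Schwarz:
  assumes w: "cmod w < 1"
  shows "integrable arc_measure (\<lambda>t. herglotz_kernel w t * of_real (u n t))"
    "(\<integral>t. herglotz_kernel w t * of_real (u n t) \<partial>arc_measure) =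
      2 * of_real pi * (K (of_real (\<rho> n) * w) - \<i> * of_real (Im (K 0)))"
proof -
  have c: "continuous_on {0..2 * pi} (\<lambda>t. herglotz_kernel w t * of_real (u n t))"
    by (intro continuous_intros continuous_on_herglotz_kernel[OF w] continuous_on_u)
  note i = Schwarz_integral_formula[OF dilated[of n] w]
  show "integrable arc_measure (\<lambda>t. herglotz_kernel w t * of_real (u n t))"
    "(\<integral>t. herglotz_kernel w t * of_real (u n t) \<partial>arc_measure) =
      2 * of_real pi * (K (of_real (\<rho> n) * w) - \<i> * of_real (Im (K 0)))"
    using arc_integral_eq[OF c] i by (simp_all add: u_def)
qed

lemma u_mass: "integrable arc_measure (u n)" "(\<integral>t. u n t \<partial>arc_measure) = 2 * pi * Re (K 0)"
proof -
  have "((\<lambda>t. K (of_real (\<rho> n) * cis t)) has_integral (2 * of_real pi * K (of_real (\<rho> n) * 0))) {0..2 * pi}"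
    by (rule mean_value_cis[OF dilated])
  then have "((\<lambda>t. Re (K (of_real (\<rho> n) * cis t))) has_integral Re (2 * of_real pi * K 0)) {0..2 * pi}"
    by (intro has_integral_Re) simp
  then have "((u n) has_integral 2 * pi * Re (K 0)) {0..2 * pi}" by (simp add: u_def[abs_def])
  from arc_integral_eq[OF continuous_on_u this]
  show "integrable arc_measure (u n)" "(\<integral>t. u n t \<partial>arc_measure) = 2 * pi * Re (K 0)" .
qed

lemma u_lim: "t \<in> {0<..<2 * pi} \<Longrightarrow> (\<lambda>n. u n t) \<longlonglongrightarrow> U t"
proof -
  assume t: "t \<in> {0<..<2 * pi}"
  have e: "u n t = ln M - ln (cmod (h (of_real (\<rho> n) * cis t)))" for n
    unfolding u_def by (rule ReK, rule \<rho>_disc) simp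
  have "(\<lambda>n. of_real (\<rho> n) * cis t) \<longlonglongrightarrow> of_real 1 * cis t" by (intro tendsto_intros \<rho>_lim)
  then have "(\<lambda>n. of_real (\<rho> n) * cis t) \<longlonglongrightarrow> cis t" by simp
  then have "(\<lambda>n. h (of_real (\<rho> n) * cis t)) \<longlonglongrightarrow> h (cis t)"
    by (rule continuous_on_tendsto_compose[OF cont])
      (use \<rho>_disc[of "cis t"] in \<open>auto intro!: always_eventually less_imp_le\<close>)
  then show "(\<lambda>n. u n t) \<longlonglongrightarrow> U t"
    unfolding e U_def by (intro tendsto_intros) (use nz[of "cis t"] cis_ne_1_arc[OF t] in auto)
qed

text \<open>Fatou's lemma for the dilates, which by the mean value property all have mass 2 pi Re (K
  0). A strict inequality means that mass escapes to the point 1.\<close>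

lemma U_integrable: "integrable arc_measure U" "(\<integral>t. U t \<partial>arc_measure) \<le> 2 * pi * Re (K 0)"
proof -
  have mu: "u n \<in> borel_measurable arc_measure" for n using u_mass(1) by (rule borel_measurable_integrable)
  have "(\<integral>\<^sup>+t. ennreal (U t) \<partial>arc_measure) = (\<integral>\<^sup>+t. liminf (\<lambda>n. ennreal (u n t)) \<partial>arc_measure)"
  proof (rule nn_integral_cong)
    fix t assume "t \<in> space arc_measure"
    then have "(\<lambda>n. ennreal (u n t)) \<longlonglongrightarrow> ennreal (U t)" by (intro tendsto_ennrealI u_lim) (simp add: space_arc)
    then show "ennreal (U t) = liminf (\<lambda>n. ennreal (u n t))"
      by (intro lim_imp_Liminf[symmetric]) auto
  qed
  also have "\<dots> \<le> liminf (\<lambda>n. \<integral>\<^sup>+t. ennreal (u n t) \<partial>arc_measure)"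
    by (rule nn_integral_liminf) (use mu in measurable)
  also have "(\<lambda>n. \<integral>\<^sup>+t. ennreal (u n t) \<partial>arc_measure) = (\<lambda>n. ennreal (2 * pi * Re (K 0)))"
  proof
    fix n
    show "(\<integral>\<^sup>+t. ennreal (u n t) \<partial>arc_measure) = ennreal (2 * pi * Re (K 0))"
      unfolding u_mass(2)[of n, symmetric]
      by (rule nn_integral_eq_integral[OF u_mass(1)]) (use u_pos in \<open>auto intro: less_imp_le\<close>)
  qed
  finally have le: "(\<integral>\<^sup>+t. ennreal (U t) \<partial>arc_measure) \<le> ennreal (2 * pi * Re (K 0))" by (simp add: Liminf_const)
  have ae: "AE t in arc_measure. 0 \<le> U t" by (rule AE_I2) (simp add: space_arc U_nonneg)
  show int: "integrable arc_measure U"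
    by (rule integrableI_nonneg[OF measurable_U ae]) (use le in \<open>auto intro: order.strict_trans1\<close>)
  have "ennreal (\<integral>t. U t \<partial>arc_measure) \<le> ennreal (2 * pi * Re (K 0))"
    using nn_integral_eq_integral[OF int ae] le by simp
  moreover have "0 < Re (K 0)" by (rule posK) simp
  ultimately show "(\<integral>t. U t \<partial>arc_measure) \<le> 2 * pi * Re (K 0)"
    by (subst (asm) ennreal_le_iff) (auto intro: mult_nonneg_nonneg)
qed

text \<open>Near the endpoints, which represent the point 1, \<open>d\<close> is small and the
  masses are bounded. On a compact arc \<open>J\<close> in between, h has no zero, the functions
  \<open>u n\<close> are uniformly bounded and dominated convergence applies. The zero of
  \<open>d\<close> at 1 hides the mass that may concentrate there.\<close>

lemma weak_limit:
  fixes d :: "real \<Rightarrow> complex"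
  assumes d: "continuous_on {0..2 * pi} d" "d 0 = 0" "d (2 * pi) = 0"
  shows "(\<lambda>n. \<integral>t. d t * of_real (u n t) \<partial>arc_measure) \<longlonglongrightarrow> (\<integral>t. d t * of_real (U t) \<partial>arc_measure)"
proof -
  obtain B where "\<forall>z\<in>d ` {0..2 * pi}. cmod z \<le> B"
    using compact_imp_bounded[OF compact_continuous_image[OF d(1) compact_Icc]] unfolding bounded_iff by blast
  then have B: "cmod (d t) \<le> B" if "t \<in> {0..2 * pi}" for t using that by blast
  have B0: "0 \<le> B" using B[of 0] norm_ge_zero[of "d 0"] by (metis atLeastAtMost_iff order_trans order_refl pi_ge_zero mult_nonneg_nonneg zero_le_numeral)
  have md: "d \<in> borel_measurable arc_measure"
  proof -
    have "d \<in> borel_measurable (restrict_space borel {0<..<2 * pi})"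
      by (rule borel_measurable_continuous_on_restrict) (rule continuous_on_subset[OF d(1)], auto)
    then show ?thesis by (simp add: measurable_def space_restrict_space sets_restrict_space)
  qed
  have mu: "u n \<in> borel_measurable arc_measure" for n using u_mass(1) by (rule borel_measurable_integrable)
  have int_prod: "integrable arc_measure (\<lambda>t. g t * of_real (v t))"
    if "g \<in> borel_measurable arc_measure" "\<And>t. t \<in> {0<..<2 * pi} \<Longrightarrow> cmod (g t) \<le> B" "integrable arc_measure v" for g and v :: "real \<Rightarrow> real"
  proof (rule Bochner_Integration.integrable_bound)
    show "integrable arc_measure (\<lambda>t. B * v t)" using that(3) by simp
    show "(\<lambda>t. g t * of_real (v t)) \<in> borel_measurable arc_measure"
      using that(1) borel_measurable_integrable[OF that(3)] by measurable
    show "AE t in arc_measure. norm (g t * of_real (v t)) \<le> norm (B * v t)"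
      using that(2) B0 by (intro AE_I2) (auto simp: space_arc norm_mult abs_mult intro!: mult_right_mono)
  qed
  show ?thesis
  proof (rule LIMSEQ_I)
    fix e :: real assume e: "0 < e"
    define m where "m = 2 * pi * Re (K 0)"
    have m: "0 < m" using posK[of 0] by (simp add: m_def)
    \<comment> \<open>With masses at most m the part outside \<open>J\<close> contributes at most
      e/4 for \<open>u n\<close> and e/4 for \<open>U\<close>; the part on \<open>J\<close> gets
      less than e/4.\<close>
    define e' where "e' = e / (4 * m)"
    have e': "0 < e'" using e m by (simp add: e'_def)
    have "\<exists>\<delta>>0. \<forall>t\<in>{0..2 * pi}. dist t 0 < \<delta> \<longrightarrow> dist (d t) (d 0) < e'"
      by (rule d(1)[unfolded continuous_on_iff, rule_format]) (use e' in auto)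
    then obtain \<eta>1 where \<eta>1: "\<eta>1 > 0" "\<And>t. t \<in> {0..2 * pi} \<Longrightarrow> t < \<eta>1 \<Longrightarrow> cmod (d t) < e'"
      using d(2) by (auto simp: dist_norm)
    have "\<exists>\<delta>>0. \<forall>t\<in>{0..2 * pi}. dist t (2 * pi) < \<delta> \<longrightarrow> dist (d t) (d (2 * pi)) < e'"
      by (rule d(1)[unfolded continuous_on_iff, rule_format]) (use e' in auto)
    then obtain \<eta>2 where \<eta>2: "\<eta>2 > 0" "\<And>t. t \<in> {0..2 * pi} \<Longrightarrow> 2 * pi - t < \<eta>2 \<Longrightarrow> cmod (d t) < e'"
      using d(3) by (auto simp: dist_norm abs_minus_commute)
    define J where "J = {\<eta>1..2 * pi - \<eta>2}"
    have J: "J \<subseteq> {0<..<2 * pi}" using \<eta>1 \<eta>2 by (auto simp: J_def)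
    have JS: "J \<inter> space arc_measure \<in> sets arc_measure"
      using J by (auto simp: space_arc sets_restrict_space J_def image_iff intro!: bexI[of _ "{\<eta>1..2 * pi - \<eta>2}"])
    define d1 where "d1 t = indicat_real J t *\<^sub>R d t" for t
    define d2 where "d2 t = d t - d1 t" for t
    have md1: "d1 \<in> borel_measurable arc_measure"
      unfolding d1_def by (intro borel_measurable_scaleR borel_measurable_indicator' md) (use JS in \<open>simp add: Int_def conj_commute\<close>)
    then have md2: "d2 \<in> borel_measurable arc_measure" unfolding d2_def using md by (intro borel_measurable_diff)
    have d1B: "cmod (d1 t) \<le> B" if "t \<in> {0<..<2 * pi}" for t
      using B[of t] B0 that by (auto simp: d1_def indicator_def)
    have d2e: "cmod (d2 t) \<le> e'" if "t \<in> {0<..<2 * pi}" for t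
      using \<eta>1(2)[of t] \<eta>2(2)[of t] that e' by (cases "t \<in> J") (auto simp: d2_def d1_def J_def indicator_def)
    have d2B: "cmod (d2 t) \<le> B" if "t \<in> {0<..<2 * pi}" for t
      using B[of t] B0 that by (auto simp: d2_def d1_def indicator_def)
    have small: "cmod (\<integral>t. d2 t * of_real (v t) \<partial>arc_measure) \<le> e / 4"
      if v: "integrable arc_measure v" "\<And>t. t \<in> {0<..<2 * pi} \<Longrightarrow> 0 \<le> v t" "(\<integral>t. v t \<partial>arc_measure) \<le> m" for v
    proof -
      have "cmod (\<integral>t. d2 t * of_real (v t) \<partial>arc_measure) \<le> (\<integral>t. e' * v t \<partial>arc_measure)"
        by (rule Bochner_Integration.integral_norm_bound_integral[OF int_prod[OF md2 d2B v(1)]])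
          (use v d2e in \<open>auto simp: space_arc norm_mult intro!: mult_right_mono\<close>)
      also have "\<dots> = e' * (\<integral>t. v t \<partial>arc_measure)" by simp
      also have "\<dots> \<le> e' * m" using v(3) e' by (intro mult_left_mono) auto
      also have "\<dots> = e / 4" using m by (simp add: e'_def)
      finally show ?thesis .
    qed
    \<comment> \<open>The compact set swept by the radii from 1/2 to 1 over \<open>J\<close>. It
      avoids the point 1, so ln |h| is bounded on it, which bounds all \<open>u n\<close> on
      \<open>J\<close> at once.\<close>
    define Z :: "complex set" where "Z = (\<lambda>(r, t). of_real r * cis t) ` ({1/2..1} \<times> J)"
    have cK: "continuous_on Z (\<lambda>z. ln M - ln (cmod (h z)))"
    proof -
      have "z \<in> cdisc \<and> h z \<noteq> 0" if "z \<in> Z" for z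
      proof -
        obtain r t where rt: "1 / 2 \<le> r" "r \<le> 1" "t \<in> J" "z = of_real r * cis t" using \<open>z \<in> Z\<close> by (auto simp: Z_def)
        then have n: "cmod z = r" by (simp add: norm_mult)
        have "z \<noteq> 1"
        proof
          assume "z = 1"
          then have "r = 1" using n by simp
          then show False using \<open>z = 1\<close> rt cis_ne_1_arc[of t] J by auto
        qed
        then show ?thesis using nz[of z] n rt by auto
      qed
      then show ?thesis by (intro continuous_intros continuous_on_subset[OF cont]) auto
    qed
    have cimg: "compact Z"
      unfolding Z_def by (intro compact_continuous_image compact_Times) (auto simp: J_def case_prod_beta intro!: continuous_intros)
    obtain W where W: "\<And>r t. 1/2 \<le> r \<Longrightarrow> r \<le> 1 \<Longrightarrow> t \<in> J \<Longrightarrow> \<bar>ln M - ln (cmod (h (of_real r * cis t)))\<bar> \<le> W"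
      using compact_imp_bounded[OF compact_continuous_image[OF cK cimg]] unfolding Z_def by (force simp: bounded_iff)
    have uW: "\<bar>u n t\<bar> \<le> W" if "t \<in> J" for n t
    proof -
      have "u n t = ln M - ln (cmod (h (of_real (\<rho> n) * cis t)))" unfolding u_def by (rule ReK, rule \<rho>_disc) simp
      then show ?thesis using W[of "\<rho> n" t] \<rho>[of n] that by simp
    qed
    interpret finite_measure arc_measure by (rule finite_measure_arc)
    have "(\<lambda>n. \<integral>t. d1 t * of_real (u n t) \<partial>arc_measure) \<longlonglongrightarrow> (\<integral>t. d1 t * of_real (U t) \<partial>arc_measure)"
    proof (rule integral_dominated_convergence)
      show "(\<lambda>t. d1 t * of_real (U t)) \<in> borel_measurable arc_measure" using md1 measurable_U by measurable
      show "(\<lambda>t. d1 t * of_real (u n t)) \<in> borel_measurable arc_measure" for n using md1 mu[of n] by measurable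
      show "integrable arc_measure (\<lambda>_. B * \<bar>W\<bar>)" by simp
      show "AE t in arc_measure. (\<lambda>n. d1 t * of_real (u n t)) \<longlonglongrightarrow> d1 t * of_real (U t)"
        by (intro AE_I2 tendsto_intros u_lim) (simp add: space_arc)
      show "AE t in arc_measure. norm (d1 t * of_real (u n t)) \<le> B * \<bar>W\<bar>" for n
      proof (rule AE_I2)
        fix t assume "t \<in> space arc_measure"
        then have t: "t \<in> {0<..<2 * pi}" by (simp add: space_arc)
        show "norm (d1 t * of_real (u n t)) \<le> B * \<bar>W\<bar>"
        proof (cases "t \<in> J")
          case True
          then have "cmod (d1 t) * \<bar>u n t\<bar> \<le> B * \<bar>W\<bar>" using d1B[OF t] uW[OF True, of n] B0 by (intro mult_mono) auto
          then show ?thesis by (simp add: norm_mult)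
        qed (use B0 in \<open>simp add: d1_def\<close>)
      qed
    qed
    from LIMSEQ_D[OF this, of "e / 4"] e obtain N where N: "\<And>n. n \<ge> N \<Longrightarrow>
        cmod ((\<integral>t. d1 t * of_real (u n t) \<partial>arc_measure) - (\<integral>t. d1 t * of_real (U t) \<partial>arc_measure)) < e / 4" by auto
    have split: "(\<integral>t. d t * of_real (v t) \<partial>arc_measure) =
        (\<integral>t. d1 t * of_real (v t) \<partial>arc_measure) + (\<integral>t. d2 t * of_real (v t) \<partial>arc_measure)"
      if "integrable arc_measure v" for v
      using Bochner_Integration.integral_add[OF int_prod[OF md1 d1B that] int_prod[OF md2 d2B that]]
      by (simp add: d2_def distrib_right[symmetric])
    have "cmod ((\<integral>t. d t * of_real (u n t) \<partial>arc_measure) - (\<integral>t. d t * of_real (U t) \<partial>arc_measure)) < e" if n: "n \<ge> N" for n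
    proof -
      have a: "cmod (\<integral>t. d2 t * of_real (u n t) \<partial>arc_measure) \<le> e / 4"
        by (rule small[OF u_mass(1)]) (use u_pos u_mass(2) in \<open>auto simp: m_def intro: less_imp_le\<close>)
      have b: "cmod (\<integral>t. d2 t * of_real (U t) \<partial>arc_measure) \<le> e / 4"
        by (rule small[OF U_integrable(1)]) (use U_nonneg U_integrable(2) in \<open>auto simp: m_def\<close>)
      have "(\<integral>t. d t * of_real (u n t) \<partial>arc_measure) - (\<integral>t. d t * of_real (U t) \<partial>arc_measure) =
          ((\<integral>t. d1 t * of_real (u n t) \<partial>arc_measure) - (\<integral>t. d1 t * of_real (U t) \<partial>arc_measure)) +
          ((\<integral>t. d2 t * of_real (u n t) \<partial>arc_measure) - (\<integral>t. d2 t * of_real (U t) \<partial>arc_measure))"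
        unfolding split[OF u_mass(1)] split[OF U_integrable(1)] by simp
      also have "cmod \<dots> \<le> e / 4 + (e / 4 + e / 4)"
        by (rule norm_triangle_mono[OF less_imp_le[OF N[OF n]]]) (rule norm_triangle_le_diff, use a b in linarith)
      also have "\<dots> < e" using e by simp
      finally show ?thesis .
    qed
    then show "\<exists>N. \<forall>n\<ge>N. cmod ((\<integral>t. d t * of_real (u n t) \<partial>arc_measure) - (\<integral>t. d t * of_real (U t) \<partial>arc_measure)) < e"
      by blast
  qed
qed

text \<open>The mass lost in the limit sits at the point \<open>1\<close>.\<close>

lemma K_representation:
  assumes w: "cmod w < 1"
  shows "K w = \<i> * of_real (Im (K 0)) + of_real (Re (K 0) - (\<integral>t. U t \<partial>arc_measure) / (2 * pi)) * ((1 + w) / (1 - w)) +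
    (\<integral>t. herglotz_kernel w t * of_real (U t) \<partial>arc_measure) / (2 * of_real pi)"
proof -
  define c where "c = (1 + w) / (1 - w)"
  have c: "herglotz_kernel w 0 = c" "herglotz_kernel w (2 * pi) = c" by (simp_all add: herglotz_kernel_def c_def)
  \<comment> \<open>Subtracting the value of the kernel at the point 1 makes
    \<open>weak_limit\<close> applicable; the subtracted constant is multiplied by the total masses,
    whose difference appears as the atom.\<close>
  define d where "d t = herglotz_kernel w t - c" for t
  have split: "(\<integral>t. d t * of_real (v t) \<partial>arc_measure) =
      (\<integral>t. herglotz_kernel w t * of_real (v t) \<partial>arc_measure) - c * of_real (\<integral>t. v t \<partial>arc_measure)"
    if "integrable arc_measure v" for v
    unfolding d_def left_diff_distrib using herglotz_integrable[OF w that] that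
    by (subst Bochner_Integration.integral_diff) auto
  have "(\<lambda>n. \<integral>t. d t * of_real (u n t) \<partial>arc_measure) \<longlonglongrightarrow> (\<integral>t. d t * of_real (U t) \<partial>arc_measure)"
    by (rule weak_limit) (use continuous_on_herglotz_kernel[OF w] in \<open>auto simp: d_def c intro!: continuous_intros\<close>)
  moreover have "(\<integral>t. d t * of_real (u n t) \<partial>arc_measure) =
      2 * of_real pi * (K (of_real (\<rho> n) * w) - \<i> * of_real (Im (K 0))) - c * of_real (2 * pi * Re (K 0))" for n
    unfolding split[OF u_mass(1)] u_Schwarz(2)[OF w] u_mass(2) ..
  ultimately have "(\<lambda>n. 2 * of_real pi * (K (of_real (\<rho> n) * w) - \<i> * of_real (Im (K 0))) - c * of_real (2 * pi * Re (K 0))) \<longlonglongrightarrow>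
      (\<integral>t. d t * of_real (U t) \<partial>arc_measure)" by simp
  moreover have "(\<lambda>n. 2 * of_real pi * (K (of_real (\<rho> n) * w) - \<i> * of_real (Im (K 0))) - c * of_real (2 * pi * Re (K 0))) \<longlonglongrightarrow>
      2 * of_real pi * (K w - \<i> * of_real (Im (K 0))) - c * of_real (2 * pi * Re (K 0))"
  proof (intro tendsto_intros)
    have "(\<lambda>n. of_real (\<rho> n) * w) \<longlonglongrightarrow> of_real 1 * w" by (intro tendsto_intros \<rho>_lim)
    then show "(\<lambda>n. K (of_real (\<rho> n) * w)) \<longlonglongrightarrow> K w"
      by (intro continuous_on_tendsto_compose[OF holomorphic_on_imp_continuous_on[OF K]])
        (use \<rho>_disc[of w] w in \<open>auto intro!: always_eventually\<close>)
  qed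
  ultimately have "2 * of_real pi * (K w - \<i> * of_real (Im (K 0))) - c * of_real (2 * pi * Re (K 0)) =
      (\<integral>t. d t * of_real (U t) \<partial>arc_measure)" by (rule LIMSEQ_unique[rotated])
  also have "\<dots> = (\<integral>t. herglotz_kernel w t * of_real (U t) \<partial>arc_measure) - c * of_real (\<integral>t. U t \<partial>arc_measure)"
    by (rule split[OF U_integrable(1)])
  finally show ?thesis unfolding c_def[symmetric] by (simp add: field_simps)
qed

end

end

lemma herglotz_measurable:
  assumes "cmod z < 1" "v \<in> borel_measurable borel"
  shows "(\<lambda>t. (cis t + z) / (cis t - z) * complex_of_real (v t)) \<in> borel_measurable borel"
proof -
  have "herglotz_kernel z \<in> borel_measurable borel"
    by (rule borel_measurable_continuous_onI[OF continuous_on_herglotz_kernel[OF assms(1)]])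
  then have "(\<lambda>t. herglotz_kernel z t * complex_of_real (v t)) \<in> borel_measurable borel"
    using assms(2) by measurable
  then show ?thesis by (simp add: herglotz_kernel_def)
qed

lemma herglotz_integral_const:
  assumes "cmod w < 1"
  shows "(\<integral>t. herglotz_kernel w t * of_real c \<partial>arc_measure) = 2 * of_real pi * of_real c"
proof -
  have 1: "((\<lambda>t. herglotz_kernel w t * of_real c) has_integral 2 * of_real pi * (of_real c)) {0..2 * pi}"
    using Schwarz_integral_formula[of "\<lambda>_. of_real c" w] assms by simp
  show ?thesis
    by (rule arc_integral_eq(2)[OF _ 1]) (intro continuous_intros continuous_on_herglotz_kernel assms)
qed

section \<open>Outer functions and the atom at the point 1\<close>

context one_boundary_zero
begin

definition V :: "real \<Rightarrow> real" where "V t = ln (cmod (h (cis t))) / (2 * pi)"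

lemma V_integrable: "integrable arc_measure V"
proof -
  obtain K where K: "K holomorphic_on disc" "\<And>z. z \<in> disc \<Longrightarrow> h z = of_real M * exp (- K z)"
    "\<And>z. z \<in> disc \<Longrightarrow> Re (K z) = ln M - ln (cmod (h z))" "\<And>z. z \<in> disc \<Longrightarrow> 0 < Re (K z)" by (fact log_exists)
  interpret finite_measure arc_measure by (rule finite_measure_arc)
  have "integrable arc_measure (\<lambda>t. (ln M - U t) / (2 * pi))"
    using U_integrable(1)[OF K] by simp
  then show ?thesis by (simp add: V_def[abs_def] U_def)
qed

lemma V_integral_eq:
  assumes "cmod z < 1"
  shows "(LINT t:{0..2 * pi}|lborel. (cis t + z) / (cis t - z) * complex_of_real (ln (cmod (h (cis t))) / (2 * pi))) =
    (\<integral>t. herglotz_kernel z t * of_real (V t) \<partial>arc_measure)"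
proof -
  have "(\<lambda>t. ln (cmod (h (cis t))) / (2 * pi)) \<in> borel_measurable borel" using measurable_ln_h by measurable
  from set_integral_eq_arc_integral[OF herglotz_measurable[OF assms this]]
  show ?thesis by (simp only: V_def herglotz_kernel_def)
qed

text \<open>1 - r times the kernel is bounded by 2 and tends to 0 at every point of the circle other
  than 1. By dominated convergence an integrable density contributes nothing to the limit, whereas
  an atom at 1 would.\<close>

lemma radial_limit_if_outer:
  assumes "outer_function h"
  shows "((\<lambda>r. (1 - r) * ln (cmod (h (of_real r)))) \<longlongrightarrow> 0) (at_left (1::real))"
proof -
  obtain c where c: "cmod c = 1" "\<And>z. z \<in> disc \<Longrightarrow> h z = c * exp (LINT t:{0..2 * pi}|lborel.
      (cis t + z) / (cis t - z) * complex_of_real (ln (cmod (h (cis t))) / (2 * pi)))"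
    using assms unfolding outer_function_def by blast
  define I where "I r = (\<integral>t. herglotz_kernel (of_real r) t * of_real (V t) \<partial>arc_measure)" for r :: real
  have lnh: "(1 - r) * ln (cmod (h (of_real r))) = Re (of_real (1 - r) * I r)" if "0 < r" "r < 1" for r
  proof -
    have r: "cmod (of_real r) < 1" using that by simp
    then have "h (of_real r) = c * exp (I r)" unfolding I_def V_integral_eq[OF r, symmetric] by (intro c(2)) simp
    then have "cmod (h (of_real r)) = exp (Re (I r))" using c(1) by (simp add: norm_mult)
    then show ?thesis by simp
  qed
  have lim: "((\<lambda>r. of_real (1 - r) * I r) \<longlongrightarrow> 0) (at_left (1::real))"
  proof (rule tendsto_at_left_sequentially[of 0 1])
    fix S :: "nat \<Rightarrow> real"
    assume S: "\<And>n. S n < 1" "\<And>n. 0 < S n" "S \<longlonglongrightarrow> 1"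
    have Sc: "cmod (of_real (S n)) < 1" for n using S(1,2)[of n] by simp
    have "(\<lambda>n. \<integral>t. of_real (1 - S n) * (herglotz_kernel (of_real (S n)) t * of_real (V t)) \<partial>arc_measure) \<longlonglongrightarrow>
        (\<integral>t. 0 \<partial>(arc_measure :: real measure))"
    proof (rule integral_dominated_convergence)
      show "(\<lambda>t. of_real (1 - S n) * (herglotz_kernel (of_real (S n)) t * of_real (V t))) \<in> borel_measurable arc_measure" for n
        using borel_measurable_integrable[OF herglotz_integrable[OF Sc V_integrable]] by measurable
      show "integrable arc_measure (\<lambda>t. 2 * \<bar>V t\<bar>)" using V_integrable by simp
      show "AE t in arc_measure. norm (of_real (1 - S n) * (herglotz_kernel (of_real (S n)) t * of_real (V t))) \<le> 2 * \<bar>V t\<bar>" for n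
      proof (rule AE_I2)
        fix t
        have "(1 - S n) * cmod (herglotz_kernel (of_real (S n)) t) \<le> (1 - S n) * (2 / (1 - S n))"
          using herglotz_kernel_bound[OF Sc[of n], of t] S(1,2)[of n] by (intro mult_left_mono) auto
        moreover have "(1 - S n) * (2 / (1 - S n)) = 2" using S(1)[of n]
          by (simp only: times_divide_eq_right) (rule nonzero_mult_div_cancel_left, simp)
        ultimately have "(1 - S n) * cmod (herglotz_kernel (of_real (S n)) t) \<le> 2" by simp
        then have "(1 - S n) * cmod (herglotz_kernel (of_real (S n)) t) * \<bar>V t\<bar> \<le> 2 * \<bar>V t\<bar>" by (rule mult_right_mono) simp
        moreover have "norm (of_real (1 - S n) * (herglotz_kernel (of_real (S n)) t * of_real (V t))) =
            (1 - S n) * cmod (herglotz_kernel (of_real (S n)) t) * \<bar>V t\<bar>"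
          using S(1)[of n] unfolding norm_mult norm_of_real by simp
        ultimately show "norm (of_real (1 - S n) * (herglotz_kernel (of_real (S n)) t * of_real (V t))) \<le> 2 * \<bar>V t\<bar>" by simp
      qed
      show "AE t in arc_measure. (\<lambda>n. of_real (1 - S n) * (herglotz_kernel (of_real (S n)) t * of_real (V t))) \<longlonglongrightarrow> 0"
      proof (rule AE_I2)
        fix t assume "t \<in> space arc_measure"
        then have ne: "cis t \<noteq> 1" by (simp add: space_arc cis_ne_1_arc)
        have "(\<lambda>n. of_real (1 - S n) * ((cis t + of_real (S n)) / (cis t - of_real (S n)) * of_real (V t))) \<longlonglongrightarrow>
            of_real (1 - 1) * ((cis t + of_real 1) / (cis t - of_real 1) * of_real (V t))"
          by (intro tendsto_intros S(3)) (use ne in auto)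
        then show "(\<lambda>n. of_real (1 - S n) * (herglotz_kernel (of_real (S n)) t * of_real (V t))) \<longlonglongrightarrow> 0"
          by (simp add: herglotz_kernel_def)
      qed
    qed auto
    then show "(\<lambda>n. of_real (1 - S n) * I (S n)) \<longlonglongrightarrow> 0" by (simp add: I_def)
  qed simp
  have "((\<lambda>r. Re (of_real (1 - r) * I r)) \<longlongrightarrow> Re 0) (at_left (1::real))" by (intro tendsto_Re lim)
  moreover have "\<forall>\<^sub>F r in at_left (1::real). Re (of_real (1 - r) * I r) = (1 - r) * ln (cmod (h (of_real r)))"
    unfolding eventually_at_left_field by (intro exI[of _ 0]) (use lnh in auto)
  ultimately show ?thesis by (simp add: Lim_transform_eventually)
qed

text \<open>\<open>a\<close> is the normalized mass of the atom at 1 in the Herglotz measure. The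
  last claim bounds h after removal of its singular inner factor: what remains is, up to a
  unimodular constant, M exp (- J) with Re J \<ge> 0.\<close>

lemma inner_outer_factorization:
  obtains c a where "cmod c = 1" "0 \<le> a"
    "\<And>z. z \<in> disc \<Longrightarrow> h z = c * exp (- (of_real a * ((1 + z) / (1 - z)))) * exp (LINT t:{0..2 * pi}|lborel.
      (cis t + z) / (cis t - z) * complex_of_real (ln (cmod (h (cis t))) / (2 * pi)))"
    "\<And>z. z \<in> disc \<Longrightarrow> cmod (h z * exp (of_real a * ((1 + z) / (1 - z)))) \<le> M"
proof -
  obtain K where K: "K holomorphic_on disc" "\<And>z. z \<in> disc \<Longrightarrow> h z = of_real M * exp (- K z)"
    "\<And>z. z \<in> disc \<Longrightarrow> Re (K z) = ln M - ln (cmod (h z))" "\<And>z. z \<in> disc \<Longrightarrow> 0 < Re (K z)" by (fact log_exists)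
  define a where "a = Re (K 0) - (\<integral>t. U t \<partial>arc_measure) / (2 * pi)"
  define c where "c = exp (- (\<i> * of_real (Im (K 0))))"
  define J where "J z = (\<integral>t. herglotz_kernel z t * of_real (U t) \<partial>arc_measure) / (2 * of_real pi)" for z
  have Uint: "integrable arc_measure U" by (rule U_integrable(1)[OF K])
  have Krep: "K z = \<i> * of_real (Im (K 0)) + of_real a * ((1 + z) / (1 - z)) + J z" if "z \<in> disc" for z
    using K_representation[OF K, of z] that by (simp add: a_def J_def)
  have eq: "h z = c * exp (- (of_real a * ((1 + z) / (1 - z)))) * (of_real M * exp (- J z))" if "z \<in> disc" for z
  proof -
    have "- K z = - (\<i> * of_real (Im (K 0))) + (- (of_real a * ((1 + z) / (1 - z))) + - J z)" using Krep[OF that] by simp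
    then have "exp (- K z) = c * (exp (- (of_real a * ((1 + z) / (1 - z)))) * exp (- J z))"
      unfolding c_def by (simp only: exp_add)
    then show ?thesis using K(2)[OF that] by (simp add: mult_ac)
  qed
  have Jeq: "of_real M * exp (- J z) = exp (\<integral>t. herglotz_kernel z t * of_real (V t) \<partial>arc_measure)" if z: "cmod z < 1" for z
  proof -
    have "herglotz_kernel z t * of_real (V t) =
        (herglotz_kernel z t * of_real (ln M) - herglotz_kernel z t * of_real (U t)) / (2 * of_real pi)" for t
      by (simp add: V_def U_def right_diff_distrib)
    then have "(\<integral>t. herglotz_kernel z t * of_real (V t) \<partial>arc_measure) =
        (\<integral>t. herglotz_kernel z t * of_real (ln M) - herglotz_kernel z t * of_real (U t) \<partial>arc_measure) / (2 * of_real pi)"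
      by simp
    also have "(\<integral>t. herglotz_kernel z t * of_real (ln M) - herglotz_kernel z t * of_real (U t) \<partial>arc_measure) =
        2 * of_real pi * of_real (ln M) - (\<integral>t. herglotz_kernel z t * of_real (U t) \<partial>arc_measure)"
    proof -
      interpret finite_measure arc_measure by (rule finite_measure_arc)
      have i: "integrable arc_measure (\<lambda>t. ln M)" by simp
      show ?thesis unfolding herglotz_integral_const[OF z, symmetric]
        by (rule Bochner_Integration.integral_diff[OF herglotz_integrable[OF z i] herglotz_integrable[OF z Uint]])
    qed
    finally have "(\<integral>t. herglotz_kernel z t * of_real (V t) \<partial>arc_measure) = of_real (ln M) - J z"
      by (simp add: J_def diff_divide_distrib)
    then show ?thesis using M by (simp add: exp_diff exp_minus exp_of_real divide_inverse)
  qed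
  have J_nonneg: "0 \<le> Re (J z)" if z: "cmod z < 1" for z
  proof -
    have "Re (J z) = (\<integral>t. Re (herglotz_kernel z t * of_real (U t)) \<partial>arc_measure) / (2 * pi)"
      unfolding J_def integral_Re[OF herglotz_integrable[OF z Uint]]
      using Re_divide_of_real[of _ "2 * pi"] by simp
    moreover have "0 \<le> (\<integral>t. Re (herglotz_kernel z t * of_real (U t)) \<partial>arc_measure)"
      by (rule integral_nonneg_AE, rule AE_I2)
        (use U_nonneg Re_herglotz_kernel_nonneg[OF z] in \<open>simp add: space_arc\<close>)
    ultimately show ?thesis by simp
  qed
  show ?thesis
  proof (rule that[of c a])
    show "cmod c = 1" by (simp add: c_def)
    show "0 \<le> a" using U_integrable(2)[OF K] by (simp add: a_def field_simps)
    fix z assume z: "z \<in> disc"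
    then have z': "cmod z < 1" by simp
    show "h z = c * exp (- (of_real a * ((1 + z) / (1 - z)))) * exp (LINT t:{0..2 * pi}|lborel.
      (cis t + z) / (cis t - z) * complex_of_real (ln (cmod (h (cis t))) / (2 * pi)))"
      unfolding V_integral_eq[OF z'] Jeq[OF z', symmetric] by (rule eq[OF z])
    have "h z * exp (of_real a * ((1 + z) / (1 - z))) =
        c * (exp (- (of_real a * ((1 + z) / (1 - z)))) * exp (of_real a * ((1 + z) / (1 - z)))) * (of_real M * exp (- J z))"
      unfolding eq[OF z] by (simp only: mult_ac)
    also have "\<dots> = c * (of_real M * exp (- J z))" by (simp flip: exp_add)
    finally have "cmod (h z * exp (of_real a * ((1 + z) / (1 - z)))) = M * exp (- Re (J z))"
      using M by (simp add: c_def norm_mult)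
    also have "\<dots> \<le> M * 1" using J_nonneg[OF z'] M by (intro mult_left_mono) auto
    finally show "cmod (h z * exp (of_real a * ((1 + z) / (1 - z)))) \<le> M" by simp
  qed
qed

text \<open>Let h g be close to z - 1. Division by the singular inner factor does not change |h g|
  on the circle off the point 1, so the maximum principle bounds the quotient by 3 in the disc.
  Hence |h g| at r is at most 3 exp (- a/(1 - r)), which is too small to approximate r - 1 unless a
  = 0.\<close>

lemma outer_if_approximable:
  assumes h: "h \<in> disc_algebra"
    and approx: "\<And>\<epsilon>. 0 < \<epsilon> \<Longrightarrow> \<exists>g. continuous_on cdisc g \<and> g holomorphic_on disc \<and>
      (\<forall>z\<in>cdisc. cmod (z - 1 - h z * g z) < \<epsilon>)"
  shows "outer_function h"
proof -
  obtain c a where c: "cmod c = 1" and a: "0 \<le> a"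
    and rep: "\<And>z. z \<in> disc \<Longrightarrow> h z = c * exp (- (of_real a * ((1 + z) / (1 - z)))) * exp (LINT t:{0..2 * pi}|lborel.
      (cis t + z) / (cis t - z) * complex_of_real (ln (cmod (h (cis t))) / (2 * pi)))"
    and bdM: "\<And>z. z \<in> disc \<Longrightarrow> cmod (h z * exp (of_real a * ((1 + z) / (1 - z)))) \<le> M"
    by (fact inner_outer_factorization)
  have main: "1 - r \<le> \<epsilon> + 3 * exp (- (a / (1 - r)))" if r: "0 \<le> r" "r < 1" and \<epsilon>: "0 < \<epsilon>" "\<epsilon> \<le> 1" for r \<epsilon>
  proof -
    obtain g where g: "continuous_on cdisc g" "g holomorphic_on disc" "\<And>z. z \<in> cdisc \<Longrightarrow> cmod (z - 1 - h z * g z) < \<epsilon>"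
      using approx[OF \<epsilon>(1)] by blast
    obtain G where "\<forall>z\<in>g ` cdisc. cmod z \<le> G"
      using compact_imp_bounded[OF compact_continuous_image[OF g(1) compact_cball]] unfolding bounded_iff by blast
    then have G: "cmod (g z) \<le> G" if "z \<in> cdisc" for z using that by blast
    define q where "q z = h z * exp (of_real a * ((1 + z) / (1 - z))) * g z" for z
    have hg3: "cmod (h z * g z) \<le> 3" if "z \<in> cdisc" for z
    proof -
      have "cmod (h z * g z) \<le> cmod (z - 1) + cmod (z - 1 - h z * g z)"
        using norm_triangle_ineq4[of "z - 1" "z - 1 - h z * g z"] by simp
      moreover have "cmod (z - 1) \<le> 2" using norm_triangle_ineq4[of z 1] that by simp
      ultimately show ?thesis using g(3)[OF that] \<epsilon> by linarith
    qed
    have bq: "cmod (q z) = cmod (h z * g z)" if "cmod z = 1" "z \<noteq> 1" for z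
    proof -
      have "Re ((1 + z) / (1 - z)) = 0"
      proof -
        have "(Re z)\<^sup>2 + (Im z)\<^sup>2 = 1" using that(1) by (metis cmod_power2 power_one)
        then show ?thesis by (simp add: Re_divide power2_eq_square algebra_simps)
      qed
      moreover have "Re (of_real a * w) = a * Re w" for w by simp
      ultimately have "Re (of_real a * ((1 + z) / (1 - z))) = 0" by (simp only: mult_zero_right)
      then have "cmod (exp (of_real a * ((1 + z) / (1 - z)))) = 1" by (simp only: norm_exp_eq_Re exp_zero)
      then show ?thesis by (simp add: q_def norm_mult)
    qed
    have "cmod (q (of_real r)) \<le> 3"
    \<comment> \<open>The bound with \<open>G\<close> depends on g and thus on \<epsilon>; it only
      makes the exceptional point 1 harmless. The effective bound 3 comes from the circle: 2 for |z
      - 1| and 1 for \<epsilon>.\<close>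
    proof (rule maximum_modulus_exceptional[of q cdisc "{1}" "max 3 (M * \<bar>G\<bar>)" 3])
      have ne: "1 - z \<noteq> 0" if "z \<in> cdisc - {1}" for z using that by auto
      have ne': "1 - z \<noteq> 0" if "z \<in> disc" for z using that by auto
      show "q holomorphic_on interior cdisc" unfolding q_def interior_cball
        by (intro holomorphic_intros hol g(2)) (use ne' in auto)
      show "continuous_on (cdisc - {1}) q" unfolding q_def
        by (intro continuous_intros continuous_on_subset[OF cont] continuous_on_subset[OF g(1)]) (use ne in auto)
      show "cmod (q z) \<le> max 3 (M * \<bar>G\<bar>)" if z: "z \<in> cdisc - {1}" for z
      proof (cases "cmod z = 1")
        case True then show ?thesis using bq[of z] hg3[of z] z by auto
      next
        case False
        then have zd: "z \<in> disc" using z by auto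
        have "cmod (q z) = cmod (h z * exp (of_real a * ((1 + z) / (1 - z)))) * cmod (g z)" by (simp add: q_def norm_mult)
        also have "\<dots> \<le> M * \<bar>G\<bar>" using bdM[OF zd] G[of z] z M by (intro mult_mono) auto
        finally show ?thesis by simp
      qed
      show "cmod (q z) \<le> 3" if "z \<in> frontier cdisc - {1}" for z
        using bq[of z] hg3[of z] that by (auto simp: frontier_cball)
    qed (use r in auto)
    moreover have "cmod (q (of_real r)) = cmod (h (of_real r) * g (of_real r)) * exp (a * ((1 + r) / (1 - r)))"
    proof -
      have "of_real a * ((1 + of_real r) / (1 - of_real r)) = complex_of_real (a * ((1 + r) / (1 - r)))" by simp
      then have "cmod (exp (of_real a * ((1 + of_real r) / (1 - of_real r)))) = exp (a * ((1 + r) / (1 - r)))"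
        by (simp only: norm_exp_eq_Re Re_complex_of_real)
      then show ?thesis by (simp add: q_def norm_mult)
    qed
    ultimately have "cmod (h (of_real r) * g (of_real r)) \<le> 3 * exp (- (a * ((1 + r) / (1 - r))))"
      by (simp add: exp_minus field_simps)
    also have "\<dots> \<le> 3 * exp (- (a / (1 - r)))"
    proof -
      have "a * (1 / (1 - r)) \<le> a * ((1 + r) / (1 - r))" using r a by (intro mult_left_mono divide_right_mono) auto
      then show ?thesis by simp
    qed
    finally have hgr: "cmod (h (of_real r) * g (of_real r)) \<le> 3 * exp (- (a / (1 - r)))" .
    have "1 - r = cmod (of_real r - 1)" using r norm_of_real[of "r - 1", where 'a = complex] by simp
    also have "\<dots> \<le> cmod (of_real r - 1 - h (of_real r) * g (of_real r)) + cmod (h (of_real r) * g (of_real r))"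
      using norm_triangle_ineq[of "of_real r - 1 - h (of_real r) * g (of_real r)" "h (of_real r) * g (of_real r)"] by simp
    also have "\<dots> \<le> \<epsilon> + 3 * exp (- (a / (1 - r)))" using g(3)[of "of_real r"] hgr r by (intro add_mono) auto
    finally show ?thesis .
  qed
  have "a = 0"
  proof (rule ccontr)
    assume "a \<noteq> 0"
    then have ap: "0 < a" using a by simp
    \<comment> \<open>With x = 1/(1 - r) the estimate exp (a x) \<le> 3 x and the quadratic term of
      the exponential give a^2 x \<le> 6, which this x violates.\<close>
    define x where "x = 7 / a\<^sup>2 + 1"
    define r where "r = 1 - 1 / x"
    have x: "1 \<le> x" "7 / a\<^sup>2 < x" by (auto simp: x_def)
    have r: "0 \<le> r" "r < 1" using x by (auto simp: r_def)
    have "1 - r \<le> 3 * exp (- (a / (1 - r)))"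
    proof (rule field_le_epsilon)
      fix e :: real assume "0 < e"
      then have "1 - r \<le> min e 1 + 3 * exp (- (a / (1 - r)))" by (intro main[OF r]) auto
      then show "1 - r \<le> 3 * exp (- (a / (1 - r))) + e" using min.cobounded1[of e 1] by linarith
    qed
    then have "1 / x \<le> 3 * exp (- (a * x))" by (simp add: r_def)
    then have "exp (a * x) \<le> 3 * x" using x by (simp add: exp_minus field_simps)
    moreover have "(a * x)\<^sup>2 / 2 \<le> exp (a * x)"
    proof -
      have "1 + a * x + (a * x)\<^sup>2 / 2 \<le> exp (a * x)" by (rule exp_lower_Taylor_quadratic) (use ap x in simp)
      moreover have "0 \<le> a * x" using ap x by simp
      ultimately show ?thesis by linarith
    qed
    ultimately have "(a * x)\<^sup>2 \<le> 6 * x" by linarith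
    then have "(a\<^sup>2 * x) * x \<le> 6 * x" by (simp add: power2_eq_square mult_ac)
    then have "a\<^sup>2 * x \<le> 6" using x by simp
    moreover have "7 < a\<^sup>2 * x" using x(2) ap by (simp add: divide_less_eq mult.commute)
    ultimately show False by simp
  qed
  moreover have "\<exists>z\<in>cdisc. h z \<noteq> 0" using nz[of 0] by (intro bexI[of _ 0]) auto
  ultimately show ?thesis using h c rep unfolding outer_function_def by (auto intro!: exI[of _ c])
qed

end

section \<open>Representation of the bidisc algebra\<close>

definition coeffs2 :: "complex fps fps \<Rightarrow> nat \<times> nat \<Rightarrow> complex"
  where "coeffs2 \<phi> = (\<lambda>(n, m). fps_nth (fps_nth \<phi> n) m)"

definition to_fps2 :: "(nat \<times> nat \<Rightarrow> complex) \<Rightarrow> complex fps fps"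
  where "to_fps2 a = Abs_fps (\<lambda>n. Abs_fps (\<lambda>m. a (n, m)))"

lemma coeffs2_to_fps2 [simp]: "coeffs2 (to_fps2 a) = a"
  by (auto simp: coeffs2_def to_fps2_def)

lemma to_fps2_coeffs2 [simp]: "to_fps2 (coeffs2 \<phi>) = \<phi>"
  by (auto simp: coeffs2_def to_fps2_def intro!: fps_ext)

lemma weighted_coeff_nonneg: "0 \<le> weighted_coeff \<alpha> \<beta> a p"
  by (cases p) (simp add: weighted_coeff_def)

lemma bnorm_eq_double_suminf:
  "bnorm \<alpha> \<beta> \<phi> = (\<Sum>n. \<Sum>m. ennreal (weighted_coeff \<alpha> \<beta> (coeffs2 \<phi>) (n, m)))"
proof -
  have "ennreal ((1 + real n) powr \<alpha>) * (ennreal ((1 + real m) powr \<beta>) * ennreal (cmod (fps_nth (fps_nth \<phi> n) m))) =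
      ennreal (weighted_coeff \<alpha> \<beta> (coeffs2 \<phi>) (n, m))" for n m
    by (simp add: weighted_coeff_def coeffs2_def mult_ac flip: ennreal_mult)
  then show ?thesis unfolding wnorm_def ennreal_suminf_cmult[symmetric] by simp
qed

text \<open>Links the iterated series behind \<open>bnorm\<close> with the unordered sum used in
  \<open>Aplus_norm\<close>.\<close>

lemma bnorm_eq_infsum:
  assumes "weighted_coeff \<alpha> \<beta> (coeffs2 \<phi>) summable_on UNIV"
  shows "bnorm \<alpha> \<beta> \<phi> = ennreal (\<Sum>\<^sub>\<infinity>p. weighted_coeff \<alpha> \<beta> (coeffs2 \<phi>) p)"
proof -
  define g where "g = weighted_coeff \<alpha> \<beta> (coeffs2 \<phi>)"
  have g0: "0 \<le> g p" for p unfolding g_def by (rule weighted_coeff_nonneg)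
  have hs: "(g has_sum infsum g UNIV) (Sigma UNIV (\<lambda>_. UNIV))" using has_sum_infsum[OF assms] by (simp add: g_def)
  have "(\<lambda>(x, y). g (x, y)) summable_on Sigma UNIV (\<lambda>_. UNIV)" using assms by (simp add: g_def)
  then have inner: "(\<lambda>m. g (n, m)) summable_on UNIV" for n by (rule summable_on_SigmaD1) simp
  define b where "b n = infsum (\<lambda>m. g (n, m)) UNIV" for n
  have b: "((\<lambda>m. g (n, m)) has_sum b n) UNIV" for n unfolding b_def by (rule has_sum_infsum[OF inner])
  have b0: "0 \<le> b n" for n unfolding b_def by (rule infsum_nonneg) (rule g0)
  have "(b has_sum infsum g UNIV) UNIV" by (rule has_sum_SigmaD[OF hs b])
  then have "(\<Sum>n. ennreal (b n)) = ennreal (infsum g UNIV)"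
    by (intro suminf_ennreal_eq b0 has_sum_imp_sums)
  moreover have "(\<Sum>m. ennreal (g (n, m))) = ennreal (b n)" for n
    by (intro suminf_ennreal_eq g0 has_sum_imp_sums b)
  ultimately show ?thesis unfolding bnorm_eq_double_suminf by (simp add: g_def)
qed

lemma summable_on_if_bnorm_finite:
  assumes "bnorm \<alpha> \<beta> \<phi> < \<infinity>"
  shows "weighted_coeff \<alpha> \<beta> (coeffs2 \<phi>) summable_on UNIV"
proof -
  define g where "g = weighted_coeff \<alpha> \<beta> (coeffs2 \<phi>)"
  have g0: "0 \<le> g p" for p unfolding g_def by (rule weighted_coeff_nonneg)
  have fin: "(\<Sum>n. \<Sum>m. ennreal (g (n, m))) < \<infinity>" using assms unfolding bnorm_eq_double_suminf g_def .
  then have fin_n: "(\<Sum>m. ennreal (g (n, m))) < \<infinity>" for n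
    using ennreal_suminf_lessD[of "\<lambda>n. \<Sum>m. ennreal (g (n, m))" \<infinity>] by simp
  have S: "summable (\<lambda>m. g (n, m))" for n
    by (rule summable_suminf_not_top[OF g0]) (use fin_n[of n] in auto)
  define b where "b n = (\<Sum>m. g (n, m))" for n
  have b: "((\<lambda>m. g (n, m)) has_sum b n) UNIV" for n
    unfolding b_def by (intro sums_nonneg_imp_has_sum summable_sums S g0)
  have b0: "0 \<le> b n" for n unfolding b_def by (intro suminf_nonneg S g0)
  have "(\<Sum>m. ennreal (g (n, m))) = ennreal (b n)" for n unfolding b_def by (intro suminf_ennreal2 g0 S)
  then have "(\<Sum>n. ennreal (b n)) < \<infinity>" using fin by simp
  then have "summable b" by (intro summable_suminf_not_top b0) auto
  then have "b summable_on UNIV" using b0 by (simp add: summable_on_UNIV_nonneg_real_iff)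
  then have "g summable_on Sigma UNIV (\<lambda>_. UNIV)" by (rule summable_on_SigmaI[OF b]) (simp_all add: g0)
  then show ?thesis by (simp add: g_def)
qed

lemma bnorm_finite_iff: "bnorm \<alpha> \<beta> \<phi> < \<infinity> \<longleftrightarrow> weighted_coeff \<alpha> \<beta> (coeffs2 \<phi>) summable_on UNIV"
  using bnorm_eq_infsum[of \<alpha> \<beta> \<phi>] summable_on_if_bnorm_finite[of \<alpha> \<beta> \<phi>] by auto

section \<open>Values of a double series on the closed bidisc\<close>

definition ev2 :: "complex fps fps \<Rightarrow> complex \<times> complex \<Rightarrow> complex"
  where "ev2 \<phi> p = (\<Sum>k. eval_fps (fps_nth \<phi> k) (snd p) * fst p ^ k)"

context
  fixes \<alpha> \<beta> :: real
  assumes \<alpha>: "0 \<le> \<alpha>" and \<beta>: "0 \<le> \<beta>"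
begin

lemma nth_pnorm_le_bnorm: "ennreal ((1 + real k) powr \<alpha>) * pnorm \<beta> (fps_nth \<phi> k) \<le> bnorm \<alpha> \<beta> \<phi>"
  unfolding wnorm_def[of \<alpha>]
  using sum_le_suminf[of "\<lambda>n. ennreal ((1 + real n) powr \<alpha>) * pnorm \<beta> (fps_nth \<phi> n)" "{k}"] by simp

lemma pnorm_le_weighted: "pnorm \<beta> F \<le> ennreal ((1 + real k) powr \<alpha>) * pnorm \<beta> F"
proof -
  have "1 * pnorm \<beta> F \<le> ennreal ((1 + real k) powr \<alpha>) * pnorm \<beta> F"
    using one_le_weight[OF \<alpha>, of k] by (intro mult_right_mono) (auto simp flip: ennreal_1 intro: ennreal_leI)
  then show ?thesis by simp
qed

lemma nth_pnorm_finite: "bnorm \<alpha> \<beta> \<phi> < \<infinity> \<Longrightarrow> pnorm \<beta> (fps_nth \<phi> k) < \<infinity>"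
  using order_trans[OF pnorm_le_weighted nth_pnorm_le_bnorm] by (rule order.strict_trans1)

lemma summable_pnorm_nth:
  assumes "bnorm \<alpha> \<beta> \<phi> < \<infinity>"
  shows "summable (\<lambda>k. enn2real (pnorm \<beta> (fps_nth \<phi> k)))"
proof (rule summable_suminf_not_top)
  have "(\<Sum>k. ennreal (enn2real (pnorm \<beta> (fps_nth \<phi> k)))) = (\<Sum>k. pnorm \<beta> (fps_nth \<phi> k))"
    using nth_pnorm_finite[OF assms] by simp
  also have "\<dots> \<le> bnorm \<alpha> \<beta> \<phi>" unfolding wnorm_def[of \<alpha>] by (intro suminf_le pnorm_le_weighted) auto
  finally show "(\<Sum>k. ennreal (enn2real (pnorm \<beta> (fps_nth \<phi> k)))) \<noteq> top" using assms by (auto simp: top_unique)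
qed simp

lemma eval_term_bound:
  assumes "bnorm \<alpha> \<beta> \<phi> < \<infinity>" "cmod z \<le> 1" "cmod w \<le> 1"
  shows "cmod (eval_fps (fps_nth \<phi> k) w * z ^ k) \<le> enn2real (pnorm \<beta> (fps_nth \<phi> k))"
proof -
  have "cmod (eval_fps (fps_nth \<phi> k) w) \<le> enn2real (pnorm \<beta> (fps_nth \<phi> k))"
    using enn2real_mono[OF eval_fps_norm_le_pnorm[OF \<beta> assms(3)]] nth_pnorm_finite[OF assms(1)] by simp
  moreover have "cmod (z ^ k) \<le> 1" using assms(2) by (simp add: norm_power power_le_one)
  ultimately have "cmod (eval_fps (fps_nth \<phi> k) w) * cmod (z ^ k) \<le> enn2real (pnorm \<beta> (fps_nth \<phi> k)) * 1"
    by (intro mult_mono) auto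
  then show ?thesis by (simp add: norm_mult)
qed

lemma summable_eval_terms:
  assumes "bnorm \<alpha> \<beta> \<phi> < \<infinity>" "cmod z \<le> 1" "cmod w \<le> 1"
  shows "summable (\<lambda>k. cmod (eval_fps (fps_nth \<phi> k) w * z ^ k))"
  by (rule summable_comparison_test'[OF summable_pnorm_nth[OF assms(1)]]) (use eval_term_bound[OF assms] in simp)

lemma ev2_sums:
  assumes "bnorm \<alpha> \<beta> \<phi> < \<infinity>" "cmod z \<le> 1" "cmod w \<le> 1"
  shows "(\<lambda>k. eval_fps (fps_nth \<phi> k) w * z ^ k) sums ev2 \<phi> (z, w)"
  unfolding ev2_def fst_conv snd_conv by (rule summable_sums[OF summable_norm_cancel[OF summable_eval_terms[OF assms]]])

lemma ev2_has_sum: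
  assumes \<phi>: "bnorm \<alpha> \<beta> \<phi> < \<infinity>" and z: "cmod z \<le> 1" and w: "cmod w \<le> 1"
  shows "((\<lambda>(n, m). coeffs2 \<phi> (n, m) * z ^ n * w ^ m) has_sum ev2 \<phi> (z, w)) UNIV"
proof -
  let ?f = "\<lambda>(n, m). coeffs2 \<phi> (n, m) * z ^ n * w ^ m"
  have ab: "(\<lambda>p. norm (?f p)) summable_on UNIV"
  proof (rule Infinite_Sum.abs_summable_on_comparison_test)
    show "(\<lambda>p. norm (weighted_coeff \<alpha> \<beta> (coeffs2 \<phi>) p)) summable_on UNIV"
      using summable_on_if_bnorm_finite[OF \<phi>] by (subst summable_on_iff_abs_summable_on_real[symmetric])
    fix p :: "nat \<times> nat"
    obtain n m where p: "p = (n, m)" by (cases p)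
    have "cmod (coeffs2 \<phi> (n, m) * z ^ n * w ^ m) \<le> cmod (coeffs2 \<phi> (n, m)) * (1 + real n) powr \<alpha> * (1 + real m) powr \<beta>"
      unfolding norm_mult norm_power
      using z w one_le_weight[OF \<alpha>, of n] one_le_weight[OF \<beta>, of m]
      by (intro mult_mono) (auto intro: order_trans[OF power_le_one] mult_nonneg_nonneg)
    then show "norm (?f p) \<le> norm (weighted_coeff \<alpha> \<beta> (coeffs2 \<phi>) p)" by (simp add: p weighted_coeff_def)
  qed
  then have hs: "(?f has_sum infsum ?f UNIV) (Sigma UNIV (\<lambda>_. UNIV))"
    using has_sum_infsum[OF Infinite_Sum.abs_summable_summable[OF ab]] by simp
  have "((\<lambda>n. eval_fps (fps_nth \<phi> n) w * z ^ n) has_sum infsum ?f UNIV) UNIV"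
  proof (rule has_sum_SigmaD[OF hs])
    fix n :: nat
    have S: "summable (\<lambda>m. norm (fps_nth (fps_nth \<phi> n) m * w ^ m))"
    proof (rule summable_comparison_test'[OF pnorm_finite_summable[OF nth_pnorm_finite[OF \<phi>] \<beta>]])
      show "norm (norm (fps_nth (fps_nth \<phi> n) m * w ^ m)) \<le> cmod (fps_nth (fps_nth \<phi> n) m)" for m
        using w by (simp add: norm_mult norm_power power_le_one mult_left_le)
    qed
    have "((\<lambda>m. fps_nth (fps_nth \<phi> n) m * w ^ m) has_sum eval_fps (fps_nth \<phi> n) w) UNIV"
      unfolding eval_fps_def by (rule norm_summable_imp_has_sum[OF S summable_sums[OF summable_norm_cancel[OF S]]])
    then have "((\<lambda>m. z ^ n * (fps_nth (fps_nth \<phi> n) m * w ^ m)) has_sum z ^ n * eval_fps (fps_nth \<phi> n) w) UNIV"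
      by (rule has_sum_cmult_right)
    then show "((\<lambda>m. ?f (n, m)) has_sum eval_fps (fps_nth \<phi> n) w * z ^ n) UNIV"
      by (simp add: coeffs2_def mult_ac)
  qed
  then have "infsum ?f UNIV = ev2 \<phi> (z, w)"
    using ev2_sums[OF \<phi> z w] by (auto dest: has_sum_imp_sums intro: sums_unique2)
  then show ?thesis using hs by simp
qed

lemma ev2_norm_le:
  assumes \<phi>: "bnorm \<alpha> \<beta> \<phi> < \<infinity>" and z: "cmod z \<le> 1" and w: "cmod w \<le> 1"
  shows "cmod (ev2 \<phi> (z, w)) \<le> enn2real (bnorm \<alpha> \<beta> \<phi>)"
proof -
  obtain F where F: "pnorm \<beta> F \<le> bnorm \<alpha> \<beta> \<phi>"
    "\<And>w. cmod w \<le> 1 \<Longrightarrow> (\<lambda>k. eval_fps (fps_nth \<phi> k) w * z ^ k) sums eval_fps F w"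
    using slice_exists[OF \<alpha> \<beta> \<phi> z] by blast
  have "ev2 \<phi> (z, w) = eval_fps F w" using sums_unique2[OF ev2_sums[OF \<phi> z w] F(2)[OF w]] .
  then have "ennreal (cmod (ev2 \<phi> (z, w))) \<le> bnorm \<alpha> \<beta> \<phi>"
    using order_trans[OF eval_fps_norm_le_pnorm[OF \<beta> w] F(1)] by simp
  from enn2real_mono[OF this] show ?thesis using \<phi> by simp
qed

lemma continuous_on_ev2:
  assumes \<phi>: "bnorm \<alpha> \<beta> \<phi> < \<infinity>"
  shows "continuous_on (cdisc \<times> cdisc) (ev2 \<phi>)"
proof -
  have ce: "continuous_on cdisc (eval_fps (fps_nth \<phi> k))" for k
  proof -
    have "uniform_limit cdisc (\<lambda>n w. \<Sum>i<n. fps_nth (fps_nth \<phi> k) i * w ^ i) (eval_fps (fps_nth \<phi> k)) sequentially"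
      unfolding eval_fps_def[abs_def]
    proof (rule Weierstrass_m_test)
      show "summable (\<lambda>i. cmod (fps_nth (fps_nth \<phi> k) i))"
        by (rule pnorm_finite_summable[OF nth_pnorm_finite[OF \<phi>] \<beta>])
      show "norm (fps_nth (fps_nth \<phi> k) i * w ^ i) \<le> cmod (fps_nth (fps_nth \<phi> k) i)" if "w \<in> cdisc" for i w
        using that by (simp add: norm_mult norm_power power_le_one mult_left_le)
    qed
    then show ?thesis
      by (rule uniform_limit_theorem[rotated]) (auto intro!: always_eventually continuous_intros)
  qed
  have "uniform_limit (cdisc \<times> cdisc) (\<lambda>n p. \<Sum>k<n. eval_fps (fps_nth \<phi> k) (snd p) * fst p ^ k) (ev2 \<phi>) sequentially"
    unfolding ev2_def[abs_def]
    by (rule Weierstrass_m_test[OF _ summable_pnorm_nth[OF \<phi>]]) (auto intro: eval_term_bound[OF \<phi>])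
  then show ?thesis
    by (rule uniform_limit_theorem[rotated])
      (auto intro!: always_eventually continuous_intros continuous_on_compose2[OF ce])
qed

lemma ev2_diff:
  assumes "bnorm \<alpha> \<beta> \<phi> < \<infinity>" "bnorm \<alpha> \<beta> \<sigma> < \<infinity>" "cmod z \<le> 1" "cmod w \<le> 1"
  shows "ev2 (\<phi> - \<sigma>) (z, w) = ev2 \<phi> (z, w) - ev2 \<sigma> (z, w)"
proof -
  have "eval_fps (fps_nth (\<phi> - \<sigma>) k) w * z ^ k = eval_fps (fps_nth \<phi> k) w * z ^ k - eval_fps (fps_nth \<sigma> k) w * z ^ k" for k
    using eval_fps_diff_pnorm[OF nth_pnorm_finite[OF assms(1)] nth_pnorm_finite[OF assms(2)] \<beta> assms(4)]
    by (simp add: left_diff_distrib)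
  then show ?thesis
    using sums_unique[OF sums_diff[OF ev2_sums[OF assms(1,3,4)] ev2_sums[OF assms(2,3,4)]]]
    by (simp add: ev2_def)
qed

text \<open>A Cauchy product in z, whose coefficients are products in w. The latter are evaluated by
  \<open>eval_fps_mult\<close> strictly inside the disc of convergence, hence the open bidisc; the
  closed one is reached later by continuity.\<close>

lemma ev2_mult:
  assumes "bnorm \<alpha> \<beta> \<phi> < \<infinity>" "bnorm \<alpha> \<beta> \<sigma> < \<infinity>" "cmod z < 1" "cmod w < 1"
  shows "ev2 (\<phi> * \<sigma>) (z, w) = ev2 \<phi> (z, w) * ev2 \<sigma> (z, w)"
proof -
  interpret w: complete_algebra_norm "pnorm \<beta>" fps_const by (rule pnorm_complete_algebra_norm[OF \<beta>])
  have z: "cmod z \<le> 1" and w: "cmod w \<le> 1" using assms by auto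
  have cr: "ereal (cmod w) < fps_conv_radius (fps_nth \<psi> k)" if "bnorm \<alpha> \<beta> \<psi> < \<infinity>" for \<psi> k
    using fps_conv_radius_ge_1[OF pnorm_finite_summable[OF nth_pnorm_finite[OF that] \<beta>], of k] assms(4)
    by (auto intro: less_le_trans[of _ 1])
  have "(\<lambda>k. \<Sum>i\<le>k. (eval_fps (fps_nth \<phi> i) w * z ^ i) * (eval_fps (fps_nth \<sigma> (k - i)) w * z ^ (k - i))) sums
      (ev2 \<phi> (z, w) * ev2 \<sigma> (z, w))"
    using Cauchy_product_sums[OF summable_eval_terms[OF assms(1) z w] summable_eval_terms[OF assms(2) z w]]
    by (simp add: ev2_def)
  moreover have "(\<Sum>i\<le>k. (eval_fps (fps_nth \<phi> i) w * z ^ i) * (eval_fps (fps_nth \<sigma> (k - i)) w * z ^ (k - i))) =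
      eval_fps (fps_nth (\<phi> * \<sigma>) k) w * z ^ k" for k
  proof -
    have fin: "pnorm \<beta> (fps_nth \<phi> i * fps_nth \<sigma> (k - i)) < \<infinity>" for i
      using w.carr_mult[of "fps_nth \<phi> i" "fps_nth \<sigma> (k - i)"] nth_pnorm_finite[OF assms(1)] nth_pnorm_finite[OF assms(2)]
      by (simp add: w.carr_def)
    have "eval_fps (fps_nth (\<phi> * \<sigma>) k) w = (\<Sum>i=0..k. eval_fps (fps_nth \<phi> i * fps_nth \<sigma> (k - i)) w)"
      unfolding fps_mult_nth[of \<phi>] by (rule eval_fps_sum_pnorm[OF fin \<beta> w])
    also have "\<dots> = (\<Sum>i=0..k. eval_fps (fps_nth \<phi> i) w * eval_fps (fps_nth \<sigma> (k - i)) w)"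
      by (intro sum.cong refl eval_fps_mult cr assms)
    finally have "eval_fps (fps_nth (\<phi> * \<sigma>) k) w * z ^ k =
        (\<Sum>i=0..k. eval_fps (fps_nth \<phi> i) w * eval_fps (fps_nth \<sigma> (k - i)) w * z ^ k)" by (simp add: sum_distrib_right)
    also have "\<dots> = (\<Sum>i\<le>k. (eval_fps (fps_nth \<phi> i) w * z ^ i) * (eval_fps (fps_nth \<sigma> (k - i)) w * z ^ (k - i)))"
    proof (rule sum.cong)
      fix i assume "i \<in> {..k}"
      then have "z ^ k = z ^ i * z ^ (k - i)" by (simp flip: power_add)
      then show "eval_fps (fps_nth \<phi> i) w * eval_fps (fps_nth \<sigma> (k - i)) w * z ^ k =
          (eval_fps (fps_nth \<phi> i) w * z ^ i) * (eval_fps (fps_nth \<sigma> (k - i)) w * z ^ (k - i))" by simp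
    qed auto
    finally show ?thesis by simp
  qed
  ultimately show ?thesis by (simp add: ev2_def sums_iff)
qed

end

section \<open>Uniqueness of coefficients and representation of functions by double series\<close>

lemma power_series_zero:
  fixes d :: "nat \<Rightarrow> complex"
  assumes "\<And>z. cmod z < 1 \<Longrightarrow> (\<lambda>n. d n * z ^ n) sums 0"
  shows "d n = 0"
proof -
  have "conv_radius d \<ge> ereal (norm (1 / 2 :: complex))"
    by (rule conv_radius_geI) (use assms[of "1 / 2"] in \<open>simp add: sums_iff\<close>)
  moreover have "fps_nth (Abs_fps d) = d" by (rule ext) simp
  moreover have "0 < ereal (norm (1 / 2 :: complex))" by simp
  ultimately have cr: "fps_conv_radius (Abs_fps d) > 0"
    unfolding fps_conv_radius_def by (metis less_le_trans)
  have "Abs_fps d = 0"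
  proof (rule eval_fps_eqD[OF cr])
    show "\<forall>\<^sub>F z in nhds 0. eval_fps (Abs_fps d) z = eval_fps 0 z"
      using assms by (auto simp: eventually_nhds_metric eval_fps_def sums_iff intro!: exI[of _ 1])
  qed simp
  then show ?thesis by (metis fps_nth_Abs_fps fps_zero_nth)
qed

text \<open>The one-variable identity theorem twice, in z for fixed w and then in w. Summability at
  z = 1/2 gives summability of each inner series, since the factor (1/2)^n can be divided
  out.\<close>

lemma has_power_series2_unique:
  assumes "has_power_series2 f a" "has_power_series2 f b"
  shows "a = b"
proof -
  define d where "d p = a p - b p" for p
  have d: "((\<lambda>(n, m). d (n, m) * z ^ n * w ^ m) has_sum 0) (Sigma UNIV (\<lambda>_. UNIV))" if "z \<in> disc" "w \<in> disc" for z w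
  proof -
    have "((\<lambda>p. (case p of (n, m) \<Rightarrow> a (n, m) * z ^ n * w ^ m) + (- 1) * (case p of (n, m) \<Rightarrow> b (n, m) * z ^ n * w ^ m)) has_sum
        (f (z, w) + (- 1) * f (z, w))) UNIV"
      using assms that unfolding has_power_series2_def by (intro has_sum_add has_sum_cmult_right) auto
    moreover have "(case p of (n, m) \<Rightarrow> a (n, m) * z ^ n * w ^ m) + (- 1) * (case p of (n, m) \<Rightarrow> b (n, m) * z ^ n * w ^ m) =
        (case p of (n, m) \<Rightarrow> d (n, m) * z ^ n * w ^ m)" for p
      by (cases p) (simp add: d_def left_diff_distrib)
    ultimately show ?thesis by simp
  qed
  have inner: "(\<lambda>m. d (n, m) * w ^ m) summable_on UNIV" if w: "w \<in> disc" for n w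
  proof -
    have "(\<lambda>(x, y). d (x, y) * (1 / 2) ^ x * w ^ y) summable_on Sigma UNIV (\<lambda>_. UNIV)"
      using d[of "1 / 2" w] w by (auto simp: summable_on_def)
    then have "(\<lambda>m. d (n, m) * (1 / 2) ^ n * w ^ m) summable_on UNIV" by (rule summable_on_SigmaD1) simp
    then have "(\<lambda>m. 2 ^ n * (d (n, m) * (1 / 2) ^ n * w ^ m)) summable_on UNIV" by (rule summable_on_cmult_right)
    moreover have "2 ^ n * (d (n, m) * (1 / 2) ^ n * w ^ m) = d (n, m) * w ^ m" for m
      by (simp add: power_divide)
    ultimately show ?thesis by simp
  qed
  define c where "c n w = infsum (\<lambda>m. d (n, m) * w ^ m) UNIV" for n w
  have c: "((\<lambda>m. d (n, m) * w ^ m) has_sum c n w) UNIV" if "w \<in> disc" for n w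
    unfolding c_def by (rule has_sum_infsum[OF inner[OF that]])
  have c0: "c n w = 0" if w: "w \<in> disc" for n w
  proof (rule power_series_zero)
    fix z :: complex assume z: "cmod z < 1"
    have "((\<lambda>n. c n w * z ^ n) has_sum 0) UNIV"
    proof (rule has_sum_SigmaD[OF d[of z w]])
      fix n :: nat
      have "((\<lambda>m. z ^ n * (d (n, m) * w ^ m)) has_sum z ^ n * c n w) UNIV" by (rule has_sum_cmult_right[OF c[OF w]])
      then show "((\<lambda>m. case (n, m) of (n, m) \<Rightarrow> d (n, m) * z ^ n * w ^ m) has_sum c n w * z ^ n) UNIV"
        by (simp add: mult_ac)
    qed (use z w in auto)
    then show "(\<lambda>n. c n w * z ^ n) sums 0" by (rule has_sum_imp_sums)
  qed
  have "d (n, m) = 0" for n m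
    by (rule power_series_zero[of "\<lambda>m. d (n, m)"]) (use c[of _ n] c0[of _ n] in \<open>auto dest: has_sum_imp_sums\<close>)
  then show ?thesis by (auto simp: d_def fun_eq_iff)
qed

lemma power_series_coeff2_eq: "has_power_series2 f a \<Longrightarrow> power_series_coeff2 f = a"
  unfolding power_series_coeff2_def using has_power_series2_unique by blast

text \<open>One sequence serves both functions, so that equalities and bounds pass from the open to
  the closed bidisc.\<close>

lemma scaled_to_closed_bidisc:
  assumes F: "continuous_on (cdisc \<times> cdisc) F" and G: "continuous_on (cdisc \<times> cdisc) G"
    and z: "z \<in> cdisc" and w: "w \<in> cdisc"
  obtains s where "\<And>n. fst (s n) \<in> disc" "\<And>n. snd (s n) \<in> disc" "(\<lambda>n. F (s n)) \<longlonglongrightarrow> F (z, w)" "(\<lambda>n. G (s n)) \<longlonglongrightarrow> G (z, w)"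
proof -
  define r where "r n = 1 - 1 / (real n + 2)" for n
  have r: "0 \<le> r n" "r n < 1" for n by (auto simp: r_def field_simps)
  have "(\<lambda>n. 1 - 1 / (real n + 2)) \<longlonglongrightarrow> 1" by real_asymp
  then have rl: "r \<longlonglongrightarrow> 1" by (simp add: r_def[abs_def])
  have in_disc: "of_real (r n) * x \<in> disc" if "x \<in> cdisc" for n x
  proof -
    have "r n * cmod x \<le> r n * 1" using r(1)[of n] that by (intro mult_left_mono) auto
    then show ?thesis using r[of n] by (simp add: norm_mult)
  qed
  define s where "s n = (of_real (r n) * z, of_real (r n) * w)" for n
  have "s \<longlonglongrightarrow> (of_real 1 * z, of_real 1 * w)" unfolding s_def by (intro tendsto_intros rl)
  then have sl: "s \<longlonglongrightarrow> (z, w)" by simp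
  have sc: "\<forall>\<^sub>F n in sequentially. s n \<in> cdisc \<times> cdisc"
    using in_disc[OF z] in_disc[OF w] by (auto simp: s_def intro!: always_eventually less_imp_le)
  show ?thesis
    by (rule that[of s])
      (use in_disc[OF z] in_disc[OF w] z w in \<open>auto simp: s_def[symmetric] intro!: continuous_on_tendsto_compose[OF F sl _ sc] continuous_on_tendsto_compose[OF G sl _ sc]\<close>, simp_all add: s_def)
qed

lemma Aplus_representation:
  assumes \<alpha>: "0 \<le> \<alpha>" and \<beta>: "0 \<le> \<beta>" and f: "f \<in> Aplus \<alpha> \<beta>"
  obtains \<phi> where "bnorm \<alpha> \<beta> \<phi> < \<infinity>" "\<And>z w. z \<in> cdisc \<Longrightarrow> w \<in> cdisc \<Longrightarrow> f (z, w) = ev2 \<phi> (z, w)"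
proof -
  obtain a where a: "has_power_series2 f a" "weighted_coeff \<alpha> \<beta> a summable_on UNIV" and fb: "f \<in> bidisc_algebra"
    using f by (auto simp: Aplus_def)
  define \<phi> where "\<phi> = to_fps2 a"
  have \<phi>: "bnorm \<alpha> \<beta> \<phi> < \<infinity>" using a(2) unfolding bnorm_finite_iff \<phi>_def coeffs2_to_fps2 .
  have eq: "f (z, w) = ev2 \<phi> (z, w)" if "z \<in> disc" "w \<in> disc" for z w
  proof -
    have "((\<lambda>(n, m). a (n, m) * z ^ n * w ^ m) has_sum f (z, w)) UNIV"
      using a(1) that unfolding has_power_series2_def by blast
    moreover have "((\<lambda>(n, m). a (n, m) * z ^ n * w ^ m) has_sum ev2 \<phi> (z, w)) UNIV"
      using ev2_has_sum[OF \<alpha> \<beta> \<phi>, of z w] that by (simp add: \<phi>_def)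
    ultimately show ?thesis by (rule has_sum_unique)
  qed
  show ?thesis
  proof (rule that[OF \<phi>])
    fix z w assume zw: "z \<in> cdisc" "w \<in> cdisc"
    have fc: "continuous_on (cdisc \<times> cdisc) f" using fb by (simp add: bidisc_algebra_def)
    obtain s where s: "\<And>n. fst (s n) \<in> disc" "\<And>n. snd (s n) \<in> disc" "(\<lambda>n. f (s n)) \<longlonglongrightarrow> f (z, w)"
      "(\<lambda>n. ev2 \<phi> (s n)) \<longlonglongrightarrow> ev2 \<phi> (z, w)"
      using scaled_to_closed_bidisc[OF fc continuous_on_ev2[OF \<alpha> \<beta> \<phi>] zw] by blast
    have "f (s n) = ev2 \<phi> (s n)" for n using eq[OF s(1)[of n] s(2)[of n]] by simp
    then show "f (z, w) = ev2 \<phi> (z, w)" using LIMSEQ_unique[OF s(3)] s(4) by simp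
  qed
qed

text \<open>The condition of \<open>holomorphic2_on\<close> at a single point, isolated to obtain
  closure rules sufficient for polynomials.\<close>

definition complex_differentiable2 :: "(complex \<times> complex \<Rightarrow> complex) \<Rightarrow> complex \<times> complex \<Rightarrow> (complex \<times> complex) set \<Rightarrow> bool"
  where "complex_differentiable2 g p S \<longleftrightarrow> (\<exists>a b. (g has_derivative (\<lambda>(u, v). a * u + b * v)) (at p within S))"

lemma complex_differentiable2_const: "complex_differentiable2 (\<lambda>_. c) p S"
proof -
  have "((\<lambda>_. c) has_derivative (\<lambda>_. 0)) (at p within S)" by (rule has_derivative_const)
  moreover have "(\<lambda>_. 0) = (\<lambda>(u, v). (0::complex) * u + (0::complex) * v)" by auto
  ultimately show ?thesis unfolding complex_differentiable2_def by metis
qed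

lemma complex_differentiable2_fst: "complex_differentiable2 fst p S"
  unfolding complex_differentiable2_def
  by (intro exI[of _ 1] exI[of _ 0]) (auto intro!: derivative_eq_intros)

lemma complex_differentiable2_snd: "complex_differentiable2 snd p S"
  unfolding complex_differentiable2_def
  by (intro exI[of _ 0] exI[of _ 1]) (auto intro!: derivative_eq_intros)

lemma complex_differentiable2_add:
  assumes "complex_differentiable2 g p S" "complex_differentiable2 h p S"
  shows "complex_differentiable2 (\<lambda>p. g p + h p) p S"
proof -
  obtain a b c d where g: "(g has_derivative (\<lambda>(u, v). a * u + b * v)) (at p within S)"
    and h: "(h has_derivative (\<lambda>(u, v). c * u + d * v)) (at p within S)"
    using assms unfolding complex_differentiable2_def by blast
  have e: "(\<lambda>x. (case x of (u, v) \<Rightarrow> a * u + b * v) + (case x of (u, v) \<Rightarrow> c * u + d * v)) =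
      (\<lambda>(u, v). (a + c) * u + (b + d) * v)" by (auto simp: algebra_simps)
  show ?thesis unfolding complex_differentiable2_def using has_derivative_add[OF g h] unfolding e by blast
qed

lemma complex_differentiable2_mult:
  assumes "complex_differentiable2 g p S" "complex_differentiable2 h p S"
  shows "complex_differentiable2 (\<lambda>p. g p * h p) p S"
proof -
  obtain a b c d where g: "(g has_derivative (\<lambda>(u, v). a * u + b * v)) (at p within S)"
    and h: "(h has_derivative (\<lambda>(u, v). c * u + d * v)) (at p within S)"
    using assms unfolding complex_differentiable2_def by blast
  have e: "(\<lambda>x. g p * (case x of (u, v) \<Rightarrow> c * u + d * v) + (case x of (u, v) \<Rightarrow> a * u + b * v) * h p) =
      (\<lambda>(u, v). (g p * c + a * h p) * u + (g p * d + b * h p) * v)" by (auto simp: algebra_simps)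
  show ?thesis unfolding complex_differentiable2_def using has_derivative_mult[OF g h] unfolding e by blast
qed

lemma complex_differentiable2_power:
  "complex_differentiable2 g p S \<Longrightarrow> complex_differentiable2 (\<lambda>p. g p ^ n) p S"
  by (induction n) (simp_all add: complex_differentiable2_const complex_differentiable2_mult)

lemma complex_differentiable2_sum:
  "(\<And>i. i \<in> I \<Longrightarrow> complex_differentiable2 (g i) p S) \<Longrightarrow> complex_differentiable2 (\<lambda>p. \<Sum>i\<in>I. g i p) p S"
  by (induction I rule: infinite_finite_induct)
    (simp_all add: complex_differentiable2_const complex_differentiable2_add)

section \<open>Polynomials in two variables and their density\<close>

definition restrict_coeffs :: "(nat \<times> nat) set \<Rightarrow> (nat \<times> nat \<Rightarrow> complex) \<Rightarrow> complex fps fps"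
  where "restrict_coeffs F c = to_fps2 (\<lambda>q. if q \<in> F then c q else 0)"

text \<open>Cut off outside the closed bidisc, as membership in \<open>bidisc_algebra\<close>
  demands.\<close>

definition bidisc_polynomial :: "(nat \<times> nat) set \<Rightarrow> (nat \<times> nat \<Rightarrow> complex) \<Rightarrow> complex \<times> complex \<Rightarrow> complex"
  where "bidisc_polynomial F c p =
    (if p \<in> cdisc \<times> cdisc then \<Sum>q\<in>F. c q * fst p ^ fst q * snd p ^ snd q else 0)"

lemma weighted_restrict_coeffs:
  "weighted_coeff \<alpha> \<beta> (coeffs2 (restrict_coeffs F c)) = (\<lambda>q. if q \<in> F then weighted_coeff \<alpha> \<beta> c q else 0)"
  by (auto simp: restrict_coeffs_def weighted_coeff_def fun_eq_iff)

lemma bnorm_restrict_coeffs_finite: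
  assumes "finite F"
  shows "bnorm \<alpha> \<beta> (restrict_coeffs F c) < \<infinity>"
  unfolding bnorm_finite_iff weighted_restrict_coeffs
  by (rule summable_on_cong_neutral[THEN iffD1, OF _ _ _ summable_on_finite[OF assms, of "\<lambda>q. weighted_coeff \<alpha> \<beta> c q"]]) auto

lemma bidisc_polynomial_has_power_series2:
  assumes F: "finite F"
  shows "has_power_series2 (bidisc_polynomial F c) (coeffs2 (restrict_coeffs F c))"
  unfolding has_power_series2_def
proof (intro ballI)
  fix z w :: complex assume zw: "z \<in> disc" "w \<in> disc"
  have "((\<lambda>q. c q * z ^ fst q * w ^ snd q) has_sum (\<Sum>q\<in>F. c q * z ^ fst q * w ^ snd q)) F"
    by (rule has_sum_finite[OF F])
  then have "((\<lambda>(n, m). coeffs2 (restrict_coeffs F c) (n, m) * z ^ n * w ^ m) has_sum (\<Sum>q\<in>F. c q * z ^ fst q * w ^ snd q)) UNIV"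
    by (rule has_sum_cong_neutral[THEN iffD1, rotated -1]) (auto simp: restrict_coeffs_def)
  moreover have "bidisc_polynomial F c (z, w) = (\<Sum>q\<in>F. c q * z ^ fst q * w ^ snd q)"
    using zw by (simp add: bidisc_polynomial_def less_imp_le)
  ultimately show "((\<lambda>(n, m). coeffs2 (restrict_coeffs F c) (n, m) * z ^ n * w ^ m) has_sum bidisc_polynomial F c (z, w)) UNIV"
    by simp
qed

lemma bidisc_polynomial_in_Aplus:
  assumes F: "finite F"
  shows "bidisc_polynomial F c \<in> Aplus \<alpha> \<beta>"
proof -
  define g where "g p = (\<Sum>q\<in>F. c q * fst p ^ fst q * snd p ^ snd q)" for p :: "complex \<times> complex"
  have "continuous_on (cdisc \<times> cdisc) g" unfolding g_def by (intro continuous_intros)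
  then have 1: "continuous_on (cdisc \<times> cdisc) (bidisc_polynomial F c)"
    by (rule continuous_on_eq) (simp add: bidisc_polynomial_def g_def)
  have 2: "holomorphic2_on (bidisc_polynomial F c) (disc \<times> disc)"
    unfolding holomorphic2_on_def
  proof
    fix p assume p: "p \<in> disc \<times> disc"
    have "complex_differentiable2 g p (disc \<times> disc)"
      unfolding g_def
      by (intro complex_differentiable2_sum complex_differentiable2_mult complex_differentiable2_const
          complex_differentiable2_power complex_differentiable2_fst complex_differentiable2_snd)
    then obtain a b where "(g has_derivative (\<lambda>(u, v). a * u + b * v)) (at p within disc \<times> disc)"
      unfolding complex_differentiable2_def by blast
    then have "(bidisc_polynomial F c has_derivative (\<lambda>(u, v). a * u + b * v)) (at p within disc \<times> disc)"
      by (rule has_derivative_transform[OF p, rotated]) (auto simp: bidisc_polynomial_def g_def)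
    then show "\<exists>a b. (bidisc_polynomial F c has_derivative (\<lambda>(u, v). a * u + b * v)) (at p within disc \<times> disc)" by blast
  qed
  have 3: "weighted_coeff \<alpha> \<beta> (coeffs2 (restrict_coeffs F c)) summable_on UNIV"
    using bnorm_restrict_coeffs_finite[OF F] unfolding bnorm_finite_iff .
  show ?thesis unfolding Aplus_def bidisc_algebra_def
    using 1 2 3 bidisc_polynomial_has_power_series2[OF F, of c] by (auto simp: bidisc_polynomial_def)
qed

lemma finite_restriction_dense:
  assumes \<sigma>: "bnorm \<alpha> \<beta> \<sigma> < \<infinity>" and e: "0 < e"
  obtains F where "finite F" "bnorm \<alpha> \<beta> (\<sigma> - restrict_coeffs F (coeffs2 \<sigma>)) < ennreal e"
proof -
  define g where "g = weighted_coeff \<alpha> \<beta> (coeffs2 \<sigma>)"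
  have S: "g summable_on UNIV" unfolding g_def by (rule summable_on_if_bnorm_finite[OF \<sigma>])
  obtain F where F: "finite F" "dist (sum g F) (infsum g UNIV) \<le> e / 2"
    using infsum_finite_approximation[OF S, of "e / 2"] e by auto
  have "(g has_sum (infsum g UNIV - sum g F)) (UNIV - F)"
    by (intro has_sum_Diff has_sum_infsum S has_sum_finite F) auto
  then have hs: "((\<lambda>q. if q \<in> F then 0 else g q) has_sum (infsum g UNIV - sum g F)) UNIV"
    by (rule has_sum_cong_neutral[THEN iffD1, rotated -1]) auto
  have eq: "weighted_coeff \<alpha> \<beta> (coeffs2 (\<sigma> - restrict_coeffs F (coeffs2 \<sigma>))) = (\<lambda>q. if q \<in> F then 0 else g q)"
    by (auto simp: g_def weighted_coeff_def coeffs2_def restrict_coeffs_def to_fps2_def fun_eq_iff)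
  have "bnorm \<alpha> \<beta> (\<sigma> - restrict_coeffs F (coeffs2 \<sigma>)) = ennreal (infsum g UNIV - sum g F)"
    using bnorm_eq_infsum[of \<alpha> \<beta> "\<sigma> - restrict_coeffs F (coeffs2 \<sigma>)"] hs unfolding eq
    by (auto simp: summable_on_def infsumI)
  also have "infsum g UNIV - sum g F < e" using F(2) e unfolding dist_real_def by linarith
  then have "ennreal (infsum g UNIV - sum g F) < ennreal e" by (intro ennreal_lessI e)
  finally show ?thesis using F(1) by (rule that[rotated])
qed

lemma restrict_coeffs_eq_sum:
  assumes "finite F"
  shows "restrict_coeffs F c = (\<Sum>q\<in>F. fps_const (fps_const (c q)) * (fps_X ^ fst q * fps_const (fps_X ^ snd q)))"
proof (intro fps_ext)
  fix n m
  have "fps_nth (fps_nth (fps_const (fps_const (c q)) * (fps_X ^ fst q * fps_const (fps_X ^ snd q))) n) m =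
      (if q = (n, m) then c q else 0)" for q
    by (cases q) auto
  then have "fps_nth (fps_nth (\<Sum>q\<in>F. fps_const (fps_const (c q)) * (fps_X ^ fst q * fps_const (fps_X ^ snd q))) n) m =
      (\<Sum>q\<in>F. if q = (n, m) then c q else 0)" by (simp only: fps_sum_nth)
  also have "\<dots> = (if (n, m) \<in> F then c (n, m) else 0)" using assms by simp
  finally show "fps_nth (fps_nth (restrict_coeffs F c) n) m =
      fps_nth (fps_nth (\<Sum>q\<in>F. fps_const (fps_const (c q)) * (fps_X ^ fst q * fps_const (fps_X ^ snd q))) n) m"
    by (simp add: restrict_coeffs_def to_fps2_def)
qed

text \<open>g - f s is the expression in the definition of the closed ideal. Its coefficients are
  identified on the open bidisc and are unique, which gives the norm. The norm dominates the values
  on the open bidisc and, by continuity, on the closed one.\<close>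

lemma Aplus_norm_difference:
  assumes \<alpha>: "0 \<le> \<alpha>" and \<beta>: "0 \<le> \<beta>"
    and fin: "bnorm \<alpha> \<beta> \<phi> < \<infinity>" "bnorm \<alpha> \<beta> \<gamma> < \<infinity>" "bnorm \<alpha> \<beta> \<sigma> < \<infinity>"
    and f: "\<And>z w. z \<in> cdisc \<Longrightarrow> w \<in> cdisc \<Longrightarrow> f (z, w) = ev2 \<phi> (z, w)"
    and g: "\<And>z w. z \<in> cdisc \<Longrightarrow> w \<in> cdisc \<Longrightarrow> g (z, w) = ev2 \<gamma> (z, w)"
    and s: "\<And>z w. z \<in> cdisc \<Longrightarrow> w \<in> cdisc \<Longrightarrow> s (z, w) = ev2 \<sigma> (z, w)"
  shows "Aplus_norm \<alpha> \<beta> (\<lambda>p. g p - f p * s p) = enn2real (bnorm \<alpha> \<beta> (\<gamma> - \<phi> * \<sigma>))"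
    and "z \<in> cdisc \<Longrightarrow> w \<in> cdisc \<Longrightarrow> cmod (g (z, w) - f (z, w) * s (z, w)) \<le> Aplus_norm \<alpha> \<beta> (\<lambda>p. g p - f p * s p)"
proof -
  interpret B: complete_algebra_norm "bnorm \<alpha> \<beta>" "\<lambda>c. fps_const (fps_const c)"
    by (rule bnorm_complete_algebra_norm[OF \<alpha> \<beta>])
  have pf: "bnorm \<alpha> \<beta> (\<phi> * \<sigma>) < \<infinity>" using B.carr_mult[of \<phi> \<sigma>] fin by (simp add: B.carr_def)
  have df: "bnorm \<alpha> \<beta> (\<gamma> - \<phi> * \<sigma>) < \<infinity>" using B.carr_diff[of \<gamma> "\<phi> * \<sigma>"] fin pf by (simp add: B.carr_def)
  have eq: "g (z, w) - f (z, w) * s (z, w) = ev2 (\<gamma> - \<phi> * \<sigma>) (z, w)" if "z \<in> disc" "w \<in> disc" for z w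
    using that ev2_diff[OF \<alpha> \<beta> fin(2) pf, of z w] ev2_mult[OF \<alpha> \<beta> fin(1,3), of z w] f[of z w] g[of z w] s[of z w] by simp
  have "has_power_series2 (\<lambda>p. g p - f p * s p) (coeffs2 (\<gamma> - \<phi> * \<sigma>))"
    unfolding has_power_series2_def
  proof (intro ballI)
    fix z w :: complex assume zw: "z \<in> disc" "w \<in> disc"
    show "((\<lambda>(n, m). coeffs2 (\<gamma> - \<phi> * \<sigma>) (n, m) * z ^ n * w ^ m) has_sum g (z, w) - f (z, w) * s (z, w)) UNIV"
      unfolding eq[OF zw] using ev2_has_sum[OF \<alpha> \<beta> df, of z w] zw by simp
  qed
  then have "Aplus_norm \<alpha> \<beta> (\<lambda>p. g p - f p * s p) = (\<Sum>\<^sub>\<infinity>p. weighted_coeff \<alpha> \<beta> (coeffs2 (\<gamma> - \<phi> * \<sigma>)) p)"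
    by (simp add: Aplus_norm_def power_series_coeff2_eq)
  also have "\<dots> = enn2real (bnorm \<alpha> \<beta> (\<gamma> - \<phi> * \<sigma>))"
    unfolding bnorm_eq_infsum[OF summable_on_if_bnorm_finite[OF df]]
    by (rule enn2real_ennreal[symmetric], rule infsum_nonneg, rule weighted_coeff_nonneg)
  finally show N: "Aplus_norm \<alpha> \<beta> (\<lambda>p. g p - f p * s p) = enn2real (bnorm \<alpha> \<beta> (\<gamma> - \<phi> * \<sigma>))" .
  show "cmod (g (z, w) - f (z, w) * s (z, w)) \<le> Aplus_norm \<alpha> \<beta> (\<lambda>p. g p - f p * s p)" if zw: "z \<in> cdisc" "w \<in> cdisc"
  proof -
    define D where "D p = ev2 \<gamma> p - ev2 \<phi> p * ev2 \<sigma> p" for p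
    have cD: "continuous_on (cdisc \<times> cdisc) D"
      unfolding D_def by (intro continuous_intros continuous_on_ev2[OF \<alpha> \<beta>] fin)
    obtain t where t: "\<And>n. fst (t n) \<in> disc" "\<And>n. snd (t n) \<in> disc"
      "(\<lambda>n. D (t n)) \<longlonglongrightarrow> D (z, w)" "(\<lambda>n. D (t n)) \<longlonglongrightarrow> D (z, w)"
      by (rule scaled_to_closed_bidisc[OF cD cD zw]) (rule that)
    have "cmod (D (t n)) \<le> enn2real (bnorm \<alpha> \<beta> (\<gamma> - \<phi> * \<sigma>))" for n
    proof -
      have "D (fst (t n), snd (t n)) = ev2 (\<gamma> - \<phi> * \<sigma>) (fst (t n), snd (t n))"
        using eq[OF t(1)[of n] t(2)[of n]] f[of "fst (t n)" "snd (t n)"] g[of "fst (t n)" "snd (t n)"] s[of "fst (t n)" "snd (t n)"]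
          t(1)[of n] t(2)[of n] by (simp add: D_def)
      then show ?thesis using ev2_norm_le[OF \<alpha> \<beta> df, of "fst (t n)" "snd (t n)"] t(1)[of n] t(2)[of n] by simp
    qed
    then have "cmod (D (z, w)) \<le> enn2real (bnorm \<alpha> \<beta> (\<gamma> - \<phi> * \<sigma>))"
      by (intro LIMSEQ_le_const2[OF tendsto_norm[OF t(3)]]) auto
    then show ?thesis using f[OF zw] g[OF zw] s[OF zw] N by (simp add: D_def)
  qed
qed

text \<open>In z the slice is a power series whose coefficients are evaluated at w = 1. In w it is
  the element of the second-variable algebra that \<open>slice_exists\<close> gives at z =
  1.\<close>

lemma Aplus_slices:
  assumes \<alpha>: "0 \<le> \<alpha>" and \<beta>: "0 \<le> \<beta>" and s: "s \<in> Aplus \<alpha> \<beta>"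
  shows "continuous_on cdisc (\<lambda>z. s (z, 1))" "(\<lambda>z. s (z, 1)) holomorphic_on disc"
    "continuous_on cdisc (\<lambda>w. s (1, w))" "(\<lambda>w. s (1, w)) holomorphic_on disc"
proof -
  have c: "continuous_on (cdisc \<times> cdisc) s" using s by (simp add: Aplus_def bidisc_algebra_def)
  show "continuous_on cdisc (\<lambda>z. s (z, 1))" "continuous_on cdisc (\<lambda>w. s (1, w))"
    by (auto intro!: continuous_on_compose2[OF c] continuous_intros)
  obtain \<sigma> where \<sigma>: "bnorm \<alpha> \<beta> \<sigma> < \<infinity>" "\<And>z w. z \<in> cdisc \<Longrightarrow> w \<in> cdisc \<Longrightarrow> s (z, w) = ev2 \<sigma> (z, w)"
    using Aplus_representation[OF \<alpha> \<beta> s] by blast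
  show "(\<lambda>z. s (z, 1)) holomorphic_on disc"
    by (rule power_series_holomorphic[where a = "\<lambda>k. eval_fps (fps_nth \<sigma> k) 1"])
      (use ev2_sums[OF \<alpha> \<beta> \<sigma>(1), of _ 1] \<sigma>(2)[of _ 1] in simp)
  obtain F where F: "pnorm \<beta> F \<le> bnorm \<alpha> \<beta> \<sigma>" "\<And>w. cmod w \<le> 1 \<Longrightarrow> (\<lambda>k. eval_fps (fps_nth \<sigma> k) w * 1 ^ k) sums eval_fps F w"
    using slice_exists[OF \<alpha> \<beta> \<sigma>(1), of 1] by auto
  have Ffin: "pnorm \<beta> F < \<infinity>" using F(1) \<sigma>(1) by (rule order.strict_trans1)
  show "(\<lambda>w. s (1, w)) holomorphic_on disc"
  proof (rule power_series_holomorphic[where a = "fps_nth F"])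
    fix w :: complex assume w: "w \<in> disc"
    have "s (1, w) = eval_fps F w"
      using sums_unique2[OF ev2_sums[OF \<alpha> \<beta> \<sigma>(1), of 1 w] F(2)[of w]] \<sigma>(2)[of 1 w] w by simp
    then show "(\<lambda>n. fps_nth F n * (w - 0) ^ n) sums s (1, w)"
      using summable_sums[OF eval_fps_summable[OF Ffin \<beta>, of w]] w by (simp add: eval_fps_def)
  qed
qed

section \<open>The closed ideal\<close>

text \<open>If L annihilates an ideal, so does s |-> L (s c). A result L x = L 1 for all such
  functionals thus becomes L (x c) = L c for all c.\<close>

lemma (in complete_algebra_norm) bdd_functional_mult:
  assumes L: "bdd_functional L C" and c: "c \<in> carr"
  shows "bdd_functional (\<lambda>s. L (s * c)) (\<bar>C\<bar> * enn2real (\<nu> c))"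
  unfolding bdd_functional_def
proof (intro conjI ballI allI)
  fix a b assume ab: "a \<in> carr" "b \<in> carr"
  show "L ((a + b) * c) = L (a * c) + L (b * c)"
    unfolding distrib_right by (rule bdd_functional_add[OF L]) (use ab c in auto)
next
  fix k a assume a: "a \<in> carr"
  show "L (\<kappa> k * a * c) = k * L (a * c)"
    unfolding mult.assoc by (rule bdd_functional_scale[OF L]) (use a c in auto)
next
  fix a assume a: "a \<in> carr"
  have "cmod (L (a * c)) \<le> C * enn2real (\<nu> (a * c))" by (rule bdd_functional_bound[OF L]) (use a c in auto)
  also have "\<dots> \<le> \<bar>C\<bar> * enn2real (\<nu> (a * c))" by (intro mult_right_mono) auto
  also have "\<dots> \<le> \<bar>C\<bar> * (enn2real (\<nu> a) * enn2real (\<nu> c))"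
    by (intro mult_left_mono enn2real_norm_mult a c) auto
  finally show "cmod (L (a * c)) \<le> \<bar>C\<bar> * enn2real (\<nu> c) * enn2real (\<nu> a)" by (simp add: mult_ac)
qed

lemma (in complete_algebra_norm) bdd_functional_bound_ennreal:
  assumes L: "bdd_functional L C" and a: "\<nu> a \<le> ennreal t" "0 \<le> t"
  shows "cmod (L a) \<le> \<bar>C\<bar> * t"
proof -
  have "a \<in> carr" using a by (auto simp: carr_def intro: order.strict_trans1)
  then have "cmod (L a) \<le> C * enn2real (\<nu> a)" by (rule bdd_functional_bound[OF L])
  also have "\<dots> \<le> \<bar>C\<bar> * t" using enn2real_mono[OF a(1)] a(2) by (intro mult_mono) auto
  finally show ?thesis .
qed

text \<open>
  A one-variable series becomes a double series that is constant in the inner variable; this map goes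
  back. So the result on multiplication by \<open>z\<close> also applies to the slice in the variable \<open>w\<close>.
\<close>

definition fps_diagonal0 :: "complex fps fps \<Rightarrow> complex fps"
  where "fps_diagonal0 \<tau> = Abs_fps (\<lambda>k. fps_nth (fps_nth \<tau> k) 0)"

lemma fps_diagonal0_mult: "fps_diagonal0 (Abs_fps (\<lambda>k. fps_const (fps_nth F k)) * \<tau>) = F * fps_diagonal0 \<tau>"
  by (rule fps_ext) (simp add: fps_diagonal0_def fps_mult_nth fps_sum_nth)

lemma pnorm_diagonal0_le: "pnorm \<beta> (fps_diagonal0 \<tau>) \<le> bnorm \<beta> 1 \<tau>"
  unfolding wnorm_def[of \<beta>]
proof (intro suminf_le mult_left_mono)
  fix k
  have "ennreal ((1 + real 0) powr 1) * ennreal (cmod (fps_nth (fps_nth \<tau> k) 0)) \<le> pnorm 1 (fps_nth \<tau> k)"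
    unfolding wnorm_def using sum_le_suminf[of "\<lambda>n. ennreal ((1 + real n) powr 1) * ennreal (cmod (fps_nth (fps_nth \<tau> k) n))" "{0}"] by simp
  then show "ennreal (cmod (fps_nth (fps_diagonal0 \<tau>) k)) \<le> pnorm 1 (fps_nth \<tau> k)" by (simp add: fps_diagonal0_def)
qed auto

locale point_zero =
  fixes \<alpha> \<beta> :: real and f :: "complex \<times> complex \<Rightarrow> complex"
  assumes \<alpha>: "0 \<le> \<alpha>" "\<alpha> < 1" and \<beta>: "0 < \<beta>" "\<beta> < 1" and f: "f \<in> Aplus \<alpha> \<beta>" and zf: "zero_set f = {(1, 1)}"
begin

lemma \<beta>0: "0 \<le> \<beta>" using \<beta> by simp

sublocale w: complete_algebra_norm "pnorm \<beta>" fps_const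
  by (rule pnorm_complete_algebra_norm[OF \<beta>0])

sublocale B: complete_algebra_norm "bnorm \<alpha> \<beta>" "\<lambda>c. fps_const (fps_const c)"
  by (rule bnorm_complete_algebra_norm[OF \<alpha>(1) \<beta>0])

lemma f_eq_0_iff: "z \<in> cdisc \<Longrightarrow> w \<in> cdisc \<Longrightarrow> f (z, w) = 0 \<longleftrightarrow> z = 1 \<and> w = 1"
  using zf by (auto simp: zero_set_def set_eq_iff)

lemma continuous_f: "continuous_on (cdisc \<times> cdisc) f"
  using f by (simp add: Aplus_def bidisc_algebra_def)

lemma f_bounded: obtains M where "0 < M" "\<And>z w. z \<in> cdisc \<Longrightarrow> w \<in> cdisc \<Longrightarrow> cmod (f (z, w)) < M"
proof -
  have "bounded (f ` (cdisc \<times> cdisc))"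
    by (intro compact_imp_bounded compact_continuous_image continuous_f compact_Times compact_cball)
  then obtain m where m: "\<forall>x\<in>f ` (cdisc \<times> cdisc). cmod x \<le> m" unfolding bounded_iff by blast
  show ?thesis
  proof (rule that[of "\<bar>m\<bar> + 1"])
    show "cmod (f (z, w)) < \<bar>m\<bar> + 1" if "z \<in> cdisc" "w \<in> cdisc" for z w
    proof -
      have "cmod (f (z, w)) \<le> m" using m that by blast
      then show ?thesis by linarith
    qed
  qed auto
qed

lemma slices_one_boundary_zero:
  obtains M where "one_boundary_zero (\<lambda>z. f (z, 1)) M" "one_boundary_zero (\<lambda>w. f (1, w)) M"
proof -
  obtain M where M: "0 < M" "\<And>z w. z \<in> cdisc \<Longrightarrow> w \<in> cdisc \<Longrightarrow> cmod (f (z, w)) < M" by (fact f_bounded)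
  show ?thesis
    by (rule that[of M]; unfold_locales)
      (use M Aplus_slices[OF \<alpha>(1) \<beta>0 f] f_eq_0_iff in auto)
qed

lemma slices_disc_algebra: "(\<lambda>z. f (z, 1)) \<in> disc_algebra" "(\<lambda>w. f (1, w)) \<in> disc_algebra"
  using Aplus_slices[OF \<alpha>(1) \<beta>0 f] f by (auto simp: disc_algebra_def Aplus_def bidisc_algebra_def)

text \<open>The second variable is accessible because invariance under z makes \<open>L\<close>
  annihilate the multiples of the slice f(1, .) as well: \<phi> and this slice differ by a limit of
  multiples of X - 1. Finally \<open>L\<close> agrees with L 1 on all monomials, and these span a
  dense subspace.\<close>

lemma functional_vanishes_if_outer:
  assumes o1: "outer_function (\<lambda>z. f (z, 1))" and o2: "outer_function (\<lambda>w. f (1, w))"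
    and \<phi>: "bnorm \<alpha> \<beta> \<phi> < \<infinity>" and rep: "\<And>z w. z \<in> cdisc \<Longrightarrow> w \<in> cdisc \<Longrightarrow> f (z, w) = ev2 \<phi> (z, w)"
    and L: "B.bdd_functional L C" and L\<phi>: "\<And>s. bnorm \<alpha> \<beta> s < \<infinity> \<Longrightarrow> L (\<phi> * s) = 0"
    and \<gamma>: "bnorm \<alpha> \<beta> \<gamma> < \<infinity>" and \<gamma>11: "ev2 \<gamma> (1, 1) = 0"
  shows "L \<gamma> = 0"
proof -
  obtain M where h1: "one_boundary_zero (\<lambda>z. f (z, 1)) M" and h2: "one_boundary_zero (\<lambda>w. f (1, w)) M"
    by (fact slices_one_boundary_zero)
  note rad1 = one_boundary_zero.radial_limit_if_outer[OF h1 o1]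
  note rad2 = one_boundary_zero.radial_limit_if_outer[OF h2 o2]
  have \<phi>c: "\<phi> \<in> B.carr" using \<phi> by (simp add: B.carr_def)
  have L\<phi>': "L (\<phi> * s) = 0" if "s \<in> B.carr" for s using L\<phi> that by (simp add: B.carr_def)
  have Xc: "fps_X \<in> B.carr"
    using w.wnorm_X_power[of \<alpha> 1] by (simp add: B.carr_def)
  have constc: "fps_const h \<in> B.carr" if "pnorm \<beta> h < \<infinity>" for h
    using that by (simp add: B.carr_def w.wnorm_const)
  \<comment> \<open>For w other than 1 the slice has no zero at z = 1, so the logarithm stays
    bounded. The outer function f(., 1) accounts for w = 1.\<close>
  have rad: "((\<lambda>r. (1 - r) * ln (cmod (f (of_real r, w)))) \<longlongrightarrow> 0) (at_left (1::real))" if w: "w \<in> cdisc" for w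
  proof (cases "w = 1")
    case True then show ?thesis using rad1 by simp
  next
    case False
    have "((\<lambda>r. (complex_of_real r, w)) \<longlongrightarrow> (of_real 1, w)) (at_left (1::real))"
      by (rule tendsto_Pair[OF tendsto_of_real[OF tendsto_ident_at] tendsto_const])
    moreover have "\<forall>\<^sub>F r in at_left (1::real). (complex_of_real r, w) \<in> cdisc \<times> cdisc"
      unfolding eventually_at_left_field by (intro exI[of _ 0]) (use w in auto)
    ultimately have "((\<lambda>r. f (of_real r, w)) \<longlongrightarrow> f (of_real 1, w)) (at_left (1::real))"
      by (intro continuous_on_tendsto_compose[OF continuous_f]) (use w in auto)
    moreover have "f (of_real 1, w) \<noteq> 0" using f_eq_0_iff[of 1 w] w False by simp
    ultimately have "((\<lambda>r. (1 - r) * ln (cmod (f (of_real r, w)))) \<longlongrightarrow> (1 - 1) * ln (cmod (f (of_real 1, w)))) (at_left (1::real))"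
      by (intro tendsto_intros) auto
    then show ?thesis by simp
  qed
  have Xfix: "L (fps_X * c) = L c" if c: "c \<in> B.carr" for c
  proof -
    have "L (fps_X * c) = L (1 * c)"
    proof (rule functional_fixed_by_X[OF \<alpha> \<beta>(1) less_imp_le[OF \<beta>(2)] \<phi> continuous_f, of "\<lambda>s. L (s * c)"])
      show "(\<lambda>k. eval_fps (fps_nth \<phi> k) w * z ^ k) sums f (z, w)" if "z \<in> cdisc" "w \<in> cdisc" for z w
        using ev2_sums[OF \<alpha>(1) \<beta>0 \<phi>, of z w] rep[OF that] that by simp
      show "B.bdd_functional (\<lambda>s. L (s * c)) (\<bar>C\<bar> * enn2real (bnorm \<alpha> \<beta> c))" by (rule B.bdd_functional_mult[OF L c])
      show "L (\<phi> * s * c) = 0" if "bnorm \<alpha> \<beta> s < \<infinity>" for s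
        unfolding mult.assoc by (rule L\<phi>'[OF B.carr_mult[OF _ c]]) (use that in \<open>simp add: B.carr_def\<close>)
    qed (use f_eq_0_iff rad in auto)
    then show ?thesis by simp
  qed
  obtain F where F: "pnorm \<beta> F \<le> bnorm \<alpha> \<beta> \<phi>" "(\<lambda>K. pnorm \<beta> (F - (\<Sum>k<K. fps_const 1 ^ k * fps_nth \<phi> k))) \<longlonglongrightarrow> 0"
    "\<And>w. cmod w \<le> 1 \<Longrightarrow> (\<lambda>k. eval_fps (fps_nth \<phi> k) w * 1 ^ k) sums eval_fps F w"
    by (rule slice_exists[OF \<alpha>(1) \<beta>0 \<phi>, of 1]) (simp, rule that)
  have Ffin: "pnorm \<beta> F < \<infinity>" using F(1) \<phi> by (rule order.strict_trans1)
  have Fev: "eval_fps F w = f (1, w)" if "w \<in> cdisc" for w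
    using sums_unique2[OF ev2_sums[OF \<alpha>(1) \<beta>0 \<phi>, of 1 w] F(3)[of w]] rep[of 1 w] that by simp
  have LF: "L (fps_const F * c) = 0" if c: "c \<in> B.carr" for c
  proof -
    have shift_le: "bnorm \<alpha> \<beta> (fps_shift K \<phi>) \<le> (\<Sum>n. ennreal ((1 + real (n + K)) powr \<alpha>) * pnorm \<beta> (fps_nth \<phi> (n + K)))" for K
      by (rule w.wnorm_shift_le[OF \<alpha>(1)])
    have tail: "(\<lambda>K. \<Sum>n. ennreal ((1 + real (n + K)) powr \<alpha>) * pnorm \<beta> (fps_nth \<phi> (n + K))) \<longlonglongrightarrow> 0"
      using ennreal_suminf_tail_tendsto_0[of "\<lambda>n. ennreal ((1 + real n) powr \<alpha>) * pnorm \<beta> (fps_nth \<phi> n)"] \<phi>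
      by (simp add: wnorm_def[of \<alpha>])
    have shc: "fps_shift K \<phi> \<in> B.carr" for K
      using order_trans[OF shift_le ennreal_suminf_tail_le[of "\<lambda>n. ennreal ((1 + real n) powr \<alpha>) * pnorm \<beta> (fps_nth \<phi> n)" K]] \<phi>
      by (auto simp: B.carr_def wnorm_def[of \<alpha>] intro: order.strict_trans1)
    \<comment> \<open>What remains of F - \<phi> after the multiple (X - 1) u, which
      \<open>L\<close> kills, has been added. It tends to 0 in norm.\<close>
    define d where "d K = fps_const (F - (\<Sum>k<K. fps_const 1 ^ k * fps_nth \<phi> k)) - fps_shift K \<phi>" for K
    have eqL: "L (fps_const F * c) = L (d K * c)" for K
    proof -
      define u where "u = (\<Sum>k<K. fps_const (1 ^ k) * fps_shift (Suc k) \<phi>)"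
      have uc: "u \<in> B.carr" unfolding u_def by (intro B.carr_sum) (use shc in simp)
      have "(fps_X - fps_const 1) * u = \<phi> - fps_const (1 ^ K) * fps_shift K \<phi> - fps_const (\<Sum>k<K. 1 ^ k * fps_nth \<phi> k)"
        unfolding u_def by (rule w.fps_resolvent_identity)
      then have id: "fps_X * u - u = \<phi> - fps_shift K \<phi> - fps_const (\<Sum>k<K. fps_nth \<phi> k)"
        by (simp add: left_diff_distrib)
      have dK: "d K = fps_const F - fps_const (\<Sum>k<K. fps_nth \<phi> k) - fps_shift K \<phi>"
        by (simp add: d_def)
      have "fps_const F * c - d K * c = \<phi> * c - (fps_X * (u * c) - u * c)"
      proof -
        have "fps_const F - d K = \<phi> - (fps_X * u - u)" unfolding id dK by simp
        then have "(fps_const F - d K) * c = (\<phi> - (fps_X * u - u)) * c" by (rule arg_cong)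
        then show ?thesis by (simp only: left_diff_distrib mult.assoc)
      qed
      moreover have "L (\<phi> * c - (fps_X * (u * c) - u * c)) = 0"
        using L\<phi>'[OF c] Xfix[of "u * c"] uc c \<phi>c Xc by (simp add: B.bdd_functional_diff[OF L])
      moreover have "d K * c \<in> B.carr" "fps_const F * c \<in> B.carr"
      proof -
        have Fc: "fps_const F * c \<in> B.carr" using constc[OF Ffin] c by simp
        have "d K * c = fps_const F * c - (\<phi> * c - (fps_X * (u * c) - u * c))" using calculation(1) by (simp add: algebra_simps)
        moreover have "fps_const F * c - (\<phi> * c - (fps_X * (u * c) - u * c)) \<in> B.carr" using Fc \<phi>c uc c Xc by simp
        ultimately show "d K * c \<in> B.carr" by simp
        show "fps_const F * c \<in> B.carr" by (rule Fc)
      qed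
      ultimately show ?thesis using B.bdd_functional_diff[OF L, of "fps_const F * c" "d K * c"] by simp
    qed
    have "(\<lambda>K. bnorm \<alpha> \<beta> (d K * c)) \<longlonglongrightarrow> 0"
    proof (rule tendsto_sandwich[OF _ _ tendsto_const])
      define T where "T K = pnorm \<beta> (F - (\<Sum>k<K. fps_const 1 ^ k * fps_nth \<phi> k)) +
          (\<Sum>n. ennreal ((1 + real (n + K)) powr \<alpha>) * pnorm \<beta> (fps_nth \<phi> (n + K)))" for K
      have "T \<longlonglongrightarrow> 0 + 0" unfolding T_def by (intro tendsto_add F(2) tail)
      then have "(\<lambda>K. bnorm \<alpha> \<beta> c * T K) \<longlonglongrightarrow> bnorm \<alpha> \<beta> c * (0 + 0)"
        by (intro ennreal_tendsto_cmult) (use c in \<open>auto simp: B.carr_def\<close>)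
      then show "(\<lambda>K. bnorm \<alpha> \<beta> c * T K) \<longlonglongrightarrow> 0" by simp
      show "\<forall>\<^sub>F K in sequentially. bnorm \<alpha> \<beta> (d K * c) \<le> bnorm \<alpha> \<beta> c * T K"
      proof (rule always_eventually, rule allI)
        fix K
        have "bnorm \<alpha> \<beta> (d K) \<le> T K" unfolding d_def T_def
          by (rule order_trans[OF B.nrm_diff]) (intro add_mono shift_le, simp only: w.wnorm_const order_refl)
        then have "bnorm \<alpha> \<beta> (d K) * bnorm \<alpha> \<beta> c \<le> T K * bnorm \<alpha> \<beta> c" by (rule mult_right_mono) simp
        then show "bnorm \<alpha> \<beta> (d K * c) \<le> bnorm \<alpha> \<beta> c * T K"
          using B.nrm_mult[of "d K" c] by (simp add: mult.commute)
      qed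
    qed auto
    then have small: "\<forall>\<^sub>F K in sequentially. bnorm \<alpha> \<beta> (d K * c) < ennreal e" if "0 < e" for e
      by (rule order_tendstoD(2)) (use that in \<open>subst ennreal_less_zero_iff, simp\<close>)
    have CE: "cmod (L (fps_const F * c)) \<le> \<bar>C\<bar> * e" if e: "0 < e" for e
    proof -
      obtain K where "bnorm \<alpha> \<beta> (d K * c) < ennreal e" using small[OF e] by (auto simp: eventually_sequentially)
      then show ?thesis using B.bdd_functional_bound_ennreal[OF L, of "d K * c" e] e eqL[of K] by simp
    qed
    have "cmod (L (fps_const F * c)) \<le> 0 + e" if "0 < e" for e
    proof -
      have "cmod (L (fps_const F * c)) \<le> \<bar>C\<bar> * (e / (\<bar>C\<bar> + 1))" 
        by (rule CE) (use that in \<open>simp add: add_nonneg_pos\<close>)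
      also have "\<dots> \<le> e" using that by (simp add: divide_le_eq mult.commute add_pos_nonneg)
      finally show ?thesis by simp
    qed
    then have "cmod (L (fps_const F * c)) \<le> 0" by (rule field_le_epsilon)
    then show ?thesis by simp
  qed
  interpret B2: complete_algebra_norm "bnorm \<beta> 1" "\<lambda>c. fps_const (fps_const c)"
    by (rule bnorm_complete_algebra_norm) (use \<beta> in auto)
  have Yfix: "L (fps_const fps_X * c) = L c" if c: "c \<in> B.carr" for c
  proof -
    define \<phi>2 where "\<phi>2 = Abs_fps (\<lambda>k. fps_const (fps_nth F k))"
    have dc: "fps_const (fps_diagonal0 \<tau>) \<in> B.carr" if "bnorm \<beta> 1 \<tau> < \<infinity>" for \<tau>
      using order.strict_trans1[OF pnorm_diagonal0_le that] by (rule constc)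
    have "L (fps_const (fps_diagonal0 fps_X) * c) = L (fps_const (fps_diagonal0 1) * c)"
    \<comment> \<open>The variable w now takes the place of z, with exponent \<beta> < 1. The inner
      variable is a dummy with exponent 1, and the function f(1, fst p) is constant in it.\<close>
    proof (rule functional_fixed_by_X[OF \<beta>0 \<beta>(2), of 1 \<phi>2 "\<lambda>p. f (1, fst p)" "\<lambda>\<tau>. L (fps_const (fps_diagonal0 \<tau>) * c)"])
      have "bnorm \<beta> 1 \<phi>2 = pnorm \<beta> F"
        unfolding wnorm_def[of \<beta>] \<phi>2_def by (simp add: cmod_norm.wnorm_const)
      then show "bnorm \<beta> 1 \<phi>2 < \<infinity>" using Ffin by simp
      show "continuous_on (cdisc \<times> cdisc) (\<lambda>p. f (1, fst p))"
        by (intro continuous_on_compose2[OF continuous_f] continuous_intros) auto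
      show "(\<lambda>k. eval_fps (fps_nth \<phi>2 k) w * z ^ k) sums f (1, fst (z, w))" if "z \<in> cdisc" "w \<in> cdisc" for z w
        using summable_sums[OF eval_fps_summable[OF Ffin \<beta>0, of z]] Fev[of z] that
        by (simp add: \<phi>2_def eval_fps_const) (simp add: eval_fps_def)
      show "B2.bdd_functional (\<lambda>\<tau>. L (fps_const (fps_diagonal0 \<tau>) * c)) (\<bar>C\<bar> * enn2real (bnorm \<alpha> \<beta> c))"
        unfolding B2.bdd_functional_def
      proof (intro conjI ballI allI)
        fix a b assume ab: "a \<in> B2.carr" "b \<in> B2.carr"
        have "fps_const (fps_diagonal0 (a + b)) * c = fps_const (fps_diagonal0 a) * c + fps_const (fps_diagonal0 b) * c"
        proof -
          have "fps_diagonal0 (a + b) = fps_diagonal0 a + fps_diagonal0 b" by (rule fps_ext) (simp add: fps_diagonal0_def)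
          then show ?thesis by (simp only: fps_const_add[symmetric] distrib_right)
        qed
        then show "L (fps_const (fps_diagonal0 (a + b)) * c) = L (fps_const (fps_diagonal0 a) * c) + L (fps_const (fps_diagonal0 b) * c)"
          using ab dc c by (simp add: B2.carr_def B.bdd_functional_add[OF L])
      next
        fix k a assume a: "a \<in> B2.carr"
        have "fps_diagonal0 (fps_const (fps_const k) * a) = fps_const k * fps_diagonal0 a"
          by (rule fps_ext) (simp add: fps_diagonal0_def)
        then have e: "fps_const (fps_diagonal0 (fps_const (fps_const k) * a)) * c =
            fps_const (fps_const k) * (fps_const (fps_diagonal0 a) * c)" by (simp add: mult.assoc flip: fps_const_mult)
        show "L (fps_const (fps_diagonal0 (fps_const (fps_const k) * a)) * c) = k * L (fps_const (fps_diagonal0 a) * c)"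
          unfolding e by (rule B.bdd_functional_scale[OF L B.carr_mult[OF dc c]]) (use a in \<open>simp add: B2.carr_def\<close>)
      next
        fix a assume a: "a \<in> B2.carr"
        have "cmod (L (fps_const (fps_diagonal0 a) * c)) \<le>
            \<bar>C\<bar> * enn2real (bnorm \<alpha> \<beta> c) * enn2real (bnorm \<alpha> \<beta> (fps_const (fps_diagonal0 a)))"
          by (rule B.bdd_functional_bound[OF B.bdd_functional_mult[OF L c]]) (use dc a in \<open>simp add: B2.carr_def\<close>)
        also have "\<dots> \<le> \<bar>C\<bar> * enn2real (bnorm \<alpha> \<beta> c) * enn2real (bnorm \<beta> 1 a)"
          unfolding w.wnorm_const using a
          by (intro mult_left_mono enn2real_mono pnorm_diagonal0_le) (auto simp: B2.carr_def)
        finally show "cmod (L (fps_const (fps_diagonal0 a) * c)) \<le> \<bar>C\<bar> * enn2real (bnorm \<alpha> \<beta> c) * enn2real (bnorm \<beta> 1 a)" .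
      qed
      show "L (fps_const (fps_diagonal0 (\<phi>2 * s)) * c) = 0" if "bnorm \<beta> 1 s < \<infinity>" for s
      proof -
        have e: "fps_const (fps_diagonal0 (\<phi>2 * s)) * c = fps_const F * (fps_const (fps_diagonal0 s) * c)"
          unfolding \<phi>2_def fps_diagonal0_mult by (simp add: mult.assoc flip: fps_const_mult)
        show ?thesis unfolding e by (rule LF[OF B.carr_mult[OF dc[OF that] c]])
      qed
    qed (use f_eq_0_iff rad2 in auto)
    moreover have "fps_diagonal0 fps_X = fps_X" by (rule fps_ext) (auto simp: fps_diagonal0_def fps_X_def)
    moreover have "fps_diagonal0 1 = 1" by (rule fps_ext) (auto simp: fps_diagonal0_def)
    ultimately show ?thesis by simp
  qed
  have Yc: "fps_const fps_X \<in> B.carr"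
    by (rule constc) (use cmod_norm.wnorm_X_power[of \<beta> 1] in simp)
  have Xn: "L (fps_X ^ n * c) = L c" if "c \<in> B.carr" for n c
    by (induction n) (use Xfix that Xc in \<open>simp_all add: mult.assoc\<close>)
  have Ym: "L (fps_const fps_X ^ m * c) = L c" if "c \<in> B.carr" for m c
  proof (induction m)
    case (Suc m)
    show ?case unfolding power_Suc mult.assoc Yfix[OF B.carr_mult[OF B.carr_power[OF Yc] that]] by (rule Suc)
  qed simp
  have mono: "L (fps_X ^ n * fps_const (fps_X ^ m)) = L 1" for n m
    using Xn[OF B.carr_power[OF Yc], of n m] Ym[OF B.carr_1, of m] by (simp only: fps_const_power mult_1_right)
  have monoc: "fps_X ^ n * fps_const (fps_X ^ m) \<in> B.carr" for n m
    using B.carr_mult[OF B.carr_power[OF Xc] B.carr_power[OF Yc], of n m] by (simp only: fps_const_power)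
  \<comment> \<open>A polynomial \<delta> close to \<gamma> satisfies L \<delta> = \<delta>(1, 1) L
    1, and \<delta>(1, 1) is small because \<gamma>(1, 1) = 0.\<close>
  have "cmod (L \<gamma>) \<le> (\<bar>C\<bar> + cmod (L 1)) * e" if e: "0 < e" for e
  proof -
    obtain G where G: "finite G" "bnorm \<alpha> \<beta> (\<gamma> - restrict_coeffs G (coeffs2 \<gamma>)) < ennreal e"
      using finite_restriction_dense[OF \<gamma> e] by blast
    define \<delta> where "\<delta> = restrict_coeffs G (coeffs2 \<gamma>)"
    have \<delta>: "bnorm \<alpha> \<beta> \<delta> < \<infinity>" unfolding \<delta>_def by (rule bnorm_restrict_coeffs_finite[OF G(1)])
    have small: "bnorm \<alpha> \<beta> (\<gamma> - \<delta>) < ennreal e" using G(2) by (simp add: \<delta>_def)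
    have dfin: "bnorm \<alpha> \<beta> (\<gamma> - \<delta>) < \<infinity>" using B.carr_diff[of \<gamma> \<delta>] \<gamma> \<delta> by (simp add: B.carr_def)
    have "L \<delta> = (\<Sum>q\<in>G. L (fps_const (fps_const (coeffs2 \<gamma> q)) * (fps_X ^ fst q * fps_const (fps_X ^ snd q))))"
      unfolding \<delta>_def restrict_coeffs_eq_sum[OF G(1)] by (rule B.bdd_functional_sum[OF L]) (intro B.carr_mult monoc, simp)
    also have "\<dots> = (\<Sum>q\<in>G. coeffs2 \<gamma> q * L 1)"
      by (intro sum.cong refl) (simp only: B.bdd_functional_scale[OF L monoc] mono)
    finally have L\<delta>: "L \<delta> = (\<Sum>q\<in>G. coeffs2 \<gamma> q) * L 1" by (simp add: sum_distrib_right)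
    have "ev2 \<delta> (1, 1) = (\<Sum>q\<in>G. coeffs2 \<gamma> q)"
    proof -
      have "((\<lambda>(n, m). coeffs2 \<delta> (n, m) * 1 ^ n * 1 ^ m) has_sum ev2 \<delta> (1, 1)) UNIV"
        by (rule ev2_has_sum[OF \<alpha>(1) \<beta>0 \<delta>]) auto
      moreover have "((\<lambda>(n, m). coeffs2 \<delta> (n, m) * 1 ^ n * 1 ^ m) has_sum (\<Sum>q\<in>G. coeffs2 \<gamma> q)) UNIV"
        by (rule has_sum_finite_neutralI[OF G(1)]) (auto simp: \<delta>_def restrict_coeffs_def intro!: sum.cong)
      ultimately show ?thesis by (rule has_sum_unique)
    qed
    moreover have "ev2 (\<gamma> - \<delta>) (1, 1) = ev2 \<gamma> (1, 1) - ev2 \<delta> (1, 1)"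
      by (rule ev2_diff[OF \<alpha>(1) \<beta>0 \<gamma> \<delta>]) auto
    ultimately have "cmod (\<Sum>q\<in>G. coeffs2 \<gamma> q) = cmod (ev2 (\<gamma> - \<delta>) (1, 1))" using \<gamma>11 by simp
    also have "\<dots> \<le> enn2real (bnorm \<alpha> \<beta> (\<gamma> - \<delta>))" by (rule ev2_norm_le[OF \<alpha>(1) \<beta>0 dfin]) auto
    also have "\<dots> \<le> e" using enn2real_mono[OF less_imp_le[OF small]] e by simp
    finally have se: "cmod (\<Sum>q\<in>G. coeffs2 \<gamma> q) \<le> e" .
    have "L \<gamma> = L (\<gamma> - \<delta>) + L \<delta>"
      using B.bdd_functional_diff[OF L, of \<gamma> \<delta>] \<gamma> \<delta> by (simp add: B.carr_def)
    then have "cmod (L \<gamma>) \<le> cmod (L (\<gamma> - \<delta>)) + cmod (L \<delta>)" by (simp add: norm_triangle_ineq)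
    also have "\<dots> \<le> \<bar>C\<bar> * e + e * cmod (L 1)"
    proof (rule add_mono)
      show "cmod (L (\<gamma> - \<delta>)) \<le> \<bar>C\<bar> * e" using B.bdd_functional_bound_ennreal[OF L less_imp_le[OF small]] e by simp
      show "cmod (L \<delta>) \<le> e * cmod (L 1)" unfolding L\<delta> norm_mult by (rule mult_right_mono[OF se]) simp
    qed
    finally show ?thesis by (simp add: algebra_simps)
  qed
  then have bound: "cmod (L \<gamma>) \<le> (\<bar>C\<bar> + cmod (L 1)) * e" if "0 < e" for e using that by blast
  have "cmod (L \<gamma>) \<le> 0"
  proof (rule field_le_epsilon)
    fix e :: real assume e: "0 < e"
    define k where "k = \<bar>C\<bar> + cmod (L 1) + 1"
    have k: "0 < k" by (simp add: k_def add_nonneg_pos)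
    have "cmod (L \<gamma>) \<le> (\<bar>C\<bar> + cmod (L 1)) * (e / k)" by (rule bound) (use e k in simp)
    also have "\<dots> \<le> k * (e / k)" using e k by (intro mult_right_mono) (auto simp: k_def)
    finally show "cmod (L \<gamma>) \<le> 0 + e" using k by simp
  qed
  then show ?thesis by simp
qed

lemma vanishing_subset_closed_ideal_if_outer:
  assumes o1: "outer_function (\<lambda>z. f (z, 1))" and o2: "outer_function (\<lambda>w. f (1, w))"
    and g: "g \<in> Aplus \<alpha> \<beta>" "g (1, 1) = 0"
  shows "g \<in> closed_ideal_gen (Aplus \<alpha> \<beta>) (Aplus_norm \<alpha> \<beta>) f"
proof (rule ccontr)
  assume "g \<notin> closed_ideal_gen (Aplus \<alpha> \<beta>) (Aplus_norm \<alpha> \<beta>) f"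
  then obtain \<epsilon> where \<epsilon>: "0 < \<epsilon>" "\<And>s. s \<in> Aplus \<alpha> \<beta> \<Longrightarrow> \<epsilon> \<le> Aplus_norm \<alpha> \<beta> (\<lambda>p. g p - f p * s p)"
    using g unfolding closed_ideal_gen_def norm_closure_def by (auto simp: not_less)
  obtain \<phi> where \<phi>: "bnorm \<alpha> \<beta> \<phi> < \<infinity>" "\<And>z w. z \<in> cdisc \<Longrightarrow> w \<in> cdisc \<Longrightarrow> f (z, w) = ev2 \<phi> (z, w)"
    using Aplus_representation[OF \<alpha>(1) \<beta>0 f] by blast
  obtain \<gamma> where \<gamma>: "bnorm \<alpha> \<beta> \<gamma> < \<infinity>" "\<And>z w. z \<in> cdisc \<Longrightarrow> w \<in> cdisc \<Longrightarrow> g (z, w) = ev2 \<gamma> (z, w)"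
    using Aplus_representation[OF \<alpha>(1) \<beta>0 g(1)] by blast
  have c: "\<phi> \<in> B.carr" "\<gamma> \<in> B.carr" using \<phi> \<gamma> by (auto simp: B.carr_def)
  \<comment> \<open>The distance of g is known for multipliers in \<open>Aplus\<close>, whereas the
    functional needs it for all series of finite norm. An arbitrary \<sigma> is therefore replaced
    by a polynomial, which is known to lie in \<open>Aplus\<close>, at the cost of half of
    \<epsilon>.\<close>
  have sep: "ennreal (\<epsilon> / 2) \<le> bnorm \<alpha> \<beta> (\<gamma> - \<phi> * \<sigma>)" if \<sigma>: "\<sigma> \<in> B.carr" for \<sigma>
  proof -
    define N where "N = enn2real (bnorm \<alpha> \<beta> \<phi>) + 1"
    have N: "0 < N" by (simp add: N_def add_nonneg_pos)
    have \<phi>N: "bnorm \<alpha> \<beta> \<phi> \<le> ennreal N"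
      using B.norm_finite_real[OF c(1)] ennreal_leI[of "enn2real (bnorm \<alpha> \<beta> \<phi>)" N] by (simp add: N_def)
    have \<sigma>f: "bnorm \<alpha> \<beta> \<sigma> < \<infinity>" using \<sigma> by (simp add: B.carr_def)
    obtain F where F: "finite F" "bnorm \<alpha> \<beta> (\<sigma> - restrict_coeffs F (coeffs2 \<sigma>)) < ennreal (\<epsilon> / (2 * N))"
      using finite_restriction_dense[OF \<sigma>f, of "\<epsilon> / (2 * N)"] \<epsilon>(1) N by auto
    define \<tau> where "\<tau> = restrict_coeffs F (coeffs2 \<sigma>)"
    define s where "s = bidisc_polynomial F (coeffs2 \<sigma>)"
    have \<tau>: "bnorm \<alpha> \<beta> \<tau> < \<infinity>" unfolding \<tau>_def by (rule bnorm_restrict_coeffs_finite[OF F(1)])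
    then have \<tau>c: "\<tau> \<in> B.carr" by (simp add: B.carr_def)
    have sA: "s \<in> Aplus \<alpha> \<beta>" unfolding s_def by (rule bidisc_polynomial_in_Aplus[OF F(1)])
    obtain \<tau>' where \<tau>': "bnorm \<alpha> \<beta> \<tau>' < \<infinity>" "\<And>z w. z \<in> cdisc \<Longrightarrow> w \<in> cdisc \<Longrightarrow> s (z, w) = ev2 \<tau>' (z, w)"
      using Aplus_representation[OF \<alpha>(1) \<beta>0 sA] by blast
    \<comment> \<open>Uniqueness of coefficients shows that the series obtained from the function
      \<open>s\<close> is the truncation \<open>\<tau>\<close> itself.\<close>
    have "has_power_series2 s (coeffs2 \<tau>')"
      unfolding has_power_series2_def using ev2_has_sum[OF \<alpha>(1) \<beta>0 \<tau>'(1)] \<tau>'(2) by simp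
    then have "coeffs2 \<tau>' = coeffs2 \<tau>"
      using has_power_series2_unique bidisc_polynomial_has_power_series2[OF F(1)] unfolding s_def \<tau>_def by blast
    then have \<tau>eq: "\<tau>' = \<tau>" by (metis to_fps2_coeffs2)
    have "\<epsilon> \<le> enn2real (bnorm \<alpha> \<beta> (\<gamma> - \<phi> * \<tau>))"
      using \<epsilon>(2)[OF sA] Aplus_norm_difference(1)[OF \<alpha>(1) \<beta>0 \<phi>(1) \<gamma>(1) \<tau>'(1) \<phi>(2) \<gamma>(2) \<tau>'(2)] \<tau>eq by simp
    then have "ennreal \<epsilon> \<le> bnorm \<alpha> \<beta> (\<gamma> - \<phi> * \<tau>)"
      using B.norm_finite_real[of "\<gamma> - \<phi> * \<tau>"] c \<tau>c ennreal_leI by fastforce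
    also have "\<gamma> - \<phi> * \<tau> = (\<gamma> - \<phi> * \<sigma>) + \<phi> * (\<sigma> - \<tau>)" by (simp add: algebra_simps)
    also have "bnorm \<alpha> \<beta> \<dots> \<le> bnorm \<alpha> \<beta> (\<gamma> - \<phi> * \<sigma>) + bnorm \<alpha> \<beta> \<phi> * bnorm \<alpha> \<beta> (\<sigma> - \<tau>)"
      by (intro order_trans[OF B.nrm_add] add_left_mono B.nrm_mult)
    also have "\<dots> \<le> bnorm \<alpha> \<beta> (\<gamma> - \<phi> * \<sigma>) + ennreal N * ennreal (\<epsilon> / (2 * N))"
      using F(2) \<phi>N by (intro add_left_mono mult_mono) (auto simp: \<tau>_def)
    also have "ennreal N * ennreal (\<epsilon> / (2 * N)) = ennreal (\<epsilon> / 2)"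
      using N \<epsilon>(1) by (subst ennreal_mult[symmetric]) auto
    finally have "ennreal (\<epsilon> / 2) + ennreal (\<epsilon> / 2) \<le> ennreal (\<epsilon> / 2) + bnorm \<alpha> \<beta> (\<gamma> - \<phi> * \<sigma>)"
      unfolding add.commute[of "bnorm \<alpha> \<beta> (\<gamma> - \<phi> * \<sigma>)"] using \<epsilon>(1) by (subst ennreal_plus[symmetric]) auto
    then show ?thesis unfolding ennreal_add_left_cancel_le by simp
  qed
  obtain L where L: "B.bdd_functional L 2" "\<And>s. s \<in> B.carr \<Longrightarrow> L (\<phi> * s) = 0" "L \<gamma> \<noteq> 0"
    using B.separating_functional[OF c _ sep] \<epsilon>(1) by (metis half_gt_zero)
  have "L \<gamma> = 0"
    by (rule functional_vanishes_if_outer[OF o1 o2 \<phi> L(1) _ \<gamma>(1)])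
      (use L(2) \<gamma>(2)[of 1 1] g(2) in \<open>auto simp: B.carr_def\<close>)
  then show False using L(3) by simp
qed

text \<open>The norm dominates the supremum, so members of the closed ideal are uniform limits of
  multiples of f, all of which vanish at (1, 1).\<close>

lemma closed_ideal_subset_vanishing:
  assumes g: "g \<in> closed_ideal_gen (Aplus \<alpha> \<beta>) (Aplus_norm \<alpha> \<beta>) f"
  shows "g \<in> vanishing_ideal (Aplus \<alpha> \<beta>) {(1, 1)}"
    and "0 < \<epsilon> \<Longrightarrow> \<exists>s\<in>Aplus \<alpha> \<beta>. \<forall>z\<in>cdisc. \<forall>w\<in>cdisc. cmod (g (z, w) - f (z, w) * s (z, w)) < \<epsilon>"
proof -
  have gA: "g \<in> Aplus \<alpha> \<beta>" using g by (simp add: closed_ideal_gen_def norm_closure_def)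
  show approx: "\<exists>s\<in>Aplus \<alpha> \<beta>. \<forall>z\<in>cdisc. \<forall>w\<in>cdisc. cmod (g (z, w) - f (z, w) * s (z, w)) < \<epsilon>" if \<epsilon>: "0 < \<epsilon>" for \<epsilon>
  proof -
    obtain s where s: "s \<in> Aplus \<alpha> \<beta>" "Aplus_norm \<alpha> \<beta> (\<lambda>p. g p - f p * s p) < \<epsilon>"
      using g \<epsilon> unfolding closed_ideal_gen_def norm_closure_def by blast
    obtain \<phi> where \<phi>: "bnorm \<alpha> \<beta> \<phi> < \<infinity>" "\<And>z w. z \<in> cdisc \<Longrightarrow> w \<in> cdisc \<Longrightarrow> f (z, w) = ev2 \<phi> (z, w)"
      using Aplus_representation[OF \<alpha>(1) \<beta>0 f] by blast
    obtain \<gamma> where \<gamma>: "bnorm \<alpha> \<beta> \<gamma> < \<infinity>" "\<And>z w. z \<in> cdisc \<Longrightarrow> w \<in> cdisc \<Longrightarrow> g (z, w) = ev2 \<gamma> (z, w)"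
      using Aplus_representation[OF \<alpha>(1) \<beta>0 gA] by blast
    obtain \<sigma> where \<sigma>: "bnorm \<alpha> \<beta> \<sigma> < \<infinity>" "\<And>z w. z \<in> cdisc \<Longrightarrow> w \<in> cdisc \<Longrightarrow> s (z, w) = ev2 \<sigma> (z, w)"
      using Aplus_representation[OF \<alpha>(1) \<beta>0 s(1)] by blast
    have "cmod (g (z, w) - f (z, w) * s (z, w)) < \<epsilon>" if "z \<in> cdisc" "w \<in> cdisc" for z w
      using Aplus_norm_difference(2)[OF \<alpha>(1) \<beta>0 \<phi>(1) \<gamma>(1) \<sigma>(1) \<phi>(2) \<gamma>(2) \<sigma>(2) that] s(2) by simp
    then show ?thesis using s(1) by blast
  qed
  have "cmod (g (1, 1)) \<le> 0"
  proof (rule field_le_epsilon)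
    fix e :: real assume "0 < e"
    from approx[OF this] obtain s where "\<forall>z\<in>cdisc. \<forall>w\<in>cdisc. cmod (g (z, w) - f (z, w) * s (z, w)) < e" by blast
    then have "cmod (g (1, 1) - f (1, 1) * s (1, 1)) < e" by simp
    then show "cmod (g (1, 1)) \<le> 0 + e" using f_eq_0_iff[of 1 1] by simp
  qed
  then show "g \<in> vanishing_ideal (Aplus \<alpha> \<beta>) {(1, 1)}" using gA by (simp add: vanishing_ideal_def)
qed

text \<open>The test functions z - 1 and w - 1 lie in the vanishing ideal. Their approximations by
  multiples of f, restricted to w = 1 and to z = 1, are what \<open>outer_if_approximable\<close>
  asks for.\<close>

lemma outer_if_closed_ideal_eq_vanishing:
  assumes eq: "closed_ideal_gen (Aplus \<alpha> \<beta>) (Aplus_norm \<alpha> \<beta>) f = vanishing_ideal (Aplus \<alpha> \<beta>) {(1, 1)}"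
  shows "outer_function (\<lambda>z. f (z, 1)) \<and> outer_function (\<lambda>w. f (1, w))"
proof -
  obtain M where h1: "one_boundary_zero (\<lambda>z. f (z, 1)) M" and h2: "one_boundary_zero (\<lambda>w. f (1, w)) M"
    by (fact slices_one_boundary_zero)
  have approx: "\<exists>s\<in>Aplus \<alpha> \<beta>. \<forall>z\<in>cdisc. \<forall>w\<in>cdisc. cmod (g (z, w) - f (z, w) * s (z, w)) < \<epsilon>"
    if "g \<in> Aplus \<alpha> \<beta>" "g (1, 1) = 0" "0 < \<epsilon>" for g \<epsilon>
    using closed_ideal_subset_vanishing(2)[of g \<epsilon>] that unfolding eq by (simp add: vanishing_ideal_def)
  have one_cdisc: "1 \<in> cdisc" by simp
  define p1 where "p1 = bidisc_polynomial {(1, 0), (0, 0)} (\<lambda>q. if q = (1, 0) then 1 else - 1)"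
  define p2 where "p2 = bidisc_polynomial {(0, 1), (0, 0)} (\<lambda>q. if q = (0, 1) then 1 else - 1)"
  have p: "p1 \<in> Aplus \<alpha> \<beta>" "p2 \<in> Aplus \<alpha> \<beta>" unfolding p1_def p2_def by (intro bidisc_polynomial_in_Aplus; simp)+
  have v: "p1 (z, w) = z - 1" "p2 (z, w) = w - 1" if "z \<in> cdisc" "w \<in> cdisc" for z w
    using that by (simp_all add: p1_def p2_def bidisc_polynomial_def)
  have "outer_function (\<lambda>z. f (z, 1))"
  proof (rule one_boundary_zero.outer_if_approximable[OF h1 slices_disc_algebra(1)])
    fix \<epsilon> :: real assume \<epsilon>: "0 < \<epsilon>"
    obtain s where s: "s \<in> Aplus \<alpha> \<beta>" "\<forall>z\<in>cdisc. \<forall>w\<in>cdisc. cmod (p1 (z, w) - f (z, w) * s (z, w)) < \<epsilon>"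
      using approx[OF p(1) _ \<epsilon>] v(1)[of 1 1] by auto
    then have "\<forall>z\<in>cdisc. cmod (z - 1 - f (z, 1) * s (z, 1)) < \<epsilon>" by (metis v(1) one_cdisc)
    then show "\<exists>g. continuous_on cdisc g \<and> g holomorphic_on disc \<and> (\<forall>z\<in>cdisc. cmod (z - 1 - f (z, 1) * g z) < \<epsilon>)"
      using Aplus_slices(1,2)[OF \<alpha>(1) \<beta>0 s(1)] by (intro exI[of _ "\<lambda>z. s (z, 1)"]) auto
  qed
  moreover have "outer_function (\<lambda>w. f (1, w))"
  proof (rule one_boundary_zero.outer_if_approximable[OF h2 slices_disc_algebra(2)])
    fix \<epsilon> :: real assume \<epsilon>: "0 < \<epsilon>"
    obtain s where s: "s \<in> Aplus \<alpha> \<beta>" "\<forall>z\<in>cdisc. \<forall>w\<in>cdisc. cmod (p2 (z, w) - f (z, w) * s (z, w)) < \<epsilon>"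
      using approx[OF p(2) _ \<epsilon>] v(2)[of 1 1] by auto
    then have "\<forall>w\<in>cdisc. cmod (w - 1 - f (1, w) * s (1, w)) < \<epsilon>" by (metis v(2) one_cdisc)
    then show "\<exists>g. continuous_on cdisc g \<and> g holomorphic_on disc \<and> (\<forall>z\<in>cdisc. cmod (z - 1 - f (1, z) * g z) < \<epsilon>)"
      using Aplus_slices(3,4)[OF \<alpha>(1) \<beta>0 s(1)] by (intro exI[of _ "\<lambda>w. s (1, w)"]) auto
  qed
  ultimately show ?thesis ..
qed

end

theorem mainTheorem2:
  fixes \<alpha> \<beta> :: real
    and f :: "complex \<times> complex \<Rightarrow> complex"
  assumes "\<alpha> \<in> {0..<1}" and "\<beta> \<in> {0<..<1}"
    and "f \<in> Aplus \<alpha> \<beta>"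
    and "zero_set f = {(1, 1)}"
  shows "closed_ideal_gen (Aplus \<alpha> \<beta>) (Aplus_norm \<alpha> \<beta>) f = vanishing_ideal (Aplus \<alpha> \<beta>) {(1, 1)}
    \<longleftrightarrow> outer_function (\<lambda>z. f (z, 1)) \<and> outer_function (\<lambda>w. f (1, w))"
proof -
  interpret point_zero \<alpha> \<beta> f by unfold_locales (use assms in auto)
  show ?thesis
  proof
    assume "outer_function (\<lambda>z. f (z, 1)) \<and> outer_function (\<lambda>w. f (1, w))"
    then show "closed_ideal_gen (Aplus \<alpha> \<beta>) (Aplus_norm \<alpha> \<beta>) f = vanishing_ideal (Aplus \<alpha> \<beta>) {(1, 1)}"
      using closed_ideal_subset_vanishing(1) vanishing_subset_closed_ideal_if_outer
      by (auto simp: vanishing_ideal_def)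
  qed (rule outer_if_closed_ideal_eq_vanishing)
qed

end
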